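(* Let $\kappa\in(2,\infty)$ and let $\Gamma\subset\mathbb{R}^2$ be any closed $C^\infty$ boundary curve (not necessarily convex) having only finitely many points with vanishing curvature, of maximal order $\kappa-2$. Let $f\in C^\infty(\Gamma)$, let the weight profile $\theta$ have regularity order $q\ge0$, and let $\alpha\in[0,1]$. For a rotation $\eta\in\mathrm{SO}(2)$ and a translation $\boldsymbol\xi\in[0,1]^2$ let $\mathcal{I}_h(f;\eta,\boldsymbol\xi)$ denote the implicit boundary integral with tube width $\varepsilon$ on the transformed boundary $\eta\Gamma+h\boldsymbol\xi$. There is $\varepsilon_0>0$ such that if $\varepsilon=\varepsilon(h)=\Theta(h^\alpha)$ with $\varepsilon\le\varepsilon_0$, then, as $h\to0^+$, $$\int_{[0,1]^2}\int_{\mathrm{SO}(2)}\left|\mathcal{I}_h(f;\eta,\boldsymbol\xi)-\mathcal{I}(f)\right|^2d\eta\,d\boldsymbol\xi=\mathcal{O}\left(h^{1+2(q+1)(1-\alpha)}\right),$$ where $d\eta$ is the normalized Haar measure on $\mathrm{SO}(2)$.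
   Context: Setting ($d=2$): $\Gamma$ is the boundary of a bounded simply connected domain $\Omega\subset\mathbb{R}^2$, with outward unit normal $\mathbf{n}$. The curvature vanishes to order $\kappa'-2$ ($\kappa'>2$) at $\mathbf{z}\in\Gamma$ if, after a rigid motion placing $\mathbf{z}$ at the origin, $\Gamma$ is locally the graph $\{(x,g(x)):|x|<r\}$ for some $r>0$, with either $g(x)=|x|^{\kappa'}a(x)$, $a\in C^\infty$, or $g(x)=\mathrm{sgn}(x)|x|^{\kappa'}a(x)$, $a\in C^2$, where in both cases $a(x)\ne0$ for all $|x|<r$. "Maximal order $\kappa-2$" means that at each of the finitely many points of vanishing curvature the curvature vanishes to some order $\kappa'-2$ with $2<\kappa'\le\kappa$. The tube is $T_\varepsilon=\{\mathbf{x}\in\mathbb{R}^2: \mathrm{dist}(\mathbf{x},\Gamma)\le\varepsilon\}$, with $\varepsilon$ always assumed small enough that every $\mathbf{x}\in T_\varepsilon$ has a unique closest point $P_\Gamma(\mathbf{x})\in\Gamma$. The signed distance is $d_\Gamma(\mathbf{x})=\mathbf{n}(P_\Gamma(\mathbf{x}))\cdot(\mathbf{x}-P_\Gamma(\mathbf{x}))$. $J_\varepsilon(\mathbf{x},s)=1-s\,k(\mathbf{x})$, where $k(\mathbf{x})$ is the signed curvature at $\mathbf{x}$ of the level curve $\{d_\Gamma=s\}$ (positive for circles); this is the Jacobian of $P_\Gamma$ restricted to that level curve. Weight profile of regularity order $q\in\{0,1,2,\dots\}$: a fixed function $\theta:\mathbb{R}\to\mathbb{R}$ with $\mathrm{supp}\,\theta=[-1,1]$,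 $\int_{-1}^1\theta=1$; if $q\ge1$, $\theta\in C^{q-1}(\mathbb{R})$ and $\theta^{(q)}$ is piecewise $C^1$; if $q=0$, $\theta\in L^\infty$ is piecewise $C^1$ (piecewise $C^1$: finitely many pieces, $C^1$ up to the closure on each). $\theta_\varepsilon(s)=\varepsilon^{-1}\theta(s/\varepsilon)$. Let $\mathcal{Q}_\Gamma(\mathbf{x})=f(P_\Gamma(\mathbf{x}))\,\theta_\varepsilon(d_\Gamma(\mathbf{x}))\,J_\varepsilon(\mathbf{x},d_\Gamma(\mathbf{x}))$, extended by zero outside $T_\varepsilon$. $\mathcal{I}(f)=\int_\Gamma f\,d\sigma$, and (the integrand being transported with the curve) $\mathcal{I}_h(f;\eta,\boldsymbol\xi)=h^2\sum_{\mathbf{w}\in\mathbb{Z}^2}\mathcal{Q}_\Gamma\left(h\eta^{-1}(\mathbf{w}-\boldsymbol\xi)\right)$. $\varepsilon=\Theta(h^\alpha)$ means $c_1h^\alpha\le\varepsilon\le c_2h^\alpha$ with constants $c_1,c_2>0$; the constants in $\mathcal{O}$ are independent of $h$. *)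

theory Defs
  imports "HOL-Analysis.Analysis" "HOL-Probability.Probability"
    "HOL-Library.Landau_Symbols"
begin

text \<open>On an interval with end points, derivatives are one-sided there, so \<open>C_k_on k {a..b} g\<close> means
  that \<open>g\<close> is \<open>C^k\<close> up to the closure.\<close>

definition C_k_on :: "enat \<Rightarrow> real set \<Rightarrow> (real \<Rightarrow> 'a::real_normed_vector) \<Rightarrow> bool" where
  "C_k_on k S g \<longleftrightarrow>
     (\<exists>D. D 0 = g \<and>
          (\<forall>n. enat n < k \<longrightarrow> (\<forall>t\<in>S. (D n has_vector_derivative D (Suc n) t) (at t within S))) \<and>
          (\<forall>n. enat n \<le> k \<longrightarrow> continuous_on S (D n)))"

text \<open>The finite set \<open>B\<close> holds the break points; the values of \<open>g\<close> at them are irrelevant. On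
  each compact interval without interior break points, \<open>g\<close> extends to a \<open>C^1\<close> function.\<close>

definition piecewise_C1 :: "(real \<Rightarrow> real) \<Rightarrow> bool" where
  "piecewise_C1 g \<longleftrightarrow>
     (\<exists>B. finite B \<and>
        (\<forall>a b. a < b \<and> {a<..<b} \<inter> B = {} \<longrightarrow>
           (\<exists>G. C_k_on 1 {a..b} G \<and> (\<forall>s\<in>{a<..<b}. G s = g s))))"

definition weight_profile :: "nat \<Rightarrow> (real \<Rightarrow> real) \<Rightarrow> bool" where
  "weight_profile q \<theta> \<longleftrightarrow>
     closure {s. \<theta> s \<noteq> 0} = {-1..1} \<and>
     (\<theta> has_integral 1) {-1..1} \<and>
     (if q = 0 then bounded (range \<theta>) \<and> piecewise_C1 \<theta>
      else C_k_on (enat (q - 1)) UNIV \<theta> \<and>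
           (\<exists>B. finite B \<and> (\<forall>s. s \<notin> B \<longrightarrow> (deriv ^^ (q - 1)) \<theta> differentiable (at s))) \<and>
           piecewise_C1 ((deriv ^^ q) \<theta>))"

text \<open>The boundary is \<open>frontier \<Omega>\<close>, and \<open>\<gamma>\<close> is a regular parametrization of it with period 1,
  of either orientation.\<close>

definition smooth_closed_boundary :: "(real^2) set \<Rightarrow> (real \<Rightarrow> real^2) \<Rightarrow> bool" where
  "smooth_closed_boundary \<Omega> \<gamma> \<longleftrightarrow>
     C_k_on \<infinity> UNIV \<gamma> \<and> (\<forall>t. \<gamma> (t + 1) = \<gamma> t) \<and> inj_on \<gamma> {0..<1} \<and>
     (\<forall>t. vector_derivative \<gamma> (at t) \<noteq> 0) \<and> range \<gamma> = frontier \<Omega>"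

definition outward_normal :: "(real^2) set \<Rightarrow> (real \<Rightarrow> real^2) \<Rightarrow> real^2 \<Rightarrow> real^2" where
  "outward_normal \<Omega> \<gamma> z =
     (THE \<nu>. norm \<nu> = 1 \<and> (\<forall>t. \<gamma> t = z \<longrightarrow> orthogonal \<nu> (vector_derivative \<gamma> (at t))) \<and>
            (\<exists>\<delta>>0. \<forall>s\<in>{0<..<\<delta>}. z + s *\<^sub>R \<nu> \<notin> closure \<Omega>))"

definition local_param :: "(real^2) set \<Rightarrow> real^2 \<Rightarrow> (real \<Rightarrow> real^2) \<Rightarrow> bool" where
  "local_param L x c \<longleftrightarrow>
     (\<exists>\<delta>>0. C_k_on 2 {-\<delta><..<\<delta>} c \<and> inj_on c {-\<delta><..<\<delta>} \<and> c 0 = x \<and>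
        (\<forall>t\<in>{-\<delta><..<\<delta>}. vector_derivative c (at t) \<noteq> 0) \<and>
        (\<exists>U. open U \<and> L \<inter> U = c ` {-\<delta><..<\<delta>}))"

text \<open>The signed curvature at \<open>x\<close> of a planar curve \<open>L\<close> with unit normal \<open>\<nu>\<close> at \<open>x\<close>: the component
  of the curvature vector in direction \<open>- \<nu>\<close>. It does not depend on the local parametrization or on
  its orientation, and equals \<open>1 / R\<close> for a circle of radius \<open>R\<close> with outward \<open>\<nu>\<close>.\<close>

definition signed_curvature :: "(real^2) set \<Rightarrow> real^2 \<Rightarrow> real^2 \<Rightarrow> real" where
  "signed_curvature L \<nu> x =
     (THE k. \<exists>c. local_param L x c \<and>
        k = - (vector_derivative (\<lambda>t. vector_derivative c (at t)) (at 0) \<bullet> \<nu>)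
              / (norm (vector_derivative c (at 0)))\<^sup>2)"

definition SO2 :: "(real^2^2) set" where
  "SO2 = {A. orthogonal_matrix A \<and> det A = 1}"

text \<open>The curvature of \<open>\<Gamma>\<close> vanishes at \<open>z\<close> to order \<open>\<kappa>' - 2\<close>; the rigid motion
  is \<open>x \<mapsto> A (x - z)\<close>.\<close>

definition curvature_vanishes_like :: "(real^2) set \<Rightarrow> real^2 \<Rightarrow> real \<Rightarrow> bool" where
  "curvature_vanishes_like \<Gamma> z \<kappa>' \<longleftrightarrow>
     (\<exists>A\<in>SO2. \<exists>r>0. \<exists>g a.
        (\<exists>U. open U \<and> 0 \<in> U \<and>
           (\<lambda>x. A *v (x - z)) ` \<Gamma> \<inter> U = {vector [x, g x] |x. \<bar>x\<bar> < r}) \<and>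
        (\<forall>x. \<bar>x\<bar> < r \<longrightarrow> a x \<noteq> 0) \<and>
        (C_k_on \<infinity> {-r<..<r} a \<and> (\<forall>x. \<bar>x\<bar> < r \<longrightarrow> g x = \<bar>x\<bar> powr \<kappa>' * a x) \<or>
         C_k_on 2 {-r<..<r} a \<and> (\<forall>x. \<bar>x\<bar> < r \<longrightarrow> g x = sgn x * \<bar>x\<bar> powr \<kappa>' * a x)))"

definition flat_points :: "(real^2) set \<Rightarrow> (real \<Rightarrow> real^2) \<Rightarrow> (real^2) set" where
  "flat_points \<Omega> \<gamma> = {z \<in> frontier \<Omega>. signed_curvature (frontier \<Omega>) (outward_normal \<Omega> \<gamma> z) z = 0}"

definition finitely_flat :: "(real^2) set \<Rightarrow> (real \<Rightarrow> real^2) \<Rightarrow> real \<Rightarrow> bool" where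
  "finitely_flat \<Omega> \<gamma> \<kappa> \<longleftrightarrow>
     finite (flat_points \<Omega> \<gamma>) \<and>
     (\<forall>z\<in>flat_points \<Omega> \<gamma>. \<exists>\<kappa>'. 2 < \<kappa>' \<and> \<kappa>' \<le> \<kappa> \<and> curvature_vanishes_like (frontier \<Omega>) z \<kappa>')"

definition tube :: "(real^2) set \<Rightarrow> real \<Rightarrow> (real^2) set" where
  "tube \<Gamma> \<epsilon> = {x. infdist x \<Gamma> \<le> \<epsilon>}"

definition unique_projection :: "(real^2) set \<Rightarrow> real \<Rightarrow> bool" where
  "unique_projection \<Gamma> \<epsilon> \<longleftrightarrow> (\<forall>x\<in>tube \<Gamma> \<epsilon>. \<exists>!p. p \<in> \<Gamma> \<and> dist x p = infdist x \<Gamma>)"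

definition signed_dist :: "(real^2) set \<Rightarrow> (real \<Rightarrow> real^2) \<Rightarrow> real^2 \<Rightarrow> real" where
  "signed_dist \<Omega> \<gamma> x =
     (let p = closest_point (frontier \<Omega>) x in outward_normal \<Omega> \<gamma> p \<bullet> (x - p))"

text \<open>The unit normal at \<open>x\<close> of the level curve of the signed distance through \<open>x\<close> is the outward
  normal of the boundary at the closest point of \<open>x\<close>.\<close>

definition level_curvature :: "(real^2) set \<Rightarrow> (real \<Rightarrow> real^2) \<Rightarrow> real^2 \<Rightarrow> real" where
  "level_curvature \<Omega> \<gamma> x =
     signed_curvature {y. signed_dist \<Omega> \<gamma> y = signed_dist \<Omega> \<gamma> x}
       (outward_normal \<Omega> \<gamma> (closest_point (frontier \<Omega>) x)) x"

definition jacobian :: "(real^2) set \<Rightarrow> (real \<Rightarrow> real^2) \<Rightarrow> real^2 \<Rightarrow> real \<Rightarrow> real" where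
  "jacobian \<Omega> \<gamma> x s = 1 - s * level_curvature \<Omega> \<gamma> x"

definition scaled_weight :: "(real \<Rightarrow> real) \<Rightarrow> real \<Rightarrow> real \<Rightarrow> real" where
  "scaled_weight \<theta> \<epsilon> s = \<theta> (s / \<epsilon>) / \<epsilon>"

definition integrand ::
  "(real^2) set \<Rightarrow> (real \<Rightarrow> real^2) \<Rightarrow> (real^2 \<Rightarrow> real) \<Rightarrow> (real \<Rightarrow> real) \<Rightarrow> real \<Rightarrow> real^2 \<Rightarrow> real" where
  "integrand \<Omega> \<gamma> f \<theta> \<epsilon> x =
     (if x \<in> tube (frontier \<Omega>) \<epsilon>
      then f (closest_point (frontier \<Omega>) x) * scaled_weight \<theta> \<epsilon> (signed_dist \<Omega> \<gamma> x)
             * jacobian \<Omega> \<gamma> x (signed_dist \<Omega> \<gamma> x)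
      else 0)"

definition curve_integral :: "(real \<Rightarrow> real^2) \<Rightarrow> (real^2 \<Rightarrow> real) \<Rightarrow> real" where
  "curve_integral \<gamma> f = integral {0..1} (\<lambda>t. f (\<gamma> t) * norm (vector_derivative \<gamma> (at t)))"

text \<open>The sum over the integer lattice has only finitely many nonzero terms (the tube is bounded).\<close>

definition implicit_integral ::
  "(real^2) set \<Rightarrow> (real \<Rightarrow> real^2) \<Rightarrow> (real^2 \<Rightarrow> real) \<Rightarrow> (real \<Rightarrow> real) \<Rightarrow> real \<Rightarrow> real
     \<Rightarrow> real^2^2 \<Rightarrow> real^2 \<Rightarrow> real" where
  "implicit_integral \<Omega> \<gamma> f \<theta> \<epsilon> h \<eta> \<xi> =
     h\<^sup>2 * (\<Sum>\<^sub>\<infinity>w\<in>{w. \<forall>i. w $ i \<in> \<int>}. integrand \<Omega> \<gamma> f \<theta> \<epsilon> (h *\<^sub>R (matrix_inv \<eta> *v (w - \<xi>))))"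

definition rotation :: "real \<Rightarrow> real^2^2" where
  "rotation t = vector [vector [cos t, - sin t], vector [sin t, cos t]]"

text \<open>The uniform distribution of the rotation angle. The lemmas below show that this is the
  normalized Haar measure: a translation-invariant Borel probability measure on \<open>SO2\<close>.\<close>

definition haar_SO2 :: "(real^2^2) measure" where
  "haar_SO2 = distr (uniform_measure lborel {0..<2*pi}) (restrict_space borel SO2) rotation"

lemma rotation_nth [simp]:
  "rotation t $ 1 $ 1 = cos t" "rotation t $ 1 $ 2 = - sin t"
  "rotation t $ 2 $ 1 = sin t" "rotation t $ 2 $ 2 = cos t"
  by (simp_all add: rotation_def)

lemma rotation_add: "rotation a ** rotation t = rotation (a + t)"
  by (simp add: vec_eq_iff forall_2 matrix_matrix_mult_def sum_2 cos_add sin_add algebra_simps)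

lemma rotation_periodic: "rotation (t + 2*pi) = rotation t"
  by (simp add: vec_eq_iff forall_2)

lemma rotation_in_SO2: "rotation t \<in> SO2"
  by (simp add: SO2_def orthogonal_matrix vec_eq_iff forall_2 matrix_matrix_mult_def sum_2
      transpose_def mat_def det_2 flip: power2_eq_square)

lemma SO2_obtain_angle:
  assumes "A \<in> SO2"
  obtains a where "0 \<le> a" "a < 2*pi" "A = rotation a"
proof -
  have 1: "(A$1$1)\<^sup>2 + (A$2$1)\<^sup>2 = 1" "A$1$1 * A$1$2 + A$2$1 * A$2$2 = 0"
    and 2: "A$1$1 * A$2$2 - A$1$2 * A$2$1 = 1"
    using assms by (simp_all add: SO2_def orthogonal_matrix vec_eq_iff forall_2 matrix_matrix_mult_def
        sum_2 transpose_def mat_def det_2 power2_eq_square)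
  obtain a where a: "0 \<le> a" "a < 2*pi" "A$1$1 = cos a" "A$2$1 = sin a"
    using sincos_total_2pi[OF 1(1)] by metis
  have "A$2$2 = A$2$2 * ((A$1$1)\<^sup>2 + (A$2$1)\<^sup>2)" "A$1$2 = A$1$2 * ((A$1$1)\<^sup>2 + (A$2$1)\<^sup>2)"
    by (simp_all add: 1)
  moreover have "A$2$2 * ((A$1$1)\<^sup>2 + (A$2$1)\<^sup>2) =
      A$1$1 * (A$1$1 * A$2$2 - A$1$2 * A$2$1) + A$2$1 * (A$1$1 * A$1$2 + A$2$1 * A$2$2)"
    "A$1$2 * ((A$1$1)\<^sup>2 + (A$2$1)\<^sup>2) =
      A$1$1 * (A$1$1 * A$1$2 + A$2$1 * A$2$2) - A$2$1 * (A$1$1 * A$2$2 - A$1$2 * A$2$1)"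
    by (simp_all add: algebra_simps power2_eq_square)
  ultimately have "A$2$2 = A$1$1" "A$1$2 = - A$2$1"
    unfolding 1 2 by simp_all
  with a have "A = rotation a" by (simp add: vec_eq_iff forall_2)
  with a that show thesis by blast
qed

lemma rotation_measurable [measurable]: "rotation \<in> borel \<rightarrow>\<^sub>M restrict_space borel SO2"
proof (rule measurable_restrict_space2)
  have "continuous_on UNIV (\<lambda>t. \<chi> i j. rotation t $ i $ j)"
  proof (intro continuous_on_vec_lambda)
    fix i j :: 2
    show "continuous_on UNIV (\<lambda>t. rotation t $ i $ j)"
      using exhaust_2[of i] exhaust_2[of j]
      by (elim disjE) (simp_all add: continuous_on_cos continuous_on_sin continuous_on_minus)
  qed
  then have "continuous_on UNIV rotation" by simp
  then show "rotation \<in> borel_measurable borel" by (rule borel_measurable_continuous_onI)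
qed (simp add: rotation_in_SO2)

lemma space_haar_SO2 [simp]: "space haar_SO2 = SO2"
  and sets_haar_SO2 [simp, measurable_cong]: "sets haar_SO2 = sets (restrict_space borel SO2)"
  by (simp_all add: haar_SO2_def space_restrict_space)

lemma prob_space_haar_SO2: "prob_space haar_SO2"
  unfolding haar_SO2_def
  by (intro prob_space.prob_space_distr prob_space_uniform_measure) auto

lemma emeasure_translate: "S \<in> sets borel \<Longrightarrow> emeasure lborel ((+) c -` S) = emeasure lborel (S :: real set)"
  using emeasure_distr[of "(+) c" lborel borel S] by (simp add: lborel_distr_plus)

lemma emeasure_periodic_shift:
  fixes S :: "real set"
  assumes S [measurable]: "S \<in> sets borel" and per: "\<And>t. t + 2*pi \<in> S \<longleftrightarrow> t \<in> S"
    and a: "0 \<le> a" "a < 2*pi"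
  shows "emeasure lborel ({0..<2*pi} \<inter> (+) a -` S) = emeasure lborel ({0..<2*pi} \<inter> S)"
proof -
  have V [measurable]: "(+) c -` S \<in> sets borel" for c
    using measurable_sets[of "(+) c" borel borel S] by simp
  have p: "a + t \<in> S \<longleftrightarrow> a - 2*pi + t \<in> S" for t
    using per[of "a - 2*pi + t"] by (simp add: algebra_simps)
  have "{0..<2*pi} \<inter> (+) a -` S =
      ((+) a -` ({a..<2*pi} \<inter> S)) \<union> ((+) (a - 2*pi) -` ({0..<a} \<inter> S))"
    using a p by auto
  then have "emeasure lborel ({0..<2*pi} \<inter> (+) a -` S) =
      emeasure lborel (((+) a -` ({a..<2*pi} \<inter> S)) \<union> ((+) (a - 2*pi) -` ({0..<a} \<inter> S)))"
    by simp
  also have "\<dots> = emeasure lborel ((+) a -` ({a..<2*pi} \<inter> S)) +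
      emeasure lborel ((+) (a - 2*pi) -` ({0..<a} \<inter> S))"
    by (intro plus_emeasure [symmetric]) (auto simp: vimage_Int intro!: sets.Int
      measurable_sets[of "(+) c" borel borel for c, simplified])
  also have "\<dots> = emeasure lborel ({a..<2*pi} \<inter> S) + emeasure lborel ({0..<a} \<inter> S)"
    by (simp add: emeasure_translate del: vimage_Int)
  also have "\<dots> = emeasure lborel (({a..<2*pi} \<inter> S) \<union> ({0..<a} \<inter> S))"
    by (intro plus_emeasure) auto
  also have "({a..<2*pi} \<inter> S) \<union> ({0..<a} \<inter> S) = {0..<2*pi} \<inter> S"
    using a by auto
  finally show ?thesis .
qed

lemma haar_SO2_invariant:
  assumes "A \<in> SO2"
  shows "distr haar_SO2 haar_SO2 ((**) A) = haar_SO2"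
proof -
  obtain a where a: "0 \<le> a" "a < 2*pi" "A = rotation a"
    using SO2_obtain_angle[OF assms] .
  let ?N = "restrict_space borel SO2 :: (real^2^2) measure"
  have SO2_mult: "A ** B \<in> SO2" if "B \<in> SO2" for B
    using that a rotation_in_SO2 SO2_obtain_angle[OF that] by (metis rotation_add)
  have "continuous_on UNIV ((**) A)"
    unfolding matrix_matrix_mult_def by (intro continuous_intros)
  then have "(**) A \<in> borel_measurable borel"
    by (rule borel_measurable_continuous_onI)
  then have m [measurable]: "(**) A \<in> ?N \<rightarrow>\<^sub>M ?N"
    by (intro measurable_restrict_space3) (auto simp: SO2_mult)
  have "distr haar_SO2 haar_SO2 ((**) A) = distr haar_SO2 ?N ((**) A)"
    by (intro distr_cong) auto
  also have "\<dots> = distr (uniform_measure lborel {0..<2*pi}) ?N ((**) A \<circ> rotation)"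
    unfolding haar_SO2_def by (subst distr_distr) auto
  also have "\<dots> = distr (uniform_measure lborel {0..<2*pi}) ?N (\<lambda>t. rotation (a + t))"
    by (simp add: a(3) comp_def rotation_add)
  also have "\<dots> = haar_SO2"
    unfolding haar_SO2_def
  proof (rule measure_eqI)
    fix X assume "X \<in> sets (distr (uniform_measure lborel {0..<2*pi}) ?N (\<lambda>t. rotation (a + t)))"
    then have X [measurable]: "X \<in> sets ?N" by simp
    have S [measurable]: "rotation -` X \<in> sets borel"
      using measurable_sets[OF rotation_measurable X] by simp
    have "(+) a -` (rotation -` X) \<in> sets borel"
      using measurable_sets[of "(+) a" borel borel "rotation -` X"] S by simp
    moreover have "(\<lambda>t. rotation (a + t)) -` X = (+) a -` (rotation -` X)" by auto
    ultimately show "emeasure (distr (uniform_measure lborel {0..<2*pi}) ?N (\<lambda>t. rotation (a + t))) X =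
        emeasure (distr (uniform_measure lborel {0..<2*pi}) ?N rotation) X"
      using emeasure_periodic_shift[OF S _ a(1,2)]
      by (simp add: emeasure_distr rotation_periodic)
  qed simp
  finally show ?thesis .
qed

end

theory Submission
  imports Defs
begin

text \<open>By Parseval in the translation, the mean square error for a fixed rotation is the sum over the nonzero
  dual lattice points of the squared Fourier transform of the integrand, evaluated on the rotated lattice
  scaled by \<open>1 / h\<close>; the zero mode is the exact integral since the Jacobian turns the tube integral into an
  iterated one. Averaging over rotations replaces each term by the mean over a circle of radius \<open>\<Lambda>\<close>.
  That mean is \<open>O((\<epsilon> \<Lambda>)^(-2m) / \<Lambda>)\<close> with \<open>m = q + 1\<close>: the weight contributes \<open>(\<epsilon> \<Lambda>)^(-m)\<close>
  near directions normal to the curve, and \<open>T T\<^sup>*\<close> in the angle gains the factor \<open>1 / \<Lambda>\<close>; elsewhere the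
  phase is nonstationary along the curve. Rotating the frequency rather than the curve is what makes the bound
  insensitive to flat points. The sum over the lattice then converges to \<open>O(h^(2m+1) \<epsilon>^(-2m))\<close>.\<close>

section \<open>Integration by parts with parameters\<close>

text \<open>Stationary phase in the curve parameter degenerates at flat points; the mean square over
  the angle does not see them. Expanding the square gives a double integral over curve parameters u,
  w whose kernel is an integral over the angle. The angular derivative of its phase is \<Lambda>
  times the component of the chord perpendicular to the frequency, which near the normal direction
  is comparable to \<Lambda> |u - w| on every regular curve. So the kernel is O(1 / (1 + (\<Lambda>
  (u - w))^2)), and integrating in w gains 1 / \<Lambda>.

  The rough weight is removed beforehand: its Fourier transform at y is y^(-m) times that of a
  measure on [-1,1], and each point of this measure only moves the curve to a parallel one. Hence
  all estimates are uniform in the offset. But y = \<epsilon> \<Lambda> nd vanishes where the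
  frequency is tangential. This forces the split of the angles and, since the normal turns along the
  curve, a localization to short windows, undone by averaging over their centres. The lattice sum
  converges because its exponent 2m + 1 is at least 3 and so exceeds the dimension.\<close>

definition bounded_cont :: "real set \<Rightarrow> 'l set \<Rightarrow> ('l \<Rightarrow> real \<Rightarrow> real) \<Rightarrow> bool" where
  "bounded_cont S L a \<longleftrightarrow> (\<forall>l\<in>L. continuous_on S (a l)) \<and> (\<exists>C. \<forall>l\<in>L. \<forall>t\<in>S. \<bar>a l t\<bar> \<le> C)"

text \<open>Symbol classes: n derivatives, bounded uniformly in the parameter \<open>l\<close>. The
  uniformity is the point, since the later constants must not depend on base point, offset, angle or
  frequency.\<close>

primrec bs :: "nat \<Rightarrow> real set \<Rightarrow> 'l set \<Rightarrow> ('l \<Rightarrow> real \<Rightarrow> real) \<Rightarrow> bool" where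
  "bs 0 S L a = bounded_cont S L a"
| "bs (Suc n) S L a = (bounded_cont S L a \<and>
     (\<exists>a'. (\<forall>l\<in>L. \<forall>t\<in>S. (a l has_real_derivative a' l t) (at t within S)) \<and> bs n S L a'))"

text \<open>Amplitudes whose derivatives of order below n vanish at both end points while the n-th
  is merely continuous and bounded: this is what n integrations by parts without boundary terms
  consume.\<close>

primrec bv :: "nat \<Rightarrow> real \<Rightarrow> real \<Rightarrow> 'l set \<Rightarrow> ('l \<Rightarrow> real \<Rightarrow> real) \<Rightarrow> bool" where
  "bv 0 p r L a = bounded_cont {p..r} L a"
| "bv (Suc n) p r L a = (bounded_cont {p..r} L a \<and> (\<forall>l\<in>L. a l p = 0 \<and> a l r = 0) \<and>
     (\<exists>a'. (\<forall>l\<in>L. \<forall>t\<in>{p..r}. (a l has_real_derivative a' l t) (at t within {p..r})) \<and> bv n p r L a'))"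

lemma bs_SucI:
  assumes "bounded_cont S L a" "\<And>l t. l \<in> L \<Longrightarrow> t \<in> S \<Longrightarrow> (a l has_real_derivative a' l t) (at t within S)" "bs n S L a'"
  shows "bs (Suc n) S L a"
  using assms by auto

lemma bv_SucI:
  assumes "bounded_cont {p..r} L a" "\<And>l t. l \<in> L \<Longrightarrow> t \<in> {p..r} \<Longrightarrow> (a l has_real_derivative a' l t) (at t within {p..r})" "bv n p r L a'"
    "\<And>l. l \<in> L \<Longrightarrow> a l p = 0" "\<And>l. l \<in> L \<Longrightarrow> a l r = 0"
  shows "bv (Suc n) p r L a"
  unfolding bv.simps using assms by (intro conjI exI[of _ a']) auto

lemma bounded_cont_add:
  assumes "bounded_cont S L a" "bounded_cont S L b"
  shows "bounded_cont S L (\<lambda>l t. a l t + b l t)"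
proof -
  obtain C D where "\<forall>l\<in>L. \<forall>t\<in>S. \<bar>a l t\<bar> \<le> C" "\<forall>l\<in>L. \<forall>t\<in>S. \<bar>b l t\<bar> \<le> D"
    using assms by (auto simp: bounded_cont_def)
  then have "\<forall>l\<in>L. \<forall>t\<in>S. \<bar>a l t + b l t\<bar> \<le> C + D"
    by (intro ballI order_trans[OF abs_triangle_ineq] add_mono) auto
  then show ?thesis using assms unfolding bounded_cont_def
    by (auto intro!: continuous_on_add)
qed

lemma bounded_cont_mult:
  assumes "bounded_cont S L a" "bounded_cont S L b"
  shows "bounded_cont S L (\<lambda>l t. a l t * b l t)"
proof -
  obtain C D where "\<forall>l\<in>L. \<forall>t\<in>S. \<bar>a l t\<bar> \<le> C" "\<forall>l\<in>L. \<forall>t\<in>S. \<bar>b l t\<bar> \<le> D"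
    using assms by (auto simp: bounded_cont_def)
  then have "\<bar>a l t\<bar> * \<bar>b l t\<bar> \<le> C * D" if "l \<in> L" "t \<in> S" for l t
    using that by (intro mult_mono) (auto intro: order_trans[OF abs_ge_zero])
  then have "\<forall>l\<in>L. \<forall>t\<in>S. \<bar>a l t * b l t\<bar> \<le> C * D"
    by (simp add: abs_mult)
  then show ?thesis using assms unfolding bounded_cont_def
    by (auto intro!: continuous_on_mult)
qed

lemma bounded_cont_const:
  assumes "\<And>l. l \<in> L \<Longrightarrow> \<bar>c l\<bar> \<le> C" shows "bounded_cont S L (\<lambda>l t. c l)"
  using assms unfolding bounded_cont_def by auto

lemma bs_bounded_cont: "bs n S L a \<Longrightarrow> bounded_cont S L a"
  by (cases n) auto

lemma bv_bounded_cont: "bv n p r L a \<Longrightarrow> bounded_cont {p..r} L a"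
  by (cases n) auto

lemma bs_Suc_D: "bs (Suc n) S L a \<Longrightarrow> bs n S L a"
proof (induction n arbitrary: a)
  case (Suc n)
  then obtain a' where "bounded_cont S L a" "bs (Suc n) S L a'"
    "\<forall>l\<in>L. \<forall>t\<in>S. (a l has_real_derivative a' l t) (at t within S)" by auto
  with Suc.IH[of a'] show ?case by auto
qed auto

lemma bv_Suc_D: "bv (Suc n) p r L a \<Longrightarrow> bv n p r L a"
proof (induction n arbitrary: a)
  case (Suc n)
  then obtain a' where "bounded_cont {p..r} L a" "bv (Suc n) p r L a'" "\<forall>l\<in>L. a l p = 0 \<and> a l r = 0"
    "\<forall>l\<in>L. \<forall>t\<in>{p..r}. (a l has_real_derivative a' l t) (at t within {p..r})"
    by (auto simp del: bv.simps simp: bv.simps(2)[of "Suc n"])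
  with Suc.IH[of a'] show ?case by auto
qed auto

lemma bs_const:
  assumes "\<And>l. l \<in> L \<Longrightarrow> \<bar>c l\<bar> \<le> C" shows "bs n S L (\<lambda>l t. c l)"
  using assms
proof (induction n arbitrary: c C)
  case 0 then show ?case using bounded_cont_const[of L c C] by simp
next
  case (Suc n)
  have "bs n S L (\<lambda>l t. (\<lambda>l. 0) l)" by (rule Suc.IH[of "\<lambda>l. 0" 0]) simp
  with bounded_cont_const[of L c C, OF Suc.prems] show ?case
    by (auto intro!: exI[of _ "\<lambda>l t. 0"])
qed

lemma bs_add: "bs n S L a \<Longrightarrow> bs n S L b \<Longrightarrow> bs n S L (\<lambda>l t. a l t + b l t)"
proof (induction n arbitrary: a b)
  case 0 then show ?case by (auto intro: bounded_cont_add)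
next
  case (Suc n)
  then obtain a' b' where *: "bounded_cont S L a" "bs n S L a'" "bounded_cont S L b" "bs n S L b'"
    "\<forall>l\<in>L. \<forall>t\<in>S. (a l has_real_derivative a' l t) (at t within S)"
    "\<forall>l\<in>L. \<forall>t\<in>S. (b l has_real_derivative b' l t) (at t within S)" by auto
  then have "\<forall>l\<in>L. \<forall>t\<in>S. ((\<lambda>t. a l t + b l t) has_real_derivative a' l t + b' l t) (at t within S)"
    by (auto intro!: derivative_intros)
  then show ?case using Suc.IH[of a' b'] *
    by (intro bs_SucI[of _ _ _ "\<lambda>l t. a' l t + b' l t"] bounded_cont_add) auto
qed

lemma bs_mult: "bs n S L a \<Longrightarrow> bs n S L b \<Longrightarrow> bs n S L (\<lambda>l t. a l t * b l t)"
proof (induction n arbitrary: a b)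
  case 0 then show ?case by (auto intro: bounded_cont_mult)
next
  case (Suc n)
  then obtain a' b' where *: "bounded_cont S L a" "bs n S L a'" "bounded_cont S L b" "bs n S L b'"
    "\<forall>l\<in>L. \<forall>t\<in>S. (a l has_real_derivative a' l t) (at t within S)"
    "\<forall>l\<in>L. \<forall>t\<in>S. (b l has_real_derivative b' l t) (at t within S)" by auto
  then have "\<forall>l\<in>L. \<forall>t\<in>S. ((\<lambda>t. a l t * b l t) has_real_derivative a' l t * b l t + a l t * b' l t) (at t within S)"
    by (auto intro!: derivative_eq_intros)
  moreover have "bs n S L (\<lambda>l t. a' l t * b l t + a l t * b' l t)"
    using Suc.IH * Suc.prems by (intro bs_add) (auto dest: bs_Suc_D simp del: bs.simps)
  ultimately show ?case using *
    by (intro bs_SucI[of _ _ _ "\<lambda>l t. a' l t * b l t + a l t * b' l t"] bounded_cont_mult) auto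
qed

lemma bs_cmult:
  assumes "bs n S L a" shows "bs n S L (\<lambda>l t. c * a l t)"
  using bs_mult[OF bs_const[of L "\<lambda>_. c" "\<bar>c\<bar>" n S] assms] by simp

lemma bs_minus: assumes "bs n S L a" shows "bs n S L (\<lambda>l t. - a l t)"
  using bs_cmult[OF assms, of "-1"] by simp

lemma bs_diff: "bs n S L a \<Longrightarrow> bs n S L b \<Longrightarrow> bs n S L (\<lambda>l t. a l t - b l t)"
  using bs_add[OF _ bs_minus, of n S L a b] by simp

lemma bs_power: "bs n S L a \<Longrightarrow> bs n S L (\<lambda>l t. a l t ^ m)"
proof (induction m)
  case 0 show ?case using bs_const[of L "\<lambda>_. 1" 1] by simp
qed (auto intro: bs_mult)

text \<open>The derivative of 1/a is a product of 1/a, a' and 1/a, so order n for the inverse yields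
  order n + 1. The lower bound has to be uniform in \<open>l\<close> for the result to stay in the
  class.\<close>

lemma bs_inverse:
  assumes "bs n S L a" and lb: "\<And>l t. l \<in> L \<Longrightarrow> t \<in> S \<Longrightarrow> c \<le> \<bar>a l t\<bar>" and "0 < c"
  shows "bs n S L (\<lambda>l t. inverse (a l t))"
  using assms(1)
proof (induction n)
  have nz: "\<And>l t. l \<in> L \<Longrightarrow> t \<in> S \<Longrightarrow> a l t \<noteq> 0" using lb \<open>0 < c\<close> by fastforce
  have b: "bounded_cont S L (\<lambda>l t. inverse (a l t))"
    unfolding bounded_cont_def
  proof (intro conjI ballI)
    fix l assume "l \<in> L" then show "continuous_on S (\<lambda>t. inverse (a l t))"
      using nz bs_bounded_cont[OF assms(1)] by (intro continuous_on_inverse) (auto simp: bounded_cont_def)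
  next
    show "\<exists>C. \<forall>l\<in>L. \<forall>t\<in>S. \<bar>inverse (a l t)\<bar> \<le> C"
      using lb \<open>0 < c\<close> by (intro exI[of _ "inverse c"]) (auto simp: abs_inverse intro!: le_imp_inverse_le)
  qed
  { case 0 show ?case using b by simp }
  { case (Suc n)
    then obtain a' where a': "bs n S L a'" "\<forall>l\<in>L. \<forall>t\<in>S. (a l has_real_derivative a' l t) (at t within S)"
      by auto
    have i: "bs n S L (\<lambda>l t. inverse (a l t))" using Suc by (auto dest: bs_Suc_D simp del: bs.simps)
    have "\<forall>l\<in>L. \<forall>t\<in>S. ((\<lambda>t. inverse (a l t)) has_real_derivative - (inverse (a l t) * a' l t * inverse (a l t))) (at t within S)"
      using a' nz by (auto intro!: DERIV_inverse')
    moreover have "bs n S L (\<lambda>l t. - (inverse (a l t) * a' l t * inverse (a l t)))"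
      by (intro bs_minus bs_mult i a')
    ultimately show ?case using b by (intro bs_SucI[of _ _ _ "\<lambda>l t. - (inverse (a l t) * a' l t * inverse (a l t))"]) auto }
qed

lemma bv_mult: "bv n p r L a \<Longrightarrow> bs n {p..r} L b \<Longrightarrow> bv n p r L (\<lambda>l t. a l t * b l t)"
proof (induction n arbitrary: a b)
  case 0 then show ?case by (auto intro: bounded_cont_mult)
next
  case (Suc n)
  have add: "bv n p r L a \<Longrightarrow> bv n p r L b \<Longrightarrow> bv n p r L (\<lambda>l t. a l t + b l t)" for n a b
  proof (induction n arbitrary: a b)
    case 0 then show ?case by (auto intro: bounded_cont_add)
  next
    case (Suc n)
    then obtain a' b' where *: "bounded_cont {p..r} L a" "bv n p r L a'" "bounded_cont {p..r} L b" "bv n p r L b'"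
      "\<forall>l\<in>L. \<forall>t\<in>{p..r}. (a l has_real_derivative a' l t) (at t within {p..r})"
      "\<forall>l\<in>L. \<forall>t\<in>{p..r}. (b l has_real_derivative b' l t) (at t within {p..r})" by auto
    then have "\<forall>l\<in>L. \<forall>t\<in>{p..r}. ((\<lambda>t. a l t + b l t) has_real_derivative a' l t + b' l t) (at t within {p..r})"
      by (auto intro!: derivative_intros)
    then show ?case using Suc.IH[of a' b'] Suc.prems *
      by (intro bv_SucI[of _ _ _ _ "\<lambda>l t. a' l t + b' l t"] bounded_cont_add) auto
  qed
  from Suc obtain a' b' where *: "bounded_cont {p..r} L a" "bv n p r L a'" "bounded_cont {p..r} L b" "bs n {p..r} L b'"
    "\<forall>l\<in>L. \<forall>t\<in>{p..r}. (a l has_real_derivative a' l t) (at t within {p..r})"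
    "\<forall>l\<in>L. \<forall>t\<in>{p..r}. (b l has_real_derivative b' l t) (at t within {p..r})" by auto
  then have "\<forall>l\<in>L. \<forall>t\<in>{p..r}. ((\<lambda>t. a l t * b l t) has_real_derivative a' l t * b l t + a l t * b' l t) (at t within {p..r})"
    by (auto intro!: derivative_eq_intros)
  moreover have "bv n p r L (\<lambda>l t. a' l t * b l t + a l t * b' l t)"
    using Suc.IH * Suc.prems by (intro add) (auto dest: bs_Suc_D bv_Suc_D simp del: bs.simps bv.simps)
  ultimately show ?case using * Suc.prems
    by (intro bv_SucI[of _ _ _ _ "\<lambda>l t. a' l t * b l t + a l t * b' l t"] bounded_cont_mult) auto
qed

lemma bs_ident: "bs n {p..r} L (\<lambda>l t. t)"
proof -
  have b: "bounded_cont {p..r} L (\<lambda>l t. t)"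
    unfolding bounded_cont_def by (intro conjI ballI exI[of _ "max \<bar>p\<bar> \<bar>r\<bar>"]) auto
  show ?thesis
  proof (cases n)
    case (Suc m)
    show ?thesis unfolding Suc
      by (intro bs_SucI[of _ _ _ "\<lambda>l t. 1"] b bs_const[of L "\<lambda>_. 1" 1]) auto
  qed (simp add: b)
qed

text \<open>Only a known finite number of integrations by parts is made at a time, so a polynomial
  cutoff can replace a smooth one. Differentiating lowers its exponent by one and leaves a factor of
  the same shape, with a new \<open>g\<close>.\<close>

lemma bv_bump:
  "bs n {p..r} L g \<Longrightarrow> bv n p r L (\<lambda>l t. ((t - p) * (r - t)) ^ n * g l t)"
proof (induction n arbitrary: g)
  case 0 then show ?case by simp
next
  case (Suc n)
  then obtain g' where g': "bs n {p..r} L g'" "\<forall>l\<in>L. \<forall>t\<in>{p..r}. (g l has_real_derivative g' l t) (at t within {p..r})"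
    by auto
  have i: "bs k {p..r} L (\<lambda>l t. t)" for k by (rule bs_ident)
  have c: "bs k {p..r} L (\<lambda>l t. c)" for k c using bs_const[of L "\<lambda>_. c" "\<bar>c\<bar>"] by simp
  have B: "bs k {p..r} L (\<lambda>l t. (t - p) * (r - t))" for k
    by (intro bs_mult bs_diff i c)
  let ?h = "\<lambda>l t. real (Suc n) * ((r - t) - (t - p)) * g l t + ((t - p) * (r - t)) * g' l t"
  have "bs n {p..r} L ?h"
    using Suc.prems by (intro bs_add bs_mult bs_diff i c B g') (auto dest: bs_Suc_D simp del: bs.simps)
  then have v: "bv n p r L (\<lambda>l t. ((t - p) * (r - t)) ^ n * ?h l t)" by (rule Suc.IH)
  have b: "bounded_cont {p..r} L (\<lambda>l t. ((t - p) * (r - t)) ^ Suc n * g l t)"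
    using bounded_cont_mult[OF bs_bounded_cont[OF bs_power[OF B]] bs_bounded_cont[OF Suc.prems]] .
  have d: "((\<lambda>t. ((t - p) * (r - t)) ^ Suc n * g l t) has_real_derivative ((t - p) * (r - t)) ^ n * ?h l t) (at t within {p..r})"
    if "l \<in> L" "t \<in> {p..r}" for l t
  proof -
    have "((\<lambda>t. (t - p) * (r - t)) has_real_derivative (r - t) - (t - p)) (at t within {p..r})"
      by (auto intro!: derivative_eq_intros)
    from DERIV_mult[OF DERIV_power_Suc[OF this, of n] bspec[OF bspec[OF g'(2) that(1)] that(2)]]
    show ?thesis by (rule DERIV_cong) (simp add: algebra_simps)
  qed
  show ?case unfolding bv.simps using b v d by (intro conjI exI[of _ "\<lambda>l t. ((t - p) * (r - t)) ^ n * ?h l t"]) auto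
qed

lemma has_vector_derivative_cis [derivative_intros]:
  assumes "(g has_real_derivative g') (at t within S)"
  shows "((\<lambda>t. cis (g t)) has_vector_derivative g' *\<^sub>R (\<i> * cis (g t))) (at t within S)"
proof -
  have "(cis has_vector_derivative \<i> * cis (g t)) (at (g t) within g ` S)"
  proof (rule has_vector_derivative_at_within)
    have "((\<lambda>x. exp (\<i> * of_real x)) has_vector_derivative \<i> * exp (\<i> * of_real (g t))) (at (g t))"
      by (auto intro!: derivative_eq_intros has_vector_derivative_real_field)
    then show "(cis has_vector_derivative \<i> * cis (g t)) (at (g t))"
      by (simp add: cis_conv_exp[abs_def])
  qed
  from vector_diff_chain_within[OF _ this, of g'] assms show ?thesis
    by (simp add: has_real_derivative_iff_has_vector_derivative o_def)
qed

lemma continuous_on_cis' [continuous_intros]: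
  "continuous_on S g \<Longrightarrow> continuous_on S (\<lambda>x. cis (g x))"
  unfolding cis_conv_exp by (intro continuous_intros)

text \<open>Repeated integration by parts against \<open>cis (\<Lambda> \<phi>)\<close>, uniformly over the family.\<close>

lemma nonstationary_phase:
  assumes "p \<le> r" and "bv N p r L a" and "bs N {p..r} L \<psi>"
    and \<phi>: "\<And>l t. l \<in> L \<Longrightarrow> t \<in> {p..r} \<Longrightarrow> (\<phi> l has_real_derivative \<phi>' l t) (at t within {p..r})"
    and inv: "\<And>l t. l \<in> L \<Longrightarrow> t \<in> {p..r} \<Longrightarrow> \<psi> l t * \<phi>' l t = 1"
  shows "\<exists>C\<ge>0. \<forall>l\<in>L. \<forall>\<Lambda>>0.
     cmod (integral {p..r} (\<lambda>t. of_real (a l t) * cis (\<Lambda> * \<phi> l t))) \<le> C / \<Lambda> ^ N"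
  using assms(2,3)
proof (induction N arbitrary: a)
  case 0
  then obtain C where C: "\<forall>l\<in>L. \<forall>t\<in>{p..r}. \<bar>a l t\<bar> \<le> C" and co: "\<forall>l\<in>L. continuous_on {p..r} (a l)"
    by (auto simp: bounded_cont_def)
  have c\<phi>: "l \<in> L \<Longrightarrow> continuous_on {p..r} (\<phi> l)" for l
    using \<phi> by (meson DERIV_continuous continuous_on_eq_continuous_within)
  have "cmod (integral {p..r} (\<lambda>t. of_real (a l t) * cis (\<Lambda> * \<phi> l t))) \<le> max C 0 * (r - p)"
    if "l \<in> L" for l \<Lambda>
  proof (rule integral_bound)
    show "continuous_on {p..r} (\<lambda>t. of_real (a l t) * cis (\<Lambda> * \<phi> l t))"
      using c\<phi> co that by (intro continuous_intros) auto
    fix t assume "t \<in> {p..r}" then show "cmod (of_real (a l t) * cis (\<Lambda> * \<phi> l t)) \<le> max C 0"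
      using C that by (auto simp: norm_mult le_max_iff_disj)
  qed fact
  then show ?case using \<open>p \<le> r\<close> by (intro exI[of _ "max C 0 * (r - p)"]) auto
next
  case (Suc N)
  \<comment> \<open>\<open>\<psi>\<close> is the reciprocal of the phase derivative. Differentiating
    a \<psi> cis(\<Lambda> \<phi>) returns i \<Lambda> times the integrand plus a term with
    amplitude \<open>b'\<close> of one order less; the end point terms vanish, so each round gains 1
    / \<Lambda>.\<close>
  have av: "bv (Suc N) p r L (\<lambda>l t. a l t * \<psi> l t)"
    by (rule bv_mult) fact+
  then obtain b' where b': "bv N p r L b'"
    "\<forall>l\<in>L. \<forall>t\<in>{p..r}. ((\<lambda>t. a l t * \<psi> l t) has_real_derivative b' l t) (at t within {p..r})"
    and ends: "\<forall>l\<in>L. a l p * \<psi> l p = 0 \<and> a l r * \<psi> l r = 0"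
    by auto
  obtain C where C: "C \<ge> 0" "\<forall>l\<in>L. \<forall>\<Lambda>>0. cmod (integral {p..r} (\<lambda>t. of_real (b' l t) * cis (\<Lambda> * \<phi> l t))) \<le> C / \<Lambda> ^ N"
    using Suc.IH[OF b'(1)] Suc.prems by (auto dest: bs_Suc_D simp del: bs.simps)
  have "cmod (integral {p..r} (\<lambda>t. of_real (a l t) * cis (\<Lambda> * \<phi> l t))) \<le> C / \<Lambda> ^ Suc N"
    if l: "l \<in> L" and \<Lambda>: "\<Lambda> > 0" for l \<Lambda>
  proof -
    let ?e = "\<lambda>t. cis (\<Lambda> * \<phi> l t)"
    have ci: "continuous_on {p..r} ?e"
      using \<phi>[OF l] by (intro continuous_intros) (meson DERIV_continuous continuous_on_eq_continuous_within)
    have cb: "continuous_on {p..r} (\<lambda>t. of_real (b' l t) * ?e t)"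
      using bv_bounded_cont[OF b'(1)] l by (intro continuous_intros ci) (auto simp: bounded_cont_def)
    have ca: "continuous_on {p..r} (\<lambda>t. of_real (a l t) * ?e t)"
      using bv_bounded_cont[OF Suc.prems(1)] l by (intro continuous_intros ci) (auto simp: bounded_cont_def)
    have "((\<lambda>t. of_real (a l t * \<psi> l t) * ?e t) has_vector_derivative
             (of_real (b' l t) * ?e t + \<i> * of_real \<Lambda> * (of_real (a l t) * ?e t))) (at t within {p..r})"
      if t: "t \<in> {p..r}" for t
    proof -
      have 1: "((\<lambda>t. complex_of_real (a l t * \<psi> l t)) has_vector_derivative of_real (b' l t)) (at t within {p..r})"
        using b'(2) l t has_vector_derivative_of_real has_real_derivative_iff_has_vector_derivative by blast
      have 2: "(?e has_vector_derivative (\<Lambda> * \<phi>' l t) *\<^sub>R (\<i> * ?e t)) (at t within {p..r})"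
        by (intro derivative_intros DERIV_cmult \<phi> l t)
      have 3: "complex_of_real (a l t * \<psi> l t) * ((\<Lambda> * \<phi>' l t) *\<^sub>R (\<i> * ?e t)) + of_real (b' l t) * ?e t
          = of_real (b' l t) * ?e t + \<i> * of_real \<Lambda> * (of_real (a l t) * ?e t)"
      proof -
        have "complex_of_real (a l t * \<psi> l t) * ((\<Lambda> * \<phi>' l t) *\<^sub>R (\<i> * ?e t)) =
          of_real (\<psi> l t * \<phi>' l t) * (\<i> * of_real \<Lambda> * (of_real (a l t) * ?e t))"
          by (simp add: scaleR_conv_of_real)
        then show ?thesis using inv[OF l t] by simp
      qed
      from has_vector_derivative_mult[OF 1 2] show ?thesis unfolding 3 .
    qed
    from fundamental_theorem_of_calculus[OF \<open>p \<le> r\<close> this]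
    have i0: "((\<lambda>t. of_real (b' l t) * ?e t + \<i> * of_real \<Lambda> * (of_real (a l t) * ?e t)) has_integral 0) {p..r}"
      using ends l by auto
    have "((\<lambda>t. of_real (b' l t) * ?e t + \<i> * of_real \<Lambda> * (of_real (a l t) * ?e t)) has_integral
        integral {p..r} (\<lambda>t. of_real (b' l t) * ?e t) + \<i> * of_real \<Lambda> * integral {p..r} (\<lambda>t. of_real (a l t) * ?e t)) {p..r}"
      by (intro has_integral_add has_integral_mult_right integrable_integral integrable_continuous_real ca cb)
    from has_integral_unique[OF this i0]
    have "integral {p..r} (\<lambda>t. of_real (b' l t) * ?e t) = - (\<i> * of_real \<Lambda> * integral {p..r} (\<lambda>t. of_real (a l t) * ?e t))"
      by (simp only: eq_neg_iff_add_eq_0)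
    then have "\<Lambda> * cmod (integral {p..r} (\<lambda>t. of_real (a l t) * ?e t)) = cmod (integral {p..r} (\<lambda>t. of_real (b' l t) * ?e t))"
      using \<Lambda> by (simp add: norm_mult)
    also have "\<dots> \<le> C / \<Lambda> ^ N" using C l \<Lambda> by auto
    finally show ?thesis using \<Lambda> by (simp add: field_simps)
  qed
  then show ?case using C(1) by auto
qed

section \<open>Lebesgue integrals over compact intervals\<close>

text \<open>Encoded as a density on the whole line rather than as a restricted space: measurability
  then concerns total Borel functions, and only the bounds are relative to the interval.\<close>

definition leb :: "real \<Rightarrow> real \<Rightarrow> real measure" where
  "leb a b = density lborel (indicator {a..b})"

lemma borel_measurable_cis [measurable]: "cis \<in> borel_measurable borel"
  unfolding cis_conv_exp[abs_def] by (intro borel_measurable_continuous_onI continuous_intros)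

lemma borel_measurable_cnj [measurable]: "cnj \<in> borel_measurable borel"
  by (intro borel_measurable_continuous_onI continuous_intros)

lemma sets_leb [simp, measurable_cong]: "sets (leb a b) = sets borel"
  by (simp add: leb_def)

lemma space_leb [simp]: "space (leb a b) = UNIV"
  by (simp add: leb_def)

lemma emeasure_leb_UNIV: "emeasure (leb a b) UNIV = ennreal (max 0 (b - a))"
proof -
  have "emeasure (leb a b) UNIV = emeasure lborel {a..b}"
    by (simp add: leb_def emeasure_density)
  then show ?thesis by (auto simp: max_def)
qed

lemma finite_measure_leb: "finite_measure (leb a b)"
  by (rule finite_measureI) (simp add: emeasure_leb_UNIV)

interpretation leb: finite_measure "leb a b" for a b by (rule finite_measure_leb)
interpretation leb2: pair_sigma_finite "leb a b" "leb c d" for a b c d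
  by (intro pair_sigma_finite.intro leb.sigma_finite_measure)
interpretation leb2f: finite_measure "leb a b \<Otimes>\<^sub>M leb c d" for a b c d
  by (rule finite_measure_pair_measure) (rule finite_measure_leb)+

lemma measure_leb: "a \<le> b \<Longrightarrow> measure (leb a b) UNIV = b - a"
  by (simp add: measure_def emeasure_leb_UNIV)

lemma AE_leb: "AE x in leb a b. x \<in> {a..b}"
  unfolding leb_def by (subst AE_density) (auto simp: indicator_def)

lemma AE_leb_pair: "AE p in leb a b \<Otimes>\<^sub>M leb c d. fst p \<in> {a..b} \<and> snd p \<in> {c..d}"
proof (rule leb2.AE_pair_measure)
  show "{x \<in> space (leb a b \<Otimes>\<^sub>M leb c d). fst x \<in> {a..b} \<and> snd x \<in> {c..d}} \<in> sets (leb a b \<Otimes>\<^sub>M leb c d)"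
    by measurable
  show "AE x in leb a b. AE y in leb c d. fst (x, y) \<in> {a..b} \<and> snd (x, y) \<in> {c..d}"
    using AE_leb[of a b] AE_leb[of c d] by (auto simp: eventually_conj_iff)
qed

lemma integrable_leb:
  fixes f :: "real \<Rightarrow> 'a::{banach,second_countable_topology}"
  assumes "f \<in> borel_measurable borel" "\<And>x. x \<in> {a..b} \<Longrightarrow> norm (f x) \<le> C"
  shows "integrable (leb a b) f"
  using AE_leb[of a b] assms by (intro leb.integrable_const_bound[of f C]) auto

lemma integrable_leb2:
  fixes f :: "real \<times> real \<Rightarrow> 'a::{banach,second_countable_topology}"
  assumes "f \<in> borel_measurable (borel \<Otimes>\<^sub>M borel)"
    "\<And>x y. x \<in> {a..b} \<Longrightarrow> y \<in> {c..d} \<Longrightarrow> norm (f (x, y)) \<le> C"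
  shows "integrable (leb a b \<Otimes>\<^sub>M leb c d) f"
proof (rule leb2f.integrable_const_bound[of f C])
  show "f \<in> borel_measurable (leb a b \<Otimes>\<^sub>M leb c d)"
    using assms(1) by simp
  show "AE x in leb a b \<Otimes>\<^sub>M leb c d. norm (f x) \<le> C"
    using AE_leb_pair[of a b c d]
    by eventually_elim (use assms(2) in \<open>metis prod.collapse\<close>)
qed

lemma leb_swap:
  fixes f :: "real \<Rightarrow> real \<Rightarrow> 'a::{banach,second_countable_topology}"
  assumes "case_prod f \<in> borel_measurable (borel \<Otimes>\<^sub>M borel)"
    "\<And>x y. x \<in> {a..b} \<Longrightarrow> y \<in> {c..d} \<Longrightarrow> norm (f x y) \<le> C"
  shows "(\<integral>x. (\<integral>y. f x y \<partial>leb c d) \<partial>leb a b) = (\<integral>y. (\<integral>x. f x y \<partial>leb a b) \<partial>leb c d)"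
  using integrable_leb2[of "case_prod f" a b c d C] assms by (intro leb2.Fubini_integral[symmetric]) auto

lemma norm_leb_le:
  fixes f :: "real \<Rightarrow> 'a::{banach,second_countable_topology}"
  assumes "a \<le> b" "0 \<le> C" "\<And>x. x \<in> {a..b} \<Longrightarrow> norm (f x) \<le> C"
  shows "norm (\<integral>x. f x \<partial>leb a b) \<le> C * (b - a)"
proof (cases "integrable (leb a b) f")
  case True
  have "norm (\<integral>x. f x \<partial>leb a b) \<le> (\<integral>x. norm (f x) \<partial>leb a b)"
    by (rule integral_norm_bound)
  also have "\<dots> \<le> (\<integral>x. C \<partial>leb a b)"
    using True AE_leb[of a b] by (intro integral_mono_AE) (auto elim!: eventually_mono intro!: assms(3) simp del: atLeastAtMost_iff)
  finally have "norm (\<integral>x. f x \<partial>leb a b) \<le> (\<integral>x. C \<partial>leb a b)" .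
  then show ?thesis using assms by (simp add: measure_leb mult.commute)
next
  case False then show ?thesis using assms by (simp add: not_integrable_integral_eq)
qed

lemma leb_mono:
  fixes f g :: "real \<Rightarrow> real"
  assumes "integrable (leb a b) f" "integrable (leb a b) g" "\<And>x. x \<in> {a..b} \<Longrightarrow> f x \<le> g x"
  shows "(\<integral>x. f x \<partial>leb a b) \<le> (\<integral>x. g x \<partial>leb a b)"
  using AE_leb[of a b] assms(1,2) by (intro integral_mono_AE) (auto elim!: eventually_mono intro!: assms(3) simp del: atLeastAtMost_iff)

lemma leb_cong:
  assumes "\<And>x. x \<in> {a..b} \<Longrightarrow> f x = g x"
    "f \<in> borel_measurable borel" "g \<in> borel_measurable borel"
  shows "(\<integral>x. f x \<partial>leb a b) = (\<integral>x. g x \<partial>leb a b)"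
  using AE_leb[of a b] assms(2,3) by (intro integral_cong_AE) (auto elim!: eventually_mono intro!: assms(1) simp del: atLeastAtMost_iff)

text \<open>Nonnegativity of the variance: expand the integral of (|f| - mean)^2, where the mean is
  taken over the interval.\<close>

lemma leb_Cauchy_Schwarz:
  fixes f :: "real \<Rightarrow> 'a::{banach,second_countable_topology}"
  assumes f: "f \<in> borel_measurable borel" "\<And>x. x \<in> {a..b} \<Longrightarrow> norm (f x) \<le> C" and "a \<le> b"
  shows "(norm (\<integral>x. f x \<partial>leb a b))\<^sup>2 \<le> (b - a) * (\<integral>x. (norm (f x))\<^sup>2 \<partial>leb a b)"
proof (cases "a = b")
  case True
  then show ?thesis using norm_leb_le[of a b "max C 0" f] f(2) by (simp add: le_max_iff_disj)
next
  case False
  let ?M = "leb a b" and ?m = "\<integral>x. norm (f x) \<partial>leb a b" and ?L = "b - a"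
  have L: "?L > 0" using False \<open>a \<le> b\<close> by simp
  note [measurable] = f(1)
  have i1: "integrable ?M (\<lambda>x. norm (f x))" using f by (intro integrable_leb[of _ _ _ C]) auto
  have i2: "integrable ?M (\<lambda>x. (norm (f x))\<^sup>2)"
    using f(2) by (intro integrable_leb[of _ _ _ "C\<^sup>2"]) (auto simp: power_mono)
  have "0 \<le> (\<integral>x. (norm (f x) - ?m / ?L)\<^sup>2 \<partial>?M)" by (intro integral_nonneg_AE) auto
  also have "\<dots> = (\<integral>x. (norm (f x))\<^sup>2 - 2 * (?m / ?L) * norm (f x) + (?m / ?L)\<^sup>2 \<partial>?M)"
    by (simp add: power2_diff algebra_simps)
  also have "\<dots> = (\<integral>x. (norm (f x))\<^sup>2 \<partial>?M) - 2 * (?m / ?L) * ?m + (?m / ?L)\<^sup>2 * ?L"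
    using i1 i2 \<open>a \<le> b\<close> by (simp add: measure_leb)
  also have "\<dots> = (\<integral>x. (norm (f x))\<^sup>2 \<partial>?M) - ?m\<^sup>2 / ?L"
    using L by (simp add: power2_eq_square divide_simps)
  finally have "?m\<^sup>2 \<le> ?L * (\<integral>x. (norm (f x))\<^sup>2 \<partial>?M)"
    using L by (simp add: pos_divide_le_eq mult.commute)
  moreover have "(norm (\<integral>x. f x \<partial>?M))\<^sup>2 \<le> ?m\<^sup>2"
    by (intro power_mono integral_norm_bound) auto
  ultimately show ?thesis by linarith
qed

text \<open>The gauge integral brings the fundamental theorem of calculus, the measure brings
  Fubini; for bounded Borel functions this passes between the two.\<close>

lemma leb_eq_integral:
  fixes f :: "real \<Rightarrow> 'a::euclidean_space"
  assumes f: "f \<in> borel_measurable borel" "\<And>x. x \<in> {a..b} \<Longrightarrow> norm (f x) \<le> C"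
  shows "f integrable_on {a..b}" "(\<integral>x. f x \<partial>leb a b) = integral {a..b} f"
proof -
  have ind: "(\<lambda>x. ennreal (indicator {a..b} x)) = indicator {a..b}" by (auto simp: indicator_def)
  have leb': "leb a b = density lborel (\<lambda>x. ennreal (indicator {a..b} x))" by (simp add: leb_def ind)
  have "integrable (leb a b) f" using f by (rule integrable_leb)
  then have s: "set_integrable lborel {a..b} f"
    unfolding leb' set_integrable_def using f(1) by (subst (asm) integrable_density) auto
  have "(\<integral>x. f x \<partial>leb a b) = (LINT x:{a..b}|lborel. f x)"
    unfolding leb' set_lebesgue_integral_def using f(1) by (subst integral_density) auto
  with set_borel_integral_eq_integral[OF s] show "f integrable_on {a..b}"
    "(\<integral>x. f x \<partial>leb a b) = integral {a..b} f" by auto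
qed

text \<open>Both [0, a] followed by [a, a+p] and [0, p] followed by [p, a+p] make up [0, a+p], and
  [p, a+p] is a translate of [0, a] by the period. This needs no comparison of a with p.\<close>

lemma integral_periodic_shift:
  fixes X :: "real \<Rightarrow> 'a::euclidean_space"
  assumes X: "\<And>a b. X integrable_on {a..b}" and per: "\<And>t. X (t + p) = X t" and "0 \<le> p"
  shows "integral {a..a+p} X = integral {0..p} X"
proof -
  have sh: "integral {c+p..d+p} X = integral {c..d} X" for c d
  proof -
    have "integral {c+p..d+p} X = integral {c..d} (\<lambda>x. X (x + p))"
      using integral_shift_Icc_real[of c d X p] by (simp add: o_def add.commute)
    then show ?thesis by (simp add: per)
  qed
  have comb: "integral {c..d} X + integral {d..e} X = integral {c..e} X" if "c \<le> d" "d \<le> e" for c d e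
    using that X by (intro Henstock_Kurzweil_Integration.integral_combine) auto
  show ?thesis
  proof (cases "0 \<le> a")
    case True
    have "integral {0..a} X + integral {a..a+p} X = integral {0..a+p} X"
      "integral {0..p} X + integral {p..a+p} X = integral {0..a+p} X"
      using True \<open>0 \<le> p\<close> by (auto intro!: comb)
    then show ?thesis using sh[of 0 a] by (metis add.commute add.left_neutral add_left_cancel)
  next
    case False
    have "integral {a..a+p} X + integral {a+p..p} X = integral {a..p} X"
      "integral {a..0} X + integral {0..p} X = integral {a..p} X"
      using False \<open>0 \<le> p\<close> by (auto intro!: comb)
    then show ?thesis using sh[of a 0] by (metis add.commute add.left_neutral add_left_cancel)
  qed
qed

lemma leb_periodic_shift:
  fixes X :: "real \<Rightarrow> 'a::euclidean_space"
  assumes X: "X \<in> borel_measurable borel" "\<And>x. norm (X x) \<le> C" and per: "\<And>t. X (t + p) = X t" and "0 \<le> p"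
  shows "(\<integral>t. X (c + t) \<partial>leb a (a + p)) = (\<integral>t. X t \<partial>leb 0 p)"
proof -
  have [measurable]: "X \<in> borel_measurable borel" by fact
  have "(\<integral>t. X (c + t) \<partial>leb a (a + p)) = integral {a..a+p} (\<lambda>t. X (t + c))"
    using X(2) by (subst leb_eq_integral(2)[of _ _ _ C]) (auto simp: add.commute)
  also have "\<dots> = integral {a+c..a+c+p} X"
    using integral_shift_Icc_real[of a "a+p" X c] by (simp add: o_def algebra_simps)
  also have "\<dots> = integral {0..p} X"
    using X by (intro integral_periodic_shift per \<open>0 \<le> p\<close> leb_eq_integral(1)) auto
  finally show ?thesis using leb_eq_integral(2)[of X 0 p C] X by simp
qed

section \<open>Fourier transforms of weight profiles\<close>

text \<open>Fourier transforms of finite complex measures on \<open>[-1,1]\<close> that consist of point masses and a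
  bounded density.\<close>

inductive fourier_meas :: "(real \<Rightarrow> complex) \<Rightarrow> bool" where
  point: "\<bar>p\<bar> \<le> 1 \<Longrightarrow> fourier_meas (\<lambda>y. c * cis (p * y))"
| density: "g \<in> borel_measurable borel \<Longrightarrow> (\<And>s. cmod (g s) \<le> C) \<Longrightarrow>
    fourier_meas (\<lambda>y. \<integral>s. g s * cis (s * y) \<partial>leb (-1) 1)"
| add: "fourier_meas F \<Longrightarrow> fourier_meas G \<Longrightarrow> fourier_meas (\<lambda>y. F y + G y)"

text \<open>One integration by parts on a piece: the boundary terms are point masses at a and b, the
  derivative of the C^1 extension is the density. The values of \<open>g\<close> at a and b may
  differ from those of \<open>G\<close>, which does not affect the integral.\<close>

lemma fourier_meas_piece:
  fixes g G :: "real \<Rightarrow> real"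
  assumes ab: "-1 \<le> a" "a < b" "b \<le> 1" and G: "C_k_on 1 {a..b} G" "\<And>s. s \<in> {a<..<b} \<Longrightarrow> G s = g s"
  shows "(\<forall>y. (\<lambda>s. of_real (g s) * cis (s * y)) integrable_on {a..b}) \<and>
    fourier_meas (\<lambda>y. - \<i> * of_real y * integral {a..b} (\<lambda>s. of_real (g s) * cis (s * y)))"
proof -
  obtain D where D: "D 0 = G" "\<forall>t\<in>{a..b}. (D 0 has_vector_derivative D (Suc 0) t) (at t within {a..b})"
      "continuous_on {a..b} (D 0)" "continuous_on {a..b} (D (Suc 0))"
    using G(1) by (auto simp: C_k_on_def enat_0_iff one_enat_def)
  let ?G' = "D (Suc 0)"
  define k where "k = (\<lambda>s. indicator {a..b} s *\<^sub>R complex_of_real (?G' s))"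
  have km: "k \<in> borel_measurable borel"
    unfolding k_def using D(4) by (intro borel_measurable_continuous_on_indicator continuous_intros) auto
  have "compact (?G' ` {a..b})" using D(4) by (intro compact_continuous_image) auto
  then obtain C where C: "\<And>s. s \<in> {a..b} \<Longrightarrow> \<bar>?G' s\<bar> \<le> C"
    using compact_imp_bounded by (fastforce simp: bounded_iff)
  have kC: "cmod (k s) \<le> max C 0" for s
    using C[of s] by (auto simp: k_def indicator_def le_max_iff_disj)
  have gi: "((\<lambda>s. of_real (g s) * cis (s * y)) has_integral integral {a..b} (\<lambda>s. of_real (G s) * cis (s * y))) {a..b}" for y
  proof -
    have "continuous_on {a..b} (\<lambda>s. complex_of_real (G s) * cis (s * y))"
      using D(1,3) by (auto simp: cis_conv_exp intro!: continuous_intros)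
    then have "((\<lambda>s. complex_of_real (G s) * cis (s * y)) has_integral integral {a..b} (\<lambda>s. of_real (G s) * cis (s * y))) (cbox a b)"
      by (simp add: integrable_integral integrable_continuous_real)
    then have "((\<lambda>s. of_real (g s) * cis (s * y)) has_integral integral {a..b} (\<lambda>s. of_real (G s) * cis (s * y))) (cbox a b)"
      by (rule has_integral_spike_interior) (use G(2) in auto)
    then show ?thesis by simp
  qed
  have "- \<i> * of_real y * integral {a..b} (\<lambda>s. of_real (g s) * cis (s * y)) =
    (- of_real (G b)) * cis (b * y) + (of_real (G a) * cis (a * y) + (\<integral>s. k s * cis (s * y) \<partial>leb (-1) 1))" for y
  proof -
    have c1: "continuous_on {a..b} (\<lambda>s. complex_of_real (?G' s) * cis (s * y))"
      "continuous_on {a..b} (\<lambda>s. complex_of_real (G s) * cis (s * y))"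
      using D(1,3,4) by (auto simp: cis_conv_exp intro!: continuous_intros)
    have "((\<lambda>s. complex_of_real (G s) * cis (s * y)) has_vector_derivative
       of_real (G t) * (y *\<^sub>R (\<i> * cis (t * y))) + of_real (?G' t) * cis (t * y)) (at t within {a..b})"
      if "t \<in> {a..b}" for t
      using D(1,2) that by (intro has_vector_derivative_mult has_vector_derivative_cis has_vector_derivative_of_real)
        (auto intro!: derivative_eq_intros simp: has_real_derivative_iff_has_vector_derivative)
    from fundamental_theorem_of_calculus[OF _ this]
    have "((\<lambda>t. of_real (G t) * (y *\<^sub>R (\<i> * cis (t * y))) + of_real (?G' t) * cis (t * y)) has_integral
       of_real (G b) * cis (b * y) - of_real (G a) * cis (a * y)) {a..b}" using ab by auto
    moreover have "((\<lambda>t. \<i> * of_real y * (of_real (G t) * cis (t * y)) + of_real (?G' t) * cis (t * y)) has_integral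
       \<i> * of_real y * integral {a..b} (\<lambda>s. of_real (G s) * cis (s * y)) + integral {a..b} (\<lambda>s. of_real (?G' s) * cis (s * y))) {a..b}"
      by (intro has_integral_add has_integral_mult_right integrable_integral integrable_continuous_real c1)
    ultimately have "\<i> * of_real y * integral {a..b} (\<lambda>s. of_real (G s) * cis (s * y)) + integral {a..b} (\<lambda>s. of_real (?G' s) * cis (s * y))
      = of_real (G b) * cis (b * y) - of_real (G a) * cis (a * y)"
      by (intro has_integral_unique) (auto simp: scaleR_conv_of_real algebra_simps)
    moreover have "(\<integral>s. k s * cis (s * y) \<partial>leb (-1) 1) = integral {a..b} (\<lambda>s. of_real (?G' s) * cis (s * y))"
    proof -
      have "(\<integral>s. k s * cis (s * y) \<partial>leb (-1) 1) = integral {-1..1} (\<lambda>s. k s * cis (s * y))"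
        using km kC by (intro leb_eq_integral(2)[of _ _ _ "max C 0"]) (auto simp: norm_mult)
      also have "\<dots> = integral {-1..1} (\<lambda>s. if s \<in> {a..b} then of_real (?G' s) * cis (s * y) else 0)"
        by (intro arg_cong[where f="integral {-1..1}"] ext) (auto simp: k_def)
      also have "\<dots> = integral {a..b} (\<lambda>s. of_real (?G' s) * cis (s * y))"
        using ab integrable_integral[OF integrable_continuous_real[OF c1(1)]]
        by (intro integral_unique) (subst has_integral_restrict, auto)
      finally show ?thesis .
    qed
    ultimately show ?thesis using integral_unique[OF gi[of y]] by (simp add: algebra_simps)
  qed
  moreover have "fourier_meas (\<lambda>y. (- of_real (G b)) * cis (b * y) + (of_real (G a) * cis (a * y) + (\<integral>s. k s * cis (s * y) \<partial>leb (-1) 1)))"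
    using ab by (intro fourier_meas.add fourier_meas.point fourier_meas.density[OF km kC]) auto
  ultimately show ?thesis using gi by (auto simp: integrable_on_def)
qed

text \<open>Induction on the number of break points strictly inside the interval: cutting at one of
  them leaves fewer on either side. The jumps accumulate as point masses at the cuts.\<close>

lemma fourier_meas_piecewise_C1:
  fixes g :: "real \<Rightarrow> real"
  assumes B: "finite B" "\<And>a b. a < b \<Longrightarrow> {a<..<b} \<inter> B = {} \<Longrightarrow>
           \<exists>G. C_k_on 1 {a..b} G \<and> (\<forall>s\<in>{a<..<b}. G s = g s)"
  shows "-1 \<le> a \<Longrightarrow> a < b \<Longrightarrow> b \<le> 1 \<Longrightarrow> (\<forall>y. (\<lambda>s. of_real (g s) * cis (s * y)) integrable_on {a..b}) \<and>
    fourier_meas (\<lambda>y. - \<i> * of_real y * integral {a..b} (\<lambda>s. of_real (g s) * cis (s * y)))"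
proof (induction "card (B \<inter> {a<..<b})" arbitrary: a b rule: less_induct)
  case less
  show ?case
  proof (cases "{a<..<b} \<inter> B = {}")
    case True
    with B(2)[of a b] less.prems obtain G where "C_k_on 1 {a..b} G" "\<forall>s\<in>{a<..<b}. G s = g s" by auto
    then show ?thesis using less.prems by (intro fourier_meas_piece[of a b G]) auto
  next
    case False
    then obtain p where p: "a < p" "p < b" "p \<in> B" by auto
    have c: "card (B \<inter> {a<..<p}) < card (B \<inter> {a<..<b})" "card (B \<inter> {p<..<b}) < card (B \<inter> {a<..<b})"
      using p B(1) by (auto intro!: psubset_card_mono)
    have 1: "(\<forall>y. (\<lambda>s. of_real (g s) * cis (s * y)) integrable_on {a..p}) \<and>
        fourier_meas (\<lambda>y. - \<i> * of_real y * integral {a..p} (\<lambda>s. of_real (g s) * cis (s * y)))"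
      using less.prems p by (intro less.hyps c) auto
    have 2: "(\<forall>y. (\<lambda>s. of_real (g s) * cis (s * y)) integrable_on {p..b}) \<and>
        fourier_meas (\<lambda>y. - \<i> * of_real y * integral {p..b} (\<lambda>s. of_real (g s) * cis (s * y)))"
      using less.prems p by (intro less.hyps c) auto
    have 3: "\<forall>y. (\<lambda>s. of_real (g s) * cis (s * y)) integrable_on {a..b}"
      using 1 2 p by (auto intro: Henstock_Kurzweil_Integration.integrable_combine[of a p b])
    have "- \<i> * of_real y * integral {a..b} (\<lambda>s. of_real (g s) * cis (s * y)) =
       - \<i> * of_real y * integral {a..p} (\<lambda>s. of_real (g s) * cis (s * y)) +
       - \<i> * of_real y * integral {p..b} (\<lambda>s. of_real (g s) * cis (s * y))" for y
      using p 3 by (subst Henstock_Kurzweil_Integration.integral_combine[of a p b, symmetric]) (auto simp: algebra_simps)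
    then show ?thesis using 3 fourier_meas.add[OF conjunct2[OF 1] conjunct2[OF 2]] by simp
  qed
qed

text \<open>Off the finite set of break points the function is continuous, and a finite set cannot
  spoil Borel measurability whatever the values on it.\<close>

lemma piecewise_C1_borel:
  assumes "piecewise_C1 g" shows "g \<in> borel_measurable borel"
proof -
  obtain B where B: "finite B" "\<And>a b. a < b \<Longrightarrow> {a<..<b} \<inter> B = {} \<Longrightarrow>
           \<exists>G. C_k_on 1 {a..b} G \<and> (\<forall>s\<in>{a<..<b}. G s = g s)"
    using assms unfolding piecewise_C1_def by meson
  have op: "open (- B)" using B(1) finite_imp_closed by blast
  have "continuous_on (- B) g"
  proof (rule continuous_at_imp_continuous_on, rule ballI)
    fix x assume "x \<in> - B"
    then obtain e where e: "e > 0" "ball x e \<subseteq> - B" using op open_contains_ball by blast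
    then have "{x - e<..<x + e} \<inter> B = {}" by (auto simp: ball_eq_greaterThanLessThan)
    then obtain G where G: "C_k_on 1 {x-e..x+e} G" "\<forall>s\<in>{x-e<..<x+e}. G s = g s"
      using B(2)[of "x - e" "x + e"] e by auto
    then have "continuous_on {x-e..x+e} G" unfolding C_k_on_def by (metis zero_enat_def zero_le)
    then have "continuous_on {x-e<..<x+e} G" by (rule continuous_on_subset) auto
    then have "continuous_on {x-e<..<x+e} g" by (rule continuous_on_eq) (use G(2) in auto)
    then show "isCont g x" using e(1) by (auto simp: continuous_on_eq_continuous_at)
  qed
  then have "g \<in> borel_measurable (restrict_space borel (- B))"
    by (rule borel_measurable_continuous_on_restrict)
  then show ?thesis by (rule measurable_restrict_countable[OF countable_finite[OF B(1)], rotated 2]) simp_all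
qed

lemma weight_profile_zero:
  assumes "weight_profile q \<theta>" "\<not> \<bar>s\<bar> \<le> 1" shows "\<theta> s = 0"
proof (rule ccontr)
  assume "\<theta> s \<noteq> 0"
  then have "s \<in> closure {s. \<theta> s \<noteq> 0}" using closure_subset[of "{s. \<theta> s \<noteq> 0}"] by auto
  with assms show False by (auto simp: weight_profile_def)
qed

lemma weight_profile_borel_bounded:
  assumes "weight_profile q \<theta>"
  shows "\<theta> \<in> borel_measurable borel" "\<exists>C. \<forall>s. \<bar>\<theta> s\<bar> \<le> C"
proof -
  have "\<theta> \<in> borel_measurable borel \<and> (\<exists>C. \<forall>s. \<bar>\<theta> s\<bar> \<le> C)"
  proof (cases "q = 0")
    case True
    then show ?thesis using assms piecewise_C1_borel[of \<theta>] by (auto simp: weight_profile_def bounded_iff)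
  next
    case False
    then have "C_k_on (enat (q - 1)) UNIV \<theta>" using assms by (auto simp: weight_profile_def)
    then have c: "continuous_on UNIV \<theta>" by (auto simp: C_k_on_def)
    have "compact (\<theta> ` {-1..1})" by (intro compact_continuous_image continuous_on_subset[OF c]) auto
    then obtain C where C: "\<And>s. s \<in> {-1..1} \<Longrightarrow> \<bar>\<theta> s\<bar> \<le> C"
      using compact_imp_bounded by (fastforce simp: bounded_iff)
    have "\<bar>\<theta> s\<bar> \<le> max C 0" for s
      using C[of s] weight_profile_zero[OF assms, of s] by (cases "\<bar>s\<bar> \<le> 1") (auto simp: le_max_iff_disj abs_le_iff)
    then show ?thesis using c borel_measurable_continuous_onI by blast
  qed
  then show "\<theta> \<in> borel_measurable borel" "\<exists>C. \<forall>s. \<bar>\<theta> s\<bar> \<le> C" by auto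
qed

text \<open>The derivatives of order below q are continuous and vanish outside [-1,1], hence also at
  the two end points; so q integrations by parts produce no boundary terms.\<close>

lemma weight_profile_by_parts:
  assumes w: "weight_profile q \<theta>" and "0 < q"
  shows "(- \<i> * of_real y) ^ q * integral {-1..1} (\<lambda>s. of_real (\<theta> s) * cis (s * y)) =
     integral {-1..1} (\<lambda>s. of_real ((deriv ^^ q) \<theta> s) * cis (s * y))"
proof -
  obtain D where D: "D 0 = \<theta>" "\<And>n t. n < q - 1 \<Longrightarrow> (D n has_vector_derivative D (Suc n) t) (at t)"
    "\<And>n. n \<le> q - 1 \<Longrightarrow> continuous_on UNIV (D n)"
    and "\<exists>B. finite B \<and> (\<forall>s. s \<notin> B \<longrightarrow> (deriv ^^ (q - 1)) \<theta> differentiable (at s))"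
    using w \<open>0 < q\<close> unfolding weight_profile_def C_k_on_def by auto
  then obtain B where B: "finite B" "\<And>s. s \<notin> B \<Longrightarrow> (deriv ^^ (q - 1)) \<theta> differentiable (at s)" by auto
  have dD: "(deriv ^^ n) \<theta> = D n" if "n \<le> q - 1" for n
    using that
  proof (induction n)
    case (Suc n)
    then have "(D n has_real_derivative D (Suc n) t) (at t)" for t
      using D(2)[of n t] by (simp add: has_real_derivative_iff_has_vector_derivative)
    then have "deriv (D n) t = D (Suc n) t" for t by (rule DERIV_imp_deriv)
    then have "deriv (D n) = D (Suc n)" by (rule ext)
    then show ?case using Suc by simp
  qed (use D in simp)
  have out: "D n t = 0" if "n \<le> q - 1" "\<bar>t\<bar> > 1" for n t
    using that
  proof (induction n arbitrary: t)
    case 0 then show ?case using D(1) weight_profile_zero[OF w] by auto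
  next
    case (Suc n)
    have op: "open {t::real. \<bar>t\<bar> > 1}" by (intro open_Collect_less continuous_intros)
    have "(D n has_real_derivative D (Suc n) t) (at t)"
      using D(2)[of n t] Suc by (simp add: has_real_derivative_iff_has_vector_derivative)
    moreover have "((\<lambda>_. 0) has_real_derivative 0) (at t)" by simp
    then have "(D n has_real_derivative 0) (at t)"
      by (rule has_field_derivative_transform_within_open[OF _ op]) (use Suc in auto)
    ultimately show ?case by (rule DERIV_unique)
  qed
  have ends: "D n 1 = 0" "D n (-1) = 0" if "n \<le> q - 1" for n
  proof -
    have cont: "isCont (D n) x" for x using D(3)[OF that] by (simp add: continuous_on_eq_continuous_at)
    have "(D n \<longlongrightarrow> D n 1) (at_right 1)" using cont[of 1] by (auto simp: isCont_def filterlim_at_split)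
    moreover have "(D n \<longlongrightarrow> 0) (at_right 1)"
      by (rule tendsto_eventually) (use out[OF that] in \<open>auto simp: eventually_at_filter\<close>)
    ultimately show "D n 1 = 0" using tendsto_unique trivial_limit_at_right_real by blast
    have "(D n \<longlongrightarrow> D n (-1)) (at_left (-1))" using cont[of "-1"] by (auto simp: isCont_def filterlim_at_split)
    moreover have "(D n \<longlongrightarrow> 0) (at_left (-1))"
      by (rule tendsto_eventually) (use out[OF that] in \<open>auto simp: eventually_at_filter\<close>)
    ultimately show "D n (-1) = 0" using tendsto_unique trivial_limit_at_left_real by blast
  qed
  have step: "- \<i> * of_real y * integral {-1..1} (\<lambda>s. of_real ((deriv ^^ n) \<theta> s) * cis (s * y)) =
     integral {-1..1} (\<lambda>s. of_real ((deriv ^^ Suc n) \<theta> s) * cis (s * y))" if n: "n \<le> q - 1" for n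
  proof -
    have df: "((D n) has_vector_derivative (deriv ^^ Suc n) \<theta> s) (at s)" if "s \<notin> B" for s
    proof -
      have "D n differentiable (at s)"
      proof (cases "n = q - 1")
        case True then show ?thesis using B(2)[OF that] dD[of n] by simp
      next
        case False then show ?thesis using D(2)[of n s] n differentiableI_vector by fastforce
      qed
      then have "(D n has_real_derivative deriv (D n) s) (at s)"
        using DERIV_deriv_iff_real_differentiable by blast
      then show ?thesis using dD[OF n] by (simp add: has_real_derivative_iff_has_vector_derivative)
    qed
    have cc: "continuous_on {-1..1} (\<lambda>s. complex_of_real (D n s) * cis (s * y))"
      using continuous_on_subset[OF D(3)[OF n]] by (auto simp: cis_conv_exp intro!: continuous_intros)
    have "((\<lambda>s. complex_of_real (D n s) * (y *\<^sub>R (\<i> * cis (s * y))) + of_real ((deriv ^^ Suc n) \<theta> s) * cis (s * y))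
       has_integral (of_real (D n 1) * cis (1 * y) - of_real (D n (-1)) * cis ((-1) * y))) {-1..1}"
    \<comment> \<open>In the last round the function is only continuous, with a derivative off a
      finite set, so the version of the fundamental theorem with a finite exceptional set is
      taken.\<close>
    proof (rule fundamental_theorem_of_calculus_interior_strong[OF B(1) _ _ cc])
      fix s assume "s \<in> {-1<..<1} - B"
      then show "((\<lambda>s. complex_of_real (D n s) * cis (s * y)) has_vector_derivative
        (complex_of_real (D n s) * (y *\<^sub>R (\<i> * cis (s * y))) + of_real ((deriv ^^ Suc n) \<theta> s) * cis (s * y))) (at s)"
        using df[of s] by (intro has_vector_derivative_mult has_vector_derivative_cis has_vector_derivative_of_real)
        (auto intro!: derivative_eq_intros simp: has_real_derivative_iff_has_vector_derivative)
    qed auto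
    then have 1: "((\<lambda>s. \<i> * of_real y * (complex_of_real (D n s) * cis (s * y)) + of_real ((deriv ^^ Suc n) \<theta> s) * cis (s * y))
       has_integral 0) {-1..1}"
      using ends[OF n] by (simp add: scaleR_conv_of_real algebra_simps)
    have 2: "((\<lambda>s. \<i> * of_real y * (complex_of_real (D n s) * cis (s * y))) has_integral
      \<i> * of_real y * integral {-1..1} (\<lambda>s. complex_of_real (D n s) * cis (s * y))) {-1..1}"
      by (intro has_integral_mult_right integrable_integral integrable_continuous_real cc)
    have "integral {-1..1} (\<lambda>s. of_real ((deriv ^^ Suc n) \<theta> s) * cis (s * y)) =
       - (\<i> * of_real y * integral {-1..1} (\<lambda>s. complex_of_real (D n s) * cis (s * y)))"
      using integral_unique[OF has_integral_diff[OF 1 2]] by simp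
    then show ?thesis using dD[OF n] by simp
  qed
  have "(- \<i> * of_real y) ^ n * integral {-1..1} (\<lambda>s. of_real (\<theta> s) * cis (s * y)) =
     integral {-1..1} (\<lambda>s. of_real ((deriv ^^ n) \<theta> s) * cis (s * y))" if "n \<le> q" for n
    using that
  proof (induction n)
    case (Suc n)
    then have "n \<le> q - 1" by simp
    from step[OF this] Suc show ?case by (simp add: mult.assoc)
  qed simp
  then show ?thesis by simp
qed

text \<open>The smoothness of the weight pays for q powers of y. One more comes from its q-th
  derivative, whose distributional derivative is still a measure: point masses at the jumps plus a
  bounded density. This is the origin of the exponent q + 1.\<close>

lemma weight_profile_fourier:
  assumes w: "weight_profile q \<theta>"
  shows "\<exists>F. fourier_meas F \<and> (\<forall>y. (- \<i> * of_real y) ^ (q + 1) * (\<integral>s. of_real (\<theta> s) * cis (s * y) \<partial>leb (-1) 1) = F y)"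
proof -
  obtain C where C: "\<And>s. \<bar>\<theta> s\<bar> \<le> C" and m: "\<theta> \<in> borel_measurable borel"
    using weight_profile_borel_bounded[OF w] by auto
  have e: "(\<integral>s. of_real (\<theta> s) * cis (s * y) \<partial>leb (-1) 1) = integral {-1..1} (\<lambda>s. complex_of_real (\<theta> s) * cis (s * y))" for y
    using C m by (intro leb_eq_integral(2)[of _ _ _ C]) (auto simp: norm_mult intro!: borel_measurable_times)
  have "piecewise_C1 ((deriv ^^ q) \<theta>)" using w by (cases "q = 0") (auto simp: weight_profile_def)
  then obtain B where "finite B" "\<And>a b. a < b \<Longrightarrow> {a<..<b} \<inter> B = {} \<Longrightarrow>
           \<exists>G. C_k_on 1 {a..b} G \<and> (\<forall>s\<in>{a<..<b}. G s = (deriv ^^ q) \<theta> s)"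
    unfolding piecewise_C1_def by meson
  from fourier_meas_piecewise_C1[OF this, of "-1" 1]
  have F: "fourier_meas (\<lambda>y. - \<i> * of_real y * integral {-1..1} (\<lambda>s. of_real ((deriv ^^ q) \<theta> s) * cis (s * y)))"
    by auto
  have "(- \<i> * of_real y) ^ q * integral {-1..1} (\<lambda>s. of_real (\<theta> s) * cis (s * y)) =
     integral {-1..1} (\<lambda>s. of_real ((deriv ^^ q) \<theta> s) * cis (s * y))" for y
    using weight_profile_by_parts[OF w] by (cases "q = 0") auto
  then have eq: "(- \<i> * of_real y) ^ (q + 1) * (\<integral>s. of_real (\<theta> s) * cis (s * y) \<partial>leb (-1) 1) =
     - \<i> * of_real y * integral {-1..1} (\<lambda>s. of_real ((deriv ^^ q) \<theta> s) * cis (s * y))" for y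
    unfolding e by (simp add: mult.assoc)
  show ?thesis by (rule exI, rule conjI, rule F, rule allI, rule eq)
qed

section \<open>Oscillatory integrals over parallel curves\<close>

definition smooth_bdd :: "(real \<Rightarrow> real) \<Rightarrow> bool" where
  "smooth_bdd g \<longleftrightarrow> (\<forall>n. bs n UNIV {()} (\<lambda>_. g))"

text \<open>Bounds on the whole line are translation invariant, so the shift may depend on the
  parameter in any manner. This is what makes the window estimates uniform in the base
  point.\<close>

lemma smooth_bdd_shift: "smooth_bdd g \<Longrightarrow> bs n S L (\<lambda>l u. g (c l + u))"
proof -
  have "bs n UNIV {()} (\<lambda>_. g) \<Longrightarrow> bs n S L (\<lambda>l u. g (c l + u))"
  proof (induction n arbitrary: g)
    case 0
    then obtain C where C: "continuous_on UNIV g" "\<And>t. \<bar>g t\<bar> \<le> C" by (auto simp: bounded_cont_def)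
    then have "continuous_on S (\<lambda>u. g (c l + u))" for l
      by (intro continuous_on_compose2[OF C(1)] continuous_intros) auto
    then show ?case using C(2) by (auto simp: bounded_cont_def)
  next
    case (Suc n)
    then obtain g' where "bs n UNIV {()} (\<lambda>_. g' ())" and d: "\<And>t. (g has_real_derivative g' () t) (at t)" by auto
    then have g': "bs n UNIV {()} (\<lambda>_. g' ())" by simp
    from Suc.prems obtain C where C: "continuous_on UNIV g" "\<And>t. \<bar>g t\<bar> \<le> C" by (auto simp: bounded_cont_def)
    then have "continuous_on S (\<lambda>u. g (c l + u))" for l
      by (intro continuous_on_compose2[OF C(1)] continuous_intros) auto
    then have b: "bounded_cont S L (\<lambda>l u. g (c l + u))" using C(2) by (auto simp: bounded_cont_def)
    have "((\<lambda>u. g (c l + u)) has_real_derivative g' () (c l + t)) (at t within S)" for l t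
      using DERIV_shift[of g "g' () (c l + t)" t "c l"] d by (simp add: add.commute has_field_derivative_at_within)
    then show ?case using Suc.IH[OF g'] b by (intro bs_SucI[of _ _ _ "\<lambda>l u. g' () (c l + u)"]) auto
  qed
  then show "smooth_bdd g \<Longrightarrow> ?thesis" by (auto simp: smooth_bdd_def)
qed

lemma smooth_bdd_continuous: "smooth_bdd g \<Longrightarrow> continuous_on UNIV g"
  unfolding smooth_bdd_def by (metis bs_bounded_cont bounded_cont_def insertI1)

lemma smooth_bdd_bound: "smooth_bdd g \<Longrightarrow> \<exists>C. \<forall>t. \<bar>g t\<bar> \<le> C"
  unfolding smooth_bdd_def by (metis bs_bounded_cont bounded_cont_def insertI1 UNIV_I)

lemma bs_cos_sin: "bs n S L (\<lambda>l t. cos (c l + t)) \<and> bs n S L (\<lambda>l t. sin (c l + t))"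
proof (induction n)
  have b: "bounded_cont S L (\<lambda>l t. cos (c l + t))" "bounded_cont S L (\<lambda>l t. sin (c l + t))"
    by (auto simp: bounded_cont_def intro!: continuous_intros exI[of _ 1])
  { case 0 show ?case using b by simp }
  { case (Suc n)
    then have "bs n S L (\<lambda>l t. - sin (c l + t))" "bs n S L (\<lambda>l t. cos (c l + t))"
      by (auto intro: bs_minus)
    then show ?case using b
      by (intro conjI bs_SucI[of _ _ "\<lambda>l t. cos (c l + t)" "\<lambda>l t. - sin (c l + t)"]
          bs_SucI[of _ _ "\<lambda>l t. sin (c l + t)" "\<lambda>l t. cos (c l + t)"]) (auto intro!: derivative_eq_intros) }
qed

text \<open>The integral over the whole line is pi / \<Lambda>, by the arctangent primitive. Here
  the factor 1 / \<Lambda> of the circle mean is gained.\<close>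

lemma Poisson_kernel_bound:
  assumes "\<Lambda> > 0" "a \<le> b"
  shows "(\<integral>w. 1 / (1 + (\<Lambda> * (u - w))\<^sup>2) \<partial>leb a b) \<le> pi / \<Lambda>"
proof -
  have pos: "1 + (\<Lambda> * (u - w))\<^sup>2 > 0" for w by (simp add: add_pos_nonneg)
  have 1: "(\<integral>w. 1 / (1 + (\<Lambda> * (u - w))\<^sup>2) \<partial>leb a b) = integral {a..b} (\<lambda>w. 1 / (1 + (\<Lambda> * (u - w))\<^sup>2))"
    by (intro leb_eq_integral(2)[of _ _ _ 1]) (use pos in \<open>auto simp: divide_le_eq\<close>)
  have "((\<lambda>w. 1 / (1 + (\<Lambda> * (u - w))\<^sup>2)) has_integral (- arctan (\<Lambda> * (u - b)) / \<Lambda> - (- arctan (\<Lambda> * (u - a)) / \<Lambda>))) {a..b}"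
  proof (rule fundamental_theorem_of_calculus[OF assms(2)])
    fix w
    have "((\<lambda>w. - arctan (\<Lambda> * (u - w)) / \<Lambda>) has_real_derivative 1 / (1 + (\<Lambda> * (u - w))\<^sup>2)) (at w within {a..b})"
    proof -
      have "((\<lambda>w. arctan (\<Lambda> * (u - w))) has_real_derivative inverse (1 + (\<Lambda> * (u - w))\<^sup>2) * (- \<Lambda>)) (at w within {a..b})"
        by (rule DERIV_chain2[OF DERIV_arctan]) (auto intro!: derivative_eq_intros)
      from DERIV_cdivide[OF DERIV_minus[OF this], of \<Lambda>] show ?thesis
        by (rule DERIV_cong) (use assms(1) in \<open>simp add: inverse_eq_divide\<close>)
    qed
    then show "((\<lambda>w. - arctan (\<Lambda> * (u - w)) / \<Lambda>) has_vector_derivative 1 / (1 + (\<Lambda> * (u - w))\<^sup>2)) (at w within {a..b})"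
      by (simp add: has_real_derivative_iff_has_vector_derivative)
  qed
  then have "integral {a..b} (\<lambda>w. 1 / (1 + (\<Lambda> * (u - w))\<^sup>2)) = (arctan (\<Lambda> * (u - a)) - arctan (\<Lambda> * (u - b))) / \<Lambda>"
    by (auto simp: integral_unique diff_divide_distrib)
  also have "\<dots> \<le> pi / \<Lambda>"
    using assms(1) arctan_bounded[of "\<Lambda> * (u - a)"] arctan_bounded[of "\<Lambda> * (u - b)"] by (intro divide_right_mono) auto
  finally show ?thesis using 1 by simp
qed

text \<open>A closed curve of period 1 with a moving frame: unit normal (nx, ny), tangent (-ny, nx),
  signed speed \<open>v\<close>, curvature \<open>k\<close>. The sign of \<open>v\<close> is free,
  so that the normal can be chosen outward for either orientation. On offsets up to
  \<open>e0\<close> the stretching 1 + \<sigma> k stays at least 1/2. In a window of radius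
  \<open>d\<close> the normal turns by an angle with cosine at least 24/25, hence with sine at most
  7/25 (the triple 7, 24, 25).\<close>

locale strip =
  fixes x y nx ny v k f :: "real \<Rightarrow> real" and e0 v0 d :: real
  assumes smooth: "smooth_bdd v" "smooth_bdd k" "smooth_bdd f"
    and xd: "\<And>t. (x has_real_derivative - (v t * ny t)) (at t)"
    and yd: "\<And>t. (y has_real_derivative v t * nx t) (at t)"
    and nxd: "\<And>t. (nx has_real_derivative - (k t * (v t * ny t))) (at t)"
    and nyd: "\<And>t. (ny has_real_derivative k t * (v t * nx t)) (at t)"
    and unit: "\<And>t. (nx t)\<^sup>2 + (ny t)\<^sup>2 = 1"
    and v0: "0 < v0" "\<And>t. v0 \<le> \<bar>v t\<bar>"
    and e0: "0 < e0" "\<And>t. \<bar>k t\<bar> * e0 \<le> 1 / 2"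
    and d: "0 < d" "\<And>\<tau> u. \<bar>u\<bar> \<le> d \<Longrightarrow> 24 / 25 \<le> nx \<tau> * nx (\<tau> + u) + ny \<tau> * ny (\<tau> + u)"
    and per: "\<And>t. x (t + 1) = x t" "\<And>t. y (t + 1) = y t" "\<And>t. nx (t + 1) = nx t" "\<And>t. ny (t + 1) = ny t"
       "\<And>t. f (t + 1) = f t"
begin

text \<open>For the unit vector e of angle \<open>\<theta>\<close>, \<open>nd\<close> and
  \<open>cr\<close> are the components along e of the normal and of the tangent. \<open>Ph\<close>
  is the inner product of e with the point of the parallel curve at offset \<open>\<sigma>\<close>,
  that is, the phase at unit frequency.\<close>

definition nd :: "real \<Rightarrow> real \<Rightarrow> real" where "nd t \<theta> = nx t * cos \<theta> + ny t * sin \<theta>"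
definition cr :: "real \<Rightarrow> real \<Rightarrow> real" where "cr t \<theta> = nx t * sin \<theta> - ny t * cos \<theta>"
definition Ph :: "real \<Rightarrow> real \<Rightarrow> real \<Rightarrow> real" where
  "Ph \<sigma> t \<theta> = (x t + \<sigma> * nx t) * cos \<theta> + (y t + \<sigma> * ny t) * sin \<theta>"

lemma Ph_add: "Ph \<sigma> t \<theta> = Ph 0 t \<theta> + \<sigma> * nd t \<theta>"
  by (simp add: Ph_def nd_def algebra_simps)

lemma cont: "continuous_on S x" "continuous_on S y" "continuous_on S nx" "continuous_on S ny" "continuous_on S f"
  using xd yd nxd nyd continuous_on_subset[OF smooth_bdd_continuous[OF smooth(3)]]
  by (auto intro!: continuous_at_imp_continuous_on DERIV_isCont)

lemma meas [measurable]: "x \<in> borel_measurable borel" "y \<in> borel_measurable borel" "nx \<in> borel_measurable borel"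
  "ny \<in> borel_measurable borel" "f \<in> borel_measurable borel"
  using cont by (auto intro: borel_measurable_continuous_onI)

lemma meas2 [measurable]:
  assumes [measurable]: "g \<in> borel_measurable M" "h \<in> borel_measurable M"
  shows "(\<lambda>p. nd (g p) (h p)) \<in> borel_measurable M"
  unfolding nd_def by measurable

lemma meas3 [measurable]:
  assumes [measurable]: "g \<in> borel_measurable M" "h \<in> borel_measurable M" "s \<in> borel_measurable M"
  shows "(\<lambda>p. Ph (s p) (g p) (h p)) \<in> borel_measurable M"
  unfolding Ph_def by measurable

lemma n_le_1: "\<bar>nx t\<bar> \<le> 1" "\<bar>ny t\<bar> \<le> 1"
proof -
  have "(nx t)\<^sup>2 \<le> 1\<^sup>2" "(ny t)\<^sup>2 \<le> 1\<^sup>2" using unit[of t] by (auto simp: add.commute) (smt (verit) zero_le_power2)+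
  then show "\<bar>nx t\<bar> \<le> 1" "\<bar>ny t\<bar> \<le> 1" using abs_le_square_iff[of _ "1::real"] by auto
qed

text \<open>The Frenet equations express the derivatives of nx and ny through v, k and these
  components themselves, so each order of regularity yields the next, simultaneously for
  both.\<close>

lemma smooth_n: "smooth_bdd nx" "smooth_bdd ny"
proof -
  have b: "bounded_cont UNIV {()} (\<lambda>_. nx)" "bounded_cont UNIV {()} (\<lambda>_. ny)"
    using cont n_le_1 by (auto simp: bounded_cont_def)
  have "bs n UNIV {()} (\<lambda>_. nx) \<and> bs n UNIV {()} (\<lambda>_. ny)" for n
  proof (induction n)
    case 0 show ?case using b by simp
  next
    case (Suc n)
    have "bs n UNIV {()} (\<lambda>_. v)" "bs n UNIV {()} (\<lambda>_. k)" using smooth by (auto simp: smooth_bdd_def)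
    then have "bs n UNIV {()} (\<lambda>_ t. - (k t * (v t * ny t)))" "bs n UNIV {()} (\<lambda>_ t. k t * (v t * nx t))"
      using Suc by (auto intro!: bs_minus bs_mult)
    then show ?case using b nxd nyd
      by (intro conjI bs_SucI[of _ _ "\<lambda>_. nx" "\<lambda>_ t. - (k t * (v t * ny t))"]
          bs_SucI[of _ _ "\<lambda>_. ny" "\<lambda>_ t. k t * (v t * nx t)"]) auto
  qed
  then show "smooth_bdd nx" "smooth_bdd ny" by (auto simp: smooth_bdd_def)
qed

lemma nd_cr_unit: "(nd t \<theta>)\<^sup>2 + (cr t \<theta>)\<^sup>2 = 1"
proof -
  have "(nd t \<theta>)\<^sup>2 + (cr t \<theta>)\<^sup>2 = ((nx t)\<^sup>2 + (ny t)\<^sup>2) * ((sin \<theta>)\<^sup>2 + (cos \<theta>)\<^sup>2)"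
    unfolding nd_def cr_def by algebra
  then show ?thesis using unit by simp
qed

lemma nd_cr_rotate:
  assumes u: "\<bar>u\<bar> \<le> d"
  obtains a b where "24 / 25 \<le> a" "a \<le> 1" "\<bar>b\<bar> \<le> 7 / 25" "\<And>\<theta>. nd (\<tau> + u) \<theta> = a * nd \<tau> \<theta> + b * cr \<tau> \<theta>"
     "\<And>\<theta>. cr (\<tau> + u) \<theta> = a * cr \<tau> \<theta> - b * nd \<tau> \<theta>"
proof -
  define a where "a = nx \<tau> * nx (\<tau> + u) + ny \<tau> * ny (\<tau> + u)"
  define b where "b = ny (\<tau> + u) * nx \<tau> - nx (\<tau> + u) * ny \<tau>"
  have "a\<^sup>2 + b\<^sup>2 = ((nx \<tau>)\<^sup>2 + (ny \<tau>)\<^sup>2) * ((nx (\<tau> + u))\<^sup>2 + (ny (\<tau> + u))\<^sup>2)"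
    by (simp add: a_def b_def power2_eq_square algebra_simps)
  then have ab: "a\<^sup>2 + b\<^sup>2 = 1" using unit by simp
  have a: "24 / 25 \<le> a" unfolding a_def by (rule d(2)[OF u])
  then have "(24/25)\<^sup>2 \<le> a\<^sup>2" by (intro power_mono) auto
  then have "b\<^sup>2 \<le> (7/25)\<^sup>2" using ab by (simp add: power2_eq_square)
  then have b: "\<bar>b\<bar> \<le> 7 / 25" using abs_le_square_iff[of b "7/25"] by simp
  have "a\<^sup>2 \<le> 1" using ab zero_le_power2[of b] by linarith
  then have a1: "a \<le> 1" by (simp add: abs_square_le_1)
  have "a * nd \<tau> \<theta> + b * cr \<tau> \<theta> = ((nx \<tau>)\<^sup>2 + (ny \<tau>)\<^sup>2) * nd (\<tau> + u) \<theta>" for \<theta>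
    by (simp add: a_def b_def nd_def cr_def power2_eq_square algebra_simps)
  moreover have "a * cr \<tau> \<theta> - b * nd \<tau> \<theta> = ((nx \<tau>)\<^sup>2 + (ny \<tau>)\<^sup>2) * cr (\<tau> + u) \<theta>" for \<theta>
    by (simp add: a_def b_def nd_def cr_def power2_eq_square algebra_simps)
  ultimately show thesis using that[of a b] a a1 b unit by simp
qed

text \<open>In the frame rotated by the turning of the normal the component changes to a nd + b cr,
  and (24/25)(1/2) - 7/25 = 1/5.\<close>

lemma nd_lower:
  assumes "\<bar>u\<bar> \<le> d" "1 / 2 \<le> \<bar>nd \<tau> \<theta>\<bar>" shows "1 / 5 \<le> \<bar>nd (\<tau> + u) \<theta>\<bar>"
proof -
  obtain a b where ab: "24 / 25 \<le> a" "\<bar>b\<bar> \<le> 7 / 25" "nd (\<tau> + u) \<theta> = a * nd \<tau> \<theta> + b * cr \<tau> \<theta>"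
    using nd_cr_rotate[OF assms(1), of \<tau>] by metis
  have "(cr \<tau> \<theta>)\<^sup>2 \<le> 1" using nd_cr_unit[of \<tau> \<theta>] zero_le_power2[of "nd \<tau> \<theta>"] by linarith
  then have "\<bar>cr \<tau> \<theta>\<bar> \<le> 1" by (simp add: abs_square_le_1)
  then have 1: "\<bar>b\<bar> * \<bar>cr \<tau> \<theta>\<bar> \<le> (7/25) * 1" using ab by (intro mult_mono) auto
  have "(24/25) * (1/2) \<le> a * \<bar>nd \<tau> \<theta>\<bar>" using ab assms(2) by (intro mult_mono) auto
  moreover have "a * \<bar>nd \<tau> \<theta>\<bar> = \<bar>a * nd \<tau> \<theta>\<bar>" using ab by (simp add: abs_mult)
  ultimately show ?thesis using 1 unfolding ab(3) abs_mult[symmetric] by linarith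
qed

lemma cr_lower:
  assumes "\<bar>u\<bar> \<le> d" "(nd \<tau> \<theta>)\<^sup>2 \<le> 1 / 2" shows "1 / 5 \<le> \<bar>cr (\<tau> + u) \<theta>\<bar>"
proof -
  obtain a b where ab: "24 / 25 \<le> a" "\<bar>b\<bar> \<le> 7 / 25" "cr (\<tau> + u) \<theta> = a * cr \<tau> \<theta> - b * nd \<tau> \<theta>"
    using nd_cr_rotate[OF assms(1), of \<tau>] by metis
  have "(nd \<tau> \<theta>)\<^sup>2 \<le> 1\<^sup>2" using assms by simp
  then have "\<bar>nd \<tau> \<theta>\<bar> \<le> 1" using abs_le_square_iff[of "nd \<tau> \<theta>" 1] by simp
  then have 1: "\<bar>b\<bar> * \<bar>nd \<tau> \<theta>\<bar> \<le> (7/25) * 1" using ab by (intro mult_mono) auto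
  \<comment> \<open>7/10 is a rational number below the square root of 1/2; then (24/25)(7/10) -
    7/25 is still above 1/5.\<close>
  have "(7/10)\<^sup>2 \<le> (cr \<tau> \<theta>)\<^sup>2" using nd_cr_unit[of \<tau> \<theta>] assms(2) by (simp add: power2_eq_square)
  then have "7/10 \<le> \<bar>cr \<tau> \<theta>\<bar>" using abs_le_square_iff[of "7/10" "cr \<tau> \<theta>"] by simp
  then have "(24/25) * (7/10) \<le> a * \<bar>cr \<tau> \<theta>\<bar>" using ab by (intro mult_mono) auto
  moreover have "a * \<bar>cr \<tau> \<theta>\<bar> = \<bar>a * cr \<tau> \<theta>\<bar>" using ab by (simp add: abs_mult)
  ultimately show ?thesis using 1 unfolding ab(3) abs_mult[symmetric] by linarith
qed

lemma k_lower: assumes "\<bar>\<sigma>\<bar> \<le> e0" shows "1 / 2 \<le> 1 + \<sigma> * k t" "1 + \<sigma> * k t \<le> 3 / 2"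
proof -
  have "\<bar>\<sigma>\<bar> * \<bar>k t\<bar> \<le> e0 * \<bar>k t\<bar>" using assms by (intro mult_right_mono) auto
  then have "\<bar>\<sigma> * k t\<bar> \<le> 1 / 2" using e0(2)[of t] by (simp add: abs_mult mult.commute)
  then show "1 / 2 \<le> 1 + \<sigma> * k t" "1 + \<sigma> * k t \<le> 3 / 2" by (auto simp: abs_le_iff)
qed

lemma Ph_deriv: "((\<lambda>t. Ph \<sigma> t \<theta>) has_real_derivative (1 + \<sigma> * k t) * v t * cr t \<theta>) (at t)"
  unfolding Ph_def by (auto intro!: derivative_eq_intros xd yd nxd nyd simp: cr_def algebra_simps)

definition bump :: "nat \<Rightarrow> real \<Rightarrow> real" where "bump N u = ((u - (- d)) * (d - u)) ^ N"

lemma bump_meas [measurable]: "bump N \<in> borel_measurable borel"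
  unfolding bump_def by measurable

text \<open>The density \<open>f\<close> cut off to the window of radius \<open>d\<close> around the
  base point \<open>\<tau>\<close>. Averaging over \<open>\<tau>\<close> restores the full density,
  see \<open>Qh_average\<close>.\<close>

definition W :: "nat \<Rightarrow> real \<Rightarrow> real \<Rightarrow> real" where "W N \<tau> u = bump N u * f (\<tau> + u)"

lemma W_meas [measurable]:
  assumes [measurable]: "g \<in> borel_measurable M" "h \<in> borel_measurable M"
  shows "(\<lambda>p. W N (g p) (h p)) \<in> borel_measurable M"
  unfolding W_def by measurable

lemma bv_W: "bv N (- d) d L (\<lambda>l. W N (c l))"
  unfolding W_def bump_def by (intro bv_bump smooth_bdd_shift smooth)

lemma W_bound: "\<exists>C\<ge>0. \<forall>\<tau>. \<forall>u\<in>{-d..d}. \<bar>W N \<tau> u\<bar> \<le> C"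
proof -
  have "bounded_cont {-d..d} UNIV (W N)" using bv_bounded_cont[OF bv_W[of N UNIV "\<lambda>l. l"]] by simp
  then obtain C where "\<forall>\<tau>. \<forall>u\<in>{-d..d}. \<bar>W N \<tau> u\<bar> \<le> C" by (auto simp: bounded_cont_def)
  then show ?thesis by (intro exI[of _ "max C 0"]) (auto simp: le_max_iff_disj)
qed

text \<open>If the frequency makes at least 45 degrees with the line of the normal at the base
  point, its tangential component stays at least 1/5 on the whole window. The phase derivative is
  then at least (1/2) v0 (1/5), and the cutoff of exponent N permits N integrations by parts along
  the curve.\<close>

lemma far_bound:
  "\<exists>C\<ge>0. \<forall>\<tau> \<sigma> \<theta> \<Lambda>. \<bar>\<sigma>\<bar> \<le> e0 \<longrightarrow> (nd \<tau> \<theta>)\<^sup>2 \<le> 1 / 2 \<longrightarrow> 0 < \<Lambda> \<longrightarrow>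
    cmod (\<integral>u. of_real (W N \<tau> u) * cis (\<Lambda> * Ph \<sigma> (\<tau> + u) \<theta>) \<partial>leb (- d) d) \<le> C / \<Lambda> ^ N"
proof -
  define L where "L = {(\<tau>, \<sigma>, \<theta>). \<bar>\<sigma>\<bar> \<le> e0 \<and> (nd \<tau> \<theta>)\<^sup>2 \<le> 1 / 2}"
  define \<phi>' where "\<phi>' = (\<lambda>(\<tau>, \<sigma>, \<theta>) u. (1 + \<sigma> * k (\<tau> + u)) * v (\<tau> + u) * cr (\<tau> + u) \<theta>)"
  have lower: "v0 / 10 \<le> \<bar>\<phi>' l u\<bar>" if lu: "l \<in> L" "u \<in> {-d..d}" for l u
  proof -
    obtain \<tau> \<sigma> \<theta> where l: "l = (\<tau>, \<sigma>, \<theta>)" "\<bar>\<sigma>\<bar> \<le> e0" "(nd \<tau> \<theta>)\<^sup>2 \<le> 1 / 2" using lu by (cases l) (auto simp: L_def)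
    have "(1 / 2) * v0 * (1 / 5) \<le> \<bar>1 + \<sigma> * k (\<tau> + u)\<bar> * \<bar>v (\<tau> + u)\<bar> * \<bar>cr (\<tau> + u) \<theta>\<bar>"
      using l lu k_lower(1)[OF l(2), of "\<tau> + u"] v0 by (intro mult_mono cr_lower) auto
    then show ?thesis by (simp add: l \<phi>'_def abs_mult)
  qed
  have cs: "bs n {-d..d} L (\<lambda>l t. cos (snd (snd l)))" "bs n {-d..d} L (\<lambda>l t. sin (snd (snd l)))" for n
    by (intro bs_const[of L _ 1]; simp)+
  have "bs N {-d..d} L (\<lambda>l t. (1 + fst (snd l) * k (fst l + t)) * v (fst l + t) *
      (nx (fst l + t) * sin (snd (snd l)) - ny (fst l + t) * cos (snd (snd l))))"
    by (intro bs_mult bs_add bs_diff cs smooth_bdd_shift smooth smooth_n bs_const[of L "\<lambda>_. 1" 1] bs_const[of L _ e0])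
       (auto simp: L_def)
  then have "bs N {-d..d} L \<phi>'" by (simp add: \<phi>'_def case_prod_beta' cr_def)
  then have \<psi>: "bs N {-d..d} L (\<lambda>l u. inverse (\<phi>' l u))"
    by (rule bs_inverse[of _ _ _ _ "v0 / 10"]) (use lower v0 in auto)
  have ph: "((\<lambda>u. Ph (fst (snd l)) (fst l + u) (snd (snd l))) has_real_derivative \<phi>' l t) (at t within {-d..d})" for l t
  proof -
    obtain \<tau> \<sigma> \<theta> where l: "l = (\<tau>, \<sigma>, \<theta>)" by (cases l)
    have "((\<lambda>u. Ph \<sigma> (u + \<tau>) \<theta>) has_real_derivative \<phi>' l t) (at t)"
      using Ph_deriv[where \<sigma>=\<sigma> and t="t + \<tau>" and \<theta>=\<theta>] DERIV_shift[of "\<lambda>t. Ph \<sigma> t \<theta>" "\<phi>' l t" t \<tau>] by (simp add: l \<phi>'_def add.commute)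
    then show ?thesis by (simp add: l add.commute has_field_derivative_at_within)
  qed
  have "\<exists>C\<ge>0. \<forall>l\<in>L. \<forall>\<Lambda>>0.
     cmod (integral {-d..d} (\<lambda>t. of_real (W N (fst l) t) * cis (\<Lambda> * Ph (fst (snd l)) (fst l + t) (snd (snd l))))) \<le> C / \<Lambda> ^ N"
    using d(1) lower v0(1) by (intro nonstationary_phase[of _ _ _ _ _ "\<lambda>l u. inverse (\<phi>' l u)" _ \<phi>'] bv_W \<psi> ph) fastforce+
  then obtain C where "C \<ge> 0" and C: "\<And>\<tau> \<sigma> \<theta> \<Lambda>. (\<tau>, \<sigma>, \<theta>) \<in> L \<Longrightarrow> \<Lambda> > 0 \<Longrightarrow>
     cmod (integral {-d..d} (\<lambda>t. of_real (W N \<tau> t) * cis (\<Lambda> * Ph \<sigma> (\<tau> + t) \<theta>))) \<le> C / \<Lambda> ^ N" by fastforce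
  obtain M where M: "\<And>\<tau> u. u \<in> {-d..d} \<Longrightarrow> \<bar>W N \<tau> u\<bar> \<le> M" using W_bound by blast
  have "(\<integral>u. of_real (W N \<tau> u) * cis (\<Lambda> * Ph \<sigma> (\<tau> + u) \<theta>) \<partial>leb (- d) d) =
     integral {-d..d} (\<lambda>t. of_real (W N \<tau> t) * cis (\<Lambda> * Ph \<sigma> (\<tau> + t) \<theta>))" for \<tau> \<sigma> \<theta> \<Lambda>
    by (rule leb_eq_integral(2)[of _ _ _ M]) (use M in \<open>auto simp: norm_mult\<close>)
  then show ?thesis using \<open>C \<ge> 0\<close> C by (intro exI[of _ C]) (auto simp: L_def)
qed

end

section \<open>The cone around the normal and the kernel over the angle\<close>

definition sector :: "real measure" where "sector = leb (- (pi / 3)) (pi / 3)"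
text \<open>The square permits the two integrations by parts in the angle that the kernel bound
  requires, while on the inner cone of half-angle pi/4 the cutoff stays bounded away from 0.\<close>

definition chi :: "real \<Rightarrow> real" where "chi t = ((t - (- (pi / 3))) * (pi / 3 - t)) ^ 2"

lemma chi_meas [measurable]: "chi \<in> borel_measurable borel"
  unfolding chi_def by measurable

lemma chi_nonneg: "0 \<le> chi t"
  by (simp add: chi_def)

context strip begin

text \<open>In use, \<open>c\<close> is the angle of the normal at \<open>\<tau>\<close> or of its
  opposite, so \<open>nd\<close> is plus or minus the cosine of t and cos(pi/3) = 1/2 gives the
  bound.\<close>

definition near :: "real \<Rightarrow> real \<Rightarrow> bool" where
  "near \<tau> c \<longleftrightarrow> (\<forall>t\<in>{- (pi / 3)..pi / 3}. 1 / 2 \<le> \<bar>nd \<tau> (c + t)\<bar>)"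

lemma near_lower: "near \<tau> c \<Longrightarrow> t \<in> {- (pi / 3)..pi / 3} \<Longrightarrow> u \<in> {-d..d} \<Longrightarrow> 1 / 5 \<le> \<bar>nd (\<tau> + u) (c + t)\<bar>"
  by (rule nd_lower) (auto simp: near_def)

text \<open>The amplitude of the kernel of \<open>T T\<^sup>*\<close> at (u, w): the angular cutoff
  and, from each of the two factors, the power of 1/nd left over when the decay of the weight in nd
  \<epsilon> \<Lambda> is written as decay in \<epsilon> \<Lambda>.\<close>

definition kamp :: "nat \<Rightarrow> real \<Rightarrow> real \<Rightarrow> real \<Rightarrow> real \<Rightarrow> real \<Rightarrow> real" where
  "kamp m \<tau> c u w t = chi t * (inverse (nd (\<tau> + u) (c + t)) ^ m * inverse (nd (\<tau> + w) (c + t)) ^ m)"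

lemma bs_inverse_nd:
  assumes "\<And>l. l \<in> L \<Longrightarrow> near (\<tau> l) (c l) \<and> u l \<in> {-d..d}"
  shows "bs n {- (pi / 3)..pi / 3} L (\<lambda>l t. inverse (nd (\<tau> l + u l) (c l + t)))"
proof (rule bs_inverse[of _ _ _ _ "1 / 5"])
  show "bs n {- (pi / 3)..pi / 3} L (\<lambda>l t. nd (\<tau> l + u l) (c l + t))"
    unfolding nd_def using bs_cos_sin
    by (intro bs_add bs_mult bs_const[of L _ 1] n_le_1) auto
  show "1 / 5 \<le> \<bar>nd (\<tau> l + u l) (c l + t)\<bar>" if "l \<in> L" "t \<in> {- (pi / 3)..pi / 3}" for l t
    using near_lower assms that by blast
qed simp

lemma bv_kamp:
  assumes "\<And>l. l \<in> L \<Longrightarrow> near (\<tau> l) (c l) \<and> u l \<in> {-d..d} \<and> w l \<in> {-d..d}"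
  shows "bv 2 (- (pi / 3)) (pi / 3) L (\<lambda>l. kamp m (\<tau> l) (c l) (u l) (w l))"
  unfolding kamp_def chi_def using assms
  by (intro bv_bump bs_mult bs_power bs_inverse_nd) auto

text \<open>The derivative of a parallel curve has components (1 + \<sigma> k) v times those of a
  unit vector, with the first factor at most 3/2. The bound keeps chords divided by the parameter
  distance bounded uniformly in the offset.\<close>

lemma P_Lipschitz: "\<exists>C\<ge>0. \<forall>\<sigma> s t. \<bar>\<sigma>\<bar> \<le> e0 \<longrightarrow> \<bar>(x s + \<sigma> * nx s) - (x t + \<sigma> * nx t)\<bar> \<le> C * \<bar>s - t\<bar> \<and>
   \<bar>(y s + \<sigma> * ny s) - (y t + \<sigma> * ny t)\<bar> \<le> C * \<bar>s - t\<bar>"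
proof -
  obtain V where V: "\<And>t. \<bar>v t\<bar> \<le> V" using smooth_bdd_bound smooth by blast
  then have V0: "V \<ge> 0" using order_trans[OF abs_ge_zero] by blast
  have lip: "\<bar>g s - g t\<bar> \<le> (3/2) * V * \<bar>s - t\<bar>"
    if g: "\<And>t. (g has_real_derivative g' t) (at t)" "\<And>t. \<bar>g' t\<bar> \<le> (3/2) * V" for g g' s t
    using field_differentiable_bound[of UNIV g g' "(3/2) * V" s t] g by simp
  have b: "\<bar>(1 + \<sigma> * k t) * v t * z\<bar> \<le> (3/2) * V" if "\<bar>\<sigma>\<bar> \<le> e0" "\<bar>z\<bar> \<le> 1" for \<sigma> t z
  proof -
    have "\<bar>1 + \<sigma> * k t\<bar> * \<bar>v t\<bar> * \<bar>z\<bar> \<le> (3/2) * V * 1"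
      using k_lower[OF that(1), of t] V that V0 by (intro mult_mono) auto
    then show ?thesis by (simp add: abs_mult)
  qed
  show ?thesis
  proof (intro exI[of _ "(3/2) * V"] conjI allI impI)
    show "0 \<le> 3 / 2 * V" using V0 by simp
    fix \<sigma> s t assume \<sigma>: "\<bar>\<sigma>\<bar> \<le> e0"
    show "\<bar>(x s + \<sigma> * nx s) - (x t + \<sigma> * nx t)\<bar> \<le> (3/2) * V * \<bar>s - t\<bar>"
    proof (rule lip)
      show "((\<lambda>t. x t + \<sigma> * nx t) has_real_derivative (1 + \<sigma> * k t) * v t * (- ny t)) (at t)" for t
        by (auto intro!: derivative_eq_intros xd nxd simp: algebra_simps)
      show "\<bar>(1 + \<sigma> * k t) * v t * (- ny t)\<bar> \<le> (3/2) * V" for t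
        by (rule b[OF \<sigma>]) (simp add: n_le_1)
    qed
    show "\<bar>(y s + \<sigma> * ny s) - (y t + \<sigma> * ny t)\<bar> \<le> (3/2) * V * \<bar>s - t\<bar>"
    proof (rule lip)
      show "((\<lambda>t. y t + \<sigma> * ny t) has_real_derivative (1 + \<sigma> * k t) * v t * nx t) (at t)" for t
        by (auto intro!: derivative_eq_intros yd nyd simp: algebra_simps)
      show "\<bar>(1 + \<sigma> * k t) * v t * nx t\<bar> \<le> (3/2) * V" for t
        by (rule b[OF \<sigma>]) (simp add: n_le_1)
    qed
  qed
qed

text \<open>The chord of a parallel curve is nearly tangential, so in the cone around the normal the phase of
  the kernel of \<open>T T\<^sup>*\<close> is monotone in the angle.\<close>

lemma chord_lower:
  assumes "near \<tau> c" "t \<in> {- (pi / 3)..pi / 3}" "u \<in> {-d..d}" "w \<in> {-d..d}" "\<bar>\<sigma>\<bar> \<le> e0"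
  shows "v0 / 10 * \<bar>u - w\<bar> \<le> \<bar>- ((x (\<tau> + u) + \<sigma> * nx (\<tau> + u)) - (x (\<tau> + w) + \<sigma> * nx (\<tau> + w))) * sin (c + t)
     + ((y (\<tau> + u) + \<sigma> * ny (\<tau> + u)) - (y (\<tau> + w) + \<sigma> * ny (\<tau> + w))) * cos (c + t)\<bar>" (is "_ \<le> ?R u w")
proof -
  \<comment> \<open>The coordinate of the parallel curve perpendicular to the frequency. Its
    derivative carries \<open>nd\<close> instead of \<open>cr\<close>, and \<open>nd\<close> is
    bounded below on the window, so the mean value theorem bounds the chord from below without any
    curvature condition.\<close>
  define g where "g s = - (x s + \<sigma> * nx s) * sin (c + t) + (y s + \<sigma> * ny s) * cos (c + t)" for s
  have gd: "(g has_real_derivative (1 + \<sigma> * k s) * v s * nd s (c + t)) (at s)" for s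
    unfolding g_def nd_def by (auto intro!: derivative_eq_intros xd yd nxd nyd simp: algebra_simps)
  have R: "?R u w = \<bar>g (\<tau> + u) - g (\<tau> + w)\<bar>" for u w by (simp add: g_def algebra_simps)
  have main: "v0 / 10 * \<bar>u - w\<bar> \<le> \<bar>g (\<tau> + u) - g (\<tau> + w)\<bar>" if "w < u" "u \<in> {-d..d}" "w \<in> {-d..d}" for u w
  proof -
    have "\<tau> + w < \<tau> + u" using that(1) by simp
    from MVT2[OF this gd] obtain r where r: "\<tau> + w < r" "r < \<tau> + u"
      "g (\<tau> + u) - g (\<tau> + w) = ((\<tau> + u) - (\<tau> + w)) * ((1 + \<sigma> * k r) * v r * nd r (c + t))" by blast
    define z where "z = r - \<tau>"
    have z: "w < z" "z < u" "g (\<tau> + u) - g (\<tau> + w) = (u - w) * ((1 + \<sigma> * k (\<tau> + z)) * v (\<tau> + z) * nd (\<tau> + z) (c + t))"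
      using r by (auto simp: z_def)
    have "(1 / 2) * v0 * (1 / 5) \<le> \<bar>1 + \<sigma> * k (\<tau> + z)\<bar> * \<bar>v (\<tau> + z)\<bar> * \<bar>nd (\<tau> + z) (c + t)\<bar>"
      using that z k_lower(1)[OF assms(5), of "\<tau> + z"] v0 by (intro mult_mono near_lower assms) auto
    then have "(u - w) * (v0 / 10) \<le> (u - w) * \<bar>(1 + \<sigma> * k (\<tau> + z)) * v (\<tau> + z) * nd (\<tau> + z) (c + t)\<bar>"
      using that by (intro mult_left_mono) (auto simp: abs_mult)
    then show ?thesis using that by (simp add: z(3) abs_mult mult.commute)
  qed
  show ?thesis
  proof (cases u w rule: linorder_cases)
    case less then show ?thesis using main[of u w] assms unfolding R by (simp add: abs_minus_commute)
  next
    case greater then show ?thesis using main[of w u] assms unfolding R by simp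
  qed simp
qed

text \<open>Two integrations by parts in the angle give C1 / (\<Lambda> |u - w|)^2, the trivial
  estimate gives C2; adding the two inequalities gives a bound that is integrable in w and valid on
  the diagonal as well.\<close>

lemma kernel_bound:
  "\<exists>C\<ge>0. \<forall>\<tau> c \<sigma> u w \<Lambda>. \<bar>\<sigma>\<bar> \<le> e0 \<longrightarrow> near \<tau> c \<longrightarrow> u \<in> {-d..d} \<longrightarrow> w \<in> {-d..d} \<longrightarrow> 0 < \<Lambda> \<longrightarrow>
    cmod (\<integral>t. of_real (kamp m \<tau> c u w t) * cis (\<Lambda> * (Ph \<sigma> (\<tau> + u) (c + t) - Ph \<sigma> (\<tau> + w) (c + t))) \<partial>sector)
      \<le> C / (1 + (\<Lambda> * (u - w))\<^sup>2)"
proof -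
  define L where "L = {(\<tau>, c, \<sigma>, u, w). \<bar>\<sigma>\<bar> \<le> e0 \<and> near \<tau> c \<and> u \<in> {-d..d} \<and> w \<in> {-d..d}}"
  define L' where "L' = L \<inter> {(\<tau>, c, \<sigma>, u, w). u \<noteq> w}"
  let ?\<tau> = "\<lambda>l::real\<times>real\<times>real\<times>real\<times>real. fst l" and ?c = "\<lambda>l::real\<times>real\<times>real\<times>real\<times>real. fst (snd l)"
  let ?\<sigma> = "\<lambda>l::real\<times>real\<times>real\<times>real\<times>real. fst (snd (snd l))"
  let ?u = "\<lambda>l::real\<times>real\<times>real\<times>real\<times>real. fst (snd (snd (snd l)))"
  let ?w = "\<lambda>l::real\<times>real\<times>real\<times>real\<times>real. snd (snd (snd (snd l)))"
  let ?S = "{- (pi / 3)..pi / 3}"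
  \<comment> \<open>Dividing the chord by |u - w| turns the phases into a family with uniform upper
    and lower bounds, in which \<Lambda> |u - w| takes the role of the large parameter. The family
    \<open>L'\<close> excludes the diagonal, where this is undefined.\<close>
  define X where "X l = ((x (?\<tau> l + ?u l) + ?\<sigma> l * nx (?\<tau> l + ?u l)) - (x (?\<tau> l + ?w l) + ?\<sigma> l * nx (?\<tau> l + ?w l))) / \<bar>?u l - ?w l\<bar>" for l
  define Y where "Y l = ((y (?\<tau> l + ?u l) + ?\<sigma> l * ny (?\<tau> l + ?u l)) - (y (?\<tau> l + ?w l) + ?\<sigma> l * ny (?\<tau> l + ?w l))) / \<bar>?u l - ?w l\<bar>" for l
  have LD: "\<bar>?\<sigma> l\<bar> \<le> e0" "near (?\<tau> l) (?c l)" "?u l \<in> {-d..d}" "?w l \<in> {-d..d}" if "l \<in> L" for l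
    using that by (auto simp: L_def)
  have LD': "l \<in> L" "?u l \<noteq> ?w l" if "l \<in> L'" for l using that by (auto simp: L'_def)
  obtain P where P: "P \<ge> 0" "\<And>\<sigma> s t. \<bar>\<sigma>\<bar> \<le> e0 \<Longrightarrow> \<bar>(x s + \<sigma> * nx s) - (x t + \<sigma> * nx t)\<bar> \<le> P * \<bar>s - t\<bar>"
    "\<And>\<sigma> s t. \<bar>\<sigma>\<bar> \<le> e0 \<Longrightarrow> \<bar>(y s + \<sigma> * ny s) - (y t + \<sigma> * ny t)\<bar> \<le> P * \<bar>s - t\<bar>"
    using P_Lipschitz by blast
  have X: "\<bar>X l\<bar> \<le> P" and Y: "\<bar>Y l\<bar> \<le> P" if "l \<in> L'" for l
    using P(2)[OF LD(1)[OF LD'(1)[OF that]], of "?\<tau> l + ?u l" "?\<tau> l + ?w l"]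
      P(3)[OF LD(1)[OF LD'(1)[OF that]], of "?\<tau> l + ?u l" "?\<tau> l + ?w l"] LD'(2)[OF that]
    by (auto simp: X_def Y_def divide_le_eq)
  define \<phi> where "\<phi> l t = X l * cos (?c l + t) + Y l * sin (?c l + t)" for l t
  define \<phi>' where "\<phi>' l t = - X l * sin (?c l + t) + Y l * cos (?c l + t)" for l t
  have lower: "v0 / 10 \<le> \<bar>\<phi>' l t\<bar>" if "l \<in> L'" "t \<in> ?S" for l t
  proof -
    note l = LD'[OF that(1)]
    have e: "X l * \<bar>?u l - ?w l\<bar> = (x (?\<tau> l + ?u l) + ?\<sigma> l * nx (?\<tau> l + ?u l)) - (x (?\<tau> l + ?w l) + ?\<sigma> l * nx (?\<tau> l + ?w l))"
      "Y l * \<bar>?u l - ?w l\<bar> = (y (?\<tau> l + ?u l) + ?\<sigma> l * ny (?\<tau> l + ?u l)) - (y (?\<tau> l + ?w l) + ?\<sigma> l * ny (?\<tau> l + ?w l))"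
      using l(2) by (simp_all add: X_def Y_def)
    have "\<phi>' l t * \<bar>?u l - ?w l\<bar> = - (X l * \<bar>?u l - ?w l\<bar>) * sin (?c l + t) + (Y l * \<bar>?u l - ?w l\<bar>) * cos (?c l + t)"
      by (simp add: \<phi>'_def algebra_simps)
    then have "v0 / 10 * \<bar>?u l - ?w l\<bar> \<le> \<bar>\<phi>' l t * \<bar>?u l - ?w l\<bar>\<bar>"
      using chord_lower[OF LD(2)[OF l(1)] that(2) LD(3,4,1)[OF l(1)]] unfolding e by simp
    then show ?thesis using l(2) by (simp add: abs_mult)
  qed
  have bs\<phi>': "bs n ?S L' \<phi>'" for n
    unfolding \<phi>'_def using X Y
    by (intro bs_add bs_mult bs_const[of L' _ P] conjunct1[OF bs_cos_sin] conjunct2[OF bs_cos_sin]) auto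
  have "\<exists>C\<ge>0. \<forall>l\<in>L'. \<forall>\<Lambda>>0.
     cmod (integral ?S (\<lambda>t. of_real (kamp m (?\<tau> l) (?c l) (?u l) (?w l) t) * cis (\<Lambda> * \<phi> l t))) \<le> C / \<Lambda> ^ 2"
  proof (rule nonstationary_phase[where \<psi> = "\<lambda>l t. inverse (\<phi>' l t)" and \<phi>' = \<phi>'])
    show "bv 2 (- (pi / 3)) (pi / 3) L' (\<lambda>l. kamp m (?\<tau> l) (?c l) (?u l) (?w l))"
      using LD LD' by (intro bv_kamp) blast
    show "bs 2 ?S L' (\<lambda>l t. inverse (\<phi>' l t))"
      using v0(1) by (intro bs_inverse[OF bs\<phi>' lower]) auto
    show "(\<phi> l has_real_derivative \<phi>' l t) (at t within ?S)" for l t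
      unfolding \<phi>_def \<phi>'_def by (auto intro!: derivative_eq_intros)
    show "inverse (\<phi>' l t) * \<phi>' l t = 1" if "l \<in> L'" "t \<in> ?S" for l t
      using lower[OF that] v0(1) by auto
  qed simp
  then obtain C1 where C1: "C1 \<ge> 0" "\<And>l \<Lambda>. l \<in> L' \<Longrightarrow> \<Lambda> > 0 \<Longrightarrow>
     cmod (integral ?S (\<lambda>t. of_real (kamp m (?\<tau> l) (?c l) (?u l) (?w l) t) * cis (\<Lambda> * \<phi> l t))) \<le> C1 / \<Lambda> ^ 2" by blast
  have "bv 2 (- (pi / 3)) (pi / 3) L (\<lambda>l. kamp m (?\<tau> l) (?c l) (?u l) (?w l))"
    using LD by (intro bv_kamp) blast
  then obtain M where M: "\<And>l t. l \<in> L \<Longrightarrow> t \<in> ?S \<Longrightarrow> \<bar>kamp m (?\<tau> l) (?c l) (?u l) (?w l) t\<bar> \<le> M"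
    using bv_bounded_cont unfolding bounded_cont_def by blast
  define C2 where "C2 = max M 0 * (pi / 3 - (- (pi / 3)))"
  have C2: "C2 \<ge> 0" by (simp add: C2_def)
  show ?thesis
  proof (intro exI[of _ "C1 + C2"] conjI allI impI)
    show "0 \<le> C1 + C2" using C1 C2 by simp
    fix \<tau> c \<sigma> u w \<Lambda> :: real
    assume a: "\<bar>\<sigma>\<bar> \<le> e0" "near \<tau> c" "u \<in> {-d..d}" "w \<in> {-d..d}" "0 < \<Lambda>"
    define l where "l = (\<tau>, c, \<sigma>, u, w)"
    have l: "l \<in> L" using a by (auto simp: L_def l_def)
    let ?g = "\<lambda>t. of_real (kamp m \<tau> c u w t) * cis (\<Lambda> * (Ph \<sigma> (\<tau> + u) (c + t) - Ph \<sigma> (\<tau> + w) (c + t)))"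
    have [measurable]: "?g \<in> borel_measurable borel" unfolding kamp_def by measurable
    have gM: "cmod (?g t) \<le> max M 0" if "t \<in> ?S" for t
      using M[OF l that] by (auto simp: norm_mult l_def le_max_iff_disj)
    let ?I = "cmod (\<integral>t. ?g t \<partial>sector)"
    have b2: "?I \<le> C2"
      unfolding sector_def C2_def using gM by (intro norm_leb_le) auto
    have b1: "?I * (\<Lambda> * (u - w))\<^sup>2 \<le> C1"
    proof (cases "u = w")
      case False
      then have l': "l \<in> L'" using l by (auto simp: L'_def l_def)
      have ph: "\<Lambda> * \<bar>u - w\<bar> * \<phi> l t = \<Lambda> * (Ph \<sigma> (\<tau> + u) (c + t) - Ph \<sigma> (\<tau> + w) (c + t))" for t
      proof -
        have e: "X l * \<bar>u - w\<bar> = (x (\<tau> + u) + \<sigma> * nx (\<tau> + u)) - (x (\<tau> + w) + \<sigma> * nx (\<tau> + w))"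
          "Y l * \<bar>u - w\<bar> = (y (\<tau> + u) + \<sigma> * ny (\<tau> + u)) - (y (\<tau> + w) + \<sigma> * ny (\<tau> + w))"
          using False by (simp_all add: X_def Y_def l_def)
        have "\<Lambda> * \<bar>u - w\<bar> * \<phi> l t = \<Lambda> * ((X l * \<bar>u - w\<bar>) * cos (c + t) + (Y l * \<bar>u - w\<bar>) * sin (c + t))"
          by (simp add: \<phi>_def l_def algebra_simps)
        then show ?thesis unfolding e Ph_def by (simp add: algebra_simps)
      qed
      have "(\<integral>t. ?g t \<partial>sector) = integral ?S ?g"
        unfolding sector_def by (rule leb_eq_integral(2)[of _ _ _ "max M 0"]) (use gM in auto)
      then have "?I \<le> C1 / (\<Lambda> * \<bar>u - w\<bar>) ^ 2"
        using C1(2)[OF l', of "\<Lambda> * \<bar>u - w\<bar>"] False a(5) unfolding ph by (simp add: l_def)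
      then show ?thesis using False a(5) by (simp add: pos_le_divide_eq power_mult_distrib)
    qed (use C1 in simp)
    have "?I * (1 + (\<Lambda> * (u - w))\<^sup>2) \<le> C1 + C2" using b1 b2 by (simp add: algebra_simps)
    then show "?I \<le> (C1 + C2) / (1 + (\<Lambda> * (u - w))\<^sup>2)"
      by (simp add: pos_le_divide_eq add_pos_nonneg)
  qed
qed

end

lemma fourier_meas_borel_bounded:
  assumes "fourier_meas F"
  shows "F \<in> borel_measurable borel \<and> (\<exists>C\<ge>0. \<forall>y. cmod (F y) \<le> C)"
  using assms
proof induction
  case (point p c)
  show ?case by (intro conjI exI[of _ "cmod c"]) (auto simp: norm_mult)
next
  case (density g C)
  have [measurable]: "g \<in> borel_measurable borel" by fact
  have "cmod (\<integral>s. g s * cis (s * y) \<partial>leb (-1) 1) \<le> max C 0 * (1 - (-1))" for y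
    using density(2) by (intro norm_leb_le) (auto simp: norm_mult le_max_iff_disj)
  then show ?case by (intro conjI exI[of _ "max C 0 * (1 - (-1))"]) auto
next
  case (add F G)
  then obtain C D where "C \<ge> 0" "D \<ge> 0" "\<And>y. cmod (F y) \<le> C" "\<And>y. cmod (G y) \<le> D" by blast
  then have "cmod (F y + G y) \<le> C + D" for y by (meson add_mono norm_triangle_le)
  then show ?case using add \<open>C \<ge> 0\<close> \<open>D \<ge> 0\<close> by (intro conjI exI[of _ "C + D"]) auto
qed

lemma cmod_add_squared: "(cmod (a + b))\<^sup>2 \<le> 2 * (cmod a)\<^sup>2 + 2 * (cmod b)\<^sup>2"
proof -
  have "(cmod (a + b))\<^sup>2 \<le> (cmod a + cmod b)\<^sup>2" by (intro power_mono norm_triangle_ineq) auto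
  also have "\<dots> \<le> 2 * (cmod a)\<^sup>2 + 2 * (cmod b)\<^sup>2"
    using zero_le_power2[of "cmod a - cmod b"] by (simp add: power2_sum power2_diff)
  finally show ?thesis .
qed

lemma chi_bound: "t \<in> {- (pi / 3)..pi / 3} \<Longrightarrow> chi t \<le> ((2 * pi / 3) * (2 * pi / 3)) ^ 2"
  unfolding chi_def by (intro power_mono mult_mono) auto

section \<open>Mean squares over the cone\<close>

context strip begin

lemma inverse_nd_le:
  assumes "near \<tau> c" "t \<in> {- (pi / 3)..pi / 3}" "u \<in> {-d..d}"
  shows "\<bar>inverse (nd (\<tau> + u) (c + t)) ^ m\<bar> \<le> 5 ^ m"
proof -
  have "\<bar>inverse (nd (\<tau> + u) (c + t))\<bar> \<le> inverse (1 / 5)"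
    unfolding abs_inverse using near_lower[OF assms] by (intro le_imp_inverse_le) auto
  then show ?thesis unfolding power_abs by (intro power_mono) auto
qed

definition amp :: "nat \<Rightarrow> nat \<Rightarrow> real \<Rightarrow> real \<Rightarrow> real \<Rightarrow> real" where
  "amp m N \<tau> u \<theta> = W N \<tau> u * inverse (nd (\<tau> + u) \<theta>) ^ m"

lemma amp_meas [measurable]:
  assumes [measurable]: "g \<in> borel_measurable M" "h \<in> borel_measurable M" "s \<in> borel_measurable M"
  shows "(\<lambda>p. amp m N (g p) (h p) (s p)) \<in> borel_measurable M"
  unfolding amp_def by measurable

lemma amp_bound: "\<exists>C\<ge>0. \<forall>\<tau> c. near \<tau> c \<longrightarrow> (\<forall>u\<in>{-d..d}. \<forall>t\<in>{- (pi / 3)..pi / 3}. \<bar>amp m N \<tau> u (c + t)\<bar> \<le> C)"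
proof -
  obtain M where M: "M \<ge> 0" "\<And>\<tau> u. u \<in> {-d..d} \<Longrightarrow> \<bar>W N \<tau> u\<bar> \<le> M" using W_bound by blast
  have "\<bar>amp m N \<tau> u (c + t)\<bar> \<le> M * 5 ^ m" if "near \<tau> c" "u \<in> {-d..d}" "t \<in> {- (pi / 3)..pi / 3}" for \<tau> c u t
    unfolding amp_def abs_mult using M that inverse_nd_le by (intro mult_mono) auto
  then show ?thesis using M(1) by (intro exI[of _ "M * 5 ^ m"]) auto
qed

text \<open>The operator T for one parallel curve: functions on the window are sent to functions of
  the angle at frequency \<Lambda>. The weight has been replaced by a point mass at the offset
  \<open>\<sigma>\<close>.\<close>

definition G :: "nat \<Rightarrow> nat \<Rightarrow> real \<Rightarrow> real \<Rightarrow> real \<Rightarrow> real \<Rightarrow> complex" where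
  "G m N \<sigma> \<tau> \<Lambda> \<theta> = (\<integral>u. of_real (amp m N \<tau> u \<theta>) * cis (\<Lambda> * Ph \<sigma> (\<tau> + u) \<theta>) \<partial>leb (- d) d)"

lemma G_meas [measurable]:
  assumes [measurable]: "g \<in> borel_measurable M" "h \<in> borel_measurable M" "s \<in> borel_measurable M"
  shows "(\<lambda>p. G m N (g p) (h p) \<Lambda> (s p)) \<in> borel_measurable M"
  unfolding G_def by measurable

lemma G_bound: "\<exists>C\<ge>0. \<forall>\<tau> c \<sigma> \<Lambda>. near \<tau> c \<longrightarrow> (\<forall>t\<in>{- (pi / 3)..pi / 3}. cmod (G m N \<sigma> \<tau> \<Lambda> (c + t)) \<le> C)"
proof -
  obtain M where M: "M \<ge> 0" "\<And>\<tau> c u t. near \<tau> c \<Longrightarrow> u \<in> {-d..d} \<Longrightarrow> t \<in> {- (pi / 3)..pi / 3} \<Longrightarrow> \<bar>amp m N \<tau> u (c + t)\<bar> \<le> M"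
    using amp_bound by blast
  have "cmod (G m N \<sigma> \<tau> \<Lambda> (c + t)) \<le> M * (d - - d)" if "near \<tau> c" "t \<in> {- (pi / 3)..pi / 3}" for \<tau> c \<sigma> \<Lambda> t
    unfolding G_def using d(1) M that by (intro norm_leb_le) (auto simp: norm_mult)
  then show ?thesis using M(1) d(1) by (intro exI[of _ "M * (d - - d)"]) auto
qed

text \<open>The square is expanded into an integral over u and w, the angle is integrated first, and
  the resulting kernel is bounded by \<open>kernel_bound\<close>. By
  \<open>Poisson_kernel_bound\<close> its integral in w is O(1 / \<Lambda>) uniformly in u, and the
  u-interval is bounded.\<close>

lemma G_square_bound:
  "\<exists>C\<ge>0. \<forall>\<tau> c \<sigma> \<Lambda>. \<bar>\<sigma>\<bar> \<le> e0 \<longrightarrow> near \<tau> c \<longrightarrow> 0 < \<Lambda> \<longrightarrow>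
    (\<integral>t. chi t * (cmod (G m N \<sigma> \<tau> \<Lambda> (c + t)))\<^sup>2 \<partial>sector) \<le> C / \<Lambda>"
proof -
  obtain M where M: "M \<ge> 0" "\<And>\<tau> u. u \<in> {-d..d} \<Longrightarrow> \<bar>W N \<tau> u\<bar> \<le> M" using W_bound by blast
  obtain A where A: "A \<ge> 0" "\<And>\<tau> c u t. near \<tau> c \<Longrightarrow> u \<in> {-d..d} \<Longrightarrow> t \<in> {- (pi / 3)..pi / 3} \<Longrightarrow> \<bar>amp m N \<tau> u (c + t)\<bar> \<le> A"
    using amp_bound by blast
  obtain K where K: "K \<ge> 0" "\<And>\<tau> c \<sigma> u w \<Lambda>. \<bar>\<sigma>\<bar> \<le> e0 \<Longrightarrow> near \<tau> c \<Longrightarrow> u \<in> {-d..d} \<Longrightarrow> w \<in> {-d..d} \<Longrightarrow> 0 < \<Lambda> \<Longrightarrow>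
    cmod (\<integral>t. of_real (kamp m \<tau> c u w t) * cis (\<Lambda> * (Ph \<sigma> (\<tau> + u) (c + t) - Ph \<sigma> (\<tau> + w) (c + t))) \<partial>sector)
      \<le> K / (1 + (\<Lambda> * (u - w))\<^sup>2)" using kernel_bound[of m] by blast
  have "(\<integral>t. chi t * (cmod (G m N \<sigma> \<tau> \<Lambda> (c + t)))\<^sup>2 \<partial>sector) \<le> (M * M * K * pi * (d - - d)) / \<Lambda>"
    if a: "\<bar>\<sigma>\<bar> \<le> e0" "near \<tau> c" "0 < \<Lambda>" for \<tau> c \<sigma> \<Lambda>
  proof -
    let ?S = "{- (pi / 3)..pi / 3}"
    let ?D = "leb (- d) d"
    define B where "B = ((2 * pi / 3) * (2 * pi / 3)) ^ 2"
    have B: "\<bar>chi t\<bar> \<le> B" if "t \<in> ?S" for t using chi_bound[OF that] chi_nonneg by (simp add: B_def)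
    have B0: "B \<ge> 0" by (simp add: B_def)
    define h where "h t u = of_real (amp m N \<tau> u (c + t)) * cis (\<Lambda> * Ph \<sigma> (\<tau> + u) (c + t))" for t u
    have hm [measurable]: "case_prod h \<in> borel_measurable (borel \<Otimes>\<^sub>M borel)"
      unfolding h_def case_prod_beta' by measurable
    have hA: "cmod (h t u) \<le> A" if "t \<in> ?S" "u \<in> {-d..d}" for t u
      using A that a by (simp add: h_def norm_mult)
    define H where "H t u w = of_real (chi t) * h t u * cnj (h t w)" for t u w
    have Hm' [measurable]: "(\<lambda>p. H (fst p) u (snd p)) \<in> borel_measurable (borel \<Otimes>\<^sub>M borel)" for u
      unfolding H_def h_def case_prod_beta' by measurable
    have Hb: "cmod (H t u w) \<le> B * A * A" if "t \<in> ?S" "u \<in> {-d..d}" "w \<in> {-d..d}" for t u w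
      unfolding H_def norm_mult using B that hA A B0 by (intro mult_mono) auto
    have ih: "integrable ?D (h t)" if "t \<in> ?S" for t
      using hA[OF that] by (intro integrable_leb[of _ _ _ A]) (auto simp: h_def)
    have e1: "complex_of_real (chi t * (cmod (G m N \<sigma> \<tau> \<Lambda> (c + t)))\<^sup>2) = (\<integral>u. (\<integral>w. H t u w \<partial>?D) \<partial>?D)" if t: "t \<in> ?S" for t
    proof -
      have "G m N \<sigma> \<tau> \<Lambda> (c + t) = (\<integral>u. h t u \<partial>?D)" by (simp add: G_def h_def)
      then have "complex_of_real (chi t * (cmod (G m N \<sigma> \<tau> \<Lambda> (c + t)))\<^sup>2) =
         of_real (chi t) * ((\<integral>u. h t u \<partial>?D) * (\<integral>w. cnj (h t w) \<partial>?D))"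
        by (simp only: of_real_mult complex_norm_square integral_bounded_linear[OF bounded_linear_cnj ih[OF t]])
      also have "\<dots> = (\<integral>u. of_real (chi t) * h t u * (\<integral>w. cnj (h t w) \<partial>?D) \<partial>?D)"
        using ih[OF t] by simp
      also have "\<dots> = (\<integral>u. (\<integral>w. H t u w \<partial>?D) \<partial>?D)"
        using ih[OF t] by (simp add: H_def)
      finally show ?thesis .
    qed
    have m1 [measurable]: "(\<lambda>t. chi t * (cmod (G m N \<sigma> \<tau> \<Lambda> (c + t)))\<^sup>2) \<in> borel_measurable borel" by measurable
    have m2 [measurable]: "(\<lambda>p. \<integral>w. H (fst p) (snd p) w \<partial>?D) \<in> borel_measurable (borel \<Otimes>\<^sub>M borel)"
      unfolding H_def h_def by measurable
    have m3 [measurable]: "(\<lambda>t. \<integral>u. (\<integral>w. H t u w \<partial>?D) \<partial>?D) \<in> borel_measurable borel"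
      unfolding H_def h_def by measurable
    define X where "X u w = (\<integral>t. H t u w \<partial>sector)" for u w
    have "complex_of_real (\<integral>t. chi t * (cmod (G m N \<sigma> \<tau> \<Lambda> (c + t)))\<^sup>2 \<partial>sector) =
       (\<integral>t. complex_of_real (chi t * (cmod (G m N \<sigma> \<tau> \<Lambda> (c + t)))\<^sup>2) \<partial>sector)" by (rule integral_complex_of_real[symmetric])
    also have "\<dots> = (\<integral>t. (\<integral>u. (\<integral>w. H t u w \<partial>?D) \<partial>?D) \<partial>sector)"
      unfolding sector_def by (rule leb_cong) (use e1 in auto)
    also have "\<dots> = (\<integral>u. (\<integral>t. (\<integral>w. H t u w \<partial>?D) \<partial>sector) \<partial>?D)"
      unfolding sector_def
    proof (rule leb_swap[where C = "B * A * A * (d - - d)"])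
      show "(\<lambda>(t, u). \<integral>w. H t u w \<partial>?D) \<in> borel_measurable (borel \<Otimes>\<^sub>M borel)"
        using m2 by (simp add: case_prod_beta')
      show "cmod (\<integral>w. H t u w \<partial>?D) \<le> B * A * A * (d - - d)" if "t \<in> ?S" "u \<in> {-d..d}" for t u
        using Hb that d(1) A B0 by (intro norm_leb_le) auto
    qed
    also have "\<dots> = (\<integral>u. (\<integral>w. X u w \<partial>?D) \<partial>?D)"
      unfolding X_def sector_def
    proof (rule leb_cong)
      show "(\<integral>t. (\<integral>w. H t u w \<partial>?D) \<partial>leb (- (pi/3)) (pi/3)) = (\<integral>w. (\<integral>t. H t u w \<partial>leb (- (pi/3)) (pi/3)) \<partial>?D)"
        if "u \<in> {-d..d}" for u
        by (rule leb_swap[where C = "B * A * A"]) (use Hm'[of u] Hb that in \<open>auto simp: case_prod_beta'\<close>)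
      show "(\<lambda>u. \<integral>t. (\<integral>w. H t u w \<partial>?D) \<partial>leb (- (pi/3)) (pi/3)) \<in> borel_measurable borel"
        unfolding H_def h_def by measurable
      show "(\<lambda>u. \<integral>w. (\<integral>t. H t u w \<partial>leb (- (pi/3)) (pi/3)) \<partial>?D) \<in> borel_measurable borel"
        unfolding H_def h_def by measurable
    qed
    finally have e2: "complex_of_real (\<integral>t. chi t * (cmod (G m N \<sigma> \<tau> \<Lambda> (c + t)))\<^sup>2 \<partial>sector) = (\<integral>u. (\<integral>w. X u w \<partial>?D) \<partial>?D)" .
    have Xb: "cmod (X u w) \<le> M * M * K * (1 / (1 + (\<Lambda> * (u - w))\<^sup>2))" if u: "u \<in> {-d..d}" "w \<in> {-d..d}" for u w
    proof -
      have "H t u w = of_real (W N \<tau> u * W N \<tau> w) * (of_real (kamp m \<tau> c u w t) *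
          cis (\<Lambda> * (Ph \<sigma> (\<tau> + u) (c + t) - Ph \<sigma> (\<tau> + w) (c + t))))" for t
        by (simp add: H_def h_def amp_def kamp_def cis_cnj cis_divide[symmetric] right_diff_distrib divide_inverse)
      then have "X u w = of_real (W N \<tau> u * W N \<tau> w) * (\<integral>t. of_real (kamp m \<tau> c u w t) *
          cis (\<Lambda> * (Ph \<sigma> (\<tau> + u) (c + t) - Ph \<sigma> (\<tau> + w) (c + t))) \<partial>sector)"
        by (simp only: X_def integral_mult_right_zero)
      then have "cmod (X u w) = (\<bar>W N \<tau> u\<bar> * \<bar>W N \<tau> w\<bar>) * cmod (\<integral>t. of_real (kamp m \<tau> c u w t) *
          cis (\<Lambda> * (Ph \<sigma> (\<tau> + u) (c + t) - Ph \<sigma> (\<tau> + w) (c + t))) \<partial>sector)"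
        by (simp only: norm_mult norm_of_real abs_mult)
      also have "\<dots> \<le> (M * M) * (K / (1 + (\<Lambda> * (u - w))\<^sup>2))"
        using M K u a by (intro mult_mono) auto
      finally show ?thesis by simp
    qed
    have Xm [measurable]: "(\<lambda>w. X u w) \<in> borel_measurable borel" for u
      unfolding X_def sector_def H_def h_def by measurable
    have "cmod (\<integral>w. X u w \<partial>?D) \<le> M * M * K * (pi / \<Lambda>)" if u: "u \<in> {-d..d}" for u
    proof -
      have le1: "1 / (1 + (\<Lambda> * (u - w))\<^sup>2) \<le> 1" for w by (simp add: add_pos_nonneg divide_le_eq)
      have MK: "0 \<le> M * M * K" using M K by simp
      have XM: "cmod (X u w) \<le> M * M * K" if "w \<in> {-d..d}" for w
        using order_trans[OF Xb[OF u that] mult_left_mono[OF le1 MK]] by simp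
      have "cmod (\<integral>w. X u w \<partial>?D) \<le> (\<integral>w. cmod (X u w) \<partial>?D)" by (rule integral_norm_bound)
      also have "\<dots> \<le> (\<integral>w. M * M * K * (1 / (1 + (\<Lambda> * (u - w))\<^sup>2)) \<partial>?D)"
      proof (rule leb_mono)
        show "integrable ?D (\<lambda>w. cmod (X u w))" using XM by (intro integrable_leb[of _ _ _ "M * M * K"]) auto
        show "integrable ?D (\<lambda>w. M * M * K * (1 / (1 + (\<Lambda> * (u - w))\<^sup>2)))"
          using mult_left_mono[OF le1 MK] MK by (intro integrable_leb[of _ _ _ "M * M * K"]) (auto simp: abs_mult M K)
      qed (rule Xb[OF u])
      also have "\<dots> = M * M * K * (\<integral>w. 1 / (1 + (\<Lambda> * (u - w))\<^sup>2) \<partial>?D)"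
        by (rule integral_mult_right_zero)
      also have "\<dots> \<le> M * M * K * (pi / \<Lambda>)"
        using d(1) a(3) by (intro mult_left_mono MK Poisson_kernel_bound) auto
      finally show ?thesis .
    qed
    then have "cmod (\<integral>u. (\<integral>w. X u w \<partial>?D) \<partial>?D) \<le> M * M * K * (pi / \<Lambda>) * (d - - d)"
      using d(1) M K a(3) by (intro norm_leb_le) auto
    then have "\<bar>\<integral>t. chi t * (cmod (G m N \<sigma> \<tau> \<Lambda> (c + t)))\<^sup>2 \<partial>sector\<bar> \<le> M * M * K * (pi / \<Lambda>) * (d - - d)"
      unfolding e2[symmetric] norm_of_real .
    then show ?thesis by (simp add: algebra_simps)
  qed
  then show ?thesis using M K d(1) by (intro exI[of _ "M * M * K * pi * (d - - d)"]) auto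
qed

text \<open>The window transform near the normal after multiplication by (-i \<epsilon>
  \<Lambda>)^m, see \<open>qf_near\<close>; \<open>F\<close> is the Fourier transform of the measure
  that remains of the weight.\<close>

definition Z :: "(real \<Rightarrow> complex) \<Rightarrow> nat \<Rightarrow> nat \<Rightarrow> real \<Rightarrow> real \<Rightarrow> real \<Rightarrow> real \<Rightarrow> complex" where
  "Z F m N \<tau> \<epsilon> \<Lambda> \<theta> = (\<integral>u. of_real (amp m N \<tau> u \<theta>) * cis (\<Lambda> * Ph 0 (\<tau> + u) \<theta>) * F (\<epsilon> * \<Lambda> * nd (\<tau> + u) \<theta>) \<partial>leb (- d) d)"

lemma Z_meas [measurable]:
  assumes [measurable]: "F \<in> borel_measurable borel" "s \<in> borel_measurable M"
  shows "(\<lambda>p. Z F m N \<tau> \<epsilon> \<Lambda> (s p)) \<in> borel_measurable M"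
  unfolding Z_def by measurable

lemma Z_integrable:
  assumes [measurable]: "F \<in> borel_measurable borel" and C: "0 \<le> C" "\<And>y. cmod (F y) \<le> C" and n: "near \<tau> c"
  shows "integrable sector (\<lambda>t. chi t * (cmod (Z F m N \<tau> \<epsilon> \<Lambda> (c + t)))\<^sup>2)"
    and "t \<in> {- (pi / 3)..pi / 3} \<Longrightarrow> integrable (leb (- d) d) (\<lambda>u. of_real (amp m N \<tau> u (c + t)) * cis (\<Lambda> * Ph 0 (\<tau> + u) (c + t)) * F (\<epsilon> * \<Lambda> * nd (\<tau> + u) (c + t)))"
proof -
  obtain A where A: "A \<ge> 0" "\<And>u t. u \<in> {-d..d} \<Longrightarrow> t \<in> {- (pi / 3)..pi / 3} \<Longrightarrow> \<bar>amp m N \<tau> u (c + t)\<bar> \<le> A"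
    using amp_bound n by blast
  have b: "cmod (of_real (amp m N \<tau> u (c + t)) * cis (\<Lambda> * Ph 0 (\<tau> + u) (c + t)) * F (\<epsilon> * \<Lambda> * nd (\<tau> + u) (c + t))) \<le> A * C"
    if "t \<in> {- (pi / 3)..pi / 3}" "u \<in> {-d..d}" for t u
    unfolding norm_mult using A that C by (auto intro!: mult_mono)
  show "t \<in> {- (pi / 3)..pi / 3} \<Longrightarrow> integrable (leb (- d) d) (\<lambda>u. of_real (amp m N \<tau> u (c + t)) * cis (\<Lambda> * Ph 0 (\<tau> + u) (c + t)) * F (\<epsilon> * \<Lambda> * nd (\<tau> + u) (c + t)))"
    using b by (intro integrable_leb[of _ _ _ "A * C"]) auto
  have "cmod (Z F m N \<tau> \<epsilon> \<Lambda> (c + t)) \<le> A * C * (d - - d)" if "t \<in> {- (pi / 3)..pi / 3}" for t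
    unfolding Z_def using d(1) A C b[OF that] by (intro norm_leb_le) auto
  then have "chi t * (cmod (Z F m N \<tau> \<epsilon> \<Lambda> (c + t)))\<^sup>2 \<le> ((2 * pi / 3) * (2 * pi / 3)) ^ 2 * (A * C * (d - - d))\<^sup>2"
    if "t \<in> {- (pi / 3)..pi / 3}" for t
    using that chi_bound[OF that] chi_nonneg by (intro mult_mono power_mono) auto
  then show "integrable sector (\<lambda>t. chi t * (cmod (Z F m N \<tau> \<epsilon> \<Lambda> (c + t)))\<^sup>2)"
    unfolding sector_def using chi_nonneg
    by (intro integrable_leb[of _ _ _ "((2 * pi / 3) * (2 * pi / 3)) ^ 2 * (A * C * (d - - d))\<^sup>2"]) (auto simp: abs_mult)
qed

text \<open>A point mass at p adds p \<epsilon> \<Lambda> nd to the phase, and this is exactly the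
  passage to the parallel curve at offset p \<epsilon>, still within \<open>e0\<close>. A density is
  a superposition of such masses, handled by Cauchy-Schwarz in s, and a sum costs a factor 2. Hence
  the induction over the measure.\<close>

lemma Z_square_bound:
  assumes "fourier_meas F"
  shows "\<exists>C\<ge>0. \<forall>\<tau> c \<epsilon> \<Lambda>. 0 < \<epsilon> \<longrightarrow> \<epsilon> \<le> e0 \<longrightarrow> near \<tau> c \<longrightarrow> 0 < \<Lambda> \<longrightarrow>
    (\<integral>t. chi t * (cmod (Z F m N \<tau> \<epsilon> \<Lambda> (c + t)))\<^sup>2 \<partial>sector) \<le> C / \<Lambda>"
proof -
  obtain K where K: "K \<ge> 0" "\<And>\<tau> c \<sigma> \<Lambda>. \<bar>\<sigma>\<bar> \<le> e0 \<Longrightarrow> near \<tau> c \<Longrightarrow> 0 < \<Lambda> \<Longrightarrow>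
    (\<integral>t. chi t * (cmod (G m N \<sigma> \<tau> \<Lambda> (c + t)))\<^sup>2 \<partial>sector) \<le> K / \<Lambda>"
    using G_square_bound by blast
  have Gc: "of_real (amp m N \<tau> u \<theta>) * cis (\<Lambda> * Ph 0 (\<tau> + u) \<theta>) * cis (p * (\<epsilon> * \<Lambda> * nd (\<tau> + u) \<theta>))
     = of_real (amp m N \<tau> u \<theta>) * cis (\<Lambda> * Ph (p * \<epsilon>) (\<tau> + u) \<theta>)" for \<tau> u \<theta> \<Lambda> p \<epsilon>
  proof -
    have "\<Lambda> * Ph 0 (\<tau> + u) \<theta> + p * (\<epsilon> * \<Lambda> * nd (\<tau> + u) \<theta>) = \<Lambda> * Ph (p * \<epsilon>) (\<tau> + u) \<theta>"
      by (subst (2) Ph_add) (simp add: algebra_simps)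
    then show ?thesis by (simp add: mult.assoc cis_mult)
  qed
  show ?thesis using assms
  proof induction
    case (point p a)
    have Z: "Z (\<lambda>y. a * cis (p * y)) m N \<tau> \<epsilon> \<Lambda> \<theta> = a * G m N (p * \<epsilon>) \<tau> \<Lambda> \<theta>" for \<tau> \<epsilon> \<Lambda> \<theta>
    proof -
      have "Z (\<lambda>y. a * cis (p * y)) m N \<tau> \<epsilon> \<Lambda> \<theta> = (\<integral>u. a * (of_real (amp m N \<tau> u \<theta>) * cis (\<Lambda> * Ph 0 (\<tau> + u) \<theta>) * cis (p * (\<epsilon> * \<Lambda> * nd (\<tau> + u) \<theta>))) \<partial>leb (- d) d)"
        unfolding Z_def by (intro arg_cong[where f = "integral\<^sup>L _"] ext) (simp add: mult_ac)
      then show ?thesis unfolding Gc G_def by simp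
    qed
    have "(\<integral>t. chi t * (cmod (Z (\<lambda>y. a * cis (p * y)) m N \<tau> \<epsilon> \<Lambda> (c + t)))\<^sup>2 \<partial>sector) \<le> (cmod a)\<^sup>2 * K / \<Lambda>"
      if a: "0 < \<epsilon>" "\<epsilon> \<le> e0" "near \<tau> c" "0 < \<Lambda>" for \<tau> c \<epsilon> \<Lambda>
    proof -
      have "\<bar>p * \<epsilon>\<bar> \<le> e0" using a mult_mono[of "\<bar>p\<bar>" 1 \<epsilon> e0] point by (simp add: abs_mult)
      from K(2)[OF this a(3,4)]
      have "(cmod a)\<^sup>2 * (\<integral>t. chi t * (cmod (G m N (p * \<epsilon>) \<tau> \<Lambda> (c + t)))\<^sup>2 \<partial>sector) \<le> (cmod a)\<^sup>2 * (K / \<Lambda>)"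
        by (intro mult_left_mono) auto
      moreover have "(\<integral>t. chi t * (cmod (Z (\<lambda>y. a * cis (p * y)) m N \<tau> \<epsilon> \<Lambda> (c + t)))\<^sup>2 \<partial>sector) =
         (\<integral>t. (cmod a)\<^sup>2 * (chi t * (cmod (G m N (p * \<epsilon>) \<tau> \<Lambda> (c + t)))\<^sup>2) \<partial>sector)"
        unfolding Z norm_mult power_mult_distrib by (intro arg_cong[where f = "integral\<^sup>L _"] ext) (simp add: mult_ac)
      ultimately show ?thesis by simp
    qed
    then show ?case using K(1) by (intro exI[of _ "(cmod a)\<^sup>2 * K"]) auto
  next
    case (density g B0)
    note [measurable] = density(1)
    define B where "B = max B0 0"
    have gB: "cmod (g s) \<le> B" for s using density(2)[of s] by (simp add: B_def le_max_iff_disj)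
    have B: "B \<ge> 0" by (simp add: B_def)
    let ?F = "\<lambda>y. \<integral>s. g s * cis (s * y) \<partial>leb (-1) 1"
    \<comment> \<open>One factor 2 of the 4 is the length of [-1,1] in Cauchy-Schwarz, the other
      comes from integrating the uniform bound K / \<Lambda> over s.\<close>
    have "(\<integral>t. chi t * (cmod (Z ?F m N \<tau> \<epsilon> \<Lambda> (c + t)))\<^sup>2 \<partial>sector) \<le> 4 * B\<^sup>2 * K / \<Lambda>"
      if a: "0 < \<epsilon>" "\<epsilon> \<le> e0" "near \<tau> c" "0 < \<Lambda>" for \<tau> c \<epsilon> \<Lambda>
    proof -
      obtain A where A: "A \<ge> 0" "\<And>u t. u \<in> {-d..d} \<Longrightarrow> t \<in> {- (pi / 3)..pi / 3} \<Longrightarrow> \<bar>amp m N \<tau> u (c + t)\<bar> \<le> A"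
        using amp_bound a(3) by blast
      obtain H where H: "H \<ge> 0" "\<And>\<sigma> t. t \<in> {- (pi / 3)..pi / 3} \<Longrightarrow> cmod (G m N \<sigma> \<tau> \<Lambda> (c + t)) \<le> H"
        using G_bound[of m N] a(3) by metis
      have Z: "Z ?F m N \<tau> \<epsilon> \<Lambda> (c + t) = (\<integral>s. g s * G m N (s * \<epsilon>) \<tau> \<Lambda> (c + t) \<partial>leb (-1) 1)" if t: "t \<in> {- (pi / 3)..pi / 3}" for t
      proof -
        have "Z ?F m N \<tau> \<epsilon> \<Lambda> (c + t) = (\<integral>u. (\<integral>s. g s * (of_real (amp m N \<tau> u (c + t)) * cis (\<Lambda> * Ph (s * \<epsilon>) (\<tau> + u) (c + t))) \<partial>leb (-1) 1) \<partial>leb (- d) d)"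
          unfolding Z_def Gc[symmetric] integral_mult_right_zero[symmetric]
          by (intro arg_cong[where f = "integral\<^sup>L _"] ext) (simp add: mult_ac)
        also have "\<dots> = (\<integral>s. (\<integral>u. g s * (of_real (amp m N \<tau> u (c + t)) * cis (\<Lambda> * Ph (s * \<epsilon>) (\<tau> + u) (c + t))) \<partial>leb (- d) d) \<partial>leb (-1) 1)"
        proof (rule leb_swap[where C = "B * A"])
          show "cmod (g s * (of_real (amp m N \<tau> u (c + t)) * cis (\<Lambda> * Ph (s * \<epsilon>) (\<tau> + u) (c + t)))) \<le> B * A"
            if "u \<in> {-d..d}" for u s
            unfolding norm_mult using that t A gB B by (auto intro!: mult_mono)
        qed (unfold case_prod_beta', measurable)
        finally show ?thesis by (simp add: G_def)
      qed
      have gH: "cmod (g s * G m N (s * \<epsilon>) \<tau> \<Lambda> (c + t)) \<le> B * H" if "t \<in> {- (pi / 3)..pi / 3}" for s t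
        unfolding norm_mult using that gB H B by (auto intro!: mult_mono)
      have H2: "(cmod (G m N \<sigma> \<tau> \<Lambda> (c + t)))\<^sup>2 \<le> H\<^sup>2" if "t \<in> {- (pi / 3)..pi / 3}" for \<sigma> t
        using H(2)[OF that] by (intro power_mono) auto
      let ?B2 = "((2 * pi / 3) * (2 * pi / 3)) ^ 2"
      have cH: "\<bar>chi t * (cmod (G m N \<sigma> \<tau> \<Lambda> (c + t)))\<^sup>2\<bar> \<le> ?B2 * H\<^sup>2" if "t \<in> {- (pi / 3)..pi / 3}" for \<sigma> t
        unfolding abs_mult using H2[OF that] chi_bound[OF that] chi_nonneg by (intro mult_mono) auto
      have sq: "(cmod (Z ?F m N \<tau> \<epsilon> \<Lambda> (c + t)))\<^sup>2 \<le> 2 * B\<^sup>2 * (\<integral>s. (cmod (G m N (s * \<epsilon>) \<tau> \<Lambda> (c + t)))\<^sup>2 \<partial>leb (-1) 1)"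
        if t: "t \<in> {- (pi / 3)..pi / 3}" for t
      proof -
        have "(cmod (Z ?F m N \<tau> \<epsilon> \<Lambda> (c + t)))\<^sup>2 \<le> (1 - (-1)) * (\<integral>s. (cmod (g s * G m N (s * \<epsilon>) \<tau> \<Lambda> (c + t)))\<^sup>2 \<partial>leb (-1) 1)"
          unfolding Z[OF t] using gH[OF t] by (intro leb_Cauchy_Schwarz[of _ _ _ "B * H"]) auto
        also have "(\<integral>s. (cmod (g s * G m N (s * \<epsilon>) \<tau> \<Lambda> (c + t)))\<^sup>2 \<partial>leb (-1) 1) \<le>
          (\<integral>s. B\<^sup>2 * (cmod (G m N (s * \<epsilon>) \<tau> \<Lambda> (c + t)))\<^sup>2 \<partial>leb (-1) 1)"
        proof (rule leb_mono)
          show "integrable (leb (-1) 1) (\<lambda>s. (cmod (g s * G m N (s * \<epsilon>) \<tau> \<Lambda> (c + t)))\<^sup>2)"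
            using gH[OF t] by (intro integrable_leb[of _ _ _ "(B * H)\<^sup>2"]) (auto intro!: power_mono)
          show "integrable (leb (-1) 1) (\<lambda>s. B\<^sup>2 * (cmod (G m N (s * \<epsilon>) \<tau> \<Lambda> (c + t)))\<^sup>2)"
            using H2[OF t] by (intro integrable_leb[of _ _ _ "B\<^sup>2 * H\<^sup>2"]) (auto intro!: mult_left_mono)
          show "(cmod (g s * G m N (s * \<epsilon>) \<tau> \<Lambda> (c + t)))\<^sup>2 \<le> B\<^sup>2 * (cmod (G m N (s * \<epsilon>) \<tau> \<Lambda> (c + t)))\<^sup>2" for s
            using gB B unfolding norm_mult power_mult_distrib by (intro mult_right_mono power_mono) auto
        qed
        finally show ?thesis by simp
      qed
      have "(\<integral>t. chi t * (cmod (Z ?F m N \<tau> \<epsilon> \<Lambda> (c + t)))\<^sup>2 \<partial>sector) \<le>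
         (\<integral>t. 2 * B\<^sup>2 * (\<integral>s. chi t * (cmod (G m N (s * \<epsilon>) \<tau> \<Lambda> (c + t)))\<^sup>2 \<partial>leb (-1) 1) \<partial>sector)"
        unfolding sector_def
      proof (rule leb_mono)
        obtain D where D: "D \<ge> 0" "\<And>y. cmod (?F y) \<le> D" and Fm: "?F \<in> borel_measurable borel"
          using fourier_meas_borel_bounded[OF fourier_meas.density[OF density]] by auto
        show "integrable (leb (- (pi / 3)) (pi / 3)) (\<lambda>t. chi t * (cmod (Z ?F m N \<tau> \<epsilon> \<Lambda> (c + t)))\<^sup>2)"
          using Z_integrable(1)[OF Fm D a(3)] by (simp add: sector_def)
        have "norm (\<integral>s. chi t * (cmod (G m N (s * \<epsilon>) \<tau> \<Lambda> (c + t)))\<^sup>2 \<partial>leb (-1) 1) \<le> ?B2 * H\<^sup>2 * (1 - (-1))"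
          if "t \<in> {- (pi / 3)..pi / 3}" for t
          using cH[OF that] by (intro norm_leb_le) auto
        then show "integrable (leb (- (pi / 3)) (pi / 3)) (\<lambda>t. 2 * B\<^sup>2 * (\<integral>s. chi t * (cmod (G m N (s * \<epsilon>) \<tau> \<Lambda> (c + t)))\<^sup>2 \<partial>leb (-1) 1))"
          by (intro integrable_mult_right integrable_leb[of _ _ _ "?B2 * H\<^sup>2 * (1 - (-1))"]) auto
        show "chi t * (cmod (Z ?F m N \<tau> \<epsilon> \<Lambda> (c + t)))\<^sup>2 \<le> 2 * B\<^sup>2 * (\<integral>s. chi t * (cmod (G m N (s * \<epsilon>) \<tau> \<Lambda> (c + t)))\<^sup>2 \<partial>leb (-1) 1)"
          if "t \<in> {- (pi / 3)..pi / 3}" for t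
          using mult_left_mono[OF sq[OF that] chi_nonneg[of t]] by (simp add: mult_ac)
      qed
      also have "\<dots> = 2 * B\<^sup>2 * (\<integral>s. (\<integral>t. chi t * (cmod (G m N (s * \<epsilon>) \<tau> \<Lambda> (c + t)))\<^sup>2 \<partial>sector) \<partial>leb (-1) 1)"
        unfolding sector_def integral_mult_right_zero
        by (subst leb_swap[where C = "?B2 * H\<^sup>2"]) (use cH in \<open>auto simp: case_prod_beta'\<close>)
      also have "(\<integral>s. (\<integral>t. chi t * (cmod (G m N (s * \<epsilon>) \<tau> \<Lambda> (c + t)))\<^sup>2 \<partial>sector) \<partial>leb (-1) 1) \<le> K / \<Lambda> * (1 - (-1))"
      proof -
        have "norm (\<integral>t. chi t * (cmod (G m N (s * \<epsilon>) \<tau> \<Lambda> (c + t)))\<^sup>2 \<partial>sector) \<le> K / \<Lambda>" if "s \<in> {-1..1}" for s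
        proof -
          have "\<bar>s * \<epsilon>\<bar> \<le> e0" using a mult_mono[of "\<bar>s\<bar>" 1 \<epsilon> e0] that by (simp add: abs_mult abs_le_iff)
          moreover have "0 \<le> (\<integral>t. chi t * (cmod (G m N (s * \<epsilon>) \<tau> \<Lambda> (c + t)))\<^sup>2 \<partial>sector)"
            using chi_nonneg by (intro integral_nonneg_AE) auto
          ultimately show ?thesis using K(2) a by simp
        qed
        then have "norm (\<integral>s. (\<integral>t. chi t * (cmod (G m N (s * \<epsilon>) \<tau> \<Lambda> (c + t)))\<^sup>2 \<partial>sector) \<partial>leb (-1) 1) \<le> K / \<Lambda> * (1 - (-1))"
          using K(1) a(4) by (intro norm_leb_le) auto
        then show ?thesis by simp
      qed
      finally show ?thesis by (simp add: mult_left_mono)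
    qed
    then show ?case using K(1) B by (intro exI[of _ "4 * B\<^sup>2 * K"]) auto
  next
    case (add F1 F2)
    then obtain C1 C2 where C: "C1 \<ge> 0" "C2 \<ge> 0"
      "\<And>\<tau> c \<epsilon> \<Lambda>. 0 < \<epsilon> \<Longrightarrow> \<epsilon> \<le> e0 \<Longrightarrow> near \<tau> c \<Longrightarrow> 0 < \<Lambda> \<Longrightarrow> (\<integral>t. chi t * (cmod (Z F1 m N \<tau> \<epsilon> \<Lambda> (c + t)))\<^sup>2 \<partial>sector) \<le> C1 / \<Lambda>"
      "\<And>\<tau> c \<epsilon> \<Lambda>. 0 < \<epsilon> \<Longrightarrow> \<epsilon> \<le> e0 \<Longrightarrow> near \<tau> c \<Longrightarrow> 0 < \<Lambda> \<Longrightarrow> (\<integral>t. chi t * (cmod (Z F2 m N \<tau> \<epsilon> \<Lambda> (c + t)))\<^sup>2 \<partial>sector) \<le> C2 / \<Lambda>"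
      by blast
    obtain D1 D2 where D: "F1 \<in> borel_measurable borel" "F2 \<in> borel_measurable borel" "D1 \<ge> 0" "D2 \<ge> 0" "\<And>y. cmod (F1 y) \<le> D1" "\<And>y. cmod (F2 y) \<le> D2"
      using fourier_meas_borel_bounded[OF add(1)] fourier_meas_borel_bounded[OF add(2)] by blast
    obtain D3 where D3: "(\<lambda>y. F1 y + F2 y) \<in> borel_measurable borel" "D3 \<ge> 0" "\<And>y. cmod (F1 y + F2 y) \<le> D3"
      using fourier_meas_borel_bounded[OF fourier_meas.add[OF add(1,2)]] by blast
    have "(\<integral>t. chi t * (cmod (Z (\<lambda>y. F1 y + F2 y) m N \<tau> \<epsilon> \<Lambda> (c + t)))\<^sup>2 \<partial>sector) \<le> (2 * C1 + 2 * C2) / \<Lambda>"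
      if a: "0 < \<epsilon>" "\<epsilon> \<le> e0" "near \<tau> c" "0 < \<Lambda>" for \<tau> c \<epsilon> \<Lambda>
    proof -
      note i1 = Z_integrable[OF D(1,3,5) a(3), where m=m and N=N and \<epsilon>=\<epsilon> and \<Lambda>=\<Lambda>]
      note i2 = Z_integrable[OF D(2,4,6) a(3), where m=m and N=N and \<epsilon>=\<epsilon> and \<Lambda>=\<Lambda>]
      have Z: "Z (\<lambda>y. F1 y + F2 y) m N \<tau> \<epsilon> \<Lambda> (c + t) = Z F1 m N \<tau> \<epsilon> \<Lambda> (c + t) + Z F2 m N \<tau> \<epsilon> \<Lambda> (c + t)"
        if "t \<in> {- (pi / 3)..pi / 3}" for t
        unfolding Z_def distrib_left using i1(2)[OF that] i2(2)[OF that] by (rule Bochner_Integration.integral_add)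
      have "(\<integral>t. chi t * (cmod (Z (\<lambda>y. F1 y + F2 y) m N \<tau> \<epsilon> \<Lambda> (c + t)))\<^sup>2 \<partial>sector) \<le>
         (\<integral>t. 2 * (chi t * (cmod (Z F1 m N \<tau> \<epsilon> \<Lambda> (c + t)))\<^sup>2) + 2 * (chi t * (cmod (Z F2 m N \<tau> \<epsilon> \<Lambda> (c + t)))\<^sup>2) \<partial>sector)"
        unfolding sector_def
      proof (rule leb_mono)
        show "integrable (leb (- (pi / 3)) (pi / 3)) (\<lambda>t. chi t * (cmod (Z (\<lambda>y. F1 y + F2 y) m N \<tau> \<epsilon> \<Lambda> (c + t)))\<^sup>2)"
          using Z_integrable(1)[OF D3 a(3)] by (simp add: sector_def)
        show "integrable (leb (- (pi / 3)) (pi / 3)) (\<lambda>t. 2 * (chi t * (cmod (Z F1 m N \<tau> \<epsilon> \<Lambda> (c + t)))\<^sup>2) + 2 * (chi t * (cmod (Z F2 m N \<tau> \<epsilon> \<Lambda> (c + t)))\<^sup>2))"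
          using i1(1) i2(1) by (simp add: sector_def)
        show "chi t * (cmod (Z (\<lambda>y. F1 y + F2 y) m N \<tau> \<epsilon> \<Lambda> (c + t)))\<^sup>2 \<le>
          2 * (chi t * (cmod (Z F1 m N \<tau> \<epsilon> \<Lambda> (c + t)))\<^sup>2) + 2 * (chi t * (cmod (Z F2 m N \<tau> \<epsilon> \<Lambda> (c + t)))\<^sup>2)"
          if "t \<in> {- (pi / 3)..pi / 3}" for t
          unfolding Z[OF that] using mult_left_mono[OF cmod_add_squared chi_nonneg[of t]] by (simp add: algebra_simps)
      qed
      also have "\<dots> = 2 * (\<integral>t. chi t * (cmod (Z F1 m N \<tau> \<epsilon> \<Lambda> (c + t)))\<^sup>2 \<partial>sector) + 2 * (\<integral>t. chi t * (cmod (Z F2 m N \<tau> \<epsilon> \<Lambda> (c + t)))\<^sup>2 \<partial>sector)"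
        using i1(1) i2(1) by simp
      also have "\<dots> \<le> 2 * (C1 / \<Lambda>) + 2 * (C2 / \<Lambda>)"
        using C(3)[OF a] C(4)[OF a] by linarith
      finally show ?thesis by (simp add: add_divide_distrib)
    qed
    then show ?case using C(1,2) by (intro exI[of _ "2 * C1 + 2 * C2"]) auto
  qed
qed

end

section \<open>The Fourier transform of the weighted tube on a circle\<close>

context strip begin

text \<open>In tube coordinates with normalized offset s, this is the part of the Fourier transform
  at frequency \<Lambda> and angle t that comes from the window around \<open>\<tau>\<close>.
  \<open>Qh\<close> is the same quantity for the full curve.\<close>

definition qf :: "(real \<Rightarrow> real) \<Rightarrow> nat \<Rightarrow> real \<Rightarrow> real \<Rightarrow> real \<Rightarrow> real \<Rightarrow> complex" where
  "qf \<theta> N \<tau> \<epsilon> \<Lambda> t = (\<integral>s. of_real (\<theta> s) *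
     (\<integral>u. of_real (W N \<tau> u) * cis (\<Lambda> * Ph (\<epsilon> * s) (\<tau> + u) t) \<partial>leb (- d) d) \<partial>leb (-1) 1)"

definition Qh :: "(real \<Rightarrow> real) \<Rightarrow> real \<Rightarrow> real \<Rightarrow> real \<Rightarrow> complex" where
  "Qh \<theta> \<epsilon> \<Lambda> t = (\<integral>s. of_real (\<theta> s) * (\<integral>u. of_real (f u) * cis (\<Lambda> * Ph (\<epsilon> * s) u t) \<partial>leb 0 1) \<partial>leb (-1) 1)"

lemma Ph_periodic: "Ph \<sigma> t (\<theta> + 2 * pi) = Ph \<sigma> t \<theta>"
  by (simp add: Ph_def)

context
  fixes \<theta> :: "real \<Rightarrow> real" and T :: real and F :: "real \<Rightarrow> complex" and m :: nat
  assumes \<theta>m [measurable]: "\<theta> \<in> borel_measurable borel" and T: "\<And>s. \<bar>\<theta> s\<bar> \<le> T"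
    and F: "fourier_meas F"
    and rep: "\<And>y. (- \<i> * of_real y) ^ m * (\<integral>s. of_real (\<theta> s) * cis (s * y) \<partial>leb (-1) 1) = F y"
begin

lemma T_nonneg: "0 \<le> T"
  using order_trans[OF abs_ge_zero T] .

lemma F_meas [measurable]: "F \<in> borel_measurable borel"
  using fourier_meas_borel_bounded[OF F] by simp

lemma qf_meas [measurable]:
  assumes [measurable]: "g \<in> borel_measurable M" "h \<in> borel_measurable M"
  shows "(\<lambda>p. qf \<theta> N (g p) \<epsilon> \<Lambda> (h p)) \<in> borel_measurable M"
  unfolding qf_def by measurable

lemma Qh_meas [measurable]:
  assumes [measurable]: "h \<in> borel_measurable M"
  shows "(\<lambda>p. Qh \<theta> \<epsilon> \<Lambda> (h p)) \<in> borel_measurable M"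
  unfolding Qh_def by measurable

lemma qf_bound: "\<exists>C\<ge>0. \<forall>\<tau> \<epsilon> \<Lambda> t. cmod (qf \<theta> N \<tau> \<epsilon> \<Lambda> t) \<le> C"
proof -
  obtain M where M: "M \<ge> 0" "\<And>\<tau> u. u \<in> {-d..d} \<Longrightarrow> \<bar>W N \<tau> u\<bar> \<le> M" using W_bound by blast
  have "cmod (\<integral>u. of_real (W N \<tau> u) * cis (\<Lambda> * Ph (\<epsilon> * s) (\<tau> + u) t) \<partial>leb (- d) d) \<le> M * (d - - d)" for \<tau> \<epsilon> \<Lambda> t s
    using M d(1) by (intro norm_leb_le) (auto simp: norm_mult)
  then have "cmod (qf \<theta> N \<tau> \<epsilon> \<Lambda> t) \<le> (T * (M * (d - - d))) * (1 - (-1))" for \<tau> \<epsilon> \<Lambda> t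
    unfolding qf_def using M d(1) T T_nonneg by (intro norm_leb_le) (auto simp: norm_mult intro!: mult_mono)
  then show ?thesis using M d(1) T_nonneg by (intro exI[of _ "(T * (M * (d - - d))) * (1 - (-1))"]) auto
qed

text \<open>The offset enters the phase only as s \<epsilon> \<Lambda> nd, so after exchanging the
  integrals the s-integral is the Fourier transform of the weight at \<epsilon> \<Lambda> nd. As nd
  does not vanish in the cone, (\<epsilon> \<Lambda>)^m can be completed to the m-th power of that
  argument at the price of 1/nd^m, which enters \<open>amp\<close>.\<close>

lemma qf_near:
  assumes n: "near \<tau> c" and t: "t \<in> {- (pi / 3)..pi / 3}"
  shows "(- \<i> * of_real (\<epsilon> * \<Lambda>)) ^ m * qf \<theta> N \<tau> \<epsilon> \<Lambda> (c + t) = Z F m N \<tau> \<epsilon> \<Lambda> (c + t)"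
proof -
  obtain M where M: "M \<ge> 0" "\<And>\<tau> u. u \<in> {-d..d} \<Longrightarrow> \<bar>W N \<tau> u\<bar> \<le> M" using W_bound by blast
  have "qf \<theta> N \<tau> \<epsilon> \<Lambda> (c + t) = (\<integral>s. (\<integral>u. of_real (\<theta> s) * (of_real (W N \<tau> u) * cis (\<Lambda> * Ph (\<epsilon> * s) (\<tau> + u) (c + t))) \<partial>leb (- d) d) \<partial>leb (-1) 1)"
    unfolding qf_def by simp
  also have "\<dots> = (\<integral>u. (\<integral>s. of_real (\<theta> s) * (of_real (W N \<tau> u) * cis (\<Lambda> * Ph (\<epsilon> * s) (\<tau> + u) (c + t))) \<partial>leb (-1) 1) \<partial>leb (- d) d)"
  proof (rule leb_swap[where C = "T * M"])
    show "cmod (of_real (\<theta> s) * (of_real (W N \<tau> u) * cis (\<Lambda> * Ph (\<epsilon> * s) (\<tau> + u) (c + t)))) \<le> T * M" if "u \<in> {-d..d}" for s u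
      using M that T T_nonneg by (auto simp: norm_mult intro!: mult_mono)
  qed (unfold case_prod_beta', measurable)
  also have "\<dots> = (\<integral>u. of_real (W N \<tau> u) * cis (\<Lambda> * Ph 0 (\<tau> + u) (c + t)) * (\<integral>s. of_real (\<theta> s) * cis (s * (\<epsilon> * \<Lambda> * nd (\<tau> + u) (c + t))) \<partial>leb (-1) 1) \<partial>leb (- d) d)"
  proof (intro arg_cong[where f = "integral\<^sup>L _"] ext)
    fix u
    have "of_real (\<theta> s) * (of_real (W N \<tau> u) * cis (\<Lambda> * Ph (\<epsilon> * s) (\<tau> + u) (c + t))) =
       of_real (W N \<tau> u) * cis (\<Lambda> * Ph 0 (\<tau> + u) (c + t)) * (of_real (\<theta> s) * cis (s * (\<epsilon> * \<Lambda> * nd (\<tau> + u) (c + t))))" for s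
    proof -
      have "\<Lambda> * Ph (\<epsilon> * s) (\<tau> + u) (c + t) = \<Lambda> * Ph 0 (\<tau> + u) (c + t) + s * (\<epsilon> * \<Lambda> * nd (\<tau> + u) (c + t))"
        by (subst Ph_add) (simp add: algebra_simps)
      then show ?thesis by (simp add: cis_mult[symmetric])
    qed
    then show "(\<integral>s. of_real (\<theta> s) * (of_real (W N \<tau> u) * cis (\<Lambda> * Ph (\<epsilon> * s) (\<tau> + u) (c + t))) \<partial>leb (-1) 1) =
       of_real (W N \<tau> u) * cis (\<Lambda> * Ph 0 (\<tau> + u) (c + t)) * (\<integral>s. of_real (\<theta> s) * cis (s * (\<epsilon> * \<Lambda> * nd (\<tau> + u) (c + t))) \<partial>leb (-1) 1)"
      by (simp only: integral_mult_right_zero)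
  qed
  finally have "(- \<i> * of_real (\<epsilon> * \<Lambda>)) ^ m * qf \<theta> N \<tau> \<epsilon> \<Lambda> (c + t) =
     (\<integral>u. (- \<i> * of_real (\<epsilon> * \<Lambda>)) ^ m * (of_real (W N \<tau> u) * cis (\<Lambda> * Ph 0 (\<tau> + u) (c + t)) * (\<integral>s. of_real (\<theta> s) * cis (s * (\<epsilon> * \<Lambda> * nd (\<tau> + u) (c + t))) \<partial>leb (-1) 1)) \<partial>leb (- d) d)"
    by (simp only: integral_mult_right_zero)
  also have "\<dots> = Z F m N \<tau> \<epsilon> \<Lambda> (c + t)"
    unfolding Z_def
  proof (rule leb_cong)
    fix u assume u: "u \<in> {-d..d}"
    let ?n = "nd (\<tau> + u) (c + t)"
    have nz: "?n \<noteq> 0" using near_lower[OF n t u] by auto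
    have e: "(- \<i> * complex_of_real (\<epsilon> * \<Lambda>)) = (- \<i> * of_real (\<epsilon> * \<Lambda> * ?n)) * of_real (inverse ?n)"
      using nz by simp
    have "(- \<i> * complex_of_real (\<epsilon> * \<Lambda>)) ^ m = of_real (inverse ?n ^ m) * (- \<i> * of_real (\<epsilon> * \<Lambda> * ?n)) ^ m"
      unfolding e power_mult_distrib by simp
    then show "(- \<i> * of_real (\<epsilon> * \<Lambda>)) ^ m * (of_real (W N \<tau> u) * cis (\<Lambda> * Ph 0 (\<tau> + u) (c + t)) * (\<integral>s. of_real (\<theta> s) * cis (s * (\<epsilon> * \<Lambda> * ?n)) \<partial>leb (-1) 1))
      = of_real (amp m N \<tau> u (c + t)) * cis (\<Lambda> * Ph 0 (\<tau> + u) (c + t)) * F (\<epsilon> * \<Lambda> * ?n)"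
      unfolding rep[symmetric] amp_def by (simp add: mult_ac)
  qed measurable
  finally show ?thesis .
qed

lemma qf_near_integral:
  "\<exists>C\<ge>0. \<forall>\<tau> c \<epsilon> \<Lambda>. 0 < \<epsilon> \<longrightarrow> \<epsilon> \<le> e0 \<longrightarrow> near \<tau> c \<longrightarrow> 0 < \<Lambda> \<longrightarrow>
    integral {c - pi / 4..c + pi / 4} (\<lambda>t. (cmod (qf \<theta> N \<tau> \<epsilon> \<Lambda> t))\<^sup>2) \<le> C / ((\<epsilon> * \<Lambda>) ^ (2 * m) * \<Lambda>)"
proof -
  obtain K where K: "K \<ge> 0" "\<And>\<tau> c \<epsilon> \<Lambda>. 0 < \<epsilon> \<Longrightarrow> \<epsilon> \<le> e0 \<Longrightarrow> near \<tau> c \<Longrightarrow> 0 < \<Lambda> \<Longrightarrow>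
    (\<integral>t. chi t * (cmod (Z F m N \<tau> \<epsilon> \<Lambda> (c + t)))\<^sup>2 \<partial>sector) \<le> K / \<Lambda>" using Z_square_bound[OF F] by blast
  obtain B where B: "B \<ge> 0" "\<And>\<tau> \<epsilon> \<Lambda> t. cmod (qf \<theta> N \<tau> \<epsilon> \<Lambda> t) \<le> B" using qf_bound by blast
  \<comment> \<open>The value of \<open>chi\<close> at the ends of the inner cone is at least this,
    because pi/3 - pi/4 = pi/12; so the smooth mean dominates \<open>c0\<close> times the plain mean
    over [-pi/4, pi/4].\<close>
  define c0 where "c0 = ((pi / 12) * (pi / 12)) ^ 2"
  have c0: "c0 > 0" by (simp add: c0_def)
  have chi: "c0 \<le> chi t" if "t \<in> {- (pi / 4)..pi / 4}" for t
    unfolding c0_def chi_def using that by (intro power_mono mult_mono) auto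
  let ?B2 = "((2 * pi / 3) * (2 * pi / 3)) ^ 2"
  show ?thesis
  proof (intro exI[of _ "K / c0"] conjI allI impI)
    show "0 \<le> K / c0" using K c0 by simp
    fix \<tau> c \<epsilon> \<Lambda> :: real
    assume a: "0 < \<epsilon>" "\<epsilon> \<le> e0" "near \<tau> c" "0 < \<Lambda>"
    let ?Y = "\<lambda>t. (cmod (qf \<theta> N \<tau> \<epsilon> \<Lambda> (c + t)))\<^sup>2"
    let ?e = "(\<epsilon> * \<Lambda>) ^ (2 * m)"
    have e: "?e > 0" using a by simp
    have Y: "?Y t \<le> B\<^sup>2" for t using B by (intro power_mono) auto
    have cY: "\<bar>chi t * ?Y t\<bar> \<le> ?B2 * B\<^sup>2" if "t \<in> {- (pi / 3)..pi / 3}" for t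
      unfolding abs_mult using Y chi_bound[OF that] chi_nonneg by (intro mult_mono) auto
    have ZY: "chi t * (cmod (Z F m N \<tau> \<epsilon> \<Lambda> (c + t)))\<^sup>2 = ?e * (chi t * ?Y t)" if "t \<in> {- (pi / 3)..pi / 3}" for t
      unfolding qf_near[OF a(3) that, symmetric] norm_mult norm_power power_mult_distrib
      using a by (simp add: power_mult[symmetric] mult.commute[of m 2] power_mult_distrib norm_mult)
    have i3: "(\<lambda>t. chi t * ?Y t) integrable_on {- (pi / 3)..pi / 3}"
      by (rule leb_eq_integral(1)[of _ _ _ "?B2 * B\<^sup>2"]) (use cY in auto)
    have i4: "(\<lambda>t. chi t * ?Y t) integrable_on {- (pi / 4)..pi / 4}"
      by (rule integrable_subinterval_real[OF i3]) auto
    have e1: "integral {c - pi / 4..c + pi / 4} (\<lambda>t. (cmod (qf \<theta> N \<tau> \<epsilon> \<Lambda> t))\<^sup>2) = integral {- (pi / 4)..pi / 4} ?Y"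
      using integral_shift_Icc_real[of "- (pi / 4)" "pi / 4" "\<lambda>t. (cmod (qf \<theta> N \<tau> \<epsilon> \<Lambda> t))\<^sup>2" c] by (simp add: o_def algebra_simps)
    have e2: "integral {- (pi / 4)..pi / 4} (\<lambda>t. c0 * ?Y t) = c0 * integral {- (pi / 4)..pi / 4} ?Y" by simp
    have "integral {- (pi / 4)..pi / 4} (\<lambda>t. c0 * ?Y t) \<le> integral {- (pi / 4)..pi / 4} (\<lambda>t. chi t * ?Y t)"
    proof (rule integral_le)
      show "(\<lambda>t. c0 * ?Y t) integrable_on {- (pi / 4)..pi / 4}"
        using Y c0 by (intro leb_eq_integral(1)[of _ _ _ "c0 * B\<^sup>2"]) auto
      show "(\<lambda>t. chi t * ?Y t) integrable_on {- (pi / 4)..pi / 4}" by (rule i4)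
    qed (use chi in \<open>auto intro!: mult_right_mono\<close>)
    also have "integral {- (pi / 4)..pi / 4} (\<lambda>t. chi t * ?Y t) \<le> integral {- (pi / 3)..pi / 3} (\<lambda>t. chi t * ?Y t)"
      by (rule integral_subset_le[OF _ i4 i3]) (auto simp: chi_nonneg)
    also have "\<dots> = (\<integral>t. chi t * ?Y t \<partial>sector)"
      unfolding sector_def using cY by (intro leb_eq_integral(2)[of _ _ _ "?B2 * B\<^sup>2", symmetric]) auto
    also have "\<dots> = (\<integral>t. chi t * (cmod (Z F m N \<tau> \<epsilon> \<Lambda> (c + t)))\<^sup>2 \<partial>sector) / ?e"
    proof -
      have "(\<integral>t. chi t * (cmod (Z F m N \<tau> \<epsilon> \<Lambda> (c + t)))\<^sup>2 \<partial>sector) = (\<integral>t. ?e * (chi t * ?Y t) \<partial>sector)"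
        unfolding sector_def by (rule leb_cong) (use ZY in auto)
      then show ?thesis using a by simp
    qed
    also have "\<dots> \<le> (K / \<Lambda>) / ?e"
      using K(2)[OF a] e by (intro divide_right_mono) auto
    finally have "c0 * integral {- (pi / 4)..pi / 4} ?Y \<le> K / \<Lambda> / ?e" unfolding e2 .
    then have "integral {- (pi / 4)..pi / 4} ?Y \<le> K / \<Lambda> / ?e / c0"
      using c0 by (simp only: pos_le_divide_eq mult.commute)
    then show "integral {c - pi / 4..c + pi / 4} (\<lambda>t. (cmod (qf \<theta> N \<tau> \<epsilon> \<Lambda> t))\<^sup>2) \<le> K / c0 / (?e * \<Lambda>)"
      unfolding e1 by (simp add: mult_ac)
  qed
qed

lemma qf_far:
  "\<exists>C\<ge>0. \<forall>\<tau> \<epsilon> t \<Lambda>. 0 < \<epsilon> \<longrightarrow> \<epsilon> \<le> e0 \<longrightarrow> (nd \<tau> t)\<^sup>2 \<le> 1 / 2 \<longrightarrow> 0 < \<Lambda> \<longrightarrow> cmod (qf \<theta> N \<tau> \<epsilon> \<Lambda> t) \<le> C / \<Lambda> ^ N"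
proof -
  obtain C where C: "C \<ge> 0" "\<And>\<tau> \<sigma> \<theta> \<Lambda>. \<bar>\<sigma>\<bar> \<le> e0 \<Longrightarrow> (nd \<tau> \<theta>)\<^sup>2 \<le> 1 / 2 \<Longrightarrow> 0 < \<Lambda> \<Longrightarrow>
    cmod (\<integral>u. of_real (W N \<tau> u) * cis (\<Lambda> * Ph \<sigma> (\<tau> + u) \<theta>) \<partial>leb (- d) d) \<le> C / \<Lambda> ^ N" using far_bound by blast
  have "cmod (qf \<theta> N \<tau> \<epsilon> \<Lambda> t) \<le> (T * (C / \<Lambda> ^ N)) * (1 - (-1))"
    if a: "0 < \<epsilon>" "\<epsilon> \<le> e0" "(nd \<tau> t)\<^sup>2 \<le> 1 / 2" "0 < \<Lambda>" for \<tau> \<epsilon> t \<Lambda>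
    unfolding qf_def
  proof (rule norm_leb_le)
    fix s :: real assume "s \<in> {-1..1}"
    then have "\<bar>\<epsilon> * s\<bar> \<le> e0" using a mult_mono[of \<epsilon> e0 "\<bar>s\<bar>" 1] by (simp add: abs_mult abs_le_iff)
    then show "cmod (of_real (\<theta> s) * (\<integral>u. of_real (W N \<tau> u) * cis (\<Lambda> * Ph (\<epsilon> * s) (\<tau> + u) t) \<partial>leb (- d) d)) \<le> T * (C / \<Lambda> ^ N)"
      unfolding norm_mult using T T_nonneg C a by (intro mult_mono) auto
  qed (use C T_nonneg a in auto)
  then show ?thesis using C T_nonneg by (intro exI[of _ "2 * (T * C)"]) (auto simp: mult_ac)
qed

text \<open>The circle splits into four quarter arcs: two centred at the normal and its opposite,
  where \<open>qf_near_integral\<close> applies, and two around the tangential directions, where the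
  decay \<Lambda>^(-N) along the curve holds. With N = m + 1 the square of the latter is
  \<Lambda>^(-2m-2), which suffices.\<close>

lemma qf_integral:
  "\<exists>C\<ge>0. \<forall>\<tau> \<epsilon> \<Lambda>. 0 < \<epsilon> \<longrightarrow> \<epsilon> \<le> e0 \<longrightarrow> 1 \<le> \<Lambda> \<longrightarrow>
    integral {0..2 * pi} (\<lambda>t. (cmod (qf \<theta> (m + 1) \<tau> \<epsilon> \<Lambda> t))\<^sup>2) \<le> C / ((\<epsilon> * \<Lambda>) ^ (2 * m) * \<Lambda>)"
proof -
  let ?N = "m + 1"
  obtain K where K: "K \<ge> 0" "\<And>\<tau> c \<epsilon> \<Lambda>. 0 < \<epsilon> \<Longrightarrow> \<epsilon> \<le> e0 \<Longrightarrow> near \<tau> c \<Longrightarrow> 0 < \<Lambda> \<Longrightarrow>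
    integral {c - pi / 4..c + pi / 4} (\<lambda>t. (cmod (qf \<theta> ?N \<tau> \<epsilon> \<Lambda> t))\<^sup>2) \<le> K / ((\<epsilon> * \<Lambda>) ^ (2 * m) * \<Lambda>)"
    using qf_near_integral by blast
  obtain J where J: "J \<ge> 0" "\<And>\<tau> \<epsilon> t \<Lambda>. 0 < \<epsilon> \<Longrightarrow> \<epsilon> \<le> e0 \<Longrightarrow> (nd \<tau> t)\<^sup>2 \<le> 1 / 2 \<Longrightarrow> 0 < \<Lambda> \<Longrightarrow> cmod (qf \<theta> ?N \<tau> \<epsilon> \<Lambda> t) \<le> J / \<Lambda> ^ ?N"
    using qf_far by blast
  obtain B where B: "B \<ge> 0" "\<And>\<tau> \<epsilon> \<Lambda> t. cmod (qf \<theta> ?N \<tau> \<epsilon> \<Lambda> t) \<le> B" using qf_bound by blast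
  define C where "C = 2 * K + 2 * (J\<^sup>2 * e0 ^ (2 * m) * (pi / 2))"
  show ?thesis
  proof (intro exI[of _ C] conjI allI impI)
    show "0 \<le> C" using K J e0 by (simp add: C_def)
    fix \<tau> \<epsilon> \<Lambda> :: real
    assume a: "0 < \<epsilon>" "\<epsilon> \<le> e0" "1 \<le> \<Lambda>"
    let ?Y = "\<lambda>t. (cmod (qf \<theta> ?N \<tau> \<epsilon> \<Lambda> t))\<^sup>2"
    let ?E = "(\<epsilon> * \<Lambda>) ^ (2 * m) * \<Lambda>"
    have E: "?E > 0" using a by simp
    have YB: "?Y t \<le> B\<^sup>2" for t using B by (intro power_mono) auto
    have Yi: "?Y integrable_on {p..r}" for p r
      using YB by (intro leb_eq_integral(1)[of _ _ _ "B\<^sup>2"]) auto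
    obtain c where c: "nx \<tau> = cos c" "ny \<tau> = sin c"
      using sincos_total_2pi[OF unit[of \<tau>]] by metis
    have nd: "nd \<tau> (c + t) = cos t" "nd \<tau> (c + pi + t) = - cos t" for t
    proof -
      have nt: "nd \<tau> (c + t) = cos t" for t using cos_diff[of "c + t" c] by (simp add: nd_def c mult.commute)
      from nt[of t] nt[of "pi + t"] show "nd \<tau> (c + t) = cos t" "nd \<tau> (c + pi + t) = - cos t" by (simp_all add: add.assoc)
    qed
    have cos3: "1 / 2 \<le> \<bar>cos t\<bar>" if "t \<in> {- (pi / 3)..pi / 3}" for t :: real
    proof -
      have "cos (pi / 3) \<le> cos \<bar>t\<bar>" using that by (intro cos_monotone_0_pi_le) auto
      then show ?thesis by (simp add: cos_60)
    qed
    have near: "near \<tau> c" "near \<tau> (c + pi)" using cos3 by (auto simp: near_def nd)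
    have cos2: "(cos t)\<^sup>2 \<le> 1 / 2" if "t \<in> {pi / 4..3 * pi / 4}" for t :: real
    proof -
      have "0 \<le> cos (pi - 2 * t)" using that by (intro cos_ge_zero) auto
      then show ?thesis by (simp add: cos_double_cos)
    qed
    have far: "?Y r \<le> J\<^sup>2 * e0 ^ (2 * m) / ?E" if "(nd \<tau> r)\<^sup>2 \<le> 1 / 2" for r
    proof -
      have "?Y r \<le> (J / \<Lambda> ^ ?N)\<^sup>2" using J(2)[OF a(1,2) that] a(3) by (intro power_mono) auto
      also have "\<dots> = J\<^sup>2 * (1 / \<Lambda> ^ (2 * m + 2))"
      proof -
        have "(\<Lambda> ^ ?N)\<^sup>2 = \<Lambda> ^ (?N * 2)" by (rule power_mult[symmetric])
        moreover have "?N * 2 = 2 * m + 2" by simp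
        ultimately show ?thesis by (simp only: power_divide) simp
      qed
      \<comment> \<open>The nonstationary bound has no factor \<epsilon>^(-2m); it is inserted by
        \<epsilon> \<le> e0, and one of the two spare powers of \<Lambda> is discarded by \<Lambda>
        \<ge> 1.\<close>
      also have "1 / \<Lambda> ^ (2 * m + 2) \<le> e0 ^ (2 * m) / ?E"
      proof -
        have "\<epsilon> ^ (2 * m) * (\<Lambda> ^ (2 * m) * \<Lambda>) \<le> e0 ^ (2 * m) * (\<Lambda> ^ (2 * m) * \<Lambda> ^ 2)"
          using a power_increasing[of 1 2 \<Lambda>] by (intro mult_mono power_mono) auto
        then show ?thesis using E a by (simp add: field_simps power_add power2_eq_square)
      qed
      finally show ?thesis using mult_left_mono[of _ _ "J\<^sup>2"] by simp
    qed
    have per: "?Y (t + 2 * pi) = ?Y t" for t by (simp add: qf_def Ph_periodic)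
    have comb: "integral {p..r} ?Y + integral {r..s} ?Y = integral {p..s} ?Y" if "p \<le> r" "r \<le> s" for p r s
      using that Yi by (intro Henstock_Kurzweil_Integration.integral_combine) auto
    have farint: "integral {p..r} ?Y \<le> J\<^sup>2 * e0 ^ (2 * m) / ?E * (r - p)"
      if "p \<le> r" "\<And>t. t \<in> {p..r} \<Longrightarrow> (nd \<tau> t)\<^sup>2 \<le> 1 / 2" for p r
    proof -
      have "integral {p..r} ?Y \<le> integral {p..r} (\<lambda>_. J\<^sup>2 * e0 ^ (2 * m) / ?E)"
        using Yi far that by (intro integral_le) auto
      then show ?thesis using that(1) by (simp add: mult_ac)
    qed
    have f1: "integral {c + pi / 4..c + 3 * pi / 4} ?Y \<le> J\<^sup>2 * e0 ^ (2 * m) / ?E * ((c + 3 * pi / 4) - (c + pi / 4))"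
    proof (rule farint)
      fix t assume "t \<in> {c + pi / 4..c + 3 * pi / 4}"
      then show "(nd \<tau> t)\<^sup>2 \<le> 1 / 2" using cos2[of "t - c"] nd(1)[of "t - c"] by simp
    qed simp
    have f2: "integral {c + 5 * pi / 4..c + 7 * pi / 4} ?Y \<le> J\<^sup>2 * e0 ^ (2 * m) / ?E * ((c + 7 * pi / 4) - (c + 5 * pi / 4))"
    proof (rule farint)
      fix t assume "t \<in> {c + 5 * pi / 4..c + 7 * pi / 4}"
      then show "(nd \<tau> t)\<^sup>2 \<le> 1 / 2" using cos2[of "t - c - pi"] nd(2)[of "t - c - pi"] by simp
    qed simp
    have n1: "integral {c - pi / 4..c + pi / 4} ?Y \<le> K / ?E" using K(2)[OF a(1,2) near(1)] a by simp
    have n2: "integral {c + 3 * pi / 4..c + 5 * pi / 4} ?Y \<le> K / ?E"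
      using K(2)[OF a(1,2) near(2)] a by (simp add: algebra_simps)
    have "integral {0..2 * pi} ?Y = integral {c - pi / 4..(c - pi / 4) + 2 * pi} ?Y"
      using integral_periodic_shift[of ?Y "2 * pi" "c - pi / 4"] Yi per by simp
    also have "(c - pi / 4) + 2 * pi = c + 7 * pi / 4" by simp
    also have "integral {c - pi / 4..c + 7 * pi / 4} ?Y = integral {c - pi / 4..c + pi / 4} ?Y + (integral {c + pi / 4..c + 3 * pi / 4} ?Y
       + (integral {c + 3 * pi / 4..c + 5 * pi / 4} ?Y + integral {c + 5 * pi / 4..c + 7 * pi / 4} ?Y))"
      by (subst comb, simp, simp)+ simp
    also have "\<dots> \<le> K / ?E + (J\<^sup>2 * e0 ^ (2 * m) / ?E * (pi / 2) + (K / ?E + J\<^sup>2 * e0 ^ (2 * m) / ?E * (pi / 2)))"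
      using n1 n2 f1 f2 by (intro add_mono) (simp_all add: algebra_simps)
    also have "\<dots> = C / ?E" by (simp add: C_def add_divide_distrib mult_ac)
    finally show "integral {0..2 * pi} ?Y \<le> C / ?E" .
  qed
qed

lemma bump_integral_pos: "0 < (\<integral>u. bump N u \<partial>leb (- d) d)"
proof -
  have c: "continuous_on {-d..d} (bump N)" unfolding bump_def by (intro continuous_intros)
  have nn: "0 \<le> bump N u" if "u \<in> {-d..d}" for u unfolding bump_def using that by auto
  have b: "\<bar>bump N u\<bar> \<le> ((2 * d) * (2 * d)) ^ N" if "u \<in> {-d..d}" for u
    using that unfolding bump_def power_abs abs_mult by (intro power_mono mult_mono) auto
  have e: "(\<integral>u. bump N u \<partial>leb (- d) d) = integral {-d..d} (bump N)"
    using b by (intro leb_eq_integral(2)[of _ _ _ "((2 * d) * (2 * d)) ^ N"]) auto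
  have "integral {-d..d} (bump N) \<noteq> 0"
    using integral_eq_0_iff[OF c] nn d(1) by (auto intro!: bexI[of _ 0] simp: bump_def)
  moreover have "0 \<le> integral {-d..d} (bump N)" using nn by (intro integral_nonneg integrable_continuous_real c)
  ultimately show ?thesis unfolding e by simp
qed

text \<open>Takes the place of a partition of unity: windows are centred at every point of one
  period, and by periodicity each point of the curve is weighted equally, namely by the integral of
  the bump.\<close>

lemma Qh_average:
  "of_real (\<integral>u. bump N u \<partial>leb (- d) d) * Qh \<theta> \<epsilon> \<Lambda> t = (\<integral>\<tau>. qf \<theta> N \<tau> \<epsilon> \<Lambda> t \<partial>leb 0 1)"
proof -
  let ?D = "leb (- d) d"
  obtain Fb where Fb: "\<And>t. \<bar>f t\<bar> \<le> Fb" using smooth_bdd_bound smooth by blast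
  then have Fb0: "Fb \<ge> 0" using order_trans[OF abs_ge_zero] by blast
  obtain M where M: "M \<ge> 0" "\<And>\<tau> u. u \<in> {-d..d} \<Longrightarrow> \<bar>W N \<tau> u\<bar> \<le> M" using W_bound by blast
  define g where "g s u = of_real (f u) * cis (\<Lambda> * Ph (\<epsilon> * s) u t)" for s u
  have gm [measurable]: "(\<lambda>p. g (h1 p) (h2 p)) \<in> borel_measurable MM"
    if [measurable]: "h1 \<in> borel_measurable MM" "h2 \<in> borel_measurable MM" for h1 h2 and MM :: "'z measure"
    unfolding g_def by measurable
  have gper: "g s (u + 1) = g s u" for s u by (simp add: g_def Ph_def per)
  have gb: "cmod (g s u) \<le> Fb" for s u using Fb by (simp add: g_def norm_mult)
  have Wg: "of_real (W N \<tau> u) * cis (\<Lambda> * Ph (\<epsilon> * s) (\<tau> + u) t) = of_real (bump N u) * g s (\<tau> + u)" for \<tau> u s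
    by (simp add: W_def g_def mult_ac)
  have Wgb: "cmod (of_real (bump N u) * g s (\<tau> + u)) \<le> M" if "u \<in> {-d..d}" for u \<tau> s
    unfolding Wg[symmetric] using M that by (simp add: norm_mult)
  have gm1: "g s \<in> borel_measurable borel" for s unfolding g_def by measurable
  have sh: "(\<integral>\<tau>. g s (u + \<tau>) \<partial>leb 0 1) = (\<integral>\<tau>. g s \<tau> \<partial>leb 0 1)" for s u
    using leb_periodic_shift[of "g s" Fb 1, where c=u and a=0] gb gper gm1 by simp
  have inner: "(\<integral>\<tau>. (\<integral>u. of_real (bump N u) * g s (\<tau> + u) \<partial>?D) \<partial>leb 0 1) = of_real (\<integral>u. bump N u \<partial>?D) * (\<integral>\<tau>. g s \<tau> \<partial>leb 0 1)" for s
  proof -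
    have "(\<integral>\<tau>. (\<integral>u. of_real (bump N u) * g s (\<tau> + u) \<partial>?D) \<partial>leb 0 1) = (\<integral>u. (\<integral>\<tau>. of_real (bump N u) * g s (\<tau> + u) \<partial>leb 0 1) \<partial>?D)"
      by (rule leb_swap[where C = M]) (use Wgb in \<open>auto simp: case_prod_beta' g_def\<close>)
    also have "\<dots> = (\<integral>u. of_real (bump N u) * (\<integral>\<tau>. g s \<tau> \<partial>leb 0 1) \<partial>?D)"
      using sh by (simp add: add.commute)
    also have "\<dots> = (\<integral>u. complex_of_real (bump N u) \<partial>?D) * (\<integral>\<tau>. g s \<tau> \<partial>leb 0 1)"
      by (rule integral_mult_left_zero)
    finally show ?thesis by simp
  qed
  have "(\<integral>\<tau>. qf \<theta> N \<tau> \<epsilon> \<Lambda> t \<partial>leb 0 1) = (\<integral>s. (\<integral>\<tau>. of_real (\<theta> s) * (\<integral>u. of_real (bump N u) * g s (\<tau> + u) \<partial>?D) \<partial>leb 0 1) \<partial>leb (-1) 1)"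
    unfolding qf_def Wg
  proof (rule leb_swap[where C = "T * (M * (d - - d))"])
    show "cmod (of_real (\<theta> s) * (\<integral>u. of_real (bump N u) * g s (\<tau> + u) \<partial>?D)) \<le> T * (M * (d - - d))" for \<tau> s
      unfolding norm_mult using T T_nonneg M d(1) Wgb by (intro mult_mono norm_leb_le) auto
    show "(\<lambda>(\<tau>, s). of_real (\<theta> s) * (\<integral>u. of_real (bump N u) * g s (\<tau> + u) \<partial>?D)) \<in> borel_measurable (borel \<Otimes>\<^sub>M borel)"
      unfolding case_prod_beta' g_def by measurable
  qed
  also have "\<dots> = (\<integral>s. of_real (\<integral>u. bump N u \<partial>?D) * (of_real (\<theta> s) * (\<integral>\<tau>. g s \<tau> \<partial>leb 0 1)) \<partial>leb (-1) 1)"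
    by (intro arg_cong[where f = "integral\<^sup>L _"] ext) (simp only: integral_mult_right_zero inner mult.left_commute)
  also have "\<dots> = of_real (\<integral>u. bump N u \<partial>?D) * Qh \<theta> \<epsilon> \<Lambda> t"
    unfolding integral_mult_right_zero Qh_def g_def ..
  finally show ?thesis ..
qed

text \<open>Cauchy-Schwarz in the base point bounds the square of the average by the average of the
  squares; the window estimate is uniform in the base point, so it survives the average.\<close>

lemma Qh_circle_bound:
  "\<exists>C\<ge>0. \<forall>\<epsilon> \<Lambda>. 0 < \<epsilon> \<longrightarrow> \<epsilon> \<le> e0 \<longrightarrow> 1 \<le> \<Lambda> \<longrightarrow>
    (\<integral>t. (cmod (Qh \<theta> \<epsilon> \<Lambda> t))\<^sup>2 \<partial>leb 0 (2 * pi)) \<le> C / ((\<epsilon> * \<Lambda>) ^ (2 * m) * \<Lambda>)"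
proof -
  let ?N = "m + 1"
  define b where "b = (\<integral>u. bump ?N u \<partial>leb (- d) d)"
  have b: "b > 0" unfolding b_def by (rule bump_integral_pos)
  obtain C where C: "C \<ge> 0" "\<And>\<tau> \<epsilon> \<Lambda>. 0 < \<epsilon> \<Longrightarrow> \<epsilon> \<le> e0 \<Longrightarrow> 1 \<le> \<Lambda> \<Longrightarrow>
    integral {0..2 * pi} (\<lambda>t. (cmod (qf \<theta> ?N \<tau> \<epsilon> \<Lambda> t))\<^sup>2) \<le> C / ((\<epsilon> * \<Lambda>) ^ (2 * m) * \<Lambda>)"
    using qf_integral by blast
  obtain B where B: "B \<ge> 0" "\<And>\<tau> \<epsilon> \<Lambda> t. cmod (qf \<theta> ?N \<tau> \<epsilon> \<Lambda> t) \<le> B" using qf_bound by blast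
  have "(\<integral>t. (cmod (Qh \<theta> \<epsilon> \<Lambda> t))\<^sup>2 \<partial>leb 0 (2 * pi)) \<le> (C / b\<^sup>2) / ((\<epsilon> * \<Lambda>) ^ (2 * m) * \<Lambda>)"
    if a: "0 < \<epsilon>" "\<epsilon> \<le> e0" "1 \<le> \<Lambda>" for \<epsilon> \<Lambda>
  proof -
    let ?E = "(\<epsilon> * \<Lambda>) ^ (2 * m) * \<Lambda>"
    let ?q = "\<lambda>\<tau> t. (cmod (qf \<theta> ?N \<tau> \<epsilon> \<Lambda> t))\<^sup>2"
    have E: "?E > 0" using a by simp
    have qB: "?q \<tau> t \<le> B\<^sup>2" for \<tau> t using B by (intro power_mono) auto
    have Q: "Qh \<theta> \<epsilon> \<Lambda> t = (\<integral>\<tau>. qf \<theta> ?N \<tau> \<epsilon> \<Lambda> t \<partial>leb 0 1) / of_real b" for t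
      using Qh_average[of ?N \<epsilon> \<Lambda> t] b unfolding b_def[symmetric] by (auto simp: field_simps)
    have pw: "(cmod (Qh \<theta> \<epsilon> \<Lambda> t))\<^sup>2 \<le> (\<integral>\<tau>. ?q \<tau> t \<partial>leb 0 1) / b\<^sup>2" for t
    proof -
      have "(cmod (\<integral>\<tau>. qf \<theta> ?N \<tau> \<epsilon> \<Lambda> t \<partial>leb 0 1))\<^sup>2 \<le> (1 - 0) * (\<integral>\<tau>. ?q \<tau> t \<partial>leb 0 1)"
        using B by (intro leb_Cauchy_Schwarz[of _ _ _ B]) auto
      then show ?thesis using b unfolding Q norm_divide power_divide by (simp add: divide_right_mono)
    qed
    have nq: "norm (\<integral>\<tau>. ?q \<tau> t \<partial>leb 0 1) \<le> B\<^sup>2 * (1 - 0)" for t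
      using qB by (intro norm_leb_le) auto
    have "(\<integral>t. (cmod (Qh \<theta> \<epsilon> \<Lambda> t))\<^sup>2 \<partial>leb 0 (2 * pi)) \<le> (\<integral>t. (\<integral>\<tau>. ?q \<tau> t \<partial>leb 0 1) / b\<^sup>2 \<partial>leb 0 (2 * pi))"
    proof (rule leb_mono)
      show i: "integrable (leb 0 (2 * pi)) (\<lambda>t. (\<integral>\<tau>. ?q \<tau> t \<partial>leb 0 1) / b\<^sup>2)"
        using nq by (intro integrable_divide_zero integrable_leb[of _ _ _ "B\<^sup>2 * (1 - 0)"]) auto
      show "integrable (leb 0 (2 * pi)) (\<lambda>t. (cmod (Qh \<theta> \<epsilon> \<Lambda> t))\<^sup>2)"
        by (rule Bochner_Integration.integrable_bound[OF i]) (use pw in \<open>auto intro!: AE_I2 intro: order_trans[OF _ abs_ge_self]\<close>)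
    qed (rule pw)
    also have "\<dots> = (\<integral>\<tau>. (\<integral>t. ?q \<tau> t \<partial>leb 0 (2 * pi)) \<partial>leb 0 1) / b\<^sup>2"
      unfolding integral_divide_zero
      by (subst leb_swap[where C = "B\<^sup>2"]) (use qB in \<open>auto simp: case_prod_beta'\<close>)
    also have "(\<integral>\<tau>. (\<integral>t. ?q \<tau> t \<partial>leb 0 (2 * pi)) \<partial>leb 0 1) \<le> C / ?E * (1 - 0)"
    proof -
      have "norm (\<integral>t. ?q \<tau> t \<partial>leb 0 (2 * pi)) \<le> C / ?E" for \<tau>
      proof -
        have "(\<integral>t. ?q \<tau> t \<partial>leb 0 (2 * pi)) = integral {0..2 * pi} (?q \<tau>)"
          using qB by (intro leb_eq_integral(2)[of _ _ _ "B\<^sup>2"]) auto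
        moreover have "0 \<le> (\<integral>t. ?q \<tau> t \<partial>leb 0 (2 * pi))" by (intro integral_nonneg_AE) auto
        ultimately show ?thesis using C(2)[OF a] by simp
      qed
      then have "norm (\<integral>\<tau>. (\<integral>t. ?q \<tau> t \<partial>leb 0 (2 * pi)) \<partial>leb 0 1) \<le> C / ?E * (1 - 0)"
        using C(1) E by (intro norm_leb_le) auto
      then show ?thesis by simp
    qed
    finally show ?thesis by (simp add: divide_right_mono mult.commute)
  qed
  then show ?thesis using C(1) by (intro exI[of _ "C / b\<^sup>2"]) auto
qed

end

end

section \<open>Fourier series on the unit square\<close>

definition vec2 :: "real \<Rightarrow> real \<Rightarrow> real^2" where "vec2 a b = (\<chi> i. if i = 1 then a else b)"

lemma vec2_nth [simp]: "vec2 a b $ 1 = a" "vec2 a b $ 2 = b"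
  by (simp_all add: vec2_def)

lemma vec2_eta [simp]: "vec2 (z $ 1) (z $ 2) = z"
  by (simp add: vec_eq_iff forall_2)

lemma vec2_eq_iff: "(z :: real^2) = w \<longleftrightarrow> z $ 1 = w $ 1 \<and> z $ 2 = w $ 2"
  by (simp add: vec_eq_iff forall_2)

lemma inner_2: "(z :: real^2) \<bullet> w = z $ 1 * w $ 1 + z $ 2 * w $ 2"
  by (simp add: inner_vec_def sum_2)

lemma continuous_on_vec2 [continuous_intros]:
  assumes "continuous_on S g" "continuous_on S h" shows "continuous_on S (\<lambda>p. vec2 (g p) (h p))"
  unfolding vec2_def
proof (intro continuous_on_vec_lambda)
  fix i :: 2 show "continuous_on S (\<lambda>p. if i = 1 then g p else h p)"
    using assms by (cases "i = 1") auto
qed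

lemma vec2_measurable [measurable]:
  assumes [measurable]: "g \<in> borel_measurable M" "h \<in> borel_measurable M"
  shows "(\<lambda>p. vec2 (g p) (h p)) \<in> borel_measurable M"
proof -
  have "continuous_on UNIV (\<lambda>p::real\<times>real. vec2 (fst p) (snd p))" by (intro continuous_intros)
  then have m: "(\<lambda>p. vec2 (fst p) (snd p)) \<in> borel_measurable (borel :: (real \<times> real) measure)"
    by (rule borel_measurable_continuous_onI)
  have "(\<lambda>p. (g p, h p)) \<in> borel_measurable M" by measurable
  from measurable_compose[OF this m] show ?thesis by simp
qed

lemma vec_nth_measurable [measurable]: "(\<lambda>z::real^2. z $ i) \<in> borel_measurable borel"
  by (intro borel_measurable_continuous_onI continuous_intros)

text \<open>Lebesgue measure is determined by its values on boxes. Through this identification,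
  integrals over the plane become iterated integrals.\<close>

lemma lborel_vec2: "distr (lborel \<Otimes>\<^sub>M lborel) borel (\<lambda>p. vec2 (fst p) (snd p)) = lborel"
proof (rule lborel_eqI[symmetric])
  fix l u :: "real^2" assume le: "\<And>b. b \<in> Basis \<Longrightarrow> l \<bullet> b \<le> u \<bullet> b"
  have lu: "l $ 1 \<le> u $ 1" "l $ 2 \<le> u $ 2"
    using le[of "axis 1 1"] le[of "axis 2 1"] by (auto simp: inner_axis axis_in_Basis_iff)
  have "(\<lambda>p. vec2 (fst p) (snd p)) -` box l u = {l $ 1<..<u $ 1} \<times> {l $ 2<..<u $ 2}"
    by (auto simp: mem_box_cart forall_2)
  then have "emeasure (distr (lborel \<Otimes>\<^sub>M lborel) borel (\<lambda>p. vec2 (fst p) (snd p))) (box l u) =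
     emeasure (lborel \<Otimes>\<^sub>M lborel) ({l $ 1<..<u $ 1} \<times> {l $ 2<..<u $ 2})"
    by (subst emeasure_distr) (auto simp: space_pair_measure)
  also have "\<dots> = ennreal (u $ 1 - l $ 1) * ennreal (u $ 2 - l $ 2)"
    using lu by (subst lborel.emeasure_pair_measure_Times) auto
  also have "\<dots> = ennreal ((u $ 1 - l $ 1) * (u $ 2 - l $ 2))"
    using lu by (simp add: ennreal_mult)
  also have "(u $ 1 - l $ 1) * (u $ 2 - l $ 2) = (\<Prod>b\<in>Basis. (u - l) \<bullet> b)"
    by (simp add: Basis_vec_def UNIV_2 axis_eq_axis inner_axis)
  finally show "emeasure (distr (lborel \<Otimes>\<^sub>M lborel) borel (\<lambda>p. vec2 (fst p) (snd p))) (box l u) = ennreal (\<Prod>b\<in>Basis. (u - l) \<bullet> b)"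
    by simp
qed simp

definition cube :: "(real^2) measure" where "cube = density lborel (indicator (cbox 0 1))"

lemma sets_cube [simp, measurable_cong]: "sets cube = sets borel"
  by (simp add: cube_def)
lemma space_cube [simp]: "space cube = UNIV"
  by (simp add: cube_def)

lemma rectangle_eq:
  "density lborel (indicator {z::real^2. z $ 1 \<in> {a..b} \<and> z $ 2 \<in> {c..d}}) =
     distr (leb a b \<Otimes>\<^sub>M leb c d) borel (\<lambda>p. vec2 (fst p) (snd p))" (is "density lborel (indicator ?R) = _")
proof (rule measure_eqI)
  fix A assume "A \<in> sets (density lborel (indicator ?R))"
  then have A [measurable]: "A \<in> sets borel" by simp
  have R [measurable]: "?R \<in> sets borel" by measurable
  have "emeasure (density lborel (indicator ?R)) A = (\<integral>\<^sup>+z. indicator ?R z * indicator A z \<partial>distr (lborel \<Otimes>\<^sub>M lborel) borel (\<lambda>p. vec2 (fst p) (snd p)))"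
    unfolding lborel_vec2 by (subst emeasure_density) auto
  also have "\<dots> = (\<integral>\<^sup>+p. indicator ?R (vec2 (fst p) (snd p)) * indicator A (vec2 (fst p) (snd p)) \<partial>(lborel \<Otimes>\<^sub>M lborel))"
    by (subst nn_integral_distr) auto
  also have "\<dots> = (\<integral>\<^sup>+x. (\<integral>\<^sup>+y. indicator {a..b} x * (indicator {c..d} y * indicator A (vec2 x y)) \<partial>lborel) \<partial>lborel)"
    by (subst lborel.nn_integral_fst[symmetric])
       (auto intro!: nn_integral_cong simp: indicator_def)
  also have "\<dots> = (\<integral>\<^sup>+x. indicator {a..b} x * (\<integral>\<^sup>+y. indicator {c..d} y * indicator A (vec2 x y) \<partial>lborel) \<partial>lborel)"
    by (intro nn_integral_cong) (simp add: nn_integral_cmult)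
  also have "\<dots> = (\<integral>\<^sup>+x. (\<integral>\<^sup>+y. indicator A (vec2 x y) \<partial>leb c d) \<partial>leb a b)"
    unfolding leb_def by (simp add: nn_integral_density)
  also have "\<dots> = (\<integral>\<^sup>+p. indicator A (vec2 (fst p) (snd p)) \<partial>(leb a b \<Otimes>\<^sub>M leb c d))"
    by (subst leb.nn_integral_fst[symmetric]) auto
  also have "\<dots> = (\<integral>\<^sup>+z. indicator A z \<partial>distr (leb a b \<Otimes>\<^sub>M leb c d) borel (\<lambda>p. vec2 (fst p) (snd p)))"
    by (rule nn_integral_distr[symmetric]) auto
  also have "\<dots> = emeasure (distr (leb a b \<Otimes>\<^sub>M leb c d) borel (\<lambda>p. vec2 (fst p) (snd p))) A"
    by (rule nn_integral_indicator) simp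
  finally show "emeasure (density lborel (indicator ?R)) A = emeasure (distr (leb a b \<Otimes>\<^sub>M leb c d) borel (\<lambda>p. vec2 (fst p) (snd p))) A" .
qed simp

lemma integral_rectangle:
  fixes f :: "real^2 \<Rightarrow> complex"
  assumes [measurable]: "f \<in> borel_measurable borel" and b: "\<And>s t. s \<in> {a..b} \<Longrightarrow> t \<in> {c..d} \<Longrightarrow> cmod (f (vec2 s t)) \<le> C"
  shows "(\<integral>z. f z \<partial>density lborel (indicator {z::real^2. z $ 1 \<in> {a..b} \<and> z $ 2 \<in> {c..d}})) = (\<integral>s. (\<integral>t. f (vec2 s t) \<partial>leb c d) \<partial>leb a b)"
proof -
  have "integrable (leb a b \<Otimes>\<^sub>M leb c d) (\<lambda>p. f (vec2 (fst p) (snd p)))"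
    by (rule integrable_leb2[of _ _ _ _ _ C]) (auto intro!: b)
  from leb2.integral_fst'[OF this] show ?thesis
    unfolding rectangle_eq by (subst integral_distr) auto
qed

lemma cube_alt: "cube = density lborel (indicator {z::real^2. z $ 1 \<in> {0..1} \<and> z $ 2 \<in> {0..1}})"
proof -
  have "cbox 0 1 = {z::real^2. z $ 1 \<in> {0..1} \<and> z $ 2 \<in> {0..1}}" by (auto simp: mem_box_cart forall_2)
  then show ?thesis by (simp add: cube_def)
qed

lemma prob_space_cube: "prob_space cube"
proof
  have "emeasure cube UNIV = emeasure (lborel :: (real^2) measure) (cbox 0 1)"
    unfolding cube_def by (subst emeasure_density) auto
  also have "\<dots> = 1"
    by (subst emeasure_lborel_cbox) (auto simp: Basis_vec_def UNIV_2 axis_eq_axis inner_axis)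
  finally show "emeasure cube (space cube) = 1" by simp
qed

interpretation cube: prob_space cube by (rule prob_space_cube)

lemma integral_cube:
  fixes f :: "real^2 \<Rightarrow> complex"
  assumes "f \<in> borel_measurable borel" and b: "\<And>z. z \<in> cbox 0 1 \<Longrightarrow> cmod (f z) \<le> C"
  shows "(\<integral>z. f z \<partial>cube) = (\<integral>a. (\<integral>b. f (vec2 a b) \<partial>leb 0 1) \<partial>leb 0 1)"
  unfolding cube_alt by (rule integral_rectangle[OF assms(1), of _ _ _ _ C]) (auto intro!: b simp: mem_box_cart forall_2)

lemma AE_cube: "AE z in cube. z \<in> box 0 1"
proof -
  have "AE z in lborel. (z::real^2) \<notin> cbox 0 1 - box 0 1"
    using negligible_frontier_interval[of "0::real^2" 1] by (intro AE_not_in) (simp add: negligible_iff_null_sets null_sets_completion_iff)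
  then show ?thesis unfolding cube_def
    by (subst AE_density) (auto simp: indicator_def elim!: eventually_mono)
qed

lemma integrable_cube:
  fixes f :: "real^2 \<Rightarrow> 'a::{banach,second_countable_topology}"
  assumes "f \<in> borel_measurable borel" "\<And>z. z \<in> cbox 0 1 \<Longrightarrow> norm (f z) \<le> C"
  shows "integrable cube f"
  using AE_cube assms box_subset_cbox[of 0 "1::real^2"]
  by (intro cube.integrable_const_bound[of f C]) (auto elim!: eventually_mono)

section \<open>Characters, density of trigonometric polynomials, and Parseval\<close>

definition chr :: "int \<times> int \<Rightarrow> real^2 \<Rightarrow> complex" where
  "chr k z = cis (2 * pi * (of_int (fst k) * z $ 1 + of_int (snd k) * z $ 2))"

lemma chr_meas [measurable]: "chr k \<in> borel_measurable borel"
  unfolding chr_def[abs_def] by measurable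

lemma cmod_chr [simp]: "cmod (chr k z) = 1"
  by (simp add: chr_def)

lemma chr_mult: "chr k z * chr l z = chr (k + l) z"
  by (simp add: chr_def cis_mult algebra_simps)

lemma chr_mult_cnj: "chr k z * cnj (chr l z) = chr (k - l) z"
  by (simp add: chr_def cis_cnj cis_mult algebra_simps)

lemma integral_cis_int: "(\<integral>x. cis (2 * pi * (of_int n * x)) \<partial>leb 0 1) = (if n = 0 then 1 else 0)"
proof -
  have e: "(\<integral>x. cis (2 * pi * (of_int n * x)) \<partial>leb 0 1) = integral {0..1} (\<lambda>x. cis (2 * pi * (of_int n * x)))"
    by (intro leb_eq_integral(2)[of _ _ _ 1]) auto
  show ?thesis
  proof (cases "n = 0")
    case False
    let ?c = "2 * pi * of_int n :: real"
    have c: "?c \<noteq> 0" using False by simp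
    have "((\<lambda>x. cis (?c * x) / (\<i> * of_real ?c)) has_vector_derivative cis (?c * x)) (at x within {0..1})" for x
    proof -
      have "((\<lambda>x. exp (\<i> * of_real (?c * x)) / (\<i> * of_real ?c)) has_vector_derivative exp (\<i> * of_real (?c * x))) (at x within {0..1})"
        using c by (auto intro!: derivative_eq_intros has_vector_derivative_real_field simp: field_simps)
      then show ?thesis by (simp add: cis_conv_exp)
    qed
    then have "((\<lambda>x. cis (?c * x)) has_integral (cis (?c * 1) / (\<i> * of_real ?c) - cis (?c * 0) / (\<i> * of_real ?c))) {0..1}"
      by (intro fundamental_theorem_of_calculus) auto
    moreover have "cis ?c = 1" using cis_multiple_2pi[of "of_int n"] by simp
    ultimately have "integral {0..1} (\<lambda>x. cis (?c * x)) = 0" by (simp add: integral_unique)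
    then show ?thesis using False unfolding e by (simp add: mult.assoc)
  qed (simp add: measure_leb)
qed

lemma integral_chr: "(\<integral>z. chr k z \<partial>cube) = (if k = 0 then 1 else 0)"
proof -
  have "(\<integral>z. chr k z \<partial>cube) = (\<integral>a. (\<integral>b. cis (2 * pi * (of_int (fst k) * a)) * cis (2 * pi * (of_int (snd k) * b)) \<partial>leb 0 1) \<partial>leb 0 1)"
    by (subst integral_cube[of _ 1]) (auto simp: chr_def cis_mult distrib_left)
  also have "\<dots> = (if fst k = 0 then 1 else 0) * (if snd k = 0 then 1 else 0)"
    unfolding integral_mult_right_zero integral_cis_int integral_mult_left_zero ..
  finally show ?thesis by (auto simp: prod_eq_iff)
qed

lemma chr_orthonormal: "(\<integral>z. chr k z * cnj (chr l z) \<partial>cube) = (if k = l then 1 else 0)"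
  unfolding chr_mult_cnj integral_chr by simp

definition ibox :: "nat \<Rightarrow> (int \<times> int) set" where "ibox N = {- int N..int N} \<times> {- int N..int N}"

lemma finite_ibox [simp]: "finite (ibox N)"
  by (simp add: ibox_def)

inductive trig :: "(real^2 \<Rightarrow> complex) \<Rightarrow> bool" where
  chr: "trig (\<lambda>z. c * chr k z)"
| add: "trig P \<Longrightarrow> trig Q \<Longrightarrow> trig (\<lambda>z. P z + Q z)"

lemma trig_mult: "trig P \<Longrightarrow> trig Q \<Longrightarrow> trig (\<lambda>z. P z * Q z)"
proof (induction rule: trig.induct)
  case (chr c k)
  from chr show ?case
  proof (induction rule: trig.induct)
    case (chr c' k')
    have e: "(\<lambda>z. c * chr k z * (c' * chr k' z)) = (\<lambda>z. (c * c') * chr (k + k') z)"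
      by (simp add: fun_eq_iff chr_mult[symmetric] mult_ac)
    show ?case unfolding e by (rule trig.chr)
  next
    case (add P Q) then show ?case by (simp add: distrib_left trig.add)
  qed
next
  case (add P P') then show ?case by (simp add: distrib_right trig.add)
qed

lemma trig_const: "trig (\<lambda>z. c)"
  using trig.chr[of c 0] by (simp add: chr_def)

lemma trig_cmult: "trig P \<Longrightarrow> trig (\<lambda>z. c * P z)"
  using trig_mult[OF trig_const] .

lemma trig_expand: "trig P \<Longrightarrow> \<exists>N a. \<forall>z. P z = (\<Sum>k\<in>ibox N. a k * chr k z)"
proof (induction rule: trig.induct)
  case (chr c k)
  obtain k1 k2 where k: "k = (k1, k2)" by (cases k)
  define N where "N = nat (max \<bar>k1\<bar> \<bar>k2\<bar>)"
  have "k \<in> ibox N" by (auto simp: k ibox_def N_def)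
  then have "(\<Sum>l\<in>ibox N. (if l = k then c else 0) * chr l z) = c * chr k z" for z
    by (subst sum.remove[of _ k]) (auto intro!: sum.neutral)
  then show ?case by (intro exI[of _ N] exI[of _ "\<lambda>l. if l = k then c else 0"]) simp
next
  case (add P Q)
  then obtain N a M b where P: "\<And>z. P z = (\<Sum>k\<in>ibox N. a k * chr k z)" and Q: "\<And>z. Q z = (\<Sum>k\<in>ibox M. b k * chr k z)"
    by blast
  let ?L = "max N M"
  have ext: "(\<Sum>k\<in>ibox N. a k * chr k z) = (\<Sum>k\<in>ibox ?L. (if k \<in> ibox N then a k else 0) * chr k z)"
    if "N \<le> L'" "L' = ?L" for N a z L'
    using that by (intro sum.mono_neutral_cong_left) (auto simp: ibox_def)
  have "P z + Q z = (\<Sum>k\<in>ibox ?L. ((if k \<in> ibox N then a k else 0) + (if k \<in> ibox M then b k else 0)) * chr k z)" for z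
    unfolding P Q ext[of N ?L a z, OF _ refl, simplified] ext[of M ?L b z, OF _ refl, simplified] distrib_right sum.distrib ..
  then show ?case
    by (intro exI[of _ ?L] exI[of _ "\<lambda>k. (if k \<in> ibox N then a k else 0) + (if k \<in> ibox M then b k else 0)"]) simp
qed

text \<open>The torus as a compact subset of C x C: opposite sides of the square have the same
  image, so Stone-Weierstrass on this image produces periodic approximants.\<close>

definition tor :: "real^2 \<Rightarrow> complex \<times> complex" where
  "tor z = (cis (2 * pi * z $ 1), cis (2 * pi * z $ 2))"

lemma trig_cos_sin:
  "trig (\<lambda>z. of_real (Re (cis (2 * pi * z $ 1))))" "trig (\<lambda>z. of_real (Im (cis (2 * pi * z $ 1))))"
  "trig (\<lambda>z. of_real (Re (cis (2 * pi * z $ 2))))" "trig (\<lambda>z. of_real (Im (cis (2 * pi * z $ 2))))"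
proof -
  have re: "complex_of_real (Re (cis a)) = 1 / 2 * cis a + 1 / 2 * cis (- a)" for a
    by (simp add: complex_eq_iff)
  have im: "complex_of_real (Im (cis a)) = - (\<i> / 2) * cis a + \<i> / 2 * cis (- a)" for a
    by (simp add: complex_eq_iff)
  have e: "cis (2 * pi * z $ 1) = chr (1, 0) z" "cis (- (2 * pi * z $ 1)) = chr (-1, 0) z"
    "cis (2 * pi * z $ 2) = chr (0, 1) z" "cis (- (2 * pi * z $ 2)) = chr (0, -1) z" for z
    by (simp_all add: chr_def)
  show "trig (\<lambda>z. of_real (Re (cis (2 * pi * z $ 1))))" "trig (\<lambda>z. of_real (Im (cis (2 * pi * z $ 1))))"
    "trig (\<lambda>z. of_real (Re (cis (2 * pi * z $ 2))))" "trig (\<lambda>z. of_real (Im (cis (2 * pi * z $ 2))))"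
    unfolding re im unfolding e by (intro trig.intros)+
qed

text \<open>On the torus the four real coordinates are cosines and sines, each a combination of two
  characters, and products of characters are characters. So the pullback of any polynomial is a
  trigonometric polynomial.\<close>

lemma trig_real_polynomial:
  "real_polynomial_function p \<Longrightarrow> trig (\<lambda>z. of_real (p (tor z)))"
proof (induction rule: real_polynomial_function.induct)
  case (linear h)
  then have lin: "linear h" by (rule bounded_linear.linear)
  have he: "h (a, b) = h (1, 0) * Re a + h (\<i>, 0) * Im a + (h (0, 1) * Re b + h (0, \<i>) * Im b)" for a b
  proof -
    have "(a, b) = Re a *\<^sub>R (1, 0) + Im a *\<^sub>R (\<i>, 0) + (Re b *\<^sub>R (0, 1) + Im b *\<^sub>R (0, \<i>))"
      by (simp add: complex_eq_iff)
    then have "h (a, b) = h (Re a *\<^sub>R (1, 0) + Im a *\<^sub>R (\<i>, 0) + (Re b *\<^sub>R (0, 1) + Im b *\<^sub>R (0, \<i>)))" by simp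
    also have "\<dots> = Re a * h (1, 0) + Im a * h (\<i>, 0) + (Re b * h (0, 1) + Im b * h (0, \<i>))"
      by (simp only: linear_add[OF lin] linear_scale[OF lin] real_scaleR_def)
    finally show ?thesis by (simp add: mult.commute)
  qed
  have hz: "complex_of_real (h (tor z)) = of_real (h (1, 0)) * of_real (Re (cis (2 * pi * z $ 1))) + of_real (h (\<i>, 0)) * of_real (Im (cis (2 * pi * z $ 1))) +
     (of_real (h (0, 1)) * of_real (Re (cis (2 * pi * z $ 2))) + of_real (h (0, \<i>)) * of_real (Im (cis (2 * pi * z $ 2))))" for z
    unfolding tor_def he[of "cis (2 * pi * z $ 1)" "cis (2 * pi * z $ 2)"] by simp
  show ?case unfolding hz by (intro trig.add trig_cmult trig_cos_sin)
next
  case (const c) then show ?case by (simp add: trig_const)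
next
  case (add f g) then show ?case by (simp add: trig.add)
next
  case (mult f g) then show ?case by (simp add: trig_mult)
qed

lemma cis_2pi_eq: 
  assumes "cis (2 * pi * a) = cis (2 * pi * b)" "a \<in> {0..1}" "b \<in> {0..1}"
  shows "a = b \<or> (a = 0 \<and> b = 1) \<or> (a = 1 \<and> b = 0)"
proof -
  have "cos (2 * pi * (a - b)) = 1"
    using assms(1) by (simp add: complex_eq_iff right_diff_distrib cos_diff)
  then obtain n where "2 * pi * (a - b) = of_int n * 2 * pi" using cos_one_2pi_int by blast
  then have n: "a - b = of_int n" by simp
  then have "-1 \<le> n" "n \<le> 1" using assms by (auto; linarith)+
  then have "n = -1 \<or> n = 0 \<or> n = 1" by auto
  then show ?thesis using n assms by auto
qed

text \<open>A continuous map from a compact space to a Hausdorff space is closed, hence a quotient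
  map onto its image. Applied to the torus here, and to tube coordinates in
  \<open>Q_meas\<close>.\<close>

lemma continuous_on_quotient_compact:
  fixes \<phi> :: "'a::topological_space \<Rightarrow> 'b::t2_space" and G :: "'b \<Rightarrow> 'c::topological_space"
  assumes C: "compact C" and \<phi>: "continuous_on C \<phi>" and G: "continuous_on C (\<lambda>z. G (\<phi> z))"
  shows "continuous_on (\<phi> ` C) G"
  unfolding continuous_on_closed_invariant
proof (intro allI impI)
  fix B :: "'c set" assume "closed B"
  then obtain A where A: "closed A" "A \<inter> C = (\<lambda>z. G (\<phi> z)) -` B \<inter> C"
    using G unfolding continuous_on_closed_invariant by blast
  have "compact (A \<inter> C)" using A(1) C by (intro closed_Int_compact)
  then have "closed (\<phi> ` (A \<inter> C))"
    by (intro compact_imp_closed compact_continuous_image continuous_on_subset[OF \<phi>]) auto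
  moreover have "\<phi> ` (A \<inter> C) \<inter> \<phi> ` C = G -` B \<inter> \<phi> ` C" unfolding A(2) by auto
  ultimately show "\<exists>A. closed A \<and> A \<inter> \<phi> ` C = G -` B \<inter> \<phi> ` C" by blast
qed

text \<open>A function on the square vanishing on its boundary descends to the torus.\<close>

lemma trig_approx_continuous:
  fixes H :: "real^2 \<Rightarrow> real"
  assumes H: "continuous_on (cbox 0 1) H" and bd: "\<And>z. z \<in> cbox 0 1 \<Longrightarrow> z \<notin> box 0 1 \<Longrightarrow> H z = 0" and "0 < e"
  shows "\<exists>P. trig P \<and> (\<forall>z\<in>cbox 0 1. cmod (of_real (H z) - P z) < e)"
proof -
  let ?C = "cbox 0 1 :: (real^2) set"
  have ct: "continuous_on S tor" for S
    unfolding tor_def cis_conv_exp by (intro continuous_intros)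
  have inj: "H z = H w" if "z \<in> ?C" "w \<in> ?C" "tor z = tor w" for z w
  proof -
    have zw: "z $ i \<in> {0..1}" "w $ i \<in> {0..1}" for i using that by (auto simp: mem_box_cart)
    have "z $ i = w $ i \<or> (z $ i \<in> {0,1} \<and> w $ i \<in> {0,1})" for i
      using cis_2pi_eq[OF _ zw(1)[of i] zw(2)[of i]] that(3) exhaust_2[of i] by (auto simp: tor_def)
    then have "z = w \<or> (z \<notin> box 0 1 \<and> w \<notin> box 0 1)"
      by (auto simp: vec_eq_iff mem_box_cart) (metis less_irrefl)+
    then show ?thesis using bd that by auto
  qed
  define G where "G t = H (SOME z. z \<in> ?C \<and> tor z = t)" for t
  have GH: "G (tor z) = H z" if "z \<in> ?C" for z
  proof -
    have "(SOME w. w \<in> ?C \<and> tor w = tor z) \<in> ?C \<and> tor (SOME w. w \<in> ?C \<and> tor w = tor z) = tor z"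
      by (rule someI[of _ z]) (use that in simp)
    then show ?thesis unfolding G_def using inj that by blast
  qed
  have "continuous_on (tor ` ?C) G"
    by (rule continuous_on_quotient_compact[OF compact_cbox ct continuous_on_eq[OF H]]) (simp add: GH)
  then obtain p where p: "real_polynomial_function p" "\<And>t. t \<in> tor ` ?C \<Longrightarrow> \<bar>G t - p t\<bar> < e"
    using Stone_Weierstrass_real_polynomial_function[OF _ _ \<open>0 < e\<close>, of "tor ` ?C" G]
      compact_continuous_image[OF ct compact_cbox] by metis
  have "cmod (of_real (H z) - of_real (p (tor z))) < e" if "z \<in> ?C" for z
    using p(2)[of "tor z"] GH[OF that] that by (simp flip: of_real_diff)
  then show ?thesis using trig_real_polynomial[OF p(1)] by blast
qed

text \<open>A measurable function is almost everywhere a limit of continuous ones. These are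
  truncated at M and multiplied by cutoffs that vanish on the boundary of the square and tend to 1
  inside; dominated convergence concludes. Vanishing on the boundary makes \<open>H\<close>
  periodic.\<close>

lemma continuous_L2_approx:
  fixes F :: "real^2 \<Rightarrow> real"
  assumes Fm [measurable]: "F \<in> borel_measurable borel" and M: "\<And>z. \<bar>F z\<bar> \<le> M" and "0 < e"
  shows "\<exists>H. continuous_on UNIV H \<and> (\<forall>z\<in>cbox 0 1. z \<notin> box 0 1 \<longrightarrow> H z = 0) \<and> (\<forall>z\<in>cbox 0 1. \<bar>H z\<bar> \<le> M) \<and> (\<integral>z. (F z - H z)\<^sup>2 \<partial>cube) < e"
proof -
  have M0: "0 \<le> M" using M[of 0] by linarith
  have "F measurable_on UNIV"
    by (subst measurable_on_iff_borel_measurable) (auto simp: lebesgue_on_UNIV_eq measurable_completion)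
  then obtain N g where N: "negligible N" and g: "\<And>n. continuous_on UNIV (g n)" "\<And>x. x \<notin> N \<Longrightarrow> (\<lambda>n. g n x) \<longlonglongrightarrow> F x"
    unfolding measurable_on_def by auto
  \<comment> \<open>Positive exactly in the interior of the square, so \<open>min 1 (n b)\<close> is
    eventually 1 at each interior point and 0 on the boundary for every n.\<close>
  define b where "b z = z $ 1 * (1 - z $ 1) * (z $ 2 * (1 - z $ 2))" for z :: "real^2"
  define H where "H n z = max (- M) (min M (g n z)) * min 1 (real n * b z)" for n z
  have Hc: "continuous_on UNIV (H n)" for n
    unfolding H_def b_def by (intro continuous_intros g)
  then have Hm [measurable]: "H n \<in> borel_measurable borel" for n by (rule borel_measurable_continuous_onI)
  have b0: "0 \<le> b z" if "z \<in> cbox 0 1" for z using that by (auto simp: b_def mem_box_cart forall_2)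
  have Hb: "\<bar>H n z\<bar> \<le> M" if "z \<in> cbox 0 1" for n z
  proof -
    have "\<bar>max (- M) (min M (g n z))\<bar> * \<bar>min 1 (real n * b z)\<bar> \<le> M * 1"
      using M0 b0[OF that] by (intro mult_mono) auto
    then show ?thesis by (simp add: H_def abs_mult)
  qed
  have lim: "(\<lambda>n. H n z) \<longlonglongrightarrow> F z" if "z \<notin> N" "z \<in> box 0 1" for z
  proof -
    have "0 < b z" using that(2) by (auto simp: b_def mem_box_cart forall_2)
    then have "filterlim (\<lambda>n. real n * b z) at_top sequentially"
      by (intro filterlim_at_top_mult_tendsto_pos[where c = "b z"] filterlim_real_sequentially tendsto_const)
    then have "eventually (\<lambda>n. 1 \<le> real n * b z) sequentially" by (simp add: filterlim_at_top)
    then have 1: "(\<lambda>n. min 1 (real n * b z)) \<longlonglongrightarrow> 1"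
      by (intro tendsto_eventually) (auto elim!: eventually_mono)
    have "(\<lambda>n. max (- M) (min M (g n z))) \<longlonglongrightarrow> max (- M) (min M (F z))"
      by (intro tendsto_intros g that)
    moreover have "max (- M) (min M (F z)) = F z" using M[of z] by (auto simp: abs_le_iff)
    ultimately show ?thesis unfolding H_def using tendsto_mult[OF _ 1] by fastforce
  qed
  have AEN: "AE z in cube. z \<notin> N"
  proof -
    have "AE z in lebesgue. z \<notin> N" using N by (intro AE_not_in) (simp add: negligible_iff_null_sets)
    then have "AE z in lborel. z \<notin> N" by (simp add: AE_completion_iff)
    then show ?thesis unfolding cube_def by (subst AE_density) auto
  qed
  have "(\<lambda>n. \<integral>z. (F z - H n z)\<^sup>2 \<partial>cube) \<longlonglongrightarrow> (\<integral>z. 0 \<partial>cube)"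
  proof (rule integral_dominated_convergence[where w = "\<lambda>_. (M + M)\<^sup>2"])
    show "AE z in cube. (\<lambda>n. (F z - H n z)\<^sup>2) \<longlonglongrightarrow> 0"
      using AEN AE_cube
    proof eventually_elim
      case (elim z)
      then have "(\<lambda>n. (F z - H n z)\<^sup>2) \<longlonglongrightarrow> (F z - F z)\<^sup>2" by (intro tendsto_intros lim)
      then show ?case by simp
    qed
    show "AE z in cube. norm ((F z - H n z)\<^sup>2) \<le> (M + M)\<^sup>2" for n
      using AE_cube
    proof eventually_elim
      case (elim z)
      then have "\<bar>F z - H n z\<bar> \<le> M + M" using M[of z] Hb[of z n] box_subset_cbox[of 0 "1::real^2"] by fastforce
      from power_mono[OF this abs_ge_zero, of 2] show ?case by simp
    qed
  qed auto
  then have "eventually (\<lambda>n. (\<integral>z. (F z - H n z)\<^sup>2 \<partial>cube) < e) sequentially"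
    using \<open>0 < e\<close> by (intro order_tendstoD) auto
  then obtain n where "(\<integral>z. (F z - H n z)\<^sup>2 \<partial>cube) < e" by (auto simp: eventually_sequentially)
  moreover have "H n z = 0" if "z \<in> cbox 0 1" "z \<notin> box 0 1" for z
  proof -
    have "b z = 0" using that by (auto simp: b_def mem_box_cart forall_2)
    then show ?thesis by (simp add: H_def)
  qed
  ultimately show ?thesis using Hc[of n] Hb[of _ n] by blast
qed

definition fc :: "(real^2 \<Rightarrow> real) \<Rightarrow> int \<times> int \<Rightarrow> complex" where
  "fc F k = (\<integral>z. of_real (F z) * cnj (chr k z) \<partial>cube)"

text \<open>With c the Fourier coefficients, orthonormality gives ||F - P||^2 = ||F||^2 - sum |c|^2
  + sum |a - c|^2, and the last sum is nonnegative.\<close>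

lemma best_approximation:
  fixes F :: "real^2 \<Rightarrow> real"
  assumes Fm [measurable]: "F \<in> borel_measurable borel" and M: "\<And>z. \<bar>F z\<bar> \<le> M" and "finite A"
  shows "(\<integral>z. (F z)\<^sup>2 \<partial>cube) \<le> (\<integral>z. (cmod (of_real (F z) - (\<Sum>k\<in>A. a k * chr k z)))\<^sup>2 \<partial>cube) + (\<Sum>k\<in>A. (cmod (fc F k))\<^sup>2)"
proof -
  define P where "P z = (\<Sum>k\<in>A. a k * chr k z)" for z
  have Pm [measurable]: "P \<in> borel_measurable borel" unfolding P_def by measurable
  have Pb: "cmod (P z) \<le> (\<Sum>k\<in>A. cmod (a k))" for z
    unfolding P_def by (rule order_trans[OF norm_sum]) (simp add: norm_mult)
  let ?B = "\<Sum>k\<in>A. cmod (a k)"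
  have B0: "?B \<ge> 0" by (intro sum_nonneg) auto
  have M0: "0 \<le> M" using M[of 0] by linarith
  have iF: "integrable cube (\<lambda>z. (F z)\<^sup>2)" using power_mono[OF M abs_ge_zero, of _ 2] by (intro integrable_cube[of _ "M\<^sup>2"]) auto
  have ichr: "integrable cube (\<lambda>z. of_real (F z) * cnj (chr k z))" for k
    using M by (intro integrable_cube[of _ M]) (auto simp: norm_mult)
  have iFP: "integrable cube (\<lambda>z. of_real (F z) * cnj (P z))"
    using M Pb M0 B0 by (intro integrable_cube[of _ "M * ?B"]) (auto simp: norm_mult intro!: mult_mono)
  have iP: "integrable cube (\<lambda>z. P z * cnj (P z))"
    using Pb B0 by (intro integrable_cube[of _ "?B * ?B"]) (auto simp: norm_mult intro!: mult_mono)
  have FP: "(\<integral>z. of_real (F z) * cnj (P z) \<partial>cube) = (\<Sum>k\<in>A. cnj (a k) * fc F k)"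
  proof -
    have "(\<integral>z. of_real (F z) * cnj (P z) \<partial>cube) = (\<integral>z. (\<Sum>k\<in>A. cnj (a k) * (of_real (F z) * cnj (chr k z))) \<partial>cube)"
      by (simp add: P_def sum_distrib_left mult_ac)
    also have "\<dots> = (\<Sum>k\<in>A. cnj (a k) * fc F k)"
      using ichr by (subst Bochner_Integration.integral_sum) (auto simp: fc_def)
    finally show ?thesis .
  qed
  have PP: "(\<integral>z. P z * cnj (P z) \<partial>cube) = (\<Sum>k\<in>A. a k * cnj (a k))"
  proof -
    have ic: "integrable cube (\<lambda>z. c * (chr k z * cnj (chr l z)))" for c k l
      by (intro integrable_mult_right integrable_cube[of _ 1]) (auto simp: norm_mult)
    have "(\<integral>z. P z * cnj (P z) \<partial>cube) = (\<integral>z. (\<Sum>k\<in>A. \<Sum>l\<in>A. (a k * cnj (a l)) * (chr k z * cnj (chr l z))) \<partial>cube)"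
      by (simp add: P_def sum_product mult_ac)
    also have "\<dots> = (\<Sum>k\<in>A. \<Sum>l\<in>A. (a k * cnj (a l)) * (if k = l then 1 else 0))"
      using ic by (subst Bochner_Integration.integral_sum, force)+ (simp add: chr_orthonormal)
    also have "\<dots> = (\<Sum>k\<in>A. a k * cnj (a k))"
      using \<open>finite A\<close> by (intro sum.cong refl) (simp add: if_distrib sum.delta' cong: if_cong)
    finally show ?thesis .
  qed
  have pw: "(cmod (of_real (F z) - P z))\<^sup>2 = (F z)\<^sup>2 - 2 * Re (of_real (F z) * cnj (P z)) + Re (P z * cnj (P z))" for z
    unfolding cmod_power2 by (simp add: power2_eq_square algebra_simps)
  have "(\<integral>z. (cmod (of_real (F z) - P z))\<^sup>2 \<partial>cube) = (\<integral>z. (F z)\<^sup>2 \<partial>cube) - 2 * Re (\<integral>z. of_real (F z) * cnj (P z) \<partial>cube) + Re (\<integral>z. P z * cnj (P z) \<partial>cube)"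
  proof -
    define b c where "b z = Re (of_real (F z) * cnj (P z))" and "c z = Re (P z * cnj (P z))" for z
    have "integrable cube b" "integrable cube c" unfolding b_def c_def by (rule integrable_Re[OF iFP], rule integrable_Re[OF iP])
    then have "(\<integral>z. (F z)\<^sup>2 - 2 * b z + c z \<partial>cube) = (\<integral>z. (F z)\<^sup>2 \<partial>cube) - 2 * (\<integral>z. b z \<partial>cube) + (\<integral>z. c z \<partial>cube)"
      using iF by simp
    then show ?thesis unfolding pw b_def c_def integral_Re[OF iFP] integral_Re[OF iP] .
  qed
  also have "\<dots> = (\<integral>z. (F z)\<^sup>2 \<partial>cube) + (\<Sum>k\<in>A. Re (a k * cnj (a k)) - 2 * Re (cnj (a k) * fc F k))"
    unfolding FP PP by (simp add: sum_subtractf sum_distrib_left)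
  also have "\<dots> \<ge> (\<integral>z. (F z)\<^sup>2 \<partial>cube) + (\<Sum>k\<in>A. - (cmod (fc F k))\<^sup>2)"
  proof (intro add_left_mono sum_mono)
    fix k
    have "0 \<le> (cmod (a k - fc F k))\<^sup>2" by simp
    also have "\<dots> = Re (a k * cnj (a k)) - 2 * Re (cnj (a k) * fc F k) + (cmod (fc F k))\<^sup>2"
      unfolding cmod_power2 by (simp add: power2_eq_square algebra_simps)
    finally show "- (cmod (fc F k))\<^sup>2 \<le> Re (a k * cnj (a k)) - 2 * Re (cnj (a k) * fc F k)" by simp
  qed
  finally show ?thesis by (simp add: P_def sum_negf)
qed

text \<open>The half of Parseval that expresses completeness: a trigonometric polynomial close to F
  in mean square has its frequencies in some box, and \<open>best_approximation\<close> transfers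
  the smallness of the error to the coefficients in that box.\<close>

lemma Parseval_le:
  fixes F :: "real^2 \<Rightarrow> real"
  assumes Fm [measurable]: "F \<in> borel_measurable borel" and M: "\<And>z. \<bar>F z\<bar> \<le> M" and "0 < e"
  shows "\<exists>N. (\<integral>z. (F z)\<^sup>2 \<partial>cube) \<le> e + (\<Sum>k\<in>ibox N. (cmod (fc F k))\<^sup>2)"
proof -
  \<comment> \<open>Two errors, each of square at most e/4 and each doubled by (a + b)^2 \<le> 2 a^2
    + 2 b^2, add up to e.\<close>
  obtain H where H: "continuous_on UNIV H" "\<And>z. z \<in> cbox 0 1 \<Longrightarrow> z \<notin> box 0 1 \<Longrightarrow> H z = 0" "\<And>z. z \<in> cbox 0 1 \<Longrightarrow> \<bar>H z\<bar> \<le> M"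
    "(\<integral>z. (F z - H z)\<^sup>2 \<partial>cube) < e / 4"
    using continuous_L2_approx[OF Fm M, of "e / 4"] \<open>0 < e\<close> by auto
  have Hm [measurable]: "H \<in> borel_measurable borel" using H(1) by (rule borel_measurable_continuous_onI)
  have se: "0 < sqrt (e / 4)" using \<open>0 < e\<close> by simp
  obtain P where P: "trig P" "\<And>z. z \<in> cbox 0 1 \<Longrightarrow> cmod (of_real (H z) - P z) < sqrt (e / 4)"
    using trig_approx_continuous[OF continuous_on_subset[OF H(1)] H(2) se] by auto
  obtain N a where N: "\<And>z. P z = (\<Sum>k\<in>ibox N. a k * chr k z)" using trig_expand[OF P(1)] by blast
  have Pm [measurable]: "P \<in> borel_measurable borel"
    unfolding N[abs_def] by measurable
  have le: "(cmod (of_real (F z) - P z))\<^sup>2 \<le> 2 * (F z - H z)\<^sup>2 + 2 * (e / 4)" if "z \<in> cbox 0 1" for z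
  proof -
    have "cmod (of_real (F z) - P z) \<le> cmod (of_real (F z - H z)) + cmod (of_real (H z) - P z)"
      using norm_triangle_ineq[of "of_real (F z - H z)" "of_real (H z) - P z"] by simp
    also have "cmod (of_real (F z - H z)) = \<bar>F z - H z\<bar>" by (rule norm_of_real)
    finally have "(cmod (of_real (F z) - P z))\<^sup>2 \<le> (\<bar>F z - H z\<bar> + cmod (of_real (H z) - P z))\<^sup>2"
      by (intro power_mono) auto
    also have "\<dots> \<le> 2 * \<bar>F z - H z\<bar>\<^sup>2 + 2 * (cmod (of_real (H z) - P z))\<^sup>2"
      using zero_le_power2[of "\<bar>F z - H z\<bar> - cmod (of_real (H z) - P z)"] by (simp add: power2_sum power2_diff)
    also have "(cmod (of_real (H z) - P z))\<^sup>2 \<le> (sqrt (e / 4))\<^sup>2" using P(2)[OF that] by (intro power_mono) auto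
    finally show ?thesis using \<open>0 < e\<close> by simp
  qed
  have i1: "integrable cube (\<lambda>z. (F z - H z)\<^sup>2)"
  proof (rule integrable_cube[of _ "(M + M)\<^sup>2"])
    fix z :: "real^2" assume "z \<in> cbox 0 1"
    then have "\<bar>F z - H z\<bar> \<le> M + M" using M[of z] H(3)[of z] by linarith
    from power_mono[OF this abs_ge_zero, of 2] show "norm ((F z - H z)\<^sup>2) \<le> (M + M)\<^sup>2" by simp
  qed measurable
  have i2: "integrable cube (\<lambda>z. 2 * (F z - H z)\<^sup>2 + 2 * (e / 4))" using i1 by simp
  have "(\<integral>z. (cmod (of_real (F z) - P z))\<^sup>2 \<partial>cube) \<le> (\<integral>z. 2 * (F z - H z)\<^sup>2 + 2 * (e / 4) \<partial>cube)"
  proof (rule integral_mono_AE)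
    show "integrable cube (\<lambda>z. (cmod (of_real (F z) - P z))\<^sup>2)"
      by (rule Bochner_Integration.integrable_bound[OF i2])
         (use AE_cube box_subset_cbox[of 0 "1::real^2"] le \<open>0 < e\<close> in \<open>auto elim!: eventually_mono intro: order_trans[OF _ abs_ge_self]\<close>)
    show "AE z in cube. (cmod (of_real (F z) - P z))\<^sup>2 \<le> 2 * (F z - H z)\<^sup>2 + 2 * (e / 4)"
      using AE_cube box_subset_cbox[of 0 "1::real^2"] le by (auto elim!: eventually_mono)
  qed (rule i2)
  also have "\<dots> = 2 * (\<integral>z. (F z - H z)\<^sup>2 \<partial>cube) + 2 * (e / 4)"
    using i1 cube.prob_space by simp
  also have "\<dots> \<le> e" using H(4) by simp
  finally have "(\<integral>z. (cmod (of_real (F z) - P z))\<^sup>2 \<partial>cube) \<le> e" .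
  then show ?thesis using best_approximation[OF Fm M finite_ibox[of N], of a] unfolding N[symmetric] by (intro exI[of _ N]) simp
qed

section \<open>Curvature and second-order contact\<close>

text \<open>By differentiability of \<open>\<phi>1\<close> at 0 the remainder has a derivative of
  size o(u) near 0; the mean value inequality on [-|u|, |u|] turns this into o(u^2).\<close>

lemma peano_second_order:
  fixes \<phi> \<phi>1 :: "real \<Rightarrow> real"
  assumes "\<delta> > 0" and d1: "\<And>u. \<bar>u\<bar> < \<delta> \<Longrightarrow> (\<phi> has_real_derivative \<phi>1 u) (at u)"
    and d2: "(\<phi>1 has_real_derivative \<phi>2) (at 0)" and "e > 0"
  shows "\<exists>\<eta>>0. \<forall>u. \<bar>u\<bar> < \<eta> \<longrightarrow> \<bar>\<phi> u - \<phi> 0 - \<phi>1 0 * u - \<phi>2 / 2 * u\<^sup>2\<bar> \<le> e * u\<^sup>2"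
proof -
  have "(\<lambda>h. (\<phi>1 (0 + h) - \<phi>1 0) / h) \<midarrow>0\<rightarrow> \<phi>2" using d2 unfolding DERIV_def .
  from LIM_D[OF this \<open>e > 0\<close>] obtain r where r: "r > 0" "\<And>u. u \<noteq> 0 \<Longrightarrow> \<bar>u\<bar> < r \<Longrightarrow> \<bar>(\<phi>1 u - \<phi>1 0) / u - \<phi>2\<bar> < e" by auto
  define \<eta> where "\<eta> = min r \<delta>"
  define g where "g u = \<phi> u - \<phi> 0 - \<phi>1 0 * u - \<phi>2 / 2 * u\<^sup>2" for u
  have gd: "(g has_real_derivative (\<phi>1 u - \<phi>1 0 - \<phi>2 * u)) (at u)" if "\<bar>u\<bar> < \<eta>" for u
    unfolding g_def using that by (auto intro!: derivative_eq_intros d1 simp: \<eta>_def)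
  have g': "\<bar>\<phi>1 u - \<phi>1 0 - \<phi>2 * u\<bar> \<le> e * \<bar>u\<bar>" if "\<bar>u\<bar> < \<eta>" for u
  proof (cases "u = 0")
    case False
    then have "\<bar>(\<phi>1 u - \<phi>1 0) / u - \<phi>2\<bar> * \<bar>u\<bar> \<le> e * \<bar>u\<bar>"
      using r(2)[of u] that by (intro mult_right_mono) (auto simp: \<eta>_def)
    moreover have "((\<phi>1 u - \<phi>1 0) / u - \<phi>2) * u = \<phi>1 u - \<phi>1 0 - \<phi>2 * u"
      using False by (simp add: field_simps)
    ultimately show ?thesis by (simp add: abs_mult[symmetric])
  qed simp
  have "\<bar>g u\<bar> \<le> e * u\<^sup>2" if u: "\<bar>u\<bar> < \<eta>" for u
  proof -
    have "\<bar>g u - g 0\<bar> \<le> (e * \<bar>u\<bar>) * \<bar>u - 0\<bar>"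
    proof -
      have "norm (g u - g 0) \<le> (e * \<bar>u\<bar>) * norm (u - 0)"
      proof (rule field_differentiable_bound[where S = "{- \<bar>u\<bar>..\<bar>u\<bar>}" and f' = "\<lambda>u. \<phi>1 u - \<phi>1 0 - \<phi>2 * u"])
        fix z assume z: "z \<in> {- \<bar>u\<bar>..\<bar>u\<bar>}"
        then have zz: "\<bar>z\<bar> < \<eta>" "\<bar>z\<bar> \<le> \<bar>u\<bar>" using u by auto
        show "(g has_field_derivative \<phi>1 z - \<phi>1 0 - \<phi>2 * z) (at z within {- \<bar>u\<bar>..\<bar>u\<bar>})"
          using gd[OF zz(1)] by (rule has_field_derivative_at_within)
        show "norm (\<phi>1 z - \<phi>1 0 - \<phi>2 * z) \<le> e * \<bar>u\<bar>"
          using order_trans[OF g'[OF zz(1)] mult_left_mono[OF zz(2), of e]] \<open>e > 0\<close> by simp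
      qed auto
      then show ?thesis by simp
    qed
    then show ?thesis by (simp add: g_def power2_eq_square)
  qed
  moreover have "\<eta> > 0" using r assms by (simp add: \<eta>_def)
  ultimately show ?thesis unfolding g_def by blast
qed

text \<open>Uniqueness of the second order expansion: a quadratic polynomial without constant term
  that is o(u^2) has linear coefficient 0, seen at u small against it, and then quadratic
  coefficient 0.\<close>

lemma peano_second_order_zero:
  fixes \<phi> \<phi>1 :: "real \<Rightarrow> real"
  assumes "\<delta> > 0" and d1: "\<And>u. \<bar>u\<bar> < \<delta> \<Longrightarrow> (\<phi> has_real_derivative \<phi>1 u) (at u)"
    and d2: "(\<phi>1 has_real_derivative \<phi>2) (at 0)"
    and small: "\<And>e. e > 0 \<Longrightarrow> \<exists>\<eta>>0. \<forall>u. \<bar>u\<bar> < \<eta> \<longrightarrow> \<bar>\<phi> u\<bar> \<le> e * u\<^sup>2"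
  shows "\<phi>1 0 = 0" "\<phi>2 = 0"
proof -
  have \<phi>0: "\<phi> 0 = 0"
  proof -
    obtain \<eta> where "\<eta> > 0" "\<forall>u. \<bar>u\<bar> < \<eta> \<longrightarrow> \<bar>\<phi> u\<bar> \<le> 1 * u\<^sup>2" using small[of 1] by auto
    then show ?thesis by (auto dest!: spec[of _ 0])
  qed
  have ex: "\<exists>\<eta>>0. \<forall>u. \<bar>u\<bar> < \<eta> \<longrightarrow> \<bar>\<phi>1 0 * u + \<phi>2 / 2 * u\<^sup>2\<bar> \<le> e * u\<^sup>2" if e: "e > 0" for e
  proof -
    have e2: "e / 2 > 0" using e by simp
    obtain a where a: "a > 0" "\<And>u. \<bar>u\<bar> < a \<Longrightarrow> \<bar>\<phi> u - \<phi> 0 - \<phi>1 0 * u - \<phi>2 / 2 * u\<^sup>2\<bar> \<le> e / 2 * u\<^sup>2"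
      using peano_second_order[OF assms(1) d1 d2 e2] by blast
    obtain b where b: "b > 0" "\<And>u. \<bar>u\<bar> < b \<Longrightarrow> \<bar>\<phi> u\<bar> \<le> e / 2 * u\<^sup>2" using small[OF e2] by blast
    have "\<bar>\<phi>1 0 * u + \<phi>2 / 2 * u\<^sup>2\<bar> \<le> e * u\<^sup>2" if "\<bar>u\<bar> < min a b" for u
    proof -
      have "\<bar>\<phi> u - \<phi> 0 - \<phi>1 0 * u - \<phi>2 / 2 * u\<^sup>2\<bar> \<le> e / 2 * u\<^sup>2" "\<bar>\<phi> u\<bar> \<le> e / 2 * u\<^sup>2"
        using a(2) b(2) that by auto
      moreover have "e * u\<^sup>2 = e / 2 * u\<^sup>2 + e / 2 * u\<^sup>2" by simp
      ultimately show ?thesis using \<phi>0 by linarith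
    qed
    then show ?thesis using a b by (intro exI[of _ "min a b"]) auto
  qed
  show z: "\<phi>1 0 = 0"
  proof (rule ccontr)
    assume nz: "\<phi>1 0 \<noteq> 0"
    obtain a where a: "a > 0" "\<And>u. \<bar>u\<bar> < a \<Longrightarrow> \<bar>\<phi>1 0 * u + \<phi>2 / 2 * u\<^sup>2\<bar> \<le> 1 * u\<^sup>2" using ex[of 1] by auto
    define K where "K = 1 + \<bar>\<phi>2 / 2\<bar>"
    have K: "K > 0" by (simp add: K_def add_pos_nonneg)
    define u where "u = min (a / 2) (\<bar>\<phi>1 0\<bar> / (2 * K))"
    have u: "u > 0" "u < a" "u \<le> \<bar>\<phi>1 0\<bar> / (2 * K)" using a nz K by (auto simp: u_def)
    have "\<bar>\<phi>1 0 * u\<bar> \<le> 1 * u\<^sup>2 + \<bar>\<phi>2 / 2 * u\<^sup>2\<bar>" using a(2)[of u] u by linarith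
    then have "\<bar>\<phi>1 0\<bar> * u \<le> K * u * u" using u by (simp add: abs_mult K_def power2_eq_square algebra_simps)
    then have "\<bar>\<phi>1 0\<bar> \<le> K * u" using u(1) by simp
    also have "\<dots> \<le> \<bar>\<phi>1 0\<bar> / 2" using u(3) K by (simp add: field_simps)
    finally show False using nz by simp
  qed
  have "\<bar>\<phi>2 / 2\<bar> \<le> 0"
  proof (rule field_le_epsilon)
    fix e :: real assume "e > 0"
    then obtain a where a: "a > 0" "\<And>u. \<bar>u\<bar> < a \<Longrightarrow> \<bar>\<phi>1 0 * u + \<phi>2 / 2 * u\<^sup>2\<bar> \<le> e * u\<^sup>2" using ex by auto
    from a(2)[of "a / 2"] a(1) z have "\<bar>\<phi>2 / 2\<bar> * (a / 2)\<^sup>2 \<le> e * (a / 2)\<^sup>2" by (simp add: abs_mult)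
    then show "\<bar>\<phi>2 / 2\<bar> \<le> 0 + e" using a(1) by simp
  qed
  then show "\<phi>2 = 0" by simp
qed

text \<open>The curvature is determined by the second-order contact of the set with its tangent line.\<close>

lemma local_param_curvature:
  fixes T N :: "real^2"
  assumes c: "local_param L x c" and TN: "\<And>z. (norm z)\<^sup>2 = (z \<bullet> T)\<^sup>2 + (z \<bullet> N)\<^sup>2"
    and contact: "\<And>e. e > 0 \<Longrightarrow> \<exists>U. open U \<and> x \<in> U \<and> (\<forall>y\<in>L \<inter> U. \<bar>(y - x) \<bullet> N - l * ((y - x) \<bullet> T)\<^sup>2\<bar> \<le> e * ((y - x) \<bullet> T)\<^sup>2)"
  shows "- (vector_derivative (\<lambda>t. vector_derivative c (at t)) (at 0) \<bullet> N) / (norm (vector_derivative c (at 0)))\<^sup>2 = - 2 * l"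
proof -
  obtain \<delta> U where \<delta>: "\<delta> > 0" and C2: "C_k_on 2 {-\<delta><..<\<delta>} c" and c0: "c 0 = x"
    and reg: "\<forall>t\<in>{-\<delta><..<\<delta>}. vector_derivative c (at t) \<noteq> 0" and U: "open U" "L \<inter> U = c ` {-\<delta><..<\<delta>}"
    using c unfolding local_param_def by auto
  obtain D where D: "D 0 = c" "\<forall>n. enat n < 2 \<longrightarrow> (\<forall>t\<in>{-\<delta><..<\<delta>}. (D n has_vector_derivative D (Suc n) t) (at t within {-\<delta><..<\<delta>}))"
    using C2 unfolding C_k_on_def by auto
  have at: "(at t within {-\<delta><..<\<delta>}) = at t" if "\<bar>t\<bar> < \<delta>" for t
    using that by (intro at_within_open) auto
  have e2: "enat 0 < 2" "enat 1 < 2" by (simp_all add: numeral_eq_enat)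
  have d0: "(c has_vector_derivative D 1 t) (at t)" if "\<bar>t\<bar> < \<delta>" for t
    using D(2)[rule_format, OF e2(1), of t] D(1) at[OF that] that by (simp add: abs_less_iff)
  have d1: "(D 1 has_vector_derivative D 2 t) (at t)" if "\<bar>t\<bar> < \<delta>" for t
    using D(2)[rule_format, OF e2(2), of t] at[OF that] that by (simp add: abs_less_iff numeral_2_eq_2)
  have vd: "vector_derivative c (at t) = D 1 t" if "\<bar>t\<bar> < \<delta>" for t
    using d0[OF that] by (rule vector_derivative_at)
  have vd2: "vector_derivative (\<lambda>t. vector_derivative c (at t)) (at 0) = D 2 0"
  proof (rule vector_derivative_at)
    have "((\<lambda>t. vector_derivative c (at t)) has_vector_derivative D 2 0) (at 0 within UNIV)"
      by (rule has_vector_derivative_transform_within_open[OF d1[of 0], of "{-\<delta><..<\<delta>}"]) (use \<delta> vd in auto)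
    then show "((\<lambda>t. vector_derivative c (at t)) has_vector_derivative D 2 0) (at 0)" by simp
  qed
  have di: "((\<lambda>u. g u \<bullet> w) has_real_derivative (g' \<bullet> w)) (at t)" if "(g has_vector_derivative g') (at t)" for g g' w t
    using bounded_linear.has_vector_derivative[OF bounded_linear_inner_left that]
    by (simp add: has_real_derivative_iff_has_vector_derivative)
  define X V where "X u = (c u - x) \<bullet> T" and "V u = (c u - x) \<bullet> N" for u
  have Xd: "(X has_real_derivative D 1 u \<bullet> T) (at u)" and Vd: "(V has_real_derivative D 1 u \<bullet> N) (at u)" if "\<bar>u\<bar> < \<delta>" for u
    unfolding X_def V_def using d0[OF that] by (auto intro!: di derivative_eq_intros)
  \<comment> \<open>The deviation of the curve from the osculating parabola. Contact makes it o(u^2)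
    for every parametrization, so its first two derivatives vanish at 0; the first says that the
    velocity is tangential, the second is the curvature formula.\<close>
  define \<phi> where "\<phi> u = V u - l * (X u)\<^sup>2" for u
  have d\<phi>: "(\<phi> has_real_derivative (D 1 u \<bullet> N - 2 * l * X u * (D 1 u \<bullet> T))) (at u)" if "\<bar>u\<bar> < \<delta>" for u
    unfolding \<phi>_def using Xd[OF that] Vd[OF that] by (auto intro!: derivative_eq_intros)
  have d\<phi>2: "((\<lambda>u. D 1 u \<bullet> N - 2 * l * X u * (D 1 u \<bullet> T)) has_real_derivative
     (D 2 0 \<bullet> N - 2 * l * (D 1 0 \<bullet> T) * (D 1 0 \<bullet> T))) (at 0)"
  proof -
    have 0: "\<bar>0\<bar> < \<delta>" using \<delta> by simp
    show ?thesis
      by (rule DERIV_cong[OF DERIV_diff[OF di[OF d1[OF 0]] DERIV_mult[OF DERIV_cmult[OF Xd[OF 0]] di[OF d1[OF 0]]]]])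
         (simp add: X_def c0)
  qed
  have cc: "isCont c 0" by (rule has_vector_derivative_continuous[OF d0]) (simp add: \<delta>)
  have small: "\<exists>\<eta>>0. \<forall>u. \<bar>u\<bar> < \<eta> \<longrightarrow> \<bar>\<phi> u\<bar> \<le> e * u\<^sup>2" if "e > 0" for e
  proof -
    define M where "M = \<bar>D 1 0 \<bullet> T\<bar> + 1"
    have M: "M > 0" by (simp add: M_def add_nonneg_pos)
    have "(\<lambda>h. (X (0 + h) - X 0) / h) \<midarrow>0\<rightarrow> D 1 0 \<bullet> T" using Xd[of 0] \<delta> unfolding DERIV_def by simp
    from LIM_D[OF this, of 1] obtain r where r: "r > 0" "\<And>u. u \<noteq> 0 \<Longrightarrow> \<bar>u\<bar> < r \<Longrightarrow> \<bar>X u / u - D 1 0 \<bullet> T\<bar> < 1"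
      by (auto simp: X_def c0)
    have XM: "\<bar>X u\<bar> \<le> M * \<bar>u\<bar>" if "\<bar>u\<bar> < r" for u
    proof (cases "u = 0")
      case False
      then have "\<bar>X u / u\<bar> \<le> M" using r(2)[of u] that by (auto simp: M_def)
      then show ?thesis using False by (simp add: divide_le_eq)
    qed (simp add: X_def c0)
    \<comment> \<open>Contact is measured in the tangential coordinate X of the set, while the
      expansion is in the parameter u; since |X| \<le> M |u|, dividing e by M^2 converts one into
      the other.\<close>
    obtain W where W: "open W" "x \<in> W" "\<And>y. y \<in> L \<inter> W \<Longrightarrow> \<bar>(y - x) \<bullet> N - l * ((y - x) \<bullet> T)\<^sup>2\<bar> \<le> (e / M\<^sup>2) * ((y - x) \<bullet> T)\<^sup>2"
      using contact[of "e / M\<^sup>2"] \<open>e > 0\<close> M by auto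
    have "eventually (\<lambda>u. c u \<in> W) (at 0)"
      using cc W c0 unfolding isCont_def by (intro topological_tendstoD) auto
    then obtain s where s: "s > 0" "\<And>u. u \<noteq> 0 \<Longrightarrow> \<bar>u\<bar> < s \<Longrightarrow> c u \<in> W"
      unfolding eventually_at by (auto simp: dist_real_def)
    have "\<bar>\<phi> u\<bar> \<le> e * u\<^sup>2" if "\<bar>u\<bar> < min (min r s) \<delta>" for u
    proof -
      have "c u \<in> W" using s W c0 that by (cases "u = 0") auto
      moreover have "c u \<in> L" using U(2) that by (auto simp: abs_less_iff)
      ultimately have "\<bar>\<phi> u\<bar> \<le> (e / M\<^sup>2) * (X u)\<^sup>2" using W(3)[of "c u"] by (simp add: \<phi>_def V_def X_def)
      also have "\<dots> \<le> (e / M\<^sup>2) * (M * \<bar>u\<bar>)\<^sup>2"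
        using XM[of u] that M \<open>e > 0\<close> by (intro mult_left_mono abs_le_square_iff[THEN iffD1]) auto
      also have "\<dots> = e * u\<^sup>2" using M by (simp add: power_mult_distrib)
      finally show ?thesis .
    qed
    then show ?thesis using r s \<delta> by (intro exI[of _ "min (min r s) \<delta>"]) auto
  qed
  have z: "D 1 0 \<bullet> N - 2 * l * X 0 * (D 1 0 \<bullet> T) = 0" "D 2 0 \<bullet> N - 2 * l * (D 1 0 \<bullet> T) * (D 1 0 \<bullet> T) = 0"
    by (rule peano_second_order_zero[OF \<delta> d\<phi> d\<phi>2 small]; assumption?)+
  have z1: "D 1 0 \<bullet> N = 0" using z(1) by (simp add: X_def c0)
  have nz: "D 1 0 \<noteq> 0" using reg vd[of 0] \<delta> by auto
  have n: "(norm (D 1 0))\<^sup>2 = (D 1 0 \<bullet> T)\<^sup>2" using TN[of "D 1 0"] z1 by simp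
  then have "D 2 0 \<bullet> N = 2 * l * (norm (D 1 0))\<^sup>2" using z(2) by (simp add: power2_eq_square)
  then show ?thesis using nz vd[of 0] \<delta> unfolding vd2 by simp
qed

section \<open>Tubular neighbourhoods\<close>

lemma periodic_int:
  assumes "\<And>t::real. g (t + 1) = g t" shows "g (t + of_int j) = g t"
proof -
  have n: "g (t + of_nat n) = g t" for t n
  proof (induction n)
    case (Suc n) then show ?case using assms[of "t + of_nat n"] by (simp add: add_ac)
  qed simp
  show ?thesis
  proof (cases "j \<ge> 0")
    case True then show ?thesis using n[of t "nat j"] by simp
  next
    case False then show ?thesis using n[of "t + of_int j" "nat (- j)"] by simp
  qed
qed

locale curve_tube = strip x y nx ny v k f e0 v0 d
  for x y nx ny v k f :: "real \<Rightarrow> real" and e0 v0 d :: real +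
  fixes \<Omega> :: "(real^2) set" and \<gamma> :: "real \<Rightarrow> real^2"
  assumes \<Omega>: "open \<Omega>" "\<Omega> \<noteq> {}" "bounded \<Omega>"
    and \<gamma>_eq: "\<And>t. \<gamma> t = vec2 (x t) (y t)" and \<gamma>_inj: "inj_on \<gamma> {0..<1}" and \<gamma>_range: "range \<gamma> = frontier \<Omega>"
begin

definition \<Phi> :: "real \<Rightarrow> real \<Rightarrow> real^2" where "\<Phi> t s = vec2 (x t + s * nx t) (y t + s * ny t)"
definition N :: "real \<Rightarrow> real^2" where "N t = vec2 (nx t) (ny t)"
definition Tg :: "real \<Rightarrow> real^2" where "Tg t = vec2 (- ny t) (nx t)"

lemma \<Phi>_nth: "\<Phi> t s $ 1 = x t + s * nx t" "\<Phi> t s $ 2 = y t + s * ny t"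
  by (simp_all add: \<Phi>_def)

lemma \<Phi>_alt: "\<Phi> t s = \<gamma> t + s *\<^sub>R N t"
  by (simp add: \<Phi>_def \<gamma>_eq N_def vec2_eq_iff)

lemma \<Phi>_0: "\<Phi> t 0 = \<gamma> t" by (simp add: \<Phi>_alt)

lemma per_int: "x (t + of_int j) = x t" "y (t + of_int j) = y t" "nx (t + of_int j) = nx t" "ny (t + of_int j) = ny t"
  by (auto intro!: periodic_int per)

lemma \<Phi>_int: "\<Phi> (t + of_int j) s = \<Phi> t s"
  by (simp add: \<Phi>_def per_int)

lemma \<gamma>_int: "\<gamma> (t + of_int j) = \<gamma> t"
  by (simp add: \<gamma>_eq per_int)

lemma N_int: "N (t + of_int j) = N t"
  by (simp add: N_def per_int)

lemma norm_N: "norm (N t) = 1"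
  using unit[of t] by (simp add: norm_eq_sqrt_inner inner_2 N_def power2_eq_square)

lemma norm_decomp: "(norm z)\<^sup>2 = (z \<bullet> Tg t)\<^sup>2 + (z \<bullet> N t)\<^sup>2"
proof -
  have "(z \<bullet> Tg t)\<^sup>2 + (z \<bullet> N t)\<^sup>2 = (norm z)\<^sup>2 * ((nx t)\<^sup>2 + (ny t)\<^sup>2)"
    unfolding power2_norm_eq_inner by (simp add: inner_2 Tg_def N_def power2_eq_square algebra_simps)
  then show ?thesis using unit by simp
qed

lemma cont\<Phi>: "continuous_on S (\<lambda>p. \<Phi> (fst p) (snd p))"
  unfolding \<Phi>_def
  by (intro continuous_intros continuous_on_compose2[OF cont(1)[of UNIV]] continuous_on_compose2[OF cont(2)[of UNIV]]
      continuous_on_compose2[OF cont(3)[of UNIV]] continuous_on_compose2[OF cont(4)[of UNIV]]) auto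

lemma cont\<gamma>: "continuous_on S \<gamma>"
  unfolding \<gamma>_eq[abs_def] by (intro continuous_intros cont)

lemma \<gamma>_deriv: "(\<gamma> has_vector_derivative v t *\<^sub>R Tg t) (at t)"
proof -
  have "((\<lambda>t. \<gamma> t $ i) has_real_derivative (v t *\<^sub>R Tg t) $ i) (at t)" for i
    using xd[of t] yd[of t] exhaust_2[of i] by (auto simp: \<gamma>_eq Tg_def)
  then show ?thesis
    unfolding has_vector_derivative_def has_real_derivative_iff_has_vector_derivative
    by (subst has_derivative_componentwise_within)
       (auto simp: Basis_vec_def inner_axis has_vector_derivative_def mult.assoc)
qed

text \<open>Project onto the tangent at t: the whole normal segment at t has the same projection
  \<open>p t\<close>. Along the parallel curve at offset s' the projection is strictly monotone in
  the window, as the normals there have inner product at least 24/25 and 1 + s' k is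
  positive.\<close>

lemma local_injective:
  assumes "\<bar>t' - t\<bar> \<le> d" "\<bar>s'\<bar> \<le> e0" "\<Phi> t s = \<Phi> t' s'" shows "t = t' \<and> s = s'"
proof -
  define p where "p u = (x u + s' * nx u) * (- ny t) + (y u + s' * ny u) * nx t" for u
  have pd: "(p has_real_derivative (1 + s' * k u) * v u * (nx t * nx u + ny t * ny u)) (at u)" for u
    unfolding p_def by (auto intro!: derivative_eq_intros xd yd nxd nyd simp: algebra_simps)
  have nz: "(1 + s' * k u) * v u * (nx t * nx u + ny t * ny u) \<noteq> 0" if "\<bar>u - t\<bar> \<le> d" for u
    using k_lower(1)[OF assms(2), of u] v0(1) v0(2)[of u] d(2)[of "u - t" t] that by auto
  have "p t' = (x t + s * nx t) * (- ny t) + (y t + s * ny t) * nx t"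
    using assms(3) unfolding p_def \<Phi>_def by (simp add: vec2_eq_iff)
  then have pp: "p t' = p t" by (simp add: p_def algebra_simps)
  have tt: "t = t'"
  proof (rule ccontr)
    assume "t \<noteq> t'"
    then consider "t < t'" | "t' < t" by linarith
    then obtain z where "\<bar>z - t\<bar> \<le> d" "(1 + s' * k z) * v z * (nx t * nx z + ny t * ny z) = 0"
    proof cases
      case 1
      from MVT2[OF 1 pd] obtain z where "t < z" "z < t'" "p t' - p t = (t' - t) * ((1 + s' * k z) * v z * (nx t * nx z + ny t * ny z))" by blast
      then show ?thesis using that[of z] 1 pp assms(1) by auto
    next
      case 2
      from MVT2[OF 2 pd] obtain z where "t' < z" "z < t" "p t - p t' = (t - t') * ((1 + s' * k z) * v z * (nx t * nx z + ny t * ny z))" by blast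
      then show ?thesis using that[of z] 2 pp assms(1) by auto
    qed
    then show False using nz by blast
  qed
  then have "s *\<^sub>R N t = s' *\<^sub>R N t" using assms(3) by (simp add: \<Phi>_alt)
  moreover have "N t \<noteq> 0" using norm_N[of t] by auto
  ultimately show ?thesis using tt by simp
qed

text \<open>Pairs of parameters in the unit square at distance at least d modulo 1 form a compact
  set on which the distance of the curve points is positive by injectivity, hence bounded below.
  Fractional parts reduce arbitrary parameters to such pairs.\<close>

lemma \<gamma>_separated: "\<exists>\<rho>>0. \<forall>t t'. dist (\<gamma> t) (\<gamma> t') < \<rho> \<longrightarrow> (\<exists>j::int. \<bar>t' - t - of_int j\<bar> < d)"
proof -
  define C where "C = ({0..1} \<times> {0..1}) \<inter> {p::real\<times>real. d \<le> \<bar>snd p - fst p\<bar>} \<inter> {p. d \<le> \<bar>snd p - fst p - 1\<bar>} \<inter> {p. d \<le> \<bar>snd p - fst p + 1\<bar>}"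
  have C: "compact C" unfolding C_def
    by (intro compact_Int_closed compact_Times closed_Collect_le continuous_intros) auto
  have "\<exists>\<rho>>0. \<forall>p\<in>C. \<rho> \<le> dist (\<gamma> (fst p)) (\<gamma> (snd p))"
  proof (cases "C = {}")
    case True then show ?thesis by (intro exI[of _ 1]) auto
  next
    case False
    have "continuous_on C (\<lambda>p. dist (\<gamma> (fst p)) (\<gamma> (snd p)))"
      by (intro continuous_intros continuous_on_compose2[OF cont\<gamma>[of UNIV]]) auto
    from continuous_attains_inf[OF C False this] obtain p where p: "p \<in> C" "\<And>q. q \<in> C \<Longrightarrow> dist (\<gamma> (fst p)) (\<gamma> (snd p)) \<le> dist (\<gamma> (fst q)) (\<gamma> (snd q))" by blast
    have "\<gamma> (fst p) \<noteq> \<gamma> (snd p)"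
    proof
      assume eq: "\<gamma> (fst p) = \<gamma> (snd p)"
      have r: "fst p \<in> {0..1}" "snd p \<in> {0..1}" using p(1) by (auto simp: C_def)
      \<comment> \<open>Injectivity is given on the half-open period, so the parameter 1 is folded
        to 0; this cannot make distinct pairs in \<open>C\<close> coincide, because \<open>C\<close>
        keeps differences away from 0, 1 and -1.\<close>
      define a b where "a = (if fst p = 1 then 0 else fst p)" and "b = (if snd p = 1 then 0 else snd p)"
      have "\<gamma> 1 = \<gamma> 0" using \<gamma>_int[of 0 1] by simp
      then have "\<gamma> a = \<gamma> b" using eq by (auto simp: a_def b_def)
      then have "a = b" using inj_onD[OF \<gamma>_inj, of a b] r by (auto simp: a_def b_def split: if_splits)
      then show False using p(1) d(1) by (auto simp: a_def b_def C_def split: if_splits)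
    qed
    then show ?thesis using p(2) by (intro exI[of _ "dist (\<gamma> (fst p)) (\<gamma> (snd p))"]) auto
  qed
  then obtain \<rho> where \<rho>: "\<rho> > 0" "\<And>p. p \<in> C \<Longrightarrow> \<rho> \<le> dist (\<gamma> (fst p)) (\<gamma> (snd p))" by blast
  have "\<exists>j::int. \<bar>t' - t - of_int j\<bar> < d" if "dist (\<gamma> t) (\<gamma> t') < \<rho>" for t t'
  proof (rule ccontr)
    assume no: "\<nexists>j::int. \<bar>t' - t - of_int j\<bar> < d"
    have "d \<le> \<bar>frac t' - frac t - of_int i\<bar>" for i
      using no[unfolded not_ex, rule_format, of "\<lfloor>t'\<rfloor> - \<lfloor>t\<rfloor> + i"] by (simp add: frac_def algebra_simps not_less)
    from this[of 0] this[of 1] this[of "-1"] have "(frac t, frac t') \<in> C"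
      using frac_ge_0[of t] frac_ge_0[of t'] frac_lt_1[of t] frac_lt_1[of t'] by (auto simp: C_def)
    from \<rho>(2)[OF this] have "\<rho> \<le> dist (\<gamma> (frac t)) (\<gamma> (frac t'))" by simp
    moreover have "\<gamma> (frac t) = \<gamma> t" for t using \<gamma>_int[of "frac t" "\<lfloor>t\<rfloor>"] by (simp add: frac_def)
    ultimately show False using that by simp
  qed
  then show ?thesis using \<rho>(1) by blast
qed

lemma global_injective:
  "\<exists>e1>0. e1 \<le> e0 \<and> (\<forall>t s t' s'. \<bar>s\<bar> \<le> e1 \<longrightarrow> \<bar>s'\<bar> \<le> e1 \<longrightarrow> \<Phi> t s = \<Phi> t' s' \<longrightarrow> s = s' \<and> (\<exists>j::int. t' = t + of_int j))"
proof -
  obtain \<rho> where \<rho>: "\<rho> > 0" "\<And>t t'. dist (\<gamma> t) (\<gamma> t') < \<rho> \<Longrightarrow> \<exists>j::int. \<bar>t' - t - of_int j\<bar> < d"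
    using \<gamma>_separated by blast
  \<comment> \<open>Two normal segments of length at most \<rho>/3 that meet have feet at distance
    at most 2\<rho>/3 < \<rho>, so their parameters lie within d modulo 1 and local injectivity
    applies.\<close>
  define e1 where "e1 = min e0 (\<rho> / 3)"
  have "s = s' \<and> (\<exists>j::int. t' = t + of_int j)" if a: "\<bar>s\<bar> \<le> e1" "\<bar>s'\<bar> \<le> e1" "\<Phi> t s = \<Phi> t' s'" for t s t' s'
  proof -
    have "\<gamma> t - \<gamma> t' = s' *\<^sub>R N t' - s *\<^sub>R N t" using a(3) by (simp add: \<Phi>_alt algebra_simps)
    then have "dist (\<gamma> t) (\<gamma> t') \<le> \<bar>s'\<bar> + \<bar>s\<bar>"
      unfolding dist_norm using norm_triangle_ineq4[of "s' *\<^sub>R N t'" "s *\<^sub>R N t"] by (simp add: norm_N)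
    also have "\<dots> < \<rho>" using a \<rho>(1) by (auto simp: e1_def)
    finally obtain j :: int where j: "\<bar>t' - t - of_int j\<bar> < d" using \<rho>(2) by blast
    have "\<Phi> t s = \<Phi> (t' - of_int j) s'" using a(3) \<Phi>_int[of "t' - of_int j" j s'] by simp
    with local_injective[of "t' - of_int j" t s' s] j a(2) show ?thesis
      by (auto simp: e1_def algebra_simps intro: exI[of _ j])
  qed
  moreover have "e1 > 0" "e1 \<le> e0" using \<rho> e0 by (auto simp: e1_def)
  ultimately show ?thesis by blast
qed

end

section \<open>Closest points and the two sides of the curve\<close>

locale curve_tube_inj = curve_tube +
  fixes e1 :: real
  assumes e1: "0 < e1" "e1 \<le> e0"
    and \<Phi>_inj: "\<And>t s t' s'. \<bar>s\<bar> \<le> e1 \<Longrightarrow> \<bar>s'\<bar> \<le> e1 \<Longrightarrow> \<Phi> t s = \<Phi> t' s' \<Longrightarrow> s = s' \<and> (\<exists>j::int. t' = t + of_int j)"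
begin

abbreviation \<Gamma> where "\<Gamma> \<equiv> frontier \<Omega>"

lemma \<Gamma>: "closed \<Gamma>" "\<Gamma> \<noteq> {}" "\<gamma> t \<in> \<Gamma>"
  using \<gamma>_range by auto

text \<open>At a closest point the squared distance is stationary in the parameter, so the
  connecting vector has no tangential component and is a multiple of the normal.\<close>

lemma closest_rep:
  assumes p: "p \<in> \<Gamma>" "\<And>q. q \<in> \<Gamma> \<Longrightarrow> dist z p \<le> dist z q"
  obtains t s where "p = \<gamma> t" "z = \<Phi> t s" "\<bar>s\<bar> = dist z p"
proof -
  obtain t where t: "p = \<gamma> t" using p(1) \<gamma>_range by blast
  define s where "s = (z - \<gamma> t) \<bullet> N t"
  define g where "g u = (norm (z - \<gamma> u))\<^sup>2" for u
  have gd: "(g has_real_derivative - 2 * ((z - \<gamma> u) \<bullet> (v u *\<^sub>R Tg u))) (at u)" for u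
  proof -
    have "g = (\<lambda>u. (z $ 1 - x u)\<^sup>2 + (z $ 2 - y u)\<^sup>2)"
      unfolding g_def power2_norm_eq_inner inner_2 \<gamma>_eq by (simp add: power2_eq_square fun_eq_iff)
    then show ?thesis
      by (auto intro!: derivative_eq_intros xd yd simp: inner_2 \<gamma>_eq Tg_def algebra_simps)
  qed
  have gmin: "g t \<le> g u" for u
    using p(2)[OF \<Gamma>(3), of u] unfolding g_def t dist_norm by (intro power_mono) auto
  have "- 2 * ((z - \<gamma> t) \<bullet> (v t *\<^sub>R Tg t)) = 0"
    using gmin by (intro DERIV_local_min[OF gd zero_less_one]) auto
  moreover have "v t \<noteq> 0" using v0(1) v0(2)[of t] by auto
  ultimately have o: "(z - \<gamma> t) \<bullet> Tg t = 0" by simp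
  have "(norm ((z - \<gamma> t) - s *\<^sub>R N t))\<^sup>2 = 0"
    using norm_N[of t] o unfolding norm_decomp[of _ t]
    by (simp add: inner_diff_left s_def dot_square_norm) (simp add: inner_2 N_def Tg_def)
  then have z: "z = \<Phi> t s" by (simp add: \<Phi>_alt algebra_simps)
  moreover have "\<bar>s\<bar> = dist z p" unfolding t z by (simp add: \<Phi>_alt dist_norm norm_N)
  ultimately show thesis using that t by blast
qed

lemma infdist_rep: obtains t s where "z = \<Phi> t s" "\<bar>s\<bar> = infdist z \<Gamma>"
proof -
  obtain p where p: "p \<in> \<Gamma>" "infdist z \<Gamma> = dist z p" using infdist_attains_inf[OF \<Gamma>(1,2)] by blast
  then have "dist z p \<le> dist z q" if "q \<in> \<Gamma>" for q using infdist_le[OF that, of z] by simp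
  from closest_rep[OF p(1) this] that p(2) show thesis by metis
qed

text \<open>Any closest point yields another pair of tube coordinates, with offset no larger than
  |s|. Injectivity up to e1 makes the two pairs agree up to an integer shift of the
  parameter.\<close>

lemma closest_\<Phi>: assumes "\<bar>s\<bar> \<le> e1" shows "closest_point \<Gamma> (\<Phi> t s) = \<gamma> t" "infdist (\<Phi> t s) \<Gamma> = \<bar>s\<bar>"
proof -
  have c: "closest_point \<Gamma> (\<Phi> t s) \<in> \<Gamma>" "\<And>q. q \<in> \<Gamma> \<Longrightarrow> dist (\<Phi> t s) (closest_point \<Gamma> (\<Phi> t s)) \<le> dist (\<Phi> t s) q"
    using closest_point_exists[OF \<Gamma>(1,2)] by auto
  obtain t' s' where ts: "closest_point \<Gamma> (\<Phi> t s) = \<gamma> t'" "\<Phi> t s = \<Phi> t' s'" "\<bar>s'\<bar> = dist (\<Phi> t s) (closest_point \<Gamma> (\<Phi> t s))"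
    using closest_rep[OF c] by metis
  have "dist (\<Phi> t s) (\<gamma> t) = \<bar>s\<bar>" by (simp add: \<Phi>_alt dist_norm norm_N)
  then have "\<bar>s'\<bar> \<le> e1" using c(2)[OF \<Gamma>(3), of t] ts(3) assms by simp
  from \<Phi>_inj[OF assms this ts(2)] obtain j :: int where j: "s = s'" "t' = t + of_int j" by blast
  then show "closest_point \<Gamma> (\<Phi> t s) = \<gamma> t" using ts(1) \<gamma>_int by simp
  obtain t2 s2 where 2: "\<Phi> t s = \<Phi> t2 s2" "\<bar>s2\<bar> = infdist (\<Phi> t s) \<Gamma>" using infdist_rep by metis
  have "infdist (\<Phi> t s) \<Gamma> \<le> \<bar>s\<bar>" using infdist_le[OF \<Gamma>(3), of "\<Phi> t s" t] \<open>dist (\<Phi> t s) (\<gamma> t) = \<bar>s\<bar>\<close> by simp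
  then have "\<bar>s2\<bar> \<le> e1" using 2 assms by simp
  from \<Phi>_inj[OF assms this 2(1)] 2(2) show "infdist (\<Phi> t s) \<Gamma> = \<bar>s\<bar>" by simp
qed

lemma tube_eq: assumes "\<epsilon> \<le> e1" shows "tube \<Gamma> \<epsilon> = {\<Phi> t s |t s. \<bar>s\<bar> \<le> \<epsilon>}"
proof (intro set_eqI iffI)
  fix z assume "z \<in> tube \<Gamma> \<epsilon>"
  then show "z \<in> {\<Phi> t s |t s. \<bar>s\<bar> \<le> \<epsilon>}" using infdist_rep[of z] by (auto simp: tube_def) metis
next
  fix z assume "z \<in> {\<Phi> t s |t s. \<bar>s\<bar> \<le> \<epsilon>}"
  then show "z \<in> tube \<Gamma> \<epsilon>" using closest_\<Phi>(2) assms by (auto simp: tube_def)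
qed

definition nbhd :: "(real^2) set" where "nbhd = {z. infdist z \<Gamma> < e1}"

lemma open_nbhd: "open nbhd"
  unfolding nbhd_def by (intro open_Collect_less continuous_intros)

lemma nbhd_rep: "z \<in> nbhd \<Longrightarrow> \<exists>t s. z = \<Phi> t s \<and> \<bar>s\<bar> < e1"
  using infdist_rep[of z] by (auto simp: nbhd_def) metis

lemma nbhdI: "\<bar>s\<bar> < e1 \<Longrightarrow> \<Phi> t s \<in> nbhd"
  using closest_\<Phi>(2) by (simp add: nbhd_def)

lemma \<Phi>_notin_\<Gamma>: assumes "s \<noteq> 0" "\<bar>s\<bar> \<le> e1" shows "\<Phi> t s \<notin> \<Gamma>"
proof
  assume "\<Phi> t s \<in> \<Gamma>"
  then obtain t' where "\<Phi> t s = \<Phi> t' 0" using \<gamma>_range \<Phi>_0 by (metis imageE)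
  then show False using \<Phi>_inj[of s 0 t t'] assms e1 by simp
qed

text \<open>Offsets in a connected set without 0 sweep out a connected set that avoids the frontier,
  so it lies either in the domain or off its closure. This holds for all parameters at once.\<close>

lemma side:
  assumes "connected I" "\<And>s. s \<in> I \<Longrightarrow> s \<noteq> 0 \<and> \<bar>s\<bar> < e1"
  shows "(\<forall>t. \<forall>s\<in>I. \<Phi> t s \<in> \<Omega>) \<or> (\<forall>t. \<forall>s\<in>I. \<Phi> t s \<notin> closure \<Omega>)"
proof -
  let ?S = "(\<lambda>p. \<Phi> (fst p) (snd p)) ` (UNIV \<times> I)"
  have "connected ?S" by (intro connected_continuous_image cont\<Phi> connected_Times assms(1)) simp
  moreover have "\<Phi> t s \<notin> \<Gamma>" if "s \<in> I" for t s
    using \<Phi>_notin_\<Gamma>[of s t] assms(2)[OF that] by auto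
  then have disj: "?S \<inter> \<Gamma> = {}" by auto
  ultimately have "?S \<inter> \<Omega> = {} \<or> ?S - \<Omega> = {}" using connected_Int_frontier[of ?S \<Omega>] by blast
  then show ?thesis
  proof
    assume "?S \<inter> \<Omega> = {}"
    moreover have "closure \<Omega> = \<Omega> \<union> \<Gamma>" by (simp add: closure_Un_frontier)
    ultimately have "?S \<inter> closure \<Omega> = {}" using disj by blast
    then show ?thesis by force
  next
    assume "?S - \<Omega> = {}" then show ?thesis by force
  qed
qed

text \<open>If both sides were inside, the closure would be the union of the domain and the tube, so
  open as well as closed, against boundedness. If both were outside, the tube would be an open
  neighbourhood of the frontier that misses the domain.\<close>

lemma sides_differ:
  "\<not> ((\<forall>t. \<forall>s\<in>{0<..<e1}. \<Phi> t s \<in> \<Omega>) \<and> (\<forall>t. \<forall>s\<in>{-e1<..<0}. \<Phi> t s \<in> \<Omega>))"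
  "\<not> ((\<forall>t. \<forall>s\<in>{0<..<e1}. \<Phi> t s \<notin> closure \<Omega>) \<and> (\<forall>t. \<forall>s\<in>{-e1<..<0}. \<Phi> t s \<notin> closure \<Omega>))"
proof -
  have trich: "s \<in> {0<..<e1} \<or> s \<in> {-e1<..<0} \<or> s = 0" if "\<bar>s\<bar> < e1" for s using that by auto
  show "\<not> ((\<forall>t. \<forall>s\<in>{0<..<e1}. \<Phi> t s \<in> \<Omega>) \<and> (\<forall>t. \<forall>s\<in>{-e1<..<0}. \<Phi> t s \<in> \<Omega>))"
  proof
    assume a: "(\<forall>t. \<forall>s\<in>{0<..<e1}. \<Phi> t s \<in> \<Omega>) \<and> (\<forall>t. \<forall>s\<in>{-e1<..<0}. \<Phi> t s \<in> \<Omega>)"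
    have "nbhd \<subseteq> \<Omega> \<union> \<Gamma>"
    proof
      fix z assume "z \<in> nbhd"
      then obtain t s where z: "z = \<Phi> t s" "\<bar>s\<bar> < e1" using nbhd_rep by blast
      then show "z \<in> \<Omega> \<union> \<Gamma>" using a trich[OF z(2)] \<Phi>_0 \<Gamma>(3) by auto
    qed
    moreover have "\<Gamma> \<subseteq> nbhd" using e1 by (auto simp: nbhd_def)
    moreover have "closure \<Omega> = \<Omega> \<union> \<Gamma>" by (simp add: closure_Un_frontier)
    ultimately have "closure \<Omega> = \<Omega> \<union> nbhd" by blast
    then have "open (closure \<Omega>)" using \<Omega>(1) open_nbhd by (simp add: open_Un)
    then have "closure \<Omega> = {} \<or> closure \<Omega> = UNIV" using clopen[of "closure \<Omega>"] by simp
    then show False using \<Omega> bounded_closure[OF \<Omega>(3)] not_bounded_UNIV by auto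
  qed
  show "\<not> ((\<forall>t. \<forall>s\<in>{0<..<e1}. \<Phi> t s \<notin> closure \<Omega>) \<and> (\<forall>t. \<forall>s\<in>{-e1<..<0}. \<Phi> t s \<notin> closure \<Omega>))"
  proof
    assume a: "(\<forall>t. \<forall>s\<in>{0<..<e1}. \<Phi> t s \<notin> closure \<Omega>) \<and> (\<forall>t. \<forall>s\<in>{-e1<..<0}. \<Phi> t s \<notin> closure \<Omega>)"
    have "nbhd \<inter> \<Omega> = {}"
    proof (rule ccontr)
      assume "nbhd \<inter> \<Omega> \<noteq> {}"
      then obtain t s where z: "\<Phi> t s \<in> \<Omega>" "\<bar>s\<bar> < e1" using nbhd_rep by blast
      then have "s \<noteq> 0" using \<Phi>_0 \<Gamma>(3) \<Omega>(1) by (metis Diff_iff frontier_def interior_open)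
      then show False using a trich[OF z(2)] z(1) closure_subset by blast
    qed
    then have "nbhd \<inter> closure \<Omega> = {}" using open_nbhd by (simp add: open_Int_closure_eq_empty)
    moreover have "\<gamma> 0 \<in> nbhd \<inter> closure \<Omega>" using e1 \<Gamma>(3)[of 0] by (auto simp: nbhd_def frontier_def)
    ultimately show False by blast
  qed
qed

lemma orientation:
  "((\<forall>t. \<forall>s\<in>{0<..<e1}. \<Phi> t s \<notin> closure \<Omega>) \<and> (\<forall>t. \<forall>s\<in>{-e1<..<0}. \<Phi> t s \<in> \<Omega>)) \<or>
   ((\<forall>t. \<forall>s\<in>{0<..<e1}. \<Phi> t s \<in> \<Omega>) \<and> (\<forall>t. \<forall>s\<in>{-e1<..<0}. \<Phi> t s \<notin> closure \<Omega>))"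
  using side[of "{0<..<e1}"] side[of "{-e1<..<0}"] sides_differ by auto

end

section \<open>Outward normal, signed distance and curvature of level curves\<close>

lemma smooth_bdd_derivE:
  assumes "smooth_bdd g"
  obtains g' where "\<And>t. (g has_real_derivative g' t) (at t)" "continuous_on UNIV g'"
proof -
  have "bs (Suc 0) UNIV {()} (\<lambda>_. g)" using assms by (auto simp: smooth_bdd_def simp del: bs.simps)
  then obtain a' where a: "\<And>t. (g has_real_derivative a' () t) (at t)" "bs 0 UNIV {()} a'" by auto
  then show thesis by (intro that[of "a' ()"]) (auto simp: bounded_cont_def)
qed

lemma enat_less_2: "enat n < 2 \<longleftrightarrow> n = 0 \<or> n = 1" and enat_le_2: "enat n \<le> 2 \<longleftrightarrow> n = 0 \<or> n = 1 \<or> n = 2"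
  by (auto simp: numeral_eq_enat)

lemma has_vector_derivative_vec2:
  assumes "(g has_real_derivative g') (at t within S)" "(h has_real_derivative h') (at t within S)"
  shows "((\<lambda>t. vec2 (g t) (h t)) has_vector_derivative vec2 g' h') (at t within S)"
proof -
  have "((\<lambda>t. vec2 (g t) (h t) $ i) has_real_derivative vec2 g' h' $ i) (at t within S)" for i
    using assms exhaust_2[of i] by auto
  then show ?thesis
    unfolding has_vector_derivative_def has_real_derivative_iff_has_vector_derivative
    by (subst has_derivative_componentwise_within)
       (auto simp: Basis_vec_def inner_axis has_vector_derivative_def)
qed

locale curve_out = curve_tube_inj +
  assumes outside: "\<And>t s. 0 < s \<Longrightarrow> s < e1 \<Longrightarrow> \<Phi> t s \<notin> closure \<Omega>"
    and inside: "\<And>t s. 0 < s \<Longrightarrow> s < e1 \<Longrightarrow> \<Phi> t (- s) \<in> \<Omega>"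
begin

text \<open>Orthogonality to the tangent and norm 1 leave only N and -N, and -N points into the
  domain. Other parameters of the same point differ by integers and have the same normal, so the
  orthogonality condition is consistent.\<close>

lemma outward_normal_\<gamma>: "outward_normal \<Omega> \<gamma> (\<gamma> t) = N t"
  unfolding outward_normal_def
proof (rule the_equality)
  have orth: "orthogonal (N u) (vector_derivative \<gamma> (at u))" for u
    unfolding vector_derivative_at[OF \<gamma>_deriv] orthogonal_def by (simp add: inner_2 N_def Tg_def)
  have same: "N u = N t" if "\<gamma> u = \<gamma> t" for u
  proof -
    have "\<Phi> t 0 = \<Phi> u 0" using that by (simp add: \<Phi>_0)
    from \<Phi>_inj[OF _ _ this] e1 obtain j :: int where "u = t + of_int j" by auto
    then show ?thesis by (simp add: N_int)
  qed
  show "norm (N t) = 1 \<and> (\<forall>u. \<gamma> u = \<gamma> t \<longrightarrow> orthogonal (N t) (vector_derivative \<gamma> (at u))) \<and>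
    (\<exists>\<delta>>0. \<forall>s\<in>{0<..<\<delta>}. \<gamma> t + s *\<^sub>R N t \<notin> closure \<Omega>)"
  proof (intro conjI allI impI)
    fix u assume "\<gamma> u = \<gamma> t"
    from same[OF this] orth[of u] show "orthogonal (N t) (vector_derivative \<gamma> (at u))" by simp
  next
    show "\<exists>\<delta>>0. \<forall>s\<in>{0<..<\<delta>}. \<gamma> t + s *\<^sub>R N t \<notin> closure \<Omega>"
      using e1 outside by (intro exI[of _ e1]) (auto simp: \<Phi>_alt)
  qed (rule norm_N)
  fix \<nu> assume \<nu>: "norm \<nu> = 1 \<and> (\<forall>u. \<gamma> u = \<gamma> t \<longrightarrow> orthogonal \<nu> (vector_derivative \<gamma> (at u))) \<and>
    (\<exists>\<delta>>0. \<forall>s\<in>{0<..<\<delta>}. \<gamma> t + s *\<^sub>R \<nu> \<notin> closure \<Omega>)"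
  then obtain \<delta> where \<delta>: "\<delta> > 0" "\<And>s. 0 < s \<Longrightarrow> s < \<delta> \<Longrightarrow> \<gamma> t + s *\<^sub>R \<nu> \<notin> closure \<Omega>" by auto
  have "orthogonal \<nu> (v t *\<^sub>R Tg t)" using \<nu> vector_derivative_at[OF \<gamma>_deriv[of t]] by auto
  moreover have "v t \<noteq> 0" using v0(1) v0(2)[of t] by auto
  ultimately have T: "\<nu> \<bullet> Tg t = 0" by (simp add: orthogonal_def)
  have "(\<nu> \<bullet> N t)\<^sup>2 = 1" using norm_decomp[of \<nu> t] \<nu> T by simp
  then have pm: "\<nu> \<bullet> N t = 1 \<or> \<nu> \<bullet> N t = -1" by (simp add: power2_eq_1_iff)
  have "(norm (\<nu> - (\<nu> \<bullet> N t) *\<^sub>R N t))\<^sup>2 = 0"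
  proof -
    have NT: "N t \<bullet> Tg t = 0" by (simp add: inner_2 N_def Tg_def)
    have NN: "N t \<bullet> N t = 1" using norm_N[of t] by (simp add: dot_square_norm)
    show ?thesis unfolding norm_decomp[of _ t] by (simp add: inner_diff_left T NT NN)
  qed
  then have e: "\<nu> = (\<nu> \<bullet> N t) *\<^sub>R N t" by simp
  show "\<nu> = N t"
  proof (cases "\<nu> \<bullet> N t = 1")
    case True then show ?thesis using e by simp
  next
    case False
    then have "\<nu> = - N t" using e pm by auto
    moreover define s where "s = min (\<delta> / 2) (e1 / 2)"
    have s: "0 < s" "s < \<delta>" "s < e1" using \<delta>(1) e1 by (auto simp: s_def)
    ultimately have "\<gamma> t + s *\<^sub>R \<nu> = \<Phi> t (- s)" by (simp add: \<Phi>_alt)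
    then show ?thesis using inside[OF s(1,3), of t] \<delta>(2)[OF s(1,2)] closure_subset[of \<Omega>] by auto
  qed
qed

lemma signed_dist_\<Phi>: "\<bar>s\<bar> \<le> e1 \<Longrightarrow> signed_dist \<Omega> \<gamma> (\<Phi> t s) = s"
  using norm_N[of t] by (simp add: signed_dist_def Let_def closest_\<Phi> outward_normal_\<gamma>) (simp add: \<Phi>_alt dot_square_norm)

text \<open>Within the tube the level set is a whole closed parallel curve. Removing the compact
  image of the complementary parameter arc from the open tube leaves a neighbourhood that contains
  just the short arc.\<close>

lemma level_set_local:
  assumes s: "\<bar>s\<bar> < e1" and \<delta>: "0 < \<delta>" "\<delta> \<le> 1 / 2"
  shows "\<exists>U. open U \<and> \<Phi> t s \<in> U \<and> {z. signed_dist \<Omega> \<gamma> z = s} \<inter> U = (\<lambda>u. \<Phi> (t + u) s) ` {-\<delta><..<\<delta>}"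
proof -
  define B where "B = (\<lambda>u. \<Phi> u s) ` {t + \<delta>..t + 1 - \<delta>}"
  have "continuous_on {t + \<delta>..t + 1 - \<delta>} (\<lambda>u. \<Phi> (fst (u, s)) (snd (u, s)))"
    by (rule continuous_on_compose2[OF cont\<Phi>[of UNIV]]) (auto intro!: continuous_intros)
  then have "compact B" unfolding B_def by (intro compact_continuous_image) auto
  then have op: "open (nbhd - B)" using open_nbhd compact_imp_closed by (intro open_Diff)
  have s': "\<bar>s\<bar> \<le> e1" using s by simp
  have notB: "\<Phi> (t + u) s \<notin> B" if "\<bar>u\<bar> < \<delta>" for u
  proof
    assume "\<Phi> (t + u) s \<in> B"
    then obtain w where w: "w \<in> {t + \<delta>..t + 1 - \<delta>}" "\<Phi> (t + u) s = \<Phi> w s" by (auto simp: B_def)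
    from \<Phi>_inj[OF s' s' w(2)] obtain j :: int where j: "w = t + u + of_int j" by blast
    have "0 < real_of_int j" "real_of_int j < 1" using w(1) that j by auto
    then show False by simp
  qed
  have "{z. signed_dist \<Omega> \<gamma> z = s} \<inter> (nbhd - B) = (\<lambda>u. \<Phi> (t + u) s) ` {-\<delta><..<\<delta>}"
  proof (intro set_eqI iffI)
    fix z assume z: "z \<in> {z. signed_dist \<Omega> \<gamma> z = s} \<inter> (nbhd - B)"
    then obtain w r where w: "z = \<Phi> w r" "\<bar>r\<bar> < e1" using nbhd_rep by blast
    then have r: "r = s" using z signed_dist_\<Phi>[of r w] by simp
    define j where "j = \<lfloor>w - t + \<delta>\<rfloor>"
    define u where "u = w - t - of_int j"
    have u: "- \<delta> \<le> u" "u < 1 - \<delta>" unfolding u_def j_def using floor_correct[of "w - t + \<delta>"] by linarith+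
    have zu: "z = \<Phi> (t + u) s" using \<Phi>_int[of "t + u" j s] w r by (simp add: u_def)
    have "u < \<delta>"
    proof (rule ccontr)
      assume "\<not> u < \<delta>"
      then have "z \<in> B" unfolding B_def zu using u by auto
      then show False using z by blast
    qed
    moreover have "u \<noteq> - \<delta>"
    proof
      assume "u = - \<delta>"
      then have "z = \<Phi> (t + 1 - \<delta>) s" using zu \<Phi>_int[of "t + u" 1 s] by (simp add: algebra_simps)
      then have "z \<in> B" unfolding B_def using \<delta> by auto
      then show False using z by blast
    qed
    ultimately show "z \<in> (\<lambda>u. \<Phi> (t + u) s) ` {-\<delta><..<\<delta>}" using u zu by force
  next
    fix z assume "z \<in> (\<lambda>u. \<Phi> (t + u) s) ` {-\<delta><..<\<delta>}"
    then obtain u where "z = \<Phi> (t + u) s" "\<bar>u\<bar> < \<delta>" by (auto simp: abs_less_iff)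
    then show "z \<in> {z. signed_dist \<Omega> \<gamma> z = s} \<inter> (nbhd - B)"
      using notB nbhdI[OF s] signed_dist_\<Phi>[OF s'] by auto
  qed
  moreover have "\<Phi> t s \<in> nbhd - B" using notB[of 0] nbhdI[OF s] \<delta> by simp
  ultimately show ?thesis using op by blast
qed

text \<open>A parallel curve at offset s has curvature k / (1 + s k). Its own parametrization
  witnesses this value, and second order contact with the osculating parabola rules out any
  other.\<close>

lemma level_curvature_\<Phi>:
  assumes s: "\<bar>s\<bar> < e1"
  shows "level_curvature \<Omega> \<gamma> (\<Phi> t s) = k t / (1 + s * k t)"
proof -
  let ?L = "{z. signed_dist \<Omega> \<gamma> z = s}"
  obtain k' where k': "\<And>t. (k has_real_derivative k' t) (at t)" "continuous_on UNIV k'" using smooth_bdd_derivE[OF smooth(2)] by blast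
  obtain v' where v': "\<And>t. (v has_real_derivative v' t) (at t)" "continuous_on UNIV v'" using smooth_bdd_derivE[OF smooth(1)] by blast
  define m where "m u = (1 + s * k u) * v u" for u
  define m' where "m' u = (1 + s * k u) * v' u + s * k' u * v u" for u
  define D where "D n u = (if n = 0 then \<Phi> (t + u) s else if n = 1 then vec2 (- m (t + u) * ny (t + u)) (m (t + u) * nx (t + u))
     else vec2 (- m' (t + u) * ny (t + u) - m (t + u) * (k (t + u) * (v (t + u) * nx (t + u))))
               (m' (t + u) * nx (t + u) - m (t + u) * (k (t + u) * (v (t + u) * ny (t + u)))))" for n :: nat and u
  define c where "c u = \<Phi> (t + u) s" for u
  have se: "\<bar>s\<bar> \<le> e0" using s e1 by simp
  have mnz: "m u \<noteq> 0" for u using k_lower(1)[OF se, of u] v0(1) v0(2)[of u] by (auto simp: m_def)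
  have sh: "((\<lambda>u. g (t + u)) has_real_derivative g' (t + u)) (at u within S)" if "\<And>t. (g has_real_derivative g' t) (at t)" for g g' u S
    using DERIV_shift[of g "g' (t + u)" u t] that by (simp add: add.commute has_field_derivative_at_within)
  have md: "(m has_real_derivative m' u) (at u)" for u
    unfolding m_def m'_def by (auto intro!: derivative_eq_intros k' v' simp: algebra_simps)
  have d0: "(D 0 has_vector_derivative D 1 u) (at u within S)" for u S
  proof -
    have "((\<lambda>w. x w + s * nx w) has_real_derivative - m w * ny w) (at w)" "((\<lambda>w. y w + s * ny w) has_real_derivative m w * nx w) (at w)" for w
      unfolding m_def by (auto intro!: derivative_eq_intros xd yd nxd nyd simp: algebra_simps)
    from has_vector_derivative_vec2[OF sh[OF this(1)] sh[OF this(2)]] show ?thesis by (simp add: D_def[abs_def] \<Phi>_def)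
  qed
  have d1: "(D 1 has_vector_derivative D 2 u) (at u within S)" for u S
  proof -
    have "((\<lambda>w. - m w * ny w) has_real_derivative - m' w * ny w - m w * (k w * (v w * nx w))) (at w)"
      "((\<lambda>w. m w * nx w) has_real_derivative m' w * nx w - m w * (k w * (v w * ny w))) (at w)" for w
      by (auto intro!: derivative_eq_intros md nxd nyd simp: algebra_simps)
    from has_vector_derivative_vec2[OF sh[OF this(1)] sh[OF this(2)]] show ?thesis by (simp add: D_def[abs_def])
  qed
  have cD2: "continuous_on UNIV (D 2)"
  proof -
    have cs: "continuous_on UNIV (\<lambda>u. g (t + u))" if "continuous_on UNIV g" for g :: "real \<Rightarrow> real"
      by (rule continuous_on_compose2[OF that]) (auto intro!: continuous_intros)
    note cc = cs[OF cont(3)] cs[OF cont(4)] cs[OF k'(2)] cs[OF v'(2)] cs[OF smooth_bdd_continuous[OF smooth(1)]] cs[OF smooth_bdd_continuous[OF smooth(2)]]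
    show ?thesis unfolding D_def[abs_def] m_def m'_def by (simp, intro continuous_intros cc)
  qed
  have contD: "continuous_on S (D 0)" "continuous_on S (D 1)" for S
    unfolding continuous_on_eq_continuous_within
    by (intro ballI has_vector_derivative_continuous[OF d0], intro ballI has_vector_derivative_continuous[OF d1])
  have vc: "vector_derivative c (at u) = D 1 u" for u
    using vector_derivative_at[OF d0[of u UNIV]] by (simp add: D_def[abs_def] c_def[abs_def])
  have vc2: "vector_derivative (\<lambda>t. vector_derivative c (at t)) (at 0) = D 2 0"
    unfolding vc using vector_derivative_at[OF d1[of 0 UNIV]] by simp
  have c2n: "D 2 0 \<bullet> N t = - ((1 + s * k t) * k t * (v t)\<^sup>2)"
  proof -
    have "D 2 0 \<bullet> N t = - (m t * k t * v t) * ((nx t)\<^sup>2 + (ny t)\<^sup>2)"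
      by (simp add: D_def N_def inner_2 power2_eq_square algebra_simps)
    then have "D 2 0 \<bullet> N t = - (m t * k t * v t)" using unit by simp
    then show ?thesis by (simp add: m_def power2_eq_square algebra_simps)
  qed
  have D1: "D 1 0 = m t *\<^sub>R Tg t" by (simp add: D_def Tg_def vec2_eq_iff)
  have nT: "norm (Tg t) = 1" using unit[of t] by (simp add: norm_eq_sqrt_inner inner_2 Tg_def power2_eq_square add.commute)
  \<comment> \<open>The osculating parabola is V = l X^2 in normal and tangential coordinates;
    curvature counted in the direction of -N is therefore -2 l.\<close>
  define l where "l = - (k t / (1 + s * k t)) / 2"
  have formula: "- (vector_derivative (\<lambda>t. vector_derivative c (at t)) (at 0) \<bullet> N t) / (norm (vector_derivative c (at 0)))\<^sup>2 = k t / (1 + s * k t)"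
  proof -
    have nz: "1 + s * k t \<noteq> 0" "v t \<noteq> 0" using mnz[of t] by (auto simp: m_def)
    have "(norm (D 1 0))\<^sup>2 = ((1 + s * k t) * v t)\<^sup>2" unfolding D1 by (simp add: nT m_def)
    then show ?thesis unfolding vc2 unfolding vc c2n using nz by (simp add: power2_eq_square)
  qed
  have lp: "local_param ?L (\<Phi> t s) c"
    unfolding local_param_def
  proof (intro exI[of _ "1/2"] conjI)
    show "C_k_on 2 {- (1/2)<..<1/2} c"
      unfolding C_k_on_def
      using d0 d1 contD continuous_on_subset[OF cD2]
      by (intro exI[of _ D]) (auto simp: c_def[abs_def] D_def[of 0, abs_def] enat_less_2 enat_le_2 numeral_2_eq_2)
    show "inj_on c {- (1/2)<..<1/2}"
    proof (rule inj_onI)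
      fix a b assume a: "a \<in> {- (1/2)<..<1/2}" "b \<in> {- (1/2)<..<1/2::real}" "c a = c b"
      then obtain j :: int where j: "t + b = t + a + of_int j" using \<Phi>_inj[of s s "t + a" "t + b"] s by (auto simp: c_def)
      then have "-1 < real_of_int j" "real_of_int j < 1" using a by auto
      then have "j = 0" by linarith
      then show "a = b" using j by simp
    qed
    show "\<forall>t\<in>{- (1/2)<..<1/2}. vector_derivative c (at t) \<noteq> 0"
    proof
      fix u :: real
      have "(norm (D 1 u))\<^sup>2 = (m (t + u))\<^sup>2 * ((nx (t + u))\<^sup>2 + (ny (t + u))\<^sup>2)"
        unfolding power2_norm_eq_inner by (simp add: D_def inner_2 power2_eq_square algebra_simps)
      then show "vector_derivative c (at u) \<noteq> 0" unfolding vc using mnz[of "t + u"] unit by auto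
    qed
    show "\<exists>U. open U \<and> ?L \<inter> U = c ` {- (1/2)<..<1/2}"
      using level_set_local[OF s, of "1/2" t] by (auto simp: c_def[abs_def])
  qed (auto simp: c_def)
  have contact: "\<exists>U. open U \<and> \<Phi> t s \<in> U \<and> (\<forall>z\<in>?L \<inter> U. \<bar>(z - \<Phi> t s) \<bullet> N t - l * ((z - \<Phi> t s) \<bullet> Tg t)\<^sup>2\<bar> \<le> e * ((z - \<Phi> t s) \<bullet> Tg t)\<^sup>2)"
    if e: "e > 0" for e
  proof -
    define X V where "X u = (c u - \<Phi> t s) \<bullet> Tg t" and "V u = (c u - \<Phi> t s) \<bullet> N t" for u
    have di: "((\<lambda>u. g u \<bullet> w) has_real_derivative (g' \<bullet> w)) (at t)" if "(g has_vector_derivative g') (at t)" for g :: "real \<Rightarrow> real^2" and g' w t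
      using bounded_linear.has_vector_derivative[OF bounded_linear_inner_left that]
      by (simp add: has_real_derivative_iff_has_vector_derivative)
    have cd: "(c has_vector_derivative D 1 u) (at u)" for u using d0[of u UNIV] by (simp add: D_def[of 0, abs_def] c_def[abs_def])
    have Xd: "(X has_real_derivative D 1 u \<bullet> Tg t) (at u)" and Vd: "(V has_real_derivative D 1 u \<bullet> N t) (at u)" for u
      unfolding X_def V_def using cd[of u] by (auto intro!: di derivative_eq_intros)
    have X0: "X 0 = 0" "V 0 = 0" by (auto simp: X_def V_def c_def)
    define \<phi> where "\<phi> u = V u - l * (X u)\<^sup>2" for u
    have d\<phi>: "(\<phi> has_real_derivative (D 1 u \<bullet> N t - 2 * l * X u * (D 1 u \<bullet> Tg t))) (at u)" for u
      unfolding \<phi>_def using Xd[of u] Vd[of u] by (auto intro!: derivative_eq_intros)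
    have d\<phi>2: "((\<lambda>u. D 1 u \<bullet> N t - 2 * l * X u * (D 1 u \<bullet> Tg t)) has_real_derivative
       (D 2 0 \<bullet> N t - 2 * l * (D 1 0 \<bullet> Tg t) * (D 1 0 \<bullet> Tg t))) (at 0)"
      by (rule DERIV_cong[OF DERIV_diff[OF di[OF d1] DERIV_mult[OF DERIV_cmult[OF Xd] di[OF d1]]]]) (simp add: X0)
    have DT: "D 1 0 \<bullet> Tg t = m t" "D 1 0 \<bullet> N t = 0"
      unfolding D1 using nT by (simp_all add: dot_square_norm) (simp add: Tg_def N_def inner_2)
    have z2: "D 2 0 \<bullet> N t - 2 * l * (D 1 0 \<bullet> Tg t) * (D 1 0 \<bullet> Tg t) = 0"
    proof -
      have nz: "1 + s * k t \<noteq> 0" using mnz[of t] by (auto simp: m_def)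
      have "2 * l * m t * m t = - ((1 + s * k t) * k t * (v t)\<^sup>2)" using nz by (simp add: l_def m_def power2_eq_square field_simps)
      then show ?thesis unfolding c2n DT by simp
    qed
    define mm where "mm = \<bar>m t\<bar>"
    have mm: "mm > 0" using mnz by (simp add: mm_def)
    obtain a where a: "a > 0" "\<And>u. \<bar>u\<bar> < a \<Longrightarrow> \<bar>\<phi> u\<bar> \<le> (e * (mm / 2)\<^sup>2) * u\<^sup>2"
    proof -
      have ep: "e * (mm / 2)\<^sup>2 > 0" using e mm by simp
      have \<phi>0: "\<phi> 0 = 0" by (simp add: \<phi>_def X0)
      show ?thesis using peano_second_order[OF zero_less_one d\<phi> d\<phi>2 ep] that z2 unfolding DT X0 \<phi>0 by auto
    qed
    have "(\<lambda>h. (X (0 + h) - X 0) / h) \<midarrow>0\<rightarrow> m t" using Xd[of 0] unfolding DERIV_def DT .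
    from LIM_D[OF this, of "mm / 2"] mm obtain r where r: "r > 0" "\<And>u. u \<noteq> 0 \<Longrightarrow> \<bar>u\<bar> < r \<Longrightarrow> \<bar>X u / u - m t\<bar> < mm / 2"
      by (auto simp: X0)
    have Xl: "(mm / 2 * u)\<^sup>2 \<le> (X u)\<^sup>2" if "\<bar>u\<bar> < r" for u
    proof (cases "u = 0")
      case False
      have "mm / 2 \<le> \<bar>X u / u\<bar>" using r(2)[OF False that] unfolding mm_def by linarith
      then have "\<bar>mm / 2 * u\<bar> \<le> \<bar>X u\<bar>" using False mm by (simp add: abs_mult le_divide_eq)
      then show ?thesis by (rule abs_le_square_iff[THEN iffD1])
    qed simp
    define \<delta> where "\<delta> = min (min a r) (1 / 2)"
    have \<delta>: "0 < \<delta>" "\<delta> \<le> 1 / 2" using a r by (auto simp: \<delta>_def)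
    obtain U where U: "open U" "\<Phi> t s \<in> U" "?L \<inter> U = (\<lambda>u. \<Phi> (t + u) s) ` {-\<delta><..<\<delta>}" using level_set_local[OF s \<delta>] by blast
    have "\<bar>(z - \<Phi> t s) \<bullet> N t - l * ((z - \<Phi> t s) \<bullet> Tg t)\<^sup>2\<bar> \<le> e * ((z - \<Phi> t s) \<bullet> Tg t)\<^sup>2" if zU: "z \<in> ?L \<inter> U" for z
    proof -
      obtain u where u: "z = c u" "\<bar>u\<bar> < \<delta>" using zU unfolding U(3) by (auto simp: c_def abs_less_iff)
      have "\<bar>\<phi> u\<bar> \<le> e * (mm / 2 * u)\<^sup>2" using a(2)[of u] u(2) unfolding power_mult_distrib by (simp add: \<delta>_def)
      also have "\<dots> \<le> e * (X u)\<^sup>2" using Xl[of u] u(2) e by (intro mult_left_mono) (auto simp: \<delta>_def)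
      finally show ?thesis by (simp add: \<phi>_def X_def V_def u)
    qed
    then show ?thesis using U by blast
  qed
  have s': "\<bar>s\<bar> \<le> e1" using s by simp
  have "level_curvature \<Omega> \<gamma> (\<Phi> t s) = signed_curvature ?L (N t) (\<Phi> t s)"
    unfolding level_curvature_def signed_dist_\<Phi>[OF s'] closest_\<Phi>(1)[OF s'] outward_normal_\<gamma> ..
  also have "\<dots> = k t / (1 + s * k t)"
    unfolding signed_curvature_def
  \<comment> \<open>Uniqueness ranges over arbitrary local parametrizations, which need not be
    reparametrizations of \<open>c\<close> in any explicit way; \<open>contact\<close> is a property
    of the set alone, so \<open>local_param_curvature\<close> treats all of them alike.\<close>
  proof (rule the_equality)
    show "\<exists>c. local_param ?L (\<Phi> t s) c \<and> k t / (1 + s * k t) =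
        - (vector_derivative (\<lambda>t. vector_derivative c (at t)) (at 0) \<bullet> N t) / (norm (vector_derivative c (at 0)))\<^sup>2"
      using lp formula by (intro exI[of _ c]) simp
    fix \<kappa> assume "\<exists>c. local_param ?L (\<Phi> t s) c \<and> \<kappa> =
        - (vector_derivative (\<lambda>t. vector_derivative c (at t)) (at 0) \<bullet> N t) / (norm (vector_derivative c (at 0)))\<^sup>2"
    then obtain c' where c': "local_param ?L (\<Phi> t s) c'" "\<kappa> = - (vector_derivative (\<lambda>t. vector_derivative c' (at t)) (at 0) \<bullet> N t) / (norm (vector_derivative c' (at 0)))\<^sup>2" by blast
    show "\<kappa> = k t / (1 + s * k t)"
    proof -
      have l2: "- 2 * l = k t / (1 + s * k t)" unfolding l_def
      proof -
        have "- 2 * (- r / 2) = r" for r :: real by simp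
        then show "- 2 * (- (k t / (1 + s * k t)) / 2) = k t / (1 + s * k t)" .
      qed
      show ?thesis unfolding c'(2) l2[symmetric] by (rule local_param_curvature[OF c'(1) norm_decomp contact])
    qed
  qed
  finally show ?thesis .
qed

text \<open>1 - s k / (1 + s k) = 1 / (1 + s k), the reciprocal of the stretching of the parallel
  curve. It cancels the determinant of the tube coordinates.\<close>

lemma jacobian_\<Phi>: "\<bar>s\<bar> < e1 \<Longrightarrow> jacobian \<Omega> \<gamma> (\<Phi> t s) s = 1 / (1 + s * k t)"
proof -
  assume s: "\<bar>s\<bar> < e1"
  have "1 + s * k t \<noteq> 0" using k_lower(1)[of s t] s e1 by auto
  then show ?thesis using s by (simp add: jacobian_def signed_dist_\<Phi> level_curvature_\<Phi> field_simps)
qed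

lemma integrand_\<Phi>:
  assumes "\<bar>s\<bar> \<le> \<epsilon>" "\<epsilon> < e1"
  shows "integrand \<Omega> \<gamma> F \<theta> \<epsilon> (\<Phi> t s) = F (\<gamma> t) * (\<theta> (s / \<epsilon>) / \<epsilon>) / (1 + s * k t)"
proof -
  have "\<Phi> t s \<in> tube \<Gamma> \<epsilon>" using assms by (subst tube_eq) auto
  then show ?thesis using assms by (simp add: integrand_def jacobian_\<Phi> closest_\<Phi> scaled_weight_def signed_dist_\<Phi>)
qed

end

section \<open>The tube integral in tube coordinates\<close>

lemma lborel_change_of_variables:
  fixes g :: "real^2 \<Rightarrow> real^2" and f :: "real^2 \<Rightarrow> complex"
  assumes S: "S \<in> sets borel" and gS: "g ` S \<in> sets borel"
    and der: "\<And>z. z \<in> S \<Longrightarrow> (g has_derivative g' z) (at z within S)" and inj: "inj_on g S"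
    and f: "integrable lborel f"
    and m: "(\<lambda>z. indicator S z *\<^sub>R (\<bar>det (matrix (g' z))\<bar> *\<^sub>R f (g z))) \<in> borel_measurable borel"
  shows "(\<integral>z. indicator (g ` S) z *\<^sub>R f z \<partial>lborel) = (\<integral>z. indicator S z *\<^sub>R (\<bar>det (matrix (g' z))\<bar> *\<^sub>R f (g z)) \<partial>lborel)"
proof -
  \<comment> \<open>\<open>J\<close> and \<open>J'\<close> identify the complex numbers with the
    plane, the kind of value for which \<open>has_absolute_integral_change_of_variables\<close> is
    stated.\<close>
  define J where "J c = vec2 (Re c) (Im c)" for c
  define J' where "J' z = Complex (z $ 1) (z $ 2)" for z :: "real^2"
  have J: "bounded_linear J" by (auto simp: J_def vec2_eq_iff intro!: linearI simp flip: linear_conv_bounded_linear)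
  have J': "bounded_linear J'" by (auto simp: J'_def complex_eq_iff intro!: linearI simp flip: linear_conv_bounded_linear)
  have JJ: "J' (J c) = c" for c by (simp add: J_def J'_def)
  have fi: "set_integrable lborel (g ` S) f"
    unfolding set_integrable_def using gS f by (intro integrable_mult_indicator) auto
  then have fa: "f absolutely_integrable_on (g ` S)"
    unfolding set_integrable_def by (subst integrable_completion) (auto dest: borel_measurable_integrable)
  have e1: "(\<integral>z. indicator (g ` S) z *\<^sub>R f z \<partial>lborel) = integral (g ` S) f"
    using set_borel_integral_eq_integral(2)[OF fi] by (simp add: set_lebesgue_integral_def)
  have Jf: "(J \<circ> f) absolutely_integrable_on (g ` S) \<and> integral (g ` S) (J \<circ> f) = J (integral (g ` S) f)"
    using fa J set_lebesgue_integral_eq_integral(1)[OF fa] by (intro conjI absolutely_integrable_linear integral_linear) auto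
  let ?h = "\<lambda>z. \<bar>det (matrix (g' z))\<bar> *\<^sub>R f (g z)"
  have "(\<lambda>z. \<bar>det (matrix (g' z))\<bar> *\<^sub>R (J \<circ> f) (g z)) absolutely_integrable_on S \<and>
     integral S (\<lambda>z. \<bar>det (matrix (g' z))\<bar> *\<^sub>R (J \<circ> f) (g z)) = J (integral (g ` S) f)"
    by (subst has_absolute_integral_change_of_variables[OF _ der inj]) (use S Jf in auto)
  moreover have "(\<lambda>z. \<bar>det (matrix (g' z))\<bar> *\<^sub>R (J \<circ> f) (g z)) = J \<circ> ?h"
    using bounded_linear.linear[OF J] by (auto simp: linear_scale)
  ultimately have a: "(J \<circ> ?h) absolutely_integrable_on S" "integral S (J \<circ> ?h) = J (integral (g ` S) f)" by auto
  have JJh: "J' \<circ> (J \<circ> ?h) = ?h" by (auto simp: JJ)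
  have ha: "?h absolutely_integrable_on S"
    using absolutely_integrable_linear[OF a(1) J'] unfolding JJh .
  have "integral S ?h = J' (integral S (J \<circ> ?h))"
    using integral_linear[OF set_lebesgue_integral_eq_integral(1)[OF a(1)] J'] unfolding JJh .
  then have e2: "integral S ?h = integral (g ` S) f" by (simp add: a(2) JJ)
  have "set_integrable lborel S ?h"
    using ha unfolding set_integrable_def by (subst (asm) integrable_completion) (use m in auto)
  from set_borel_integral_eq_integral(2)[OF this] show ?thesis
    unfolding e1 e2[symmetric] set_lebesgue_integral_def by simp
qed

lemma det_matrix_2: "det (matrix (h :: real^2 \<Rightarrow> real^2)) = h (axis 1 1) $ 1 * h (axis 2 1) $ 2 - h (axis 2 1) $ 1 * h (axis 1 1) $ 2"
  by (simp add: det_2 matrix_def)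

context curve_out begin

lemma k_meas [measurable]: "k \<in> borel_measurable borel" and v_meas [measurable]: "v \<in> borel_measurable borel"
  using smooth_bdd_continuous[OF smooth(1)] smooth_bdd_continuous[OF smooth(2)] by (auto intro: borel_measurable_continuous_onI)

context
  fixes F :: "real^2 \<Rightarrow> real" and \<theta> :: "real \<Rightarrow> real" and T \<epsilon> :: real
  assumes f_eq: "\<And>t. f t = F (\<gamma> t) * \<bar>v t\<bar>"
    and \<theta>m [measurable]: "\<theta> \<in> borel_measurable borel" and T: "\<And>s. \<bar>\<theta> s\<bar> \<le> T"
    and \<epsilon>: "0 < \<epsilon>" "\<epsilon> < e1"
begin

abbreviation Q where "Q \<equiv> integrand \<Omega> \<gamma> F \<theta> \<epsilon>"

lemma tube_image: "tube \<Gamma> \<epsilon> = (\<lambda>p. \<Phi> (fst p) (snd p)) ` ({0..1} \<times> {-\<epsilon>..\<epsilon>})"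
proof (intro set_eqI iffI)
  fix z assume "z \<in> tube \<Gamma> \<epsilon>"
  then obtain t s where z: "z = \<Phi> t s" "\<bar>s\<bar> \<le> \<epsilon>" using \<epsilon> by (subst (asm) tube_eq) auto
  have "z = \<Phi> (frac t) s" using \<Phi>_int[of "frac t" "\<lfloor>t\<rfloor>" s] z(1) by (simp add: frac_def)
  then show "z \<in> (\<lambda>p. \<Phi> (fst p) (snd p)) ` ({0..1} \<times> {-\<epsilon>..\<epsilon>})"
    using z(2) frac_ge_0[of t] frac_lt_1[of t] by (force simp: abs_le_iff)
next
  fix z assume "z \<in> (\<lambda>p. \<Phi> (fst p) (snd p)) ` ({0..1} \<times> {-\<epsilon>..\<epsilon>})"
  then obtain t s where "z = \<Phi> t s" "\<bar>s\<bar> \<le> \<epsilon>" by (auto simp: abs_le_iff)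
  then show "z \<in> tube \<Gamma> \<epsilon>" using \<epsilon> by (subst tube_eq) auto
qed

lemma compact_tube: "compact (tube \<Gamma> \<epsilon>)"
  unfolding tube_image by (intro compact_continuous_image cont\<Phi> compact_Times) auto

lemma F_cont: "continuous_on S (\<lambda>t. F (\<gamma> t))"
proof -
  have "F (\<gamma> t) = f t / \<bar>v t\<bar>" for t using f_eq[of t] v0(1) v0(2)[of t] by auto
  moreover have "continuous_on S (\<lambda>t. f t / \<bar>v t\<bar>)"
    using v0 continuous_on_subset[OF smooth_bdd_continuous[OF smooth(1)]]
    by (intro continuous_intros cont) (fastforce, metis abs_eq_0 less_le_not_le)
  ultimately show ?thesis by simp
qed

text \<open>Closest point, signed distance and Jacobian are continuous in tube coordinates, and
  these are a quotient map of a compact rectangle onto the tube; so they are continuous on the tube.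
  The weight is only Borel and is composed last.\<close>

lemma Q_meas [measurable]: "Q \<in> borel_measurable borel"
proof -
  let ?K = "tube \<Gamma> \<epsilon>" and ?C = "{0..1::real} \<times> {-\<epsilon>..\<epsilon>}"
  have K: "?K \<in> sets borel" using compact_tube by (intro borel_closed compact_imp_closed)
  define H1 where "H1 z = F (closest_point \<Gamma> z)" for z
  define H2 where "H2 z = signed_dist \<Omega> \<gamma> z" for z
  define H3 where "H3 z = jacobian \<Omega> \<gamma> z (signed_dist \<Omega> \<gamma> z)" for z
  have C: "compact ?C" by (intro compact_Times) auto
  note quot = continuous_on_quotient_compact[OF C cont\<Phi>, folded tube_image]
  have "continuous_on ?K H1"
  proof (rule quot)
    have "continuous_on ?C (\<lambda>p. F (\<gamma> (fst p)))"
      by (rule continuous_on_compose2[OF F_cont[of UNIV]]) (auto intro!: continuous_intros)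
    then show "continuous_on ?C (\<lambda>p. H1 (\<Phi> (fst p) (snd p)))"
      by (rule continuous_on_eq) (use \<epsilon> in \<open>auto simp: H1_def closest_\<Phi> abs_le_iff\<close>)
  qed
  moreover have "continuous_on ?K H2"
  proof (rule quot)
    have "continuous_on ?C (\<lambda>p. snd p)" by (intro continuous_intros)
    then show "continuous_on ?C (\<lambda>p. H2 (\<Phi> (fst p) (snd p)))"
      by (rule continuous_on_eq) (use \<epsilon> in \<open>auto simp: H2_def signed_dist_\<Phi> abs_le_iff\<close>)
  qed
  moreover have "continuous_on ?K H3"
  proof (rule quot)
    have nz: "1 + snd p * k (fst p) \<noteq> 0" if "p \<in> ?C" for p
      using k_lower(1)[of "snd p" "fst p"] that \<epsilon> e1 by (auto simp: abs_le_iff)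
    have "continuous_on ?C (\<lambda>p. k (fst p))"
      by (rule continuous_on_compose2[OF smooth_bdd_continuous[OF smooth(2)]]) (auto intro!: continuous_intros)
    then have "continuous_on ?C (\<lambda>p. 1 / (1 + snd p * k (fst p)))"
      using nz by (intro continuous_intros) auto
    then show "continuous_on ?C (\<lambda>p. H3 (\<Phi> (fst p) (snd p)))"
      by (rule continuous_on_eq) (use \<epsilon> in \<open>auto simp: H3_def signed_dist_\<Phi> jacobian_\<Phi> abs_le_iff\<close>)
  qed
  ultimately have [measurable]: "(\<lambda>z. indicator ?K z *\<^sub>R H1 z) \<in> borel_measurable borel"
    "(\<lambda>z. indicator ?K z *\<^sub>R H2 z) \<in> borel_measurable borel" "(\<lambda>z. indicator ?K z *\<^sub>R H3 z) \<in> borel_measurable borel"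
    by (auto intro!: borel_measurable_continuous_on_indicator[OF K] simp del: real_scaleR_def)
  have "Q = (\<lambda>z. (indicator ?K z *\<^sub>R H1 z) * (\<theta> ((indicator ?K z *\<^sub>R H2 z) / \<epsilon>) / \<epsilon>) * (indicator ?K z *\<^sub>R H3 z))"
    by (auto simp: fun_eq_iff integrand_def H1_def H2_def H3_def scaled_weight_def)
  then show ?thesis by (simp only:) measurable
qed

lemma Q_outside: "z \<notin> tube \<Gamma> \<epsilon> \<Longrightarrow> Q z = 0"
  by (simp add: integrand_def)

lemma Q_bounded: "\<exists>B\<ge>0. \<forall>z. \<bar>Q z\<bar> \<le> B"
proof -
  have "compact ((\<lambda>t. F (\<gamma> t)) ` {0..1})" by (intro compact_continuous_image F_cont) auto
  then obtain B where B: "\<And>t. t \<in> {0..1} \<Longrightarrow> \<bar>F (\<gamma> t)\<bar> \<le> B"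
    using compact_imp_bounded by (fastforce simp: bounded_iff)
  have B0: "0 \<le> B" using B[of 0] by simp
  have T0: "0 \<le> T" using T[of 0] by linarith
  have "\<bar>Q z\<bar> \<le> B * (T / \<epsilon>) * 2" for z
  proof (cases "z \<in> tube \<Gamma> \<epsilon>")
    case True
    then obtain t s where z: "z = \<Phi> t s" "t \<in> {0..1}" "\<bar>s\<bar> \<le> \<epsilon>" unfolding tube_image by (auto simp: abs_le_iff)
    have kl: "1 / 2 \<le> 1 + s * k t" using k_lower(1)[of s t] z(3) \<epsilon> e1 by simp
    have "\<bar>Q z\<bar> = \<bar>F (\<gamma> t)\<bar> * (\<bar>\<theta> (s / \<epsilon>)\<bar> / \<epsilon>) * (1 / (1 + s * k t))"
      using integrand_\<Phi>[OF z(3) \<epsilon>(2), of F \<theta> t] \<epsilon> kl by (simp add: z(1) abs_mult)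
    also have "\<dots> \<le> B * (T / \<epsilon>) * 2"
    proof (intro mult_mono divide_right_mono B T z)
      show "1 / (1 + s * k t) \<le> 2" using kl by (simp add: divide_le_eq)
    qed (use B0 T0 \<epsilon> kl in auto)
    finally show ?thesis .
  next
    case False then show ?thesis using B0 T0 \<epsilon> by (simp add: Q_outside)
  qed
  then show ?thesis using B0 T0 \<epsilon> by (intro exI[of _ "B * (T / \<epsilon>) * 2"]) auto
qed

lemma Q_integrable:
  fixes c :: "real^2 \<Rightarrow> complex"
  assumes [measurable]: "c \<in> borel_measurable borel" and c: "\<And>z. cmod (c z) \<le> 1"
  shows "integrable lborel (\<lambda>z. of_real (Q z) * c z)"
proof -
  obtain B where B: "B \<ge> 0" "\<And>z. \<bar>Q z\<bar> \<le> B" using Q_bounded by blast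
  have "integrable lborel (\<lambda>z. indicator (tube \<Gamma> \<epsilon>) z *\<^sub>R B)"
    using compact_tube emeasure_compact_finite[OF compact_tube] by (intro integrable_real_indicator integrable_scaleR_left) (auto intro: borel_closed compact_imp_closed)
  then show ?thesis
  proof (rule Bochner_Integration.integrable_bound)
    show "AE z in lborel. cmod (of_real (Q z) * c z) \<le> norm (indicator (tube \<Gamma> \<epsilon>) z *\<^sub>R B)"
    proof (rule AE_I2)
      fix z
      have "\<bar>Q z\<bar> * cmod (c z) \<le> B * 1" using B c by (intro mult_mono) auto
      then show "cmod (of_real (Q z) * c z) \<le> norm (indicator (tube \<Gamma> \<epsilon>) z *\<^sub>R B)"
        using B Q_outside[of z] by (cases "z \<in> tube \<Gamma> \<epsilon>") (auto simp: norm_mult)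
    qed
  qed measurable
qed

text \<open>The coordinates (t, s) with offset \<epsilon> s have determinant \<epsilon> (1 +
  \<epsilon> s k) |v| up to sign. The first factor cancels the scaling of the weight, the second the
  Jacobian factor of the integrand, and |v| combines with F to \<open>f\<close>. The right-hand side
  is thus free of curvature in the amplitude.\<close>

lemma Q_fourier:
  "(\<integral>z. of_real (Q z) * cis (a * z $ 1 + b * z $ 2) \<partial>lborel) =
     (\<integral>s. of_real (\<theta> s) * (\<integral>t. of_real (f t) * cis (a * \<Phi> t (\<epsilon> * s) $ 1 + b * \<Phi> t (\<epsilon> * s) $ 2) \<partial>leb 0 1) \<partial>leb (-1) 1)"
proof -
  \<comment> \<open>Half-open in the first coordinate, to make the coordinates injective; the
    missing edge is a null set and is added back when the integral is iterated.\<close>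
  define S where "S = {p::real^2. 0 \<le> p $ 1 \<and> p $ 1 < 1 \<and> -1 \<le> p $ 2 \<and> p $ 2 \<le> 1}"
  define g where "g p = \<Phi> (p $ 1) (\<epsilon> * p $ 2)" for p :: "real^2"
  define g' where "g' p w = vec2 (- ((1 + \<epsilon> * p $ 2 * k (p $ 1)) * v (p $ 1) * ny (p $ 1)) * w $ 1 + \<epsilon> * nx (p $ 1) * w $ 2)
     ((1 + \<epsilon> * p $ 2 * k (p $ 1)) * v (p $ 1) * nx (p $ 1) * w $ 1 + \<epsilon> * ny (p $ 1) * w $ 2)" for p w :: "real^2"
  define q where "q z = of_real (Q z) * cis (a * z $ 1 + b * z $ 2)" for z
  have S [measurable]: "S \<in> sets borel" unfolding S_def by measurable
  have eps: "\<bar>\<epsilon> * p $ 2\<bar> \<le> \<epsilon>" if "p \<in> S" for p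
    using that \<epsilon> mult_left_mono[of "\<bar>p $ 2\<bar>" 1 \<epsilon>] by (auto simp: S_def abs_mult abs_le_iff)
  have der: "(g has_derivative g' p) (at p within S)" for p
  proof -
    have c: "((\<lambda>p::real^2. h (p $ 1)) has_derivative (\<lambda>w. h' * w $ 1)) (at p within S)" if "(h has_real_derivative h') (at (p $ 1))" for h h'
      using has_derivative_compose[OF bounded_linear.has_derivative[OF bounded_linear_vec_nth has_derivative_ident], of h "\<lambda>w. h' * w" p 1 S]
        that by (simp add: has_field_derivative_def has_derivative_at_withinI)
    have p2: "((\<lambda>p::real^2. \<epsilon> * p $ 2) has_derivative (\<lambda>w. \<epsilon> * w $ 2)) (at p within S)"
      by (intro bounded_linear_imp_has_derivative) (auto intro: bounded_linear_const_mult bounded_linear_vec_nth)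
    have 1: "((\<lambda>p. x (p $ 1) + (\<epsilon> * p $ 2) * nx (p $ 1)) has_derivative
        (\<lambda>w. - (v (p $ 1) * ny (p $ 1)) * w $ 1 + ((\<epsilon> * p $ 2) * (- (k (p $ 1) * (v (p $ 1) * ny (p $ 1))) * w $ 1) + (\<epsilon> * w $ 2) * nx (p $ 1)))) (at p within S)"
      by (intro has_derivative_add has_derivative_mult c p2 xd nxd)
    have 2: "((\<lambda>p. y (p $ 1) + (\<epsilon> * p $ 2) * ny (p $ 1)) has_derivative
        (\<lambda>w. (v (p $ 1) * nx (p $ 1)) * w $ 1 + ((\<epsilon> * p $ 2) * ((k (p $ 1) * (v (p $ 1) * nx (p $ 1))) * w $ 1) + (\<epsilon> * w $ 2) * ny (p $ 1)))) (at p within S)"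
      by (intro has_derivative_add has_derivative_mult c p2 yd nyd)
    have "((\<lambda>p. g p $ i) has_derivative (\<lambda>w. g' p w $ i)) (at p within S)" for i
      using exhaust_2[of i] has_derivative_eq_rhs[OF 1] has_derivative_eq_rhs[OF 2]
      by (auto simp: g_def \<Phi>_def g'_def fun_eq_iff algebra_simps)
    then show ?thesis
      by (subst has_derivative_componentwise_within) (auto simp: Basis_vec_def inner_axis)
  qed
  have inj: "inj_on g S"
  proof (rule inj_onI)
    fix p r assume a: "p \<in> S" "r \<in> S" "g p = g r"
    have "\<epsilon> * p $ 2 = \<epsilon> * r $ 2 \<and> (\<exists>j::int. r $ 1 = p $ 1 + of_int j)"
      using a eps[OF a(1)] eps[OF a(2)] \<epsilon> by (intro \<Phi>_inj) (auto simp: g_def)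
    then obtain j :: int where j: "p $ 2 = r $ 2" "r $ 1 = p $ 1 + of_int j" using \<epsilon> by auto
    then have "-1 < real_of_int j" "real_of_int j < 1" using a by (auto simp: S_def)
    then have "j = 0" by linarith
    then show "p = r" using j by (simp add: vec2_eq_iff)
  qed
  have img: "g ` S = tube \<Gamma> \<epsilon>"
  proof (intro set_eqI iffI)
    fix z assume "z \<in> g ` S"
    then show "z \<in> tube \<Gamma> \<epsilon>" using eps \<epsilon> by (subst tube_eq) (auto simp: g_def)
  next
    fix z assume "z \<in> tube \<Gamma> \<epsilon>"
    then obtain t s where z: "z = \<Phi> t s" "\<bar>s\<bar> \<le> \<epsilon>" using \<epsilon> by (subst (asm) tube_eq) auto
    have "z = g (vec2 (frac t) (s / \<epsilon>))" using \<Phi>_int[of "frac t" "\<lfloor>t\<rfloor>" s] z(1) \<epsilon> by (simp add: g_def frac_def)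
    moreover have "vec2 (frac t) (s / \<epsilon>) \<in> S"
      using z(2) \<epsilon> frac_ge_0[of t] frac_lt_1[of t] by (auto simp: S_def abs_le_iff divide_le_eq le_divide_eq)
    ultimately show "z \<in> g ` S" by blast
  qed
  have dt: "\<bar>det (matrix (g' p))\<bar> = \<epsilon> * (1 + \<epsilon> * p $ 2 * k (p $ 1)) * \<bar>v (p $ 1)\<bar>" if "p \<in> S" for p
  proof -
    have "det (matrix (g' p)) = - (\<epsilon> * (1 + \<epsilon> * p $ 2 * k (p $ 1)) * v (p $ 1)) * ((nx (p $ 1))\<^sup>2 + (ny (p $ 1))\<^sup>2)"
      unfolding det_matrix_2 by (simp add: g'_def axis_def power2_eq_square algebra_simps)
    moreover have "0 \<le> 1 + \<epsilon> * p $ 2 * k (p $ 1)" using k_lower(1)[of "\<epsilon> * p $ 2" "p $ 1"] eps[OF that] \<epsilon> e1 by simp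
    ultimately show ?thesis using unit \<epsilon> by (simp add: abs_mult)
  qed
  define K where "K p = of_real (\<theta> (p $ 2)) * (of_real (f (p $ 1)) * cis (a * \<Phi> (p $ 1) (\<epsilon> * p $ 2) $ 1 + b * \<Phi> (p $ 1) (\<epsilon> * p $ 2) $ 2))" for p :: "real^2"
  have Km [measurable]: "K \<in> borel_measurable borel" unfolding K_def \<Phi>_nth by measurable
  have key: "indicator S p *\<^sub>R (\<bar>det (matrix (g' p))\<bar> *\<^sub>R q (g p)) = indicator S p *\<^sub>R K p" for p
  proof (cases "p \<in> S")
    case True
    have nz: "1 + \<epsilon> * p $ 2 * k (p $ 1) \<noteq> 0" using k_lower(1)[of "\<epsilon> * p $ 2" "p $ 1"] eps[OF True] \<epsilon> e1 by auto
    have "\<bar>det (matrix (g' p))\<bar> * Q (g p) = \<theta> (p $ 2) * f (p $ 1)"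
    proof -
      have "\<epsilon> * D * V * (A * (B / \<epsilon>) / D) = B * (A * V)" if "D \<noteq> 0" for A B D V using that \<epsilon> by simp
      moreover have "\<epsilon> * p $ 2 / \<epsilon> = p $ 2" using \<epsilon> by simp
      ultimately show ?thesis
        unfolding dt[OF True] g_def integrand_\<Phi>[OF eps[OF True] \<epsilon>(2)] f_eq using nz by simp
    qed
    then have "complex_of_real \<bar>det (matrix (g' p))\<bar> * of_real (Q (g p)) = of_real (\<theta> (p $ 2) * f (p $ 1))"
      by (metis of_real_mult)
    then show ?thesis by (simp add: q_def K_def g_def scaleR_conv_of_real flip: mult.assoc)
  qed simp
  obtain Fb where Fb: "\<And>t. \<bar>f t\<bar> \<le> Fb" using smooth_bdd_bound smooth by blast
  have T0: "0 \<le> T" using T[of 0] by linarith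
  have Kb: "cmod (K p) \<le> T * Fb" for p
    using T[of "p $ 2"] Fb[of "p $ 1"] T0 by (auto simp: K_def norm_mult intro!: mult_mono)
  have "(\<integral>z. q z \<partial>lborel) = (\<integral>z. indicator (g ` S) z *\<^sub>R q z \<partial>lborel)"
    unfolding img by (intro arg_cong[where f = "integral\<^sup>L _"] ext) (auto simp: q_def Q_outside indicator_def)
  also have "\<dots> = (\<integral>p. indicator S p *\<^sub>R (\<bar>det (matrix (g' p))\<bar> *\<^sub>R q (g p)) \<partial>lborel)"
  proof (rule lborel_change_of_variables[OF S _ der inj])
    show "g ` S \<in> sets borel" unfolding img using compact_tube by (intro borel_closed compact_imp_closed)
    show "integrable lborel q" unfolding q_def by (rule Q_integrable) auto
    show "(\<lambda>p. indicator S p *\<^sub>R (\<bar>det (matrix (g' p))\<bar> *\<^sub>R q (g p))) \<in> borel_measurable borel"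
      unfolding key by measurable
  qed
  also have "\<dots> = (\<integral>p. indicator {z::real^2. z $ 1 \<in> {0..1} \<and> z $ 2 \<in> {-1..1}} p *\<^sub>R K p \<partial>lborel)"
    unfolding key
  proof (rule integral_cong_AE)
    have "negligible {p::real^2. axis 1 1 \<bullet> p = 1}" by (intro negligible_hyperplane) auto
    moreover have "{p::real^2. axis 1 1 \<bullet> p = 1} = {p. p $ 1 = 1}" by (simp add: inner_axis')
    ultimately have "AE p::real^2 in lborel. p \<notin> {p. p $ 1 = 1}"
      by (intro AE_not_in) (simp add: negligible_iff_null_sets null_sets_completion_iff)
    then show "AE p in lborel. indicator S p *\<^sub>R K p = indicator {z::real^2. z $ 1 \<in> {0..1} \<and> z $ 2 \<in> {-1..1}} p *\<^sub>R K p"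
      by eventually_elim (auto simp: S_def indicator_def)
  qed measurable
  also have "\<dots> = (\<integral>p. K p \<partial>density lborel (\<lambda>p. ennreal (indicator {z::real^2. z $ 1 \<in> {0..1} \<and> z $ 2 \<in> {-1..1}} p)))"
    by (rule integral_density[symmetric]) auto
  also have "\<dots> = (\<integral>p. K p \<partial>density lborel (indicator {z::real^2. z $ 1 \<in> {0..1} \<and> z $ 2 \<in> {-1..1}}))"
    by (simp add: ennreal_indicator)
  also have "\<dots> = (\<integral>t. (\<integral>s. K (vec2 t s) \<partial>leb (-1) 1) \<partial>leb 0 1)"
    using Kb by (intro integral_rectangle[where C = "T * Fb"]) auto
  also have "\<dots> = (\<integral>s. (\<integral>t. K (vec2 t s) \<partial>leb 0 1) \<partial>leb (-1) 1)"
    by (rule leb_swap[where C = "T * Fb"]) (use Kb in \<open>auto simp: case_prod_beta'\<close>)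
  finally show ?thesis by (simp add: q_def K_def)
qed

end

end

section \<open>Lattice sums over randomly placed grids\<close>

definition lat :: "int \<times> int \<Rightarrow> real^2" where "lat k = vec2 (of_int (fst k)) (of_int (snd k))"

text \<open>The transposed matrix applied to z, hence the inverse when the matrix is a rotation.
  Written through the entries, it is visibly measurable in the matrix.\<close>

definition tr :: "real^2^2 \<Rightarrow> real^2 \<Rightarrow> real^2" where
  "tr \<eta> z = vec2 (\<eta> $ 1 $ 1 * z $ 1 + \<eta> $ 2 $ 1 * z $ 2) (\<eta> $ 1 $ 2 * z $ 1 + \<eta> $ 2 $ 2 * z $ 2)"

definition rt :: "real \<Rightarrow> real^2 \<Rightarrow> real^2" where
  "rt \<phi> z = vec2 (cos \<phi> * z $ 1 - sin \<phi> * z $ 2) (sin \<phi> * z $ 1 + cos \<phi> * z $ 2)"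

lemma rt_tr: "rt \<phi> (tr (rotation \<phi>) z) = z" "tr (rotation \<phi>) (rt \<phi> z) = z"
proof -
  have s: "sin \<phi> * sin \<phi> + cos \<phi> * cos \<phi> = 1" using sin_cos_squared_add[of \<phi>] by (simp add: power2_eq_square)
  have 1: "cos \<phi> * (cos \<phi> * a + sin \<phi> * b) - sin \<phi> * (- sin \<phi> * a + cos \<phi> * b) = a"
    "sin \<phi> * (cos \<phi> * a + sin \<phi> * b) + cos \<phi> * (- sin \<phi> * a + cos \<phi> * b) = b"
    "cos \<phi> * (cos \<phi> * a - sin \<phi> * b) + sin \<phi> * (sin \<phi> * a + cos \<phi> * b) = a"
    "- sin \<phi> * (cos \<phi> * a - sin \<phi> * b) + cos \<phi> * (sin \<phi> * a + cos \<phi> * b) = b" for a b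
    using s by algebra+
  show "rt \<phi> (tr (rotation \<phi>) z) = z" "tr (rotation \<phi>) (rt \<phi> z) = z"
    unfolding vec2_eq_iff rt_def tr_def vec2_nth rotation_nth 1 by simp_all
qed

lemma norm_rt: "norm (rt \<phi> z) = norm z"
proof -
  have "rt \<phi> z \<bullet> rt \<phi> z = ((sin \<phi>)\<^sup>2 + (cos \<phi>)\<^sup>2) * (z \<bullet> z)"
    unfolding inner_2 rt_def power2_eq_square vec2_nth by algebra
  then show ?thesis by (simp add: norm_eq_sqrt_inner)
qed

lemma norm_tr: "norm (tr (rotation \<phi>) z) = norm z"
  by (metis norm_rt rt_tr(1))

lemma linear_rt: "rt \<phi> (z - w) = rt \<phi> z - rt \<phi> w" "rt \<phi> (c *\<^sub>R z) = c *\<^sub>R rt \<phi> z"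
  and linear_tr: "tr \<eta> (z - w) = tr \<eta> z - tr \<eta> w" "tr \<eta> (c *\<^sub>R z) = c *\<^sub>R tr \<eta> z"
  by (simp_all add: vec2_eq_iff rt_def tr_def algebra_simps)

lemma matrix_inv_rotation: "matrix_inv (rotation \<phi>) *v z = tr (rotation \<phi>) z"
proof -
  have "rotation 0 = mat 1" by (simp add: vec_eq_iff forall_2 mat_def)
  then have "rotation \<phi> ** rotation (- \<phi>) = mat 1" "rotation (- \<phi>) ** rotation \<phi> = mat 1"
    by (simp_all add: rotation_add)
  then have "matrix_inv (rotation \<phi>) = rotation (- \<phi>)"
    unfolding matrix_inv_def by (intro some_equality) (auto, metis matrix_mul_assoc matrix_mul_lid matrix_mul_rid)
  then show ?thesis by (simp add: vec2_eq_iff tr_def matrix_vector_mult_def sum_2)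
qed

lemma entry_measurable [measurable]: "(\<lambda>\<eta>::real^2^2. \<eta> $ i $ j) \<in> borel_measurable borel"
  by (intro borel_measurable_continuous_onI continuous_intros)

lemma tr_measurable [measurable]:
  assumes [measurable]: "g \<in> borel_measurable M" "h \<in> borel_measurable M"
  shows "(\<lambda>p. tr (g p) (h p)) \<in> borel_measurable M"
proof -
  have [measurable]: "(\<lambda>p. g p $ i $ j) \<in> borel_measurable M" for i j
    using measurable_compose[OF assms(1) entry_measurable] .
  show ?thesis unfolding tr_def by measurable
qed

text \<open>Characters equal 1 at lattice points.\<close>

lemma chr_lattice_diff: "chr k (lat w - z) = cnj (chr k z)"
proof -
  have "2 * pi * (of_int (fst k) * (lat w - z) $ 1 + of_int (snd k) * (lat w - z) $ 2) =
     - (2 * pi * (of_int (fst k) * z $ 1 + of_int (snd k) * z $ 2)) + 2 * pi * of_int (fst k * fst w + snd k * snd w)"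
    by (simp add: lat_def algebra_simps)
  then have "chr k (lat w - z) = cis (- (2 * pi * (of_int (fst k) * z $ 1 + of_int (snd k) * z $ 2))) * cis (2 * pi * of_int (fst k * fst w + snd k * snd w))"
    unfolding chr_def by (simp only: cis_mult)
  moreover have "cis (2 * pi * of_int (fst k * fst w + snd k * snd w)) = 1"
    using cis_multiple_2pi[of "of_int (fst k * fst w + snd k * snd w)"] by simp
  ultimately show ?thesis by (simp add: chr_def cis_cnj)
qed

lemma rotation_measurable' [measurable]: "rotation \<in> borel_measurable borel"
  using rotation_measurable by (simp add: measurable_restrict_space2_iff)

section \<open>Fourier coefficients of the lattice sum in the translation\<close>

context curve_out begin

context
  fixes F :: "real^2 \<Rightarrow> real" and \<theta> :: "real \<Rightarrow> real" and T \<epsilon> :: real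
  assumes f_eq: "\<And>t. f t = F (\<gamma> t) * \<bar>v t\<bar>"
    and \<theta>m [measurable]: "\<theta> \<in> borel_measurable borel" and T: "\<And>s. \<bar>\<theta> s\<bar> \<le> T"
    and \<epsilon>: "0 < \<epsilon>" "\<epsilon> < e1"
begin

abbreviation (input) QQ where "QQ \<equiv> integrand \<Omega> \<gamma> F \<theta> \<epsilon>"

lemmas Qm [measurable] = Q_meas[OF f_eq \<theta>m T \<epsilon>]

definition grid_sum :: "nat \<Rightarrow> real \<Rightarrow> real^2^2 \<Rightarrow> real^2 \<Rightarrow> real" where
  "grid_sum M h \<eta> \<xi> = h\<^sup>2 * (\<Sum>w\<in>ibox M. QQ (h *\<^sub>R tr \<eta> (lat w - \<xi>)))"

lemma grid_sum_measurable [measurable]: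
  assumes [measurable]: "g \<in> borel_measurable X" "z \<in> borel_measurable X"
  shows "(\<lambda>p. grid_sum M h (g p) (z p)) \<in> borel_measurable X"
  unfolding grid_sum_def by measurable

lemma grid_sum_bounded: "\<exists>B\<ge>0. \<forall>\<eta> \<xi>. \<bar>grid_sum M h \<eta> \<xi>\<bar> \<le> B"
proof -
  obtain B where B: "B \<ge> 0" "\<And>z. \<bar>QQ z\<bar> \<le> B" using Q_bounded[OF f_eq \<theta>m T \<epsilon>] by blast
  have "\<bar>grid_sum M h \<eta> \<xi>\<bar> \<le> h\<^sup>2 * (\<Sum>w\<in>ibox M. B)" for \<eta> \<xi>
    unfolding grid_sum_def abs_mult using B by (intro mult_mono order_trans[OF sum_abs] sum_mono) auto
  then show ?thesis using B by (intro exI[of _ "h\<^sup>2 * (\<Sum>w\<in>ibox M. B)"]) (auto intro!: mult_nonneg_nonneg sum_nonneg)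
qed

lemma tube_radius: "\<exists>R\<ge>0. \<forall>z. QQ z \<noteq> 0 \<longrightarrow> norm z \<le> R"
proof -
  have "bounded (tube \<Gamma> \<epsilon>)" using compact_tube[OF f_eq \<theta>m T \<epsilon>] by (rule compact_imp_bounded)
  then obtain R where R: "\<And>z. z \<in> tube \<Gamma> \<epsilon> \<Longrightarrow> norm z \<le> R" unfolding bounded_iff by blast
  then show ?thesis using Q_outside[OF f_eq \<theta>m T \<epsilon>] by (intro exI[of _ "max R 0"]) (metis max.cobounded1 max.cobounded2 order_trans)
qed

text \<open>The integrand vanishes beyond radius R. A lattice point outside the box has a coordinate
  of size at least M + 1, and the translation moves it by at most 1, so its sample point lies at
  distance at least h M > R.\<close>

lemma implicit_integral_eq_Fm:
  assumes h: "0 < h" and R: "\<And>z. QQ z \<noteq> 0 \<Longrightarrow> norm z \<le> R" and M: "R / h < real M" and \<eta>: "\<eta> \<in> SO2" and \<xi>: "\<xi> \<in> cbox 0 1"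
  shows "implicit_integral \<Omega> \<gamma> F \<theta> \<epsilon> h \<eta> \<xi> = grid_sum M h \<eta> \<xi>"
proof -
  obtain \<phi> where \<phi>: "\<eta> = rotation \<phi>" using SO2_obtain_angle[OF \<eta>] by metis
  let ?L = "{w::real^2. \<forall>i. w $ i \<in> \<int>}" and ?q = "\<lambda>w. QQ (h *\<^sub>R tr \<eta> (w - \<xi>))"
  have L: "?L = range lat"
  proof (intro set_eqI iffI)
    fix w :: "real^2" assume "w \<in> ?L"
    then obtain a b where "w $ 1 = of_int a" "w $ 2 = of_int b" by (metis Ints_cases mem_Collect_eq)
    then have "w = lat (a, b)" by (simp add: lat_def vec2_eq_iff)
    then show "w \<in> range lat" by blast
  qed (auto simp: lat_def vec2_def)
  have inj: "inj_on lat A" for A by (auto simp: inj_on_def lat_def vec2_eq_iff prod_eq_iff)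
  have zero: "?q (lat k) = 0" if "k \<notin> ibox M" for k
  proof (rule ccontr)
    assume "?q (lat k) \<noteq> 0"
    then have n: "h * norm (lat k - \<xi>) \<le> R" using R h by (force simp: \<phi> norm_tr)
    have c: "\<bar>(lat k - \<xi>) $ i\<bar> \<le> norm (lat k - \<xi>)" for i by (rule component_le_norm_cart)
    have "0 \<le> \<xi> $ i" "\<xi> $ i \<le> 1" for i using \<xi> by (auto simp: mem_box_cart)
    note x = this[of 1] this[of 2]
    have "real M \<le> norm (lat k - \<xi>)"
    proof -
      have "int M + 1 \<le> \<bar>fst k\<bar> \<or> int M + 1 \<le> \<bar>snd k\<bar>" using that by (cases k) (auto simp: ibox_def)
      then have "real M + 1 \<le> \<bar>real_of_int (fst k)\<bar> \<or> real M + 1 \<le> \<bar>real_of_int (snd k)\<bar>" by linarith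
      then show ?thesis using c[of 1] c[of 2] x by (auto simp: lat_def)
    qed
    then have "h * real M \<le> R" using n h by (meson mult_left_mono less_imp_le order_trans)
    then show False using M h by (simp add: divide_less_eq mult.commute)
  qed
  have "(\<Sum>\<^sub>\<infinity>w\<in>?L. ?q w) = (\<Sum>\<^sub>\<infinity>w\<in>lat ` ibox M. ?q w)"
    unfolding L by (rule infsum_cong_neutral) (use zero in auto)
  also have "\<dots> = (\<Sum>w\<in>lat ` ibox M. ?q w)" by simp
  also have "\<dots> = (\<Sum>k\<in>ibox M. ?q (lat k))" by (subst sum.reindex[OF inj]) simp
  finally show ?thesis unfolding implicit_integral_def grid_sum_def \<phi> matrix_inv_rotation by simp
qed

text \<open>Unfolding, as in Poisson summation: the cells of all lattice points tile the support, so
  the integral over one period of the sum becomes one integral over the plane. The factor h^2 is the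
  determinant of the map from the unit cell, and the character may be evaluated at the difference
  since it ignores lattice points.\<close>

lemma grid_sum_coefficient:
  assumes h: "0 < h" and R: "\<And>z. QQ z \<noteq> 0 \<Longrightarrow> norm z \<le> R" and M: "R / h + 1 \<le> real M"
  shows "(\<integral>\<xi>. of_real (grid_sum M h (rotation \<phi>) \<xi>) * cnj (chr l \<xi>) \<partial>cube) =
    (\<integral>y. of_real (QQ y) * chr l ((1 / h) *\<^sub>R rt \<phi> y) \<partial>lborel)"
proof -
  \<comment> \<open>A half-open cell, so that the images tile without overlap; it differs from the
    closed square by a null set.\<close>
  define C where "C = {z::real^2. 0 \<le> z $ 1 \<and> z $ 1 < 1 \<and> 0 \<le> z $ 2 \<and> z $ 2 < 1}"
  define g where "g w \<xi> = h *\<^sub>R tr (rotation \<phi>) (lat w - \<xi>)" for w \<xi>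
  define p where "p y = of_real (QQ y) * chr l ((1 / h) *\<^sub>R rt \<phi> y)" for y
  have C [measurable]: "C \<in> sets borel" unfolding C_def by measurable
  have rtm [measurable]: "(\<lambda>z. rt \<phi> z) \<in> borel_measurable borel" unfolding rt_def by measurable
  have pm [measurable]: "p \<in> borel_measurable borel" unfolding p_def chr_def rt_def by measurable
  have gm [measurable]: "g w \<in> borel_measurable borel" for w unfolding g_def[abs_def] by measurable
  have pi: "integrable lborel p"
    unfolding p_def by (rule Q_integrable[OF f_eq \<theta>m T \<epsilon>]) (auto simp: chr_def rt_def)
  have ginv: "g w (lat w - (1 / h) *\<^sub>R rt \<phi> y) = y" "lat w - (1 / h) *\<^sub>R rt \<phi> (g w \<xi>) = \<xi>" for w y \<xi>
    using h by (simp_all add: g_def linear_tr linear_rt rt_tr)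
  have gC: "g w ` C = {y. lat w - (1 / h) *\<^sub>R rt \<phi> y \<in> C}" for w
  proof (intro set_eqI iffI)
    fix y assume "y \<in> {y. lat w - (1 / h) *\<^sub>R rt \<phi> y \<in> C}"
    then show "y \<in> g w ` C" using ginv(1)[of w y] by (metis imageI mem_Collect_eq)
  next
    fix y assume "y \<in> g w ` C"
    then obtain z where "y = g w z" "z \<in> C" by blast
    then show "y \<in> {y. lat w - (1 / h) *\<^sub>R rt \<phi> y \<in> C}" using ginv(2)[of w z] by simp
  qed
  have gCm [measurable]: "g w ` C \<in> sets borel" for w
    unfolding gC by measurable
  have pg: "p (g w \<xi>) = of_real (QQ (g w \<xi>)) * cnj (chr l \<xi>)" for w \<xi>
  proof -
    have "(1 / h) *\<^sub>R rt \<phi> (g w \<xi>) = lat w - \<xi>" using ginv(2)[of w \<xi>] by (simp add: algebra_simps)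
    then show ?thesis by (simp add: p_def chr_lattice_diff)
  qed
  define g' where "g' z = h *\<^sub>R tr (rotation \<phi>) (- z)" for z
  have lin: "linear g'" unfolding g'_def tr_def by (rule linearI) (simp_all add: vec2_eq_iff algebra_simps)
  have det: "\<bar>det (matrix g')\<bar> = h\<^sup>2"
  proof -
    have "det (matrix g') = h\<^sup>2 * (cos \<phi>)\<^sup>2 + h\<^sup>2 * (sin \<phi>)\<^sup>2"
      unfolding det_matrix_2 g'_def tr_def by (simp add: axis_def power2_eq_square mult_ac)
    also have "\<dots> = h\<^sup>2 * ((cos \<phi>)\<^sup>2 + (sin \<phi>)\<^sup>2)" unfolding distrib_left ..
    finally show ?thesis by simp
  qed
  have der: "(g w has_derivative g') (at z within C)" for w z
  proof -
    have "g w z = g' z + g w 0" for z by (simp add: g_def g'_def tr_def vec2_eq_iff algebra_simps)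
    then have "g w = (\<lambda>z. g' z + g w 0)" by blast
    moreover have "((\<lambda>z. g' z + g w 0) has_derivative g') (at z within C)"
      using lin by (intro has_derivative_add_const bounded_linear_imp_has_derivative) (simp add: linear_conv_bounded_linear)
    ultimately show ?thesis by simp
  qed
  have piece: "(\<integral>z. indicator (g w ` C) z *\<^sub>R p z \<partial>lborel) = (\<integral>z. indicator C z *\<^sub>R (h\<^sup>2 *\<^sub>R p (g w z)) \<partial>lborel)" for w
    unfolding det[symmetric]
  proof (rule lborel_change_of_variables[OF C gCm der _ pi])
    show "inj_on (g w) C" by (rule inj_on_inverseI[of _ "\<lambda>y. lat w - (1 / h) *\<^sub>R rt \<phi> y"]) (rule ginv)
  qed measurable
  have ic: "integrable lborel (\<lambda>z. indicator (g w ` C) z *\<^sub>R p z)" for w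
    using pi by (intro integrable_mult_indicator) auto
  have tiling: "(\<Sum>w\<in>ibox M. indicator (g w ` C) y *\<^sub>R p y) = p y" for y
  proof (cases "QQ y = 0")
    case True then show ?thesis by (simp add: p_def)
  next
    case False
    define u where "u = (1 / h) *\<^sub>R rt \<phi> y"
    have "norm u \<le> R / h" using R[OF False] h by (simp add: u_def norm_rt divide_right_mono)
    then have ub: "\<bar>u $ i\<bar> \<le> R / h" for i using component_le_norm_cart[of u i] by linarith
    \<comment> \<open>The conditions 0 \<le> w - u < 1 in each coordinate single out the ceilings of
      u, which lie in the box by the choice of M.\<close>
    define w0 where "w0 = (\<lceil>u $ 1\<rceil>, \<lceil>u $ 2\<rceil>)"
    have mem: "y \<in> g w ` C \<longleftrightarrow> w = w0" for w
    proof -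
      have "y \<in> g w ` C \<longleftrightarrow> (0 \<le> of_int (fst w) - u $ 1 \<and> of_int (fst w) - u $ 1 < 1) \<and> (0 \<le> of_int (snd w) - u $ 2 \<and> of_int (snd w) - u $ 2 < 1)"
        unfolding gC by (auto simp: C_def lat_def u_def)
      also have "\<dots> \<longleftrightarrow> fst w = \<lceil>u $ 1\<rceil> \<and> snd w = \<lceil>u $ 2\<rceil>"
      proof -
        have "(0 \<le> real_of_int a - r \<and> real_of_int a - r < 1) \<longleftrightarrow> a = \<lceil>r\<rceil>" for a r by linarith
        then show ?thesis by simp
      qed
      finally show ?thesis by (auto simp: w0_def prod_eq_iff)
    qed
    have "\<lceil>u $ i\<rceil> \<in> {- int M..int M}" for i
    proof -
      have "u $ i \<le> real M" "- real M \<le> u $ i" using ub[of i] M by linarith+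
      then show ?thesis by (auto simp: ceiling_le_iff intro: order_trans[OF _ le_of_int_ceiling]) linarith
    qed
    then have "w0 \<in> ibox M" by (simp add: w0_def ibox_def)
    then have "(\<Sum>w\<in>ibox M. if w0 = w then p y else 0) = p y" by simp
    moreover have "indicator (g w ` C) y *\<^sub>R p y = (if w0 = w then p y else 0)" for w using mem[of w] by (simp add: indicator_def)
    ultimately show ?thesis by simp
  qed
  have ce: "cube = density lborel (\<lambda>x. ennreal (indicat_real (cbox 0 1) x))" by (simp add: cube_def ennreal_indicator)
  have "(\<integral>\<xi>. of_real (grid_sum M h (rotation \<phi>) \<xi>) * cnj (chr l \<xi>) \<partial>cube) = (\<integral>\<xi>. (\<Sum>w\<in>ibox M. h\<^sup>2 *\<^sub>R p (g w \<xi>)) \<partial>cube)"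
    unfolding pg by (simp add: grid_sum_def g_def sum_distrib_left sum_distrib_right scaleR_conv_of_real mult_ac)
  also have "\<dots> = (\<integral>\<xi>. indicator (cbox 0 1) \<xi> *\<^sub>R (\<Sum>w\<in>ibox M. h\<^sup>2 *\<^sub>R p (g w \<xi>)) \<partial>lborel)"
    unfolding ce by (subst integral_density) auto
  also have "\<dots> = (\<integral>\<xi>. indicator C \<xi> *\<^sub>R (\<Sum>w\<in>ibox M. h\<^sup>2 *\<^sub>R p (g w \<xi>)) \<partial>lborel)"
  proof (rule integral_cong_AE)
    have n: "AE z::real^2 in lborel. z \<notin> {z. z $ i = 1}" for i
    proof -
      have "negligible {z::real^2. axis i 1 \<bullet> z = 1}" by (intro negligible_hyperplane) auto
      moreover have "{z::real^2. axis i 1 \<bullet> z = 1} = {z. z $ i = 1}" by (simp add: inner_axis')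
      moreover have "{z::real^2. z $ i = 1} \<in> sets lborel" by measurable
      ultimately show ?thesis by (intro AE_not_in) (simp add: negligible_iff_null_sets null_sets_completion_iff)
    qed
    show "AE \<xi> in lborel. indicator (cbox 0 1) \<xi> *\<^sub>R (\<Sum>w\<in>ibox M. h\<^sup>2 *\<^sub>R p (g w \<xi>)) = indicator C \<xi> *\<^sub>R (\<Sum>w\<in>ibox M. h\<^sup>2 *\<^sub>R p (g w \<xi>))"
      using n[of 1] n[of 2] by eventually_elim (auto simp: C_def indicator_def mem_box_cart forall_2)
  qed measurable
  also have "\<dots> = (\<integral>\<xi>. (\<Sum>w\<in>ibox M. indicator C \<xi> *\<^sub>R (h\<^sup>2 *\<^sub>R p (g w \<xi>))) \<partial>lborel)"
    by (simp add: scaleR_sum_right)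
  also have "\<dots> = (\<Sum>w\<in>ibox M. (\<integral>z. indicator C z *\<^sub>R (h\<^sup>2 *\<^sub>R p (g w z)) \<partial>lborel))"
  proof (rule Bochner_Integration.integral_sum)
    fix w
    obtain B where B: "B \<ge> 0" "\<And>z. \<bar>QQ z\<bar> \<le> B" using Q_bounded[OF f_eq \<theta>m T \<epsilon>] by blast
    have "integrable cube (\<lambda>z. h\<^sup>2 *\<^sub>R p (g w z))"
      using B by (intro integrable_cube[of _ "h\<^sup>2 * B"]) (auto simp: p_def norm_mult intro!: mult_left_mono)
    then have "integrable lborel (\<lambda>z. indicator (cbox 0 1) z *\<^sub>R (h\<^sup>2 *\<^sub>R p (g w z)))"
      unfolding ce by (subst (asm) integrable_density) auto
    from integrable_mult_indicator[OF _ this, of C]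
    have "integrable lborel (\<lambda>z. indicator C z *\<^sub>R indicator (cbox 0 1) z *\<^sub>R (h\<^sup>2 *\<^sub>R p (g w z)))" by simp
    moreover have "(\<lambda>z. indicator C z *\<^sub>R indicator (cbox 0 1) z *\<^sub>R (h\<^sup>2 *\<^sub>R p (g w z))) = (\<lambda>z. indicator C z *\<^sub>R (h\<^sup>2 *\<^sub>R p (g w z)))"
      by (auto simp: fun_eq_iff indicator_def C_def mem_box_cart forall_2)
    ultimately show "integrable lborel (\<lambda>z. indicator C z *\<^sub>R (h\<^sup>2 *\<^sub>R p (g w z)))" by simp
  qed
  also have "\<dots> = (\<Sum>w\<in>ibox M. (\<integral>z. indicator (g w ` C) z *\<^sub>R p z \<partial>lborel))"
    unfolding piece ..
  also have "\<dots> = (\<integral>z. (\<Sum>w\<in>ibox M. indicator (g w ` C) z *\<^sub>R p z) \<partial>lborel)"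
    using ic by (intro Bochner_Integration.integral_sum[symmetric]) auto
  also have "\<dots> = (\<integral>z. p z \<partial>lborel)" unfolding tiling ..
  finally show ?thesis by (simp add: p_def)
qed

text \<open>In polar coordinates for the dual lattice point, rotating the grid by \<phi> only
  changes the angle of the frequency to \<alpha> - \<phi>. So an average over rotations is an
  average over the circle of radius 2 pi r / h.\<close>

lemma grid_sum_coefficient_Qh:
  assumes h: "0 < h" and R: "\<And>z. QQ z \<noteq> 0 \<Longrightarrow> norm z \<le> R" and M: "R / h + 1 \<le> real M"
    and \<alpha>: "of_int (fst l) = r * cos \<alpha>" "of_int (snd l) = r * sin \<alpha>"
  shows "(\<integral>\<xi>. of_real (grid_sum M h (rotation \<phi>) \<xi>) * cnj (chr l \<xi>) \<partial>cube) = Qh \<theta> \<epsilon> (2 * pi * r / h) (\<alpha> - \<phi>)"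
proof -
  let ?\<Lambda> = "2 * pi * r / h"
  have "chr l ((1 / h) *\<^sub>R rt \<phi> y) = cis (?\<Lambda> * cos (\<alpha> - \<phi>) * y $ 1 + ?\<Lambda> * sin (\<alpha> - \<phi>) * y $ 2)" for y
    unfolding chr_def \<alpha> by (simp add: rt_def cos_diff sin_diff algebra_simps add_divide_distrib diff_divide_distrib)
  note c = this
  have "(\<integral>\<xi>. of_real (grid_sum M h (rotation \<phi>) \<xi>) * cnj (chr l \<xi>) \<partial>cube) =
     (\<integral>s. of_real (\<theta> s) * (\<integral>t. of_real (f t) * cis (?\<Lambda> * cos (\<alpha> - \<phi>) * \<Phi> t (\<epsilon> * s) $ 1 + ?\<Lambda> * sin (\<alpha> - \<phi>) * \<Phi> t (\<epsilon> * s) $ 2) \<partial>leb 0 1) \<partial>leb (-1) 1)"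
    by (subst grid_sum_coefficient[OF h _ M]) (erule R, unfold c, rule Q_fourier[OF f_eq \<theta>m T \<epsilon>])
  also have "\<dots> = Qh \<theta> \<epsilon> ?\<Lambda> (\<alpha> - \<phi>)"
  proof -
    have e: "?\<Lambda> * cos (\<alpha> - \<phi>) * \<Phi> t s $ 1 + ?\<Lambda> * sin (\<alpha> - \<phi>) * \<Phi> t s $ 2 = ?\<Lambda> * Ph s t (\<alpha> - \<phi>)" for t s
      by (simp add: \<Phi>_nth Ph_def algebra_simps add_divide_distrib)
    show ?thesis unfolding e Qh_def ..
  qed
  finally show ?thesis .
qed

end

end

section \<open>Summability over the dual lattice and the rotation average\<close>

definition rad :: "int \<times> int \<Rightarrow> real" where
  "rad k = sqrt ((of_int (fst k))\<^sup>2 + (of_int (snd k))\<^sup>2)"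

lemma rad_polar: "\<exists>a. of_int (fst k) = rad k * cos a \<and> of_int (snd k) = rad k * sin a"
proof -
  obtain r a where a: "Complex (of_int (fst k)) (of_int (snd k)) = rcis r a" "r = cmod (Complex (of_int (fst k)) (of_int (snd k)))"
    using rcis_cmod_Arg by metis
  have "rad k = r" by (simp add: a(2) rad_def cmod_def)
  moreover have "of_int (fst k) = r * cos a" "of_int (snd k) = r * sin a"
    using arg_cong[OF a(1), of Re] arg_cong[OF a(1), of Im] by simp_all
  ultimately show ?thesis by blast
qed

lemma rad_ge: "\<bar>of_int (fst k)\<bar> \<le> rad k" "\<bar>of_int (snd k)\<bar> \<le> rad k" and rad_ge_1: "k \<noteq> 0 \<Longrightarrow> 1 \<le> rad k"
proof -
  show "\<bar>of_int (fst k)\<bar> \<le> rad k" "\<bar>of_int (snd k)\<bar> \<le> rad k"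
    unfolding rad_def by (simp_all add: real_le_rsqrt)
  moreover assume "k \<noteq> 0"
  then have "1 \<le> \<bar>fst k\<bar> \<or> 1 \<le> \<bar>snd k\<bar>" by (auto simp: prod_eq_iff)
  then have "1 \<le> \<bar>real_of_int (fst k)\<bar> \<or> 1 \<le> \<bar>real_of_int (snd k)\<bar>" by linarith
  ultimately show "1 \<le> rad k" by linarith
qed

text \<open>Away from 0 both 1 + |k1| and 1 + |k2| are at most 2 rad k, so their product to the
  power 3/2 is at most 8 (rad k)^3. The sum is thus dominated by a product of two convergent
  one-dimensional sums with exponent 3/2.\<close>

lemma lattice_sum_bounded:
  assumes "3 \<le> p"
  shows "\<exists>S\<ge>0. \<forall>N. (\<Sum>k\<in>ibox N - {0}. 1 / rad k ^ p) \<le> S"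
proof -
  define a where "a j = (1 + \<bar>real_of_int j\<bar>) powr (- 3 / 2)" for j
  define A where "A = (\<Sum>n. real (Suc n) powr (- 3 / 2))"
  have a0: "0 \<le> a j" for j by (simp add: a_def)
  have sA: "summable (\<lambda>n. real (Suc n) powr (- 3 / 2))"
    using summable_real_powr_iff[of "- 3 / 2"] summable_Suc_iff[of "\<lambda>n. real n powr (- 3 / 2)"] by simp
  have A0: "0 \<le> A" unfolding A_def using sA by (intro suminf_nonneg) auto
  have half: "(\<Sum>j\<in>int ` {..N}. a j) \<le> A" for N
  proof -
    have "(\<Sum>j\<in>int ` {..N}. a j) = (\<Sum>n\<le>N. real (Suc n) powr (- 3 / 2))"
      by (subst sum.reindex) (auto simp: a_def)
    also have "\<dots> \<le> A" unfolding A_def by (rule sum_le_suminf[OF sA]) auto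
    finally show ?thesis .
  qed
  have line: "(\<Sum>j\<in>{- int N..int N}. a j) \<le> 2 * A" for N
  proof -
    have e: "{- int N..int N} = int ` {..N} \<union> uminus ` int ` {..N}"
    proof (intro set_eqI iffI)
      fix j assume "j \<in> {- int N..int N}"
      then have "j = int (nat \<bar>j\<bar>) \<or> j = - int (nat \<bar>j\<bar>)" "nat \<bar>j\<bar> \<in> {..N}" by auto
      then show "j \<in> int ` {..N} \<union> uminus ` int ` {..N}" by blast
    qed auto
    have "(\<Sum>j\<in>{- int N..int N}. a j) \<le> (\<Sum>j\<in>int ` {..N}. a j) + (\<Sum>j\<in>uminus ` int ` {..N}. a j)"
      using sum.union_inter[of "int ` {..N}" "uminus ` int ` {..N}" a] a0 sum_nonneg[of "int ` {..N} \<inter> uminus ` int ` {..N}" a]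
      unfolding e by auto
    also have "(\<Sum>j\<in>uminus ` int ` {..N}. a j) = (\<Sum>j\<in>int ` {..N}. a j)"
      by (subst sum.reindex) (auto simp: a_def)
    finally show ?thesis using half[of N] by linarith
  qed
  have summand: "1 / rad k ^ p \<le> 8 * (a (fst k) * a (snd k))" if "k \<noteq> 0" for k
  proof -
    let ?x = "1 + \<bar>real_of_int (fst k)\<bar>" and ?y = "1 + \<bar>real_of_int (snd k)\<bar>"
    have r: "1 \<le> rad k" using rad_ge_1 that by blast
    have "?x * ?y \<le> (2 * rad k) * (2 * rad k)"
      using rad_ge[of k] r by (intro mult_mono) linarith+
    then have "(?x * ?y) powr (3 / 2) \<le> ((2 * rad k) * (2 * rad k)) powr (3 / 2)" by (intro powr_mono2) auto
    also have "\<dots> = ((2 * rad k) powr 2) powr (3 / 2)" using r by (simp add: power2_eq_square)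
    also have "\<dots> = (2 * rad k) powr 3" by (simp only: powr_powr) simp
    also have "\<dots> = 8 * rad k ^ 3" using r by (simp add: power_mult_distrib)
    also have "\<dots> \<le> 8 * rad k ^ p" using assms r by (intro mult_left_mono power_increasing) auto
    finally have "1 / rad k ^ p \<le> 8 / ((?x * ?y) powr (3 / 2))"
      using r by (intro frac_le[of 8 8 "(?x * ?y) powr (3 / 2)" "8 * rad k ^ p", simplified] ) auto
    also have "\<dots> = 8 * (a (fst k) * a (snd k))"
      by (simp add: a_def powr_mult powr_minus divide_simps)
    finally show ?thesis .
  qed
  have "(\<Sum>k\<in>ibox N - {0}. 1 / rad k ^ p) \<le> 8 * (2 * A)\<^sup>2" for N
  proof -
    have "(\<Sum>k\<in>ibox N - {0}. 1 / rad k ^ p) \<le> (\<Sum>k\<in>ibox N - {0}. 8 * (a (fst k) * a (snd k)))"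
      using summand by (intro sum_mono) auto
    also have "\<dots> \<le> (\<Sum>k\<in>ibox N. 8 * (a (fst k) * a (snd k)))"
      using a0 by (intro sum_mono2) auto
    also have "\<dots> = 8 * (\<Sum>j\<in>{- int N..int N}. a j)\<^sup>2"
    proof -
      have "(\<Sum>k\<in>ibox N. a (fst k) * a (snd k)) = (\<Sum>j\<in>{- int N..int N}. a j) * (\<Sum>j\<in>{- int N..int N}. a j)"
        unfolding sum_product sum.cartesian_product ibox_def by (rule sum.cong) auto
      then show ?thesis by (simp add: sum_distrib_left[symmetric] power2_eq_square)
    qed
    also have "\<dots> \<le> 8 * (2 * A)\<^sup>2" using line[of N] a0 by (intro mult_left_mono power_mono sum_nonneg) auto
    finally show ?thesis .
  qed
  then show ?thesis by (intro exI[of _ "8 * (2 * A)\<^sup>2"]) auto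
qed

lemma leb_reflect_shift:
  fixes g :: "real \<Rightarrow> real"
  assumes [measurable]: "g \<in> borel_measurable borel" and b: "\<And>x. \<bar>g x\<bar> \<le> C" and per: "\<And>t. g (t + 2 * pi) = g t"
  shows "(\<integral>t. g (c - t) \<partial>leb 0 (2 * pi)) = (\<integral>t. g t \<partial>leb 0 (2 * pi))"
proof -
  have "(\<integral>t. g (c - t) \<partial>leb 0 (2 * pi)) = integral {0..2 * pi} (\<lambda>t. g (c - t))"
    using b by (subst leb_eq_integral(2)[of _ _ _ C]) auto
  also have "\<dots> = integral {- (2 * pi)..0} (\<lambda>t. g (c + t))"
    using Henstock_Kurzweil_Integration.integral_reflect_real[of 0 "- (2 * pi)" "\<lambda>t. g (c + t)"] unfolding minus_zero minus_minus diff_conv_add_uminus .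
  also have "\<dots> = (\<integral>t. g (c + t) \<partial>leb (- (2 * pi)) 0)"
    using b by (subst leb_eq_integral(2)[of _ _ _ C]) auto
  also have "\<dots> = (\<integral>t. g t \<partial>leb 0 (2 * pi))"
    using leb_periodic_shift[of g C "2 * pi", where c = c and a = "- (2 * pi)"] b per by simp
  finally show ?thesis .
qed

lemma integral_haar_SO2:
  fixes g :: "real^2^2 \<Rightarrow> real"
  assumes "g \<in> borel_measurable (restrict_space borel SO2)"
  shows "(\<integral>\<eta>. g \<eta> \<partial>haar_SO2) = (\<integral>\<phi>. g (rotation \<phi>) \<partial>leb 0 (2 * pi)) / (2 * pi)"
proof -
  have gm [measurable]: "(\<lambda>\<phi>. g (rotation \<phi>)) \<in> borel_measurable borel"
    using measurable_compose[OF rotation_measurable assms] .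
  have u: "uniform_measure lborel {0..<2*pi} = density lborel (\<lambda>x. ennreal (indicator {0..<2*pi} x / (2 * pi)))"
  proof -
    have "indicator {0..<2*pi} x / emeasure lborel {0..<2*pi} = ennreal (indicator {0..<2*pi} x / (2 * pi))" for x
      by (simp add: ennreal_indicator[symmetric] divide_ennreal flip: ennreal_mult)
    then show ?thesis unfolding uniform_measure_def by simp
  qed
  have l: "leb 0 (2 * pi) = density lborel (\<lambda>x. ennreal (indicator {0..2*pi} x))"
    by (simp add: leb_def ennreal_indicator)
  have "(\<integral>\<eta>. g \<eta> \<partial>haar_SO2) = (\<integral>\<phi>. g (rotation \<phi>) \<partial>uniform_measure lborel {0..<2*pi})"
    unfolding haar_SO2_def using assms by (intro integral_distr) auto
  also have "\<dots> = (\<integral>\<phi>. (indicator {0..<2*pi} \<phi> / (2 * pi)) *\<^sub>R g (rotation \<phi>) \<partial>lborel)"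
    unfolding u by (subst integral_density) auto
  also have "\<dots> = (\<integral>\<phi>. (indicator {0..2*pi} \<phi> *\<^sub>R g (rotation \<phi>)) / (2 * pi) \<partial>lborel)"
    using AE_lborel_singleton[of "2 * pi"] by (intro integral_cong_AE) (auto elim!: eventually_mono simp: indicator_def)
  also have "\<dots> = (\<integral>\<phi>. g (rotation \<phi>) \<partial>leb 0 (2 * pi)) / (2 * pi)"
    unfolding l by (subst integral_density) auto
  finally show ?thesis .
qed

lemma integral_cube_restrict:
  fixes g :: "real^2 \<Rightarrow> real"
  assumes [measurable]: "g \<in> borel_measurable borel"
  shows "(\<integral>z. g z \<partial>restrict_space lborel (cbox 0 1)) = (\<integral>z. g z \<partial>cube)"
proof -
  have ce: "cube = density lborel (\<lambda>x. ennreal (indicator (cbox 0 1) x))" by (simp add: cube_def ennreal_indicator)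
  show ?thesis unfolding ce by (subst integral_density) (auto simp: integral_restrict_space)
qed

section \<open>The mean square error\<close>

context curve_out begin

context
  fixes F :: "real^2 \<Rightarrow> real" and \<theta> :: "real \<Rightarrow> real" and T \<epsilon> :: real and FF :: "real \<Rightarrow> complex" and m :: nat
  assumes f_eq: "\<And>t. f t = F (\<gamma> t) * \<bar>v t\<bar>"
    and \<theta>m [measurable]: "\<theta> \<in> borel_measurable borel" and T: "\<And>s. \<bar>\<theta> s\<bar> \<le> T"
    and \<epsilon>: "0 < \<epsilon>" "\<epsilon> < e1"
    and FF: "fourier_meas FF"
    and rep: "\<And>y. (- \<i> * of_real y) ^ m * (\<integral>s. of_real (\<theta> s) * cis (s * y) \<partial>leb (-1) 1) = FF y"
    and mass: "(\<integral>s. \<theta> s \<partial>leb (-1) 1) = 1" and m: "1 \<le> m"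
begin

abbreviation (input) II where "II \<equiv> curve_integral \<gamma> F"
abbreviation (input) FM where "FM \<equiv> grid_sum F \<theta> \<epsilon>"

lemmas grid_sum_meas [measurable] = grid_sum_measurable[OF f_eq \<theta>m T \<epsilon>]
lemmas Qh_m = Qh_meas[OF \<theta>m T FF rep]

lemma curve_integral_eq: "II = (\<integral>t. f t \<partial>leb 0 1)"
proof -
  obtain Fb where Fb: "\<And>t. \<bar>f t\<bar> \<le> Fb" using smooth_bdd_bound smooth by blast
  have "norm (Tg t) = 1" for t using unit[of t] by (simp add: norm_eq_sqrt_inner inner_2 Tg_def power2_eq_square add.commute)
  then have "F (\<gamma> t) * norm (vector_derivative \<gamma> (at t)) = f t" for t
    using vector_derivative_at[OF \<gamma>_deriv] by (simp add: f_eq)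
  then have "II = integral {0..1} f" by (simp add: curve_integral_def)
  also have "\<dots> = (\<integral>t. f t \<partial>leb 0 1)" using Fb by (subst leb_eq_integral(2)[of _ _ _ Fb]) auto
  finally show ?thesis .
qed

lemma Qh_bounded: "\<exists>B\<ge>0. \<forall>\<Lambda> t. cmod (Qh \<theta> \<epsilon> \<Lambda> t) \<le> B"
proof -
  obtain Fb where Fb: "\<And>t. \<bar>f t\<bar> \<le> Fb" using smooth_bdd_bound smooth by blast
  have Fb0: "Fb \<ge> 0" and T0: "T \<ge> 0" using order_trans[OF abs_ge_zero] Fb T by blast+
  have "cmod (\<integral>u. of_real (f u) * cis (\<Lambda> * Ph (\<epsilon> * s) u t) \<partial>leb 0 1) \<le> Fb * (1 - 0)" for \<Lambda> s t
    using Fb Fb0 by (intro norm_leb_le) (auto simp: norm_mult)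
  then have "cmod (Qh \<theta> \<epsilon> \<Lambda> t) \<le> (T * Fb) * (1 - (-1))" for \<Lambda> t
    unfolding Qh_def using T T0 Fb0 by (intro norm_leb_le) (auto simp: norm_mult intro!: mult_mono)
  then show ?thesis using T0 Fb0 by (intro exI[of _ "(T * Fb) * (1 - (-1))"]) auto
qed

lemma fc_error:
  assumes h: "0 < h" and R: "\<And>z. integrand \<Omega> \<gamma> F \<theta> \<epsilon> z \<noteq> 0 \<Longrightarrow> norm z \<le> R" and M: "R / h + 1 \<le> real M"
    and a: "of_int (fst l) = rad l * cos a" "of_int (snd l) = rad l * sin a"
  shows "fc (\<lambda>\<xi>. FM M h (rotation \<phi>) \<xi> - II) l = (if l = 0 then 0 else Qh \<theta> \<epsilon> (2 * pi * rad l / h) (a - \<phi>))"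
proof -
  obtain B where B: "\<And>\<xi>. \<bar>FM M h (rotation \<phi>) \<xi>\<bar> \<le> B" using grid_sum_bounded[OF f_eq \<theta>m T \<epsilon>] by meson
  have i: "integrable cube (\<lambda>\<xi>. of_real (FM M h (rotation \<phi>) \<xi>) * cnj (chr l \<xi>))"
    using B by (intro integrable_cube[of _ B]) (auto simp: norm_mult chr_def)
  have j: "integrable cube (\<lambda>\<xi>. of_real II * cnj (chr l \<xi>))"
    by (intro integrable_cube[of _ "\<bar>II\<bar>"]) (auto simp: norm_mult chr_def)
  have "fc (\<lambda>\<xi>. FM M h (rotation \<phi>) \<xi> - II) l =
      (\<integral>\<xi>. of_real (FM M h (rotation \<phi>) \<xi>) * cnj (chr l \<xi>) - of_real II * cnj (chr l \<xi>) \<partial>cube)"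
    unfolding fc_def by (simp add: left_diff_distrib)
  also have "\<dots> = (\<integral>\<xi>. of_real (FM M h (rotation \<phi>) \<xi>) * cnj (chr l \<xi>) \<partial>cube) - of_real II * (\<integral>\<xi>. cnj (chr l \<xi>) \<partial>cube)"
    using i j by simp
  also have "(\<integral>\<xi>. of_real (FM M h (rotation \<phi>) \<xi>) * cnj (chr l \<xi>) \<partial>cube) = Qh \<theta> \<epsilon> (2 * pi * rad l / h) (a - \<phi>)"
    by (rule grid_sum_coefficient_Qh[OF f_eq \<theta>m T \<epsilon> h _ M a]) (rule R)
  also have "\<dots> - of_real II * (\<integral>\<xi>. cnj (chr l \<xi>) \<partial>cube) = (if l = 0 then 0 else Qh \<theta> \<epsilon> (2 * pi * rad l / h) (a - \<phi>))"
  proof (cases "l = 0")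
    \<comment> \<open>At frequency 0 the phase is trivial and \<open>Qh\<close> is the mass of the
      weight, which is 1, times the curve integral; it cancels the subtracted value exactly.\<close>
    case True
    have "Qh \<theta> \<epsilon> 0 t = of_real ((\<integral>s. \<theta> s \<partial>leb (-1) 1) * II)" for t
      unfolding Qh_def curve_integral_eq by simp
    then show ?thesis using True by (simp add: integral_chr rad_def mass)
  qed (simp add: integral_chr)
  finally show ?thesis .
qed

text \<open>The box in \<open>Parseval_le\<close> depends on the rotation and on e. Passing to the
  supremum of the partial sums removes this dependence, and monotone convergence moves the supremum
  outside the integral over rotations, where each partial sum is bounded termwise by the circle
  estimate.\<close>

lemma mean_square_error:
  assumes h: "0 < h" "h \<le> 1" and R: "\<And>z. integrand \<Omega> \<gamma> F \<theta> \<epsilon> z \<noteq> 0 \<Longrightarrow> norm z \<le> R" and M: "R / h + 1 \<le> real M"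
    and C: "0 \<le> C" "\<And>\<Lambda>. 1 \<le> \<Lambda> \<Longrightarrow> (\<integral>t. (cmod (Qh \<theta> \<epsilon> \<Lambda> t))\<^sup>2 \<partial>leb 0 (2 * pi)) \<le> C / ((\<epsilon> * \<Lambda>) ^ (2 * m) * \<Lambda>)"
    and S: "0 \<le> S" "\<And>N. (\<Sum>k\<in>ibox N - {0}. 1 / rad k ^ (2 * m + 1)) \<le> S"
  shows "(\<integral>\<phi>. (\<integral>\<xi>. (FM M h (rotation \<phi>) \<xi> - II)\<^sup>2 \<partial>cube) \<partial>leb 0 (2 * pi)) \<le> C * S * (h ^ (2 * m + 1) / \<epsilon> ^ (2 * m))"
proof -
  define D where "D \<phi> \<xi> = FM M h (rotation \<phi>) \<xi> - II" for \<phi> \<xi>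
  obtain B0 where B0: "\<And>\<eta> \<xi>. \<bar>FM M h \<eta> \<xi>\<bar> \<le> B0" using grid_sum_bounded[OF f_eq \<theta>m T \<epsilon>] by meson
  define B where "B = B0 + \<bar>II\<bar>"
  have B: "\<bar>D \<phi> \<xi>\<bar> \<le> B" for \<phi> \<xi> unfolding D_def B_def using B0[of "rotation \<phi>" \<xi>] by linarith
  have B2: "(D \<phi> \<xi>)\<^sup>2 \<le> B\<^sup>2" for \<phi> \<xi> using power_mono[OF B abs_ge_zero, of \<phi> \<xi> 2] by simp
  have Dm [measurable]: "(\<lambda>p. D (g p) (z p)) \<in> borel_measurable X" if [measurable]: "g \<in> borel_measurable X" "z \<in> borel_measurable X" for g z and X :: "'x measure"
    unfolding D_def by measurable
  define G where "G \<phi> = (\<integral>\<xi>. (D \<phi> \<xi>)\<^sup>2 \<partial>cube)" for \<phi>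
  have G0: "0 \<le> G \<phi>" for \<phi> unfolding G_def by simp
  have Gm [measurable]: "G \<in> borel_measurable borel"
    unfolding G_def[abs_def] by (rule cube.borel_measurable_lebesgue_integral) measurable
  have Gb: "G \<phi> \<le> B\<^sup>2" for \<phi>
    unfolding G_def using B2 by (intro cube.integral_le_const integrable_cube[of _ "B\<^sup>2"]) auto
  obtain a where a: "\<And>l. of_int (fst l) = rad l * cos (a l)" "\<And>l. of_int (snd l) = rad l * sin (a l)"
    using rad_polar by metis
  define P where "P l \<phi> = (cmod (Qh \<theta> \<epsilon> (2 * pi * rad l / h) (a l - \<phi>)))\<^sup>2" for l \<phi>
  define s where "s N \<phi> = (\<Sum>l\<in>ibox N - {0}. P l \<phi>)" for N \<phi>
  have Qm: "(\<lambda>t. (cmod (Qh \<theta> \<epsilon> \<Lambda> (g t)))\<^sup>2) \<in> borel_measurable borel" if g: "g \<in> borel_measurable borel" for \<Lambda> g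
    using borel_measurable_power[OF measurable_compose[OF Qh_m[OF g] borel_measurable_norm]] .
  have Pm [measurable]: "P l \<in> borel_measurable borel" for l unfolding P_def[abs_def] by (rule Qm) simp
  obtain Bq where Bq: "Bq \<ge> 0" "\<And>\<Lambda> t. cmod (Qh \<theta> \<epsilon> \<Lambda> t) \<le> Bq" using Qh_bounded by blast
  have Pb: "norm (P l \<phi>) \<le> Bq\<^sup>2" for l \<phi> unfolding P_def using Bq by (simp add: power_mono)
  have Pi: "integrable (leb 0 (2 * pi)) (P l)" for l by (rule integrable_leb[OF Pm Pb])
  have Pbound: "(\<integral>\<phi>. P l \<phi> \<partial>leb 0 (2 * pi)) \<le> C * (h ^ (2 * m + 1) / \<epsilon> ^ (2 * m)) * (1 / rad l ^ (2 * m + 1))" if "l \<noteq> 0" for l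
  proof -
    let ?\<Lambda> = "2 * pi * rad l / h"
    have r: "1 \<le> rad l" using rad_ge_1 that by blast
    have pi: "1 \<le> 2 * pi" using pi_gt3 by linarith
    \<comment> \<open>The factor 2 pi in the frequency only helps and is dropped; h \<le> 1 and rad
      l \<ge> 1 put the frequency in the range \<Lambda> \<ge> 1 of the circle bound.\<close>
    have L: "rad l / h \<le> ?\<Lambda>" "1 \<le> rad l / h" "0 < rad l / h"
      using mult_right_mono[OF pi, of "rad l / h"] r h by (simp_all add: field_simps)
    have "(\<integral>\<phi>. P l \<phi> \<partial>leb 0 (2 * pi)) = (\<integral>t. (cmod (Qh \<theta> \<epsilon> ?\<Lambda> t))\<^sup>2 \<partial>leb 0 (2 * pi))"
      unfolding P_def
    proof (rule leb_reflect_shift[of "\<lambda>t. (cmod (Qh \<theta> \<epsilon> ?\<Lambda> t))\<^sup>2"])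
      show "\<bar>(cmod (Qh \<theta> \<epsilon> ?\<Lambda> x))\<^sup>2\<bar> \<le> Bq\<^sup>2" for x using Bq by (simp add: power_mono)
      show "(\<lambda>t. (cmod (Qh \<theta> \<epsilon> ?\<Lambda> t))\<^sup>2) \<in> borel_measurable borel" by (rule Qm) simp
    qed (simp add: Qh_def Ph_periodic)
    also have "\<dots> \<le> C / ((\<epsilon> * ?\<Lambda>) ^ (2 * m) * ?\<Lambda>)" using L by (intro C) linarith
    also have "\<dots> \<le> C / ((\<epsilon> * (rad l / h)) ^ (2 * m) * (rad l / h))"
      using C L \<epsilon> by (intro divide_left_mono mult_mono power_mono mult_pos_pos zero_less_power mult_nonneg_nonneg) auto
    also have "\<dots> = C * (h ^ (2 * m + 1) / \<epsilon> ^ (2 * m)) * (1 / rad l ^ (2 * m + 1))"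
      using h by (simp add: power_mult_distrib power_divide field_simps)
    finally show ?thesis .
  qed
  have sbound: "(\<integral>\<phi>. s N \<phi> \<partial>leb 0 (2 * pi)) \<le> C * S * (h ^ (2 * m + 1) / \<epsilon> ^ (2 * m))" for N
  proof -
    let ?c = "C * (h ^ (2 * m + 1) / \<epsilon> ^ (2 * m))"
    have c0: "0 \<le> ?c" using C h \<epsilon> by simp
    have "(\<integral>\<phi>. s N \<phi> \<partial>leb 0 (2 * pi)) = (\<Sum>l\<in>ibox N - {0}. (\<integral>\<phi>. P l \<phi> \<partial>leb 0 (2 * pi)))"
      unfolding s_def using Pi by (intro Bochner_Integration.integral_sum) auto
    also have "\<dots> \<le> (\<Sum>l\<in>ibox N - {0}. ?c * (1 / rad l ^ (2 * m + 1)))" using Pbound by (intro sum_mono) auto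
    also have "\<dots> = ?c * (\<Sum>l\<in>ibox N - {0}. 1 / rad l ^ (2 * m + 1))" by (simp only: sum_distrib_left)
    also have "\<dots> \<le> ?c * S" using S c0 by (intro mult_left_mono) auto
    finally show ?thesis by (simp add: mult_ac)
  qed
  have smono: "s N \<phi> \<le> s N' \<phi>" if "N \<le> N'" for N N' \<phi>
    unfolding s_def using that by (intro sum_mono2) (auto simp: ibox_def P_def)
  have pars: "ennreal (G \<phi>) \<le> (SUP N. ennreal (s N \<phi>))" for \<phi>
  proof (rule ennreal_le_epsilon)
    fix e :: real assume e: "0 < e"
    have Dm1: "D \<phi> \<in> borel_measurable borel" by measurable
    obtain N where N: "G \<phi> \<le> e + (\<Sum>l\<in>ibox N. (cmod (fc (D \<phi>) l))\<^sup>2)"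
      using Parseval_le[OF Dm1 B e] unfolding G_def by blast
    have fcD: "fc (D \<phi>) l = (if l = 0 then 0 else Qh \<theta> \<epsilon> (2 * pi * rad l / h) (a l - \<phi>))" for l
      unfolding D_def[abs_def] by (rule fc_error[OF h(1) _ M a]) (rule R)
    have "(\<Sum>l\<in>ibox N. (cmod (fc (D \<phi>) l))\<^sup>2) = s N \<phi>"
      unfolding s_def by (intro sum.mono_neutral_cong_right) (auto simp: fcD P_def)
    then have "ennreal (G \<phi>) \<le> ennreal (s N \<phi> + e)" using N by (simp add: ennreal_leI)
    also have "\<dots> = ennreal (s N \<phi>) + ennreal e"
      using e by (intro ennreal_plus) (auto simp: s_def P_def intro!: sum_nonneg)
    also have "\<dots> \<le> (SUP N. ennreal (s N \<phi>)) + ennreal e" by (intro add_right_mono SUP_upper) auto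
    finally show "ennreal (G \<phi>) \<le> (SUP N. ennreal (s N \<phi>)) + ennreal e" .
  qed
  have Gi: "integrable (leb 0 (2 * pi)) G" using Gb G0 by (intro integrable_leb[of _ _ _ "B\<^sup>2"]) auto
  have s0: "0 \<le> s N \<phi>" for N \<phi> unfolding s_def P_def by (intro sum_nonneg) auto
  have sm [measurable]: "s N \<in> borel_measurable borel" for N unfolding s_def[abs_def] by measurable
  have si: "integrable (leb 0 (2 * pi)) (s N)" for N unfolding s_def[abs_def] using Pi by auto
  have "ennreal (\<integral>\<phi>. G \<phi> \<partial>leb 0 (2 * pi)) = (\<integral>\<^sup>+\<phi>. ennreal (G \<phi>) \<partial>leb 0 (2 * pi))"
    using Gi G0 by (intro nn_integral_eq_integral[symmetric]) auto
  also have "\<dots> \<le> (\<integral>\<^sup>+\<phi>. (SUP N. ennreal (s N \<phi>)) \<partial>leb 0 (2 * pi))"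
    using pars by (intro nn_integral_mono) auto
  also have "\<dots> = (SUP N. (\<integral>\<^sup>+\<phi>. ennreal (s N \<phi>) \<partial>leb 0 (2 * pi)))"
    using smono by (intro nn_integral_monotone_convergence_SUP) (auto simp: incseq_def le_fun_def intro!: ennreal_leI)
  also have "\<dots> \<le> ennreal (C * S * (h ^ (2 * m + 1) / \<epsilon> ^ (2 * m)))"
  proof (rule SUP_least)
    fix N
    have "(\<integral>\<^sup>+\<phi>. ennreal (s N \<phi>) \<partial>leb 0 (2 * pi)) = ennreal (\<integral>\<phi>. s N \<phi> \<partial>leb 0 (2 * pi))"
      using si s0 by (intro nn_integral_eq_integral) auto
    then show "(\<integral>\<^sup>+\<phi>. ennreal (s N \<phi>) \<partial>leb 0 (2 * pi)) \<le> ennreal (C * S * (h ^ (2 * m + 1) / \<epsilon> ^ (2 * m)))"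
      using sbound[of N] by (simp add: ennreal_leI)
  qed
  finally have "(\<integral>\<phi>. G \<phi> \<partial>leb 0 (2 * pi)) \<le> C * S * (h ^ (2 * m + 1) / \<epsilon> ^ (2 * m))"
    using C S h \<epsilon> by (subst (asm) ennreal_le_iff) auto
  then show ?thesis unfolding G_def D_def .
qed

text \<open>On the unit square times SO(2) the infinite sum equals a finite one with a fixed box,
  which is bounded and jointly measurable. This gives integrability and allows the translation to be
  integrated first, for fixed rotation.\<close>

lemma implicit_integral_mean_square:
  assumes h: "0 < h" "h \<le> 1"
    and C: "0 \<le> C" "\<And>\<Lambda>. 1 \<le> \<Lambda> \<Longrightarrow> (\<integral>t. (cmod (Qh \<theta> \<epsilon> \<Lambda> t))\<^sup>2 \<partial>leb 0 (2 * pi)) \<le> C / ((\<epsilon> * \<Lambda>) ^ (2 * m) * \<Lambda>)"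
    and S: "0 \<le> S" "\<And>N. (\<Sum>k\<in>ibox N - {0}. 1 / rad k ^ (2 * m + 1)) \<le> S"
  shows "integrable (restrict_space lborel (cbox 0 1) \<Otimes>\<^sub>M haar_SO2)
      (\<lambda>(\<xi>, \<eta>). \<bar>implicit_integral \<Omega> \<gamma> F \<theta> \<epsilon> h \<eta> \<xi> - II\<bar>\<^sup>2)" (is "integrable ?P ?E")
    and "0 \<le> (\<integral>\<xi>. (\<integral>\<eta>. \<bar>implicit_integral \<Omega> \<gamma> F \<theta> \<epsilon> h \<eta> \<xi> - II\<bar>\<^sup>2 \<partial>haar_SO2) \<partial>restrict_space lborel (cbox 0 1))" (is "0 \<le> ?I")
    and "(\<integral>\<xi>. (\<integral>\<eta>. \<bar>implicit_integral \<Omega> \<gamma> F \<theta> \<epsilon> h \<eta> \<xi> - II\<bar>\<^sup>2 \<partial>haar_SO2) \<partial>restrict_space lborel (cbox 0 1)) \<le> C * S * (h ^ (2 * m + 1) / \<epsilon> ^ (2 * m))"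
proof -
  let ?X = "restrict_space lborel (cbox 0 1) :: (real^2) measure"
  obtain R where R: "R \<ge> 0" "\<And>z. integrand \<Omega> \<gamma> F \<theta> \<epsilon> z \<noteq> 0 \<Longrightarrow> norm z \<le> R" using tube_radius[OF f_eq \<theta>m T \<epsilon>] by blast
  obtain M where M: "R / h + 1 \<le> real M" using real_arch_simple by blast
  define K where "K \<xi> \<eta> = (FM M h \<eta> \<xi> - II)\<^sup>2" for \<xi> \<eta>
  have KE: "\<bar>implicit_integral \<Omega> \<gamma> F \<theta> \<epsilon> h \<eta> \<xi> - II\<bar>\<^sup>2 = K \<xi> \<eta>" if "\<xi> \<in> cbox 0 1" "\<eta> \<in> SO2" for \<xi> \<eta>
  proof -
    have "implicit_integral \<Omega> \<gamma> F \<theta> \<epsilon> h \<eta> \<xi> = FM M h \<eta> \<xi>"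
      using M by (intro implicit_integral_eq_Fm[OF f_eq \<theta>m T \<epsilon> h(1) R(2)] that) auto
    then show ?thesis by (simp add: K_def)
  qed
  obtain B0 where B0: "\<And>\<eta> \<xi>. \<bar>FM M h \<eta> \<xi>\<bar> \<le> B0" using grid_sum_bounded[OF f_eq \<theta>m T \<epsilon>] by meson
  have KB: "norm (K \<xi> \<eta>) \<le> (B0 + \<bar>II\<bar>)\<^sup>2" for \<xi> \<eta>
  proof -
    have "\<bar>FM M h \<eta> \<xi> - II\<bar> \<le> B0 + \<bar>II\<bar>" using B0[of \<eta> \<xi>] by linarith
    from power_mono[OF this abs_ge_zero, of 2] show ?thesis by (simp add: K_def)
  qed
  have Km: "(\<lambda>p. K (z p) (g p)) \<in> borel_measurable Y" if [measurable]: "z \<in> borel_measurable Y" "g \<in> borel_measurable Y" for z g and Y :: "'y measure"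
    unfolding K_def by measurable
  interpret H: prob_space haar_SO2 by (rule prob_space_haar_SO2)
  have "emeasure ?X (space ?X) < \<infinity>" using emeasure_lborel_cbox_finite[of 0 "1::real^2"] by (simp add: space_restrict_space emeasure_restrict_space)
  then interpret X: finite_measure ?X by (intro finite_measureI) auto
  interpret XH: pair_sigma_finite ?X haar_SO2 by (intro pair_sigma_finite.intro X.sigma_finite_measure H.sigma_finite_measure)
  interpret XHf: finite_measure ?P by (rule finite_measure_pair_measure) unfold_locales
  have sp: "space ?P = cbox 0 1 \<times> SO2" by (simp add: space_pair_measure space_restrict_space)
  have m1: "fst \<in> borel_measurable ?P"
    using measurable_compose[OF measurable_fst, of "\<lambda>x. x" ?X borel haar_SO2] by (simp add: measurable_restrict_space1)
  have m2: "snd \<in> borel_measurable ?P"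
  proof -
    have "(\<lambda>x. x) \<in> haar_SO2 \<rightarrow>\<^sub>M borel"
      using measurable_restrict_space1[of "\<lambda>x. x" borel borel SO2] by (simp cong: measurable_cong_sets)
    from measurable_compose[OF measurable_snd this] show ?thesis .
  qed
  have Kp: "(\<lambda>p. K (fst p) (snd p)) \<in> borel_measurable ?P" using Km[OF m1 m2] .
  have Ki: "integrable ?P (\<lambda>p. K (fst p) (snd p))"
    using Kp KB by (intro XHf.integrable_const_bound) auto
  have "integrable ?P ?E \<longleftrightarrow> integrable ?P (\<lambda>p. K (fst p) (snd p))"
    by (rule Bochner_Integration.integrable_cong) (auto simp: sp KE[unfolded power2_abs])
  with Ki show "integrable ?P ?E" by simp
  show "0 \<le> ?I" by (intro Bochner_Integration.integral_nonneg) auto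
  have "?I = (\<integral>\<xi>. (\<integral>\<eta>. K \<xi> \<eta> \<partial>haar_SO2) \<partial>?X)"
    by (intro Bochner_Integration.integral_cong) (auto simp: space_restrict_space KE[unfolded power2_abs])
  also have "\<dots> = (\<integral>\<eta>. (\<integral>\<xi>. K \<xi> \<eta> \<partial>?X) \<partial>haar_SO2)"
    using XH.Fubini_integral[of K] Ki by (simp add: case_prod_beta')
  also have "\<dots> = (\<integral>\<eta>. (\<integral>\<xi>. K \<xi> \<eta> \<partial>cube) \<partial>haar_SO2)"
    by (subst integral_cube_restrict) (rule Km, auto)
  also have "\<dots> = (\<integral>\<phi>. (\<integral>\<xi>. K \<xi> (rotation \<phi>) \<partial>cube) \<partial>leb 0 (2 * pi)) / (2 * pi)"
  proof (rule integral_haar_SO2, rule measurable_restrict_space1, rule cube.borel_measurable_lebesgue_integral)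
    show "(\<lambda>(\<eta>, \<xi>). K \<xi> \<eta>) \<in> borel_measurable (borel \<Otimes>\<^sub>M cube)"
      using Km[of snd "borel \<Otimes>\<^sub>M cube" fst] by (simp add: case_prod_beta')
  qed
  \<comment> \<open>The normalization 1 / (2 pi) of the Haar measure is at most 1.\<close>
  also have "\<dots> \<le> (\<integral>\<phi>. (\<integral>\<xi>. K \<xi> (rotation \<phi>) \<partial>cube) \<partial>leb 0 (2 * pi)) / 1"
    using pi_gt3 by (intro divide_left_mono) (auto simp: K_def intro!: Bochner_Integration.integral_nonneg)
  also have "\<dots> \<le> C * S * (h ^ (2 * m + 1) / \<epsilon> ^ (2 * m))"
    unfolding K_def div_by_1 by (rule mean_square_error[OF h R(2) M C S])
  finally show "?I \<le> C * S * (h ^ (2 * m + 1) / \<epsilon> ^ (2 * m))" .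
qed

end

end

section \<open>Smooth closed boundaries\<close>

lemma smooth_bdd_add: "smooth_bdd a \<Longrightarrow> smooth_bdd b \<Longrightarrow> smooth_bdd (\<lambda>t. a t + b t)"
  unfolding smooth_bdd_def by (intro allI bs_add) blast+

lemma smooth_bdd_mult: "smooth_bdd a \<Longrightarrow> smooth_bdd b \<Longrightarrow> smooth_bdd (\<lambda>t. a t * b t)"
  unfolding smooth_bdd_def by (intro allI bs_mult) blast+

lemma smooth_bdd_diff: "smooth_bdd a \<Longrightarrow> smooth_bdd b \<Longrightarrow> smooth_bdd (\<lambda>t. a t - b t)"
  unfolding smooth_bdd_def by (intro allI bs_diff) blast+

lemma smooth_bdd_minus: "smooth_bdd a \<Longrightarrow> smooth_bdd (\<lambda>t. - a t)"
  unfolding smooth_bdd_def by (intro allI bs_minus) blast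

lemma smooth_bdd_inverse:
  assumes "smooth_bdd a" "0 < c" "\<And>t. c \<le> \<bar>a t\<bar>"
  shows "smooth_bdd (\<lambda>t. inverse (a t))"
  unfolding smooth_bdd_def
proof
  fix n
  have "bs n UNIV {()} (\<lambda>_. a)" using assms(1) by (simp add: smooth_bdd_def)
  then show "bs n UNIV {()} (\<lambda>_ t. inverse (a t))" by (rule bs_inverse[OF _ assms(3,2)])
qed

lemma periodic_fract:
  fixes g :: "real \<Rightarrow> real"
  assumes "\<And>t. g (t + 1) = g t"
  shows "\<exists>u\<in>{0..1}. g u = g t"
proof
  show "g (t + of_int (- \<lfloor>t\<rfloor>)) = g t" by (rule periodic_int[of g, OF assms])
  show "t + of_int (- \<lfloor>t\<rfloor>) \<in> {0..1}" by simp linarith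
qed

lemma periodic_bounded:
  fixes g :: "real \<Rightarrow> real"
  assumes "continuous_on UNIV g" "\<And>t. g (t + 1) = g t"
  shows "bounded_cont UNIV {()} (\<lambda>_. g)"
proof -
  have "compact (g ` {0..1})" using assms by (intro compact_continuous_image continuous_on_subset[OF assms(1)]) auto
  then have "bounded (g ` {0..1})" by (rule compact_imp_bounded)
  then obtain C where C: "\<forall>u\<in>{0..1}. \<bar>g u\<bar> \<le> C"
    unfolding bounded_iff by auto
  have "\<bar>g t\<bar> \<le> C" for t using C periodic_fract[of g t, OF assms(2)] by metis
  then show ?thesis using assms by (auto simp: bounded_cont_def)
qed

lemma periodic_derivatives:
  assumes G: "\<And>n t. (G n has_real_derivative G (Suc n) t) (at t)" and per: "\<And>t. G 0 (t + 1) = G 0 t"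
  shows "G n (t + 1) = G n t"
proof (induction n arbitrary: t)
  case (Suc n)
  have "((\<lambda>t. G n (t + 1)) has_real_derivative G (Suc n) (t + 1)) (at t)" using DERIV_shift[of "G n" "G (Suc n) (t + 1)" t 1] G by blast
  then show ?case using Suc.IH G[of n t] by (simp add: DERIV_unique)
qed (rule per)

text \<open>Derivatives of a periodic function are periodic and continuous, hence bounded by their
  maximum over one period.\<close>

lemma smooth_bdd_periodic:
  assumes G: "\<And>n t. (G n has_real_derivative G (Suc n) t) (at t)" and per: "\<And>t. G 0 (t + 1) = G 0 t"
  shows "smooth_bdd (G n)"
proof -
  have b: "bounded_cont UNIV {()} (\<lambda>_. G n)" for n
    using periodic_derivatives[of G, OF G per] DERIV_isCont[OF G]
    by (intro periodic_bounded) (auto simp: continuous_at_imp_continuous_on)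
  have "bs j UNIV {()} (\<lambda>_. G n)" for j
  proof (induction j arbitrary: n)
    case 0 then show ?case using b by simp
  next
    case (Suc j) show ?case by (rule bs_SucI[OF b _ Suc.IH]) (rule G)
  qed
  then show ?thesis by (simp add: smooth_bdd_def)
qed

lemma C_infinity_sequence:
  fixes g :: "real \<Rightarrow> 'a::real_normed_vector"
  assumes "C_k_on \<infinity> UNIV g"
  obtains D where "D 0 = g" "\<And>n t. (D n has_vector_derivative D (Suc n) t) (at t)"
  using assms unfolding C_k_on_def by auto

lemma Lipschitz_of_derivative_bound:
  fixes g :: "real \<Rightarrow> real"
  assumes "\<And>t. (g has_real_derivative g' t) (at t)" "\<And>t. \<bar>g' t\<bar> \<le> L"
  shows "\<bar>g b - g a\<bar> \<le> L * \<bar>b - a\<bar>"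
  using field_differentiable_bound[of UNIV g g' L b a] assms by auto

text \<open>The speed is periodic and positive, hence bounded below, so frame and curvature of a
  regular periodic curve inherit all derivative bounds. The constants \<open>e0\<close> and
  \<open>d\<close> come from the maxima of curvature and speed; adding 1 in the denominators covers
  vanishing maxima.\<close>

lemma strip_exists:
  assumes X: "\<And>n t. (X n has_real_derivative X (Suc n) t) (at t)" "\<And>t. X 0 (t + 1) = X 0 t"
    and Y: "\<And>n t. (Y n has_real_derivative Y (Suc n) t) (at t)" "\<And>t. Y 0 (t + 1) = Y 0 t"
    and E: "\<And>n t. (E n has_real_derivative E (Suc n) t) (at t)" "\<And>t. E 0 (t + 1) = E 0 t"
    and reg: "\<And>t. X 1 t \<noteq> 0 \<or> Y 1 t \<noteq> 0"
  shows "\<exists>nx ny v k e0 v0 d. strip (X 0) (Y 0) nx ny v k (\<lambda>t. E 0 t * \<bar>v t\<bar>) e0 v0 d"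
proof -
  define sp where "sp t = sqrt ((X 1 t)\<^sup>2 + (Y 1 t)\<^sup>2)" for t
  define i where "i t = inverse (sp t)" for t
  define k where "k t = (X 1 t * Y 2 t - Y 1 t * X 2 t) * (i t * i t * i t)" for t
  define nx where "nx t = Y 1 t * i t" for t
  define ny where "ny t = - (X 1 t * i t)" for t
  note perX = periodic_derivatives[of X, OF X] and perY = periodic_derivatives[of Y, OF Y]
  note sX = smooth_bdd_periodic[of X, OF X] and sY = smooth_bdd_periodic[of Y, OF Y]
  have der: "(X 0 has_real_derivative X 1 t) (at t)" "(Y 0 has_real_derivative Y 1 t) (at t)"
    "(X 1 has_real_derivative X 2 t) (at t)" "(Y 1 has_real_derivative Y 2 t) (at t)" for t
    using X(1)[of 0 t] Y(1)[of 0 t] X(1)[of 1 t] Y(1)[of 1 t] by (simp_all add: numeral_2_eq_2)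
  have w: "0 < (X 1 t)\<^sup>2 + (Y 1 t)\<^sup>2" for t using reg[of t] by (simp add: sum_power2_gt_zero_iff)
  have sp0: "0 < sp t" for t using w by (simp add: sp_def)
  have sp2: "sp t * sp t = X 1 t * X 1 t + Y 1 t * Y 1 t" for t using w[of t] by (simp add: sp_def power2_eq_square)
  have spi: "sp t * i t = 1" for t using sp0[of t] by (simp add: i_def)
  have sper: "sp (t + 1) = sp t" for t by (simp add: sp_def perX perY)
  have spd: "(sp has_real_derivative (X 1 t * X 2 t + Y 1 t * Y 2 t) * i t) (at t)" for t
  proof -
    have "((\<lambda>t. (X 1 t)\<^sup>2 + (Y 1 t)\<^sup>2) has_real_derivative 2 * (X 1 t * X 2 t + Y 1 t * Y 2 t)) (at t)"
      by (rule derivative_eq_intros der refl)+ simp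
    note w' = this
    have half: "inverse a / 2 * (2 * b) = b * inverse a" for a b :: real by simp
    from DERIV_chain2[OF DERIV_real_sqrt[OF w] w'] show ?thesis
      unfolding sp_def[abs_def] i_def by (rule DERIV_cong) (simp only: sp_def half)
  qed
  have spc: "continuous_on UNIV sp" using DERIV_isCont[OF spd] by (simp add: continuous_at_imp_continuous_on)
  have "\<exists>c>0. \<forall>t. c \<le> sp t"
  proof -
    have "continuous_on {0..1} sp" using continuous_on_subset[OF spc] by blast
    then obtain u where u: "\<forall>s\<in>{0..1}. sp u \<le> sp s"
      using continuous_attains_inf[of "{0..1::real}" sp] by force
    have "sp u \<le> sp t" for t using u periodic_fract[of sp t, OF sper] by auto
    then show ?thesis using sp0 by blast
  qed
  then obtain v0 where v0: "0 < v0" "\<And>t. v0 \<le> sp t" by blast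
  have v0': "v0 \<le> \<bar>sp t\<bar>" for t using v0(2)[of t] by linarith
  \<comment> \<open>Bootstrapping: the derivative of the speed is (X' X'' + Y' Y'') divided by the
    speed, so order n of the speed gives order n + 1.\<close>
  have bsp: "bs n UNIV {()} (\<lambda>_. sp)" for n
  proof (induction n)
    case 0 show ?case using periodic_bounded[OF spc sper] by simp
  next
    case (Suc n)
    have "bs n UNIV {()} (\<lambda>_ t. i t)"
      unfolding i_def using bs_inverse[OF Suc.IH, of v0] v0' v0(1) by simp
    moreover have "bs n UNIV {()} (\<lambda>_ t. X 1 t * X 2 t + Y 1 t * Y 2 t)"
      using smooth_bdd_add[OF smooth_bdd_mult[OF sX sX] smooth_bdd_mult[OF sY sY]] by (simp add: smooth_bdd_def)
    ultimately have "bs n UNIV {()} (\<lambda>_ t. (X 1 t * X 2 t + Y 1 t * Y 2 t) * i t)" by (rule bs_mult[rotated])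
    then show ?case using periodic_bounded[OF spc sper] spd by (intro bs_SucI) auto
  qed
  then have ssp: "smooth_bdd sp" by (simp add: smooth_bdd_def)
  have si: "smooth_bdd i" unfolding i_def[abs_def] by (rule smooth_bdd_inverse[OF ssp v0(1) v0'])
  have sk: "smooth_bdd k" unfolding k_def[abs_def] by (intro smooth_bdd_mult smooth_bdd_diff sX sY si)
  have sE: "smooth_bdd (\<lambda>t. E 0 t * \<bar>sp t\<bar>)"
    using smooth_bdd_mult[OF smooth_bdd_periodic[of E, OF E] ssp] sp0 by (simp add: abs_of_pos)
  have id: "(i has_real_derivative - (i t * ((X 1 t * X 2 t + Y 1 t * Y 2 t) * i t) * i t)) (at t)" for t
    unfolding i_def[abs_def] using sp0[of t] spd[of t, unfolded i_def] by (intro DERIV_inverse') auto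
  have nxd: "(nx has_real_derivative - (k t * (sp t * ny t))) (at t)" for t
  proof -
    have "(nx has_real_derivative Y 2 t * i t + Y 1 t * - (i t * ((X 1 t * X 2 t + Y 1 t * Y 2 t) * i t) * i t)) (at t)"
      unfolding nx_def[abs_def] by (rule DERIV_cong[OF DERIV_mult[OF der(4) id]]) (simp only: mult.commute)
    moreover have "Y 2 t * i t + Y 1 t * - (i t * ((X 1 t * X 2 t + Y 1 t * Y 2 t) * i t) * i t) = - (k t * (sp t * ny t))"
      unfolding k_def ny_def using spi[of t] sp2[of t] by algebra
    ultimately show ?thesis by simp
  qed
  have nyd: "(ny has_real_derivative k t * (sp t * nx t)) (at t)" for t
  proof -
    have "(ny has_real_derivative - (X 2 t * i t + X 1 t * - (i t * ((X 1 t * X 2 t + Y 1 t * Y 2 t) * i t) * i t))) (at t)"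
      unfolding ny_def[abs_def] by (rule DERIV_cong[OF DERIV_minus[OF DERIV_mult[OF der(3) id]]]) (simp only: mult.commute)
    moreover have "- (X 2 t * i t + X 1 t * - (i t * ((X 1 t * X 2 t + Y 1 t * Y 2 t) * i t) * i t)) = k t * (sp t * nx t)"
      unfolding k_def nx_def using spi[of t] sp2[of t] by algebra
    ultimately show ?thesis by simp
  qed
  have unit: "nx t * nx t + ny t * ny t = 1" for t
    unfolding nx_def ny_def using spi[of t] sp2[of t] by algebra
  have nb: "\<bar>nx t\<bar> \<le> 1" "\<bar>ny t\<bar> \<le> 1" for t
    using unit[of t] by (simp_all add: abs_square_le_1[symmetric] power2_eq_square) (metis add_increasing2 add_increasing zero_le_square le_add_same_cancel1 le_add_same_cancel2)+
  obtain K where K: "\<And>t. \<bar>k t\<bar> \<le> K" using smooth_bdd_bound[OF sk] by blast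
  obtain V where V: "\<And>t. \<bar>sp t\<bar> \<le> V" using smooth_bdd_bound[OF ssp] by blast
  have K0: "0 \<le> K" and V0: "0 \<le> V" using order_trans[OF abs_ge_zero] K V by blast+
  define L where "L = K * V"
  have L0: "0 \<le> L" using K0 V0 by (simp add: L_def)
  have db: "\<bar>- (k t * (sp t * ny t))\<bar> \<le> L" "\<bar>k t * (sp t * nx t)\<bar> \<le> L" for t
  proof -
    have "\<bar>k t\<bar> * (\<bar>sp t\<bar> * \<bar>ny t\<bar>) \<le> K * (V * 1)" "\<bar>k t\<bar> * (\<bar>sp t\<bar> * \<bar>nx t\<bar>) \<le> K * (V * 1)"
      using K V K0 V0 nb by (intro mult_mono mult_nonneg_nonneg; simp)+
    then show "\<bar>- (k t * (sp t * ny t))\<bar> \<le> L" "\<bar>k t * (sp t * nx t)\<bar> \<le> L" by (simp_all add: L_def abs_mult)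
  qed
  \<comment> \<open>For unit vectors the inner product is 1 - |difference|^2 / 2. If each component
    moves by at most 1/5, this is at least 1 - (2/25)/2 = 24/25; L is a Lipschitz constant of the
    components.\<close>
  have turn: "24 / 25 \<le> nx \<tau> * nx (\<tau> + u) + ny \<tau> * ny (\<tau> + u)" if "\<bar>u\<bar> \<le> 1 / (5 * (L + 1))" for \<tau> u
  proof -
    have "(L + 1) * \<bar>u\<bar> \<le> (L + 1) * (1 / (5 * (L + 1)))" using that L0 by (intro mult_left_mono) auto
    also have "\<dots> = 1 / 5" using L0 by (simp add: field_simps)
    finally have Lu: "L * \<bar>u\<bar> \<le> 1 / 5" by (simp add: algebra_simps)
    have sq: "z\<^sup>2 \<le> (1 / 5)\<^sup>2" if "\<bar>z\<bar> \<le> 1 / 5" for z :: real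
      using power_mono[OF that abs_ge_zero, of 2] by simp
    have "(nx (\<tau> + u) - nx \<tau>)\<^sup>2 \<le> (1 / 5)\<^sup>2"
      using Lipschitz_of_derivative_bound[OF nxd db(1), of "\<tau> + u" \<tau>] Lu by (intro sq) simp
    moreover have "(ny (\<tau> + u) - ny \<tau>)\<^sup>2 \<le> (1 / 5)\<^sup>2"
      using Lipschitz_of_derivative_bound[OF nyd db(2), of "\<tau> + u" \<tau>] Lu by (intro sq) simp
    ultimately show ?thesis using unit[of \<tau>] unit[of "\<tau> + u"] by (simp add: power2_eq_square algebra_simps)
  qed
  have "strip (X 0) (Y 0) nx ny sp k (\<lambda>t. E 0 t * \<bar>sp t\<bar>) (1 / (2 * (K + 1))) v0 (1 / (5 * (L + 1)))"
  proof
    show "(X 0 has_real_derivative - (sp t * ny t)) (at t)" for t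
    proof -
      have "- (sp t * ny t) = X 1 t" unfolding ny_def using spi[of t] by algebra
      then show ?thesis using der by simp
    qed
    show "(Y 0 has_real_derivative sp t * nx t) (at t)" for t
    proof -
      have "sp t * nx t = Y 1 t" unfolding nx_def using spi[of t] by algebra
      then show ?thesis using der by simp
    qed
    show "\<bar>k t\<bar> * (1 / (2 * (K + 1))) \<le> 1 / 2" for t using K[of t] K0 by (simp add: field_simps)
    show "nx (t + 1) = nx t" "ny (t + 1) = ny t" "E 0 (t + 1) * \<bar>sp (t + 1)\<bar> = E 0 t * \<bar>sp t\<bar>" for t
      by (simp_all add: nx_def ny_def i_def sper perX perY E(2))
    show "(nx t)\<^sup>2 + (ny t)\<^sup>2 = 1" for t using unit[of t] by (simp add: power2_eq_square)
  qed (use ssp sk sE nxd nyd v0 v0' K0 L0 turn X(2) Y(2) in simp_all)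
  then show ?thesis by blast
qed

text \<open>The frame equations are invariant under changing the signs of normal, speed and
  curvature together, and the curve with its density is left alone. This makes either normal
  available.\<close>

lemma (in strip) strip_flip: "strip x y (\<lambda>t. - nx t) (\<lambda>t. - ny t) (\<lambda>t. - v t) (\<lambda>t. - k t) f e0 v0 d"
proof
  show "((\<lambda>t. - nx t) has_real_derivative - (- k t * (- v t * - ny t))) (at t)"
    "((\<lambda>t. - ny t) has_real_derivative - k t * (- v t * - nx t)) (at t)" for t
    using DERIV_minus[OF nxd] DERIV_minus[OF nyd] by simp_all
qed (use smooth_bdd_minus smooth xd yd unit v0 e0 d per in simp_all)

text \<open>Which normal points outward is known only after the tube has been built and its sides
  compared. The construction is therefore instantiated for both normals, with the offset sign
  reversed, and \<open>orientation\<close> selects one.\<close>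

lemma curve_out_exists:
  assumes \<Omega>: "open \<Omega>" "\<Omega> \<noteq> {}" "bounded \<Omega>" and \<gamma>: "smooth_closed_boundary \<Omega> \<gamma>" and F: "C_k_on \<infinity> UNIV (F \<circ> \<gamma>)"
  shows "\<exists>x y nx ny v k f e0 v0 d e1. curve_out x y nx ny v k f e0 v0 d \<Omega> \<gamma> e1 \<and> (\<forall>t. f t = F (\<gamma> t) * \<bar>v t\<bar>)"
proof -
  have \<gamma>': "\<And>t. \<gamma> (t + 1) = \<gamma> t" "inj_on \<gamma> {0..<1}" "\<And>t. vector_derivative \<gamma> (at t) \<noteq> 0" "range \<gamma> = frontier \<Omega>"
    and C: "C_k_on \<infinity> UNIV \<gamma>" using \<gamma> unfolding smooth_closed_boundary_def by auto
  obtain D where D: "D 0 = \<gamma>" "\<And>n t. (D n has_vector_derivative D (Suc n) t) (at t)" using C_infinity_sequence[OF C] by blast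
  obtain E where E: "E 0 = F \<circ> \<gamma>" "\<And>n t. (E n has_vector_derivative E (Suc n) t) (at t)" using C_infinity_sequence[OF F] by blast
  define X where "X n t = D n t $ 1" for n t
  define Y where "Y n t = D n t $ 2" for n t
  have comp: "((\<lambda>t. D n t $ j) has_real_derivative D (Suc n) t $ j) (at t)" for n t j
    using bounded_linear.has_vector_derivative[OF bounded_linear_vec_nth D(2)]
    by (simp add: has_real_derivative_iff_has_vector_derivative)
  have "D 1 t \<noteq> 0" for t using \<gamma>'(3)[of t] vector_derivative_at[OF D(2)[of 0 t]] by (simp add: D(1))
  then have reg: "X 1 t \<noteq> 0 \<or> Y 1 t \<noteq> 0" for t by (auto simp: X_def Y_def vec2_eq_iff)
  obtain nx ny v k e0 v0 d where "strip (X 0) (Y 0) nx ny v k (\<lambda>t. E 0 t * \<bar>v t\<bar>) e0 v0 d"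
    using strip_exists[of X Y E] comp E reg \<gamma>'(1)
    by (auto simp: X_def[abs_def] Y_def[abs_def] D(1) has_real_derivative_iff_has_vector_derivative)
  then interpret S: strip "X 0" "Y 0" nx ny v k "\<lambda>t. E 0 t * \<bar>v t\<bar>" e0 v0 d .
  let ?f = "\<lambda>t. E 0 t * \<bar>v t\<bar>"
  have \<gamma>xy: "\<gamma> t = vec2 (X 0 t) (Y 0 t)" for t by (simp add: X_def Y_def D(1))
  interpret T: curve_tube "X 0" "Y 0" nx ny v k ?f e0 v0 d \<Omega> \<gamma>
    by unfold_locales (fact \<Omega> \<gamma>xy \<gamma>'(2) \<gamma>'(4))+
  obtain e1 where e1: "e1 > 0" "e1 \<le> e0"
    and inj: "\<And>t s t' s'. \<bar>s\<bar> \<le> e1 \<Longrightarrow> \<bar>s'\<bar> \<le> e1 \<Longrightarrow> T.\<Phi> t s = T.\<Phi> t' s' \<Longrightarrow> s = s' \<and> (\<exists>j::int. t' = t + of_int j)"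
    using T.global_injective by blast
  interpret I: curve_tube_inj "X 0" "Y 0" nx ny v k ?f e0 v0 d \<Omega> \<gamma> e1
    by unfold_locales (fact e1 inj)+
  interpret S': strip "X 0" "Y 0" "\<lambda>t. - nx t" "\<lambda>t. - ny t" "\<lambda>t. - v t" "\<lambda>t. - k t" ?f e0 v0 d
    by (rule S.strip_flip)
  interpret T': curve_tube "X 0" "Y 0" "\<lambda>t. - nx t" "\<lambda>t. - ny t" "\<lambda>t. - v t" "\<lambda>t. - k t" ?f e0 v0 d \<Omega> \<gamma>
    by unfold_locales (fact \<Omega> \<gamma>xy \<gamma>'(2) \<gamma>'(4))+
  have \<Phi>': "T'.\<Phi> t s = T.\<Phi> t (- s)" for t s by (simp add: T.\<Phi>_def T'.\<Phi>_def)
  interpret I': curve_tube_inj "X 0" "Y 0" "\<lambda>t. - nx t" "\<lambda>t. - ny t" "\<lambda>t. - v t" "\<lambda>t. - k t" ?f e0 v0 d \<Omega> \<gamma> e1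
  proof
    show "s = s' \<and> (\<exists>j::int. t' = t + of_int j)" if "\<bar>s\<bar> \<le> e1" "\<bar>s'\<bar> \<le> e1" "T'.\<Phi> t s = T'.\<Phi> t' s'" for t s t' s'
      using inj[of "- s" "- s'" t t'] that by (simp add: \<Phi>')
  qed (fact e1)+
  have f: "\<forall>t. ?f t = F (\<gamma> t) * \<bar>v t\<bar>" by (simp add: E(1))
  show ?thesis using I.orientation
  proof
    assume o: "(\<forall>t. \<forall>s\<in>{0<..<e1}. T.\<Phi> t s \<notin> closure \<Omega>) \<and> (\<forall>t. \<forall>s\<in>{-e1<..<0}. T.\<Phi> t s \<in> \<Omega>)"
    have "curve_out (X 0) (Y 0) nx ny v k ?f e0 v0 d \<Omega> \<gamma> e1" by unfold_locales (use o in auto)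
    then show ?thesis using f by blast
  next
    assume o: "(\<forall>t. \<forall>s\<in>{0<..<e1}. T.\<Phi> t s \<in> \<Omega>) \<and> (\<forall>t. \<forall>s\<in>{-e1<..<0}. T.\<Phi> t s \<notin> closure \<Omega>)"
    have "curve_out (X 0) (Y 0) (\<lambda>t. - nx t) (\<lambda>t. - ny t) (\<lambda>t. - v t) (\<lambda>t. - k t) ?f e0 v0 d \<Omega> \<gamma> e1"
      by unfold_locales (use o in \<open>auto simp: \<Phi>'\<close>)
    moreover have "\<forall>t. ?f t = F (\<gamma> t) * \<bar>- v t\<bar>" using f by simp
    ultimately show ?thesis by blast
  qed
qed

theorem corollary3p3:
  fixes \<Omega> :: "(real^2) set" and \<gamma> :: "real \<Rightarrow> real^2" and f :: "real^2 \<Rightarrow> real"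
    and \<theta> :: "real \<Rightarrow> real" and q :: nat and \<kappa> \<alpha> :: real
  assumes "open \<Omega>" and "\<Omega> \<noteq> {}" and "bounded \<Omega>" and "connected \<Omega>" and "simply_connected \<Omega>"
    and "smooth_closed_boundary \<Omega> \<gamma>"
    and "2 < \<kappa>" and "finitely_flat \<Omega> \<gamma> \<kappa>"
    and "C_k_on \<infinity> UNIV (f \<circ> \<gamma>)"
    and "weight_profile q \<theta>"
    and "0 \<le> \<alpha>" and "\<alpha> \<le> 1"
  shows "\<exists>\<epsilon>\<^sub>0>0. \<forall>\<epsilon> :: real \<Rightarrow> real.
    (\<exists>c\<^sub>1>0. \<exists>c\<^sub>2>0. \<forall>\<^sub>F h in at_right 0. c\<^sub>1 * h powr \<alpha> \<le> \<epsilon> h \<and> \<epsilon> h \<le> c\<^sub>2 * h powr \<alpha>) \<and>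
    (\<forall>\<^sub>F h in at_right 0. \<epsilon> h \<le> \<epsilon>\<^sub>0 \<and> unique_projection (frontier \<Omega>) (\<epsilon> h))
    \<longrightarrow>
    (\<forall>\<^sub>F h in at_right 0.
       integrable (restrict_space lborel (cbox 0 1) \<Otimes>\<^sub>M haar_SO2)
         (\<lambda>(\<xi>, \<eta>). \<bar>implicit_integral \<Omega> \<gamma> f \<theta> (\<epsilon> h) h \<eta> \<xi> - curve_integral \<gamma> f\<bar>\<^sup>2)) \<and>
    (\<lambda>h. \<integral>\<xi>. (\<integral>\<eta>. \<bar>implicit_integral \<Omega> \<gamma> f \<theta> (\<epsilon> h) h \<eta> \<xi> - curve_integral \<gamma> f\<bar>\<^sup>2 \<partial>haar_SO2)
           \<partial>restrict_space lborel (cbox 0 1))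
      \<in> O[at_right 0](\<lambda>h. h powr (1 + 2 * (real q + 1) * (1 - \<alpha>)))"
proof -
  obtain x y nx ny v k g e0 v0 d e1 where L: "curve_out x y nx ny v k g e0 v0 d \<Omega> \<gamma> e1" and g: "\<And>t. g t = f (\<gamma> t) * \<bar>v t\<bar>"
    using curve_out_exists[OF assms(1-3,6,9)] by blast
  interpret curve_out x y nx ny v k g e0 v0 d \<Omega> \<gamma> e1 by (rule L)
  note w = \<open>weight_profile q \<theta>\<close>
  define m where "m = q + 1"
  have \<theta>m: "\<theta> \<in> borel_measurable borel" by (rule weight_profile_borel_bounded(1)[OF w])
  obtain T where T: "\<And>s. \<bar>\<theta> s\<bar> \<le> T" using weight_profile_borel_bounded(2)[OF w] by blast
  obtain FF where FF: "fourier_meas FF"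
    and rep: "\<And>y. (- \<i> * of_real y) ^ m * (\<integral>s. of_real (\<theta> s) * cis (s * y) \<partial>leb (-1) 1) = FF y"
    using weight_profile_fourier[OF w] unfolding m_def by blast
  have "(\<integral>s. \<theta> s \<partial>leb (-1) 1) = integral {-1..1} \<theta>" using \<theta>m T by (intro leb_eq_integral(2)[of _ _ _ T]) auto
  also have "\<dots> = 1" using w by (auto simp: weight_profile_def)
  finally have mass: "(\<integral>s. \<theta> s \<partial>leb (-1) 1) = 1" .
  obtain C where C: "0 \<le> C" "\<And>\<epsilon> \<Lambda>. 0 < \<epsilon> \<Longrightarrow> \<epsilon> \<le> e0 \<Longrightarrow> 1 \<le> \<Lambda> \<Longrightarrow>
      (\<integral>t. (cmod (Qh \<theta> \<epsilon> \<Lambda> t))\<^sup>2 \<partial>leb 0 (2 * pi)) \<le> C / ((\<epsilon> * \<Lambda>) ^ (2 * m) * \<Lambda>)"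
    using Qh_circle_bound[OF \<theta>m T FF rep] by blast
  obtain S where S: "0 \<le> S" "\<And>N. (\<Sum>k\<in>ibox N - {0}. 1 / rad k ^ (2 * m + 1)) \<le> S"
    using lattice_sum_bounded[of "2 * m + 1"] unfolding m_def by auto
  have m1: "1 \<le> m" by (simp add: m_def)
  have bound: "integrable (restrict_space lborel (cbox 0 1) \<Otimes>\<^sub>M haar_SO2)
         (\<lambda>(\<xi>, \<eta>). \<bar>implicit_integral \<Omega> \<gamma> f \<theta> \<epsilon> h \<eta> \<xi> - curve_integral \<gamma> f\<bar>\<^sup>2)"
      "0 \<le> (\<integral>\<xi>. (\<integral>\<eta>. \<bar>implicit_integral \<Omega> \<gamma> f \<theta> \<epsilon> h \<eta> \<xi> - curve_integral \<gamma> f\<bar>\<^sup>2 \<partial>haar_SO2) \<partial>restrict_space lborel (cbox 0 1))"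
      "(\<integral>\<xi>. (\<integral>\<eta>. \<bar>implicit_integral \<Omega> \<gamma> f \<theta> \<epsilon> h \<eta> \<xi> - curve_integral \<gamma> f\<bar>\<^sup>2 \<partial>haar_SO2) \<partial>restrict_space lborel (cbox 0 1))
        \<le> C * S / c ^ (2 * m) * h powr (1 + 2 * (real q + 1) * (1 - \<alpha>))"
    if "0 < h" "h \<le> 1" "0 < c" "c * h powr \<alpha> \<le> \<epsilon>" "\<epsilon> \<le> e1 / 2" for h c \<epsilon> :: real
  proof -
    have p: "0 < c * h powr \<alpha>" using that by simp
    then have \<epsilon>: "0 < \<epsilon>" "\<epsilon> < e1" using that e1 by linarith+
    have "\<epsilon> \<le> e0" using \<epsilon> e1 by linarith
    note * = implicit_integral_mean_square[OF g \<theta>m T \<epsilon> FF rep mass m1 \<open>0 < h\<close> \<open>h \<le> 1\<close> C(1) _ S]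
    show "integrable (restrict_space lborel (cbox 0 1) \<Otimes>\<^sub>M haar_SO2)
         (\<lambda>(\<xi>, \<eta>). \<bar>implicit_integral \<Omega> \<gamma> f \<theta> \<epsilon> h \<eta> \<xi> - curve_integral \<gamma> f\<bar>\<^sup>2)" by (rule *(1)) (rule C(2)[OF \<epsilon>(1) \<open>\<epsilon> \<le> e0\<close>])
    show "0 \<le> (\<integral>\<xi>. (\<integral>\<eta>. \<bar>implicit_integral \<Omega> \<gamma> f \<theta> \<epsilon> h \<eta> \<xi> - curve_integral \<gamma> f\<bar>\<^sup>2 \<partial>haar_SO2) \<partial>restrict_space lborel (cbox 0 1))" by (rule *(2)) (rule C(2)[OF \<epsilon>(1) \<open>\<epsilon> \<le> e0\<close>])
    have "(\<integral>\<xi>. (\<integral>\<eta>. \<bar>implicit_integral \<Omega> \<gamma> f \<theta> \<epsilon> h \<eta> \<xi> - curve_integral \<gamma> f\<bar>\<^sup>2 \<partial>haar_SO2) \<partial>restrict_space lborel (cbox 0 1))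
        \<le> C * S * (h ^ (2 * m + 1) / \<epsilon> ^ (2 * m))"
      by (rule *(3)) (rule C(2)[OF \<epsilon>(1) \<open>\<epsilon> \<le> e0\<close>])
    \<comment> \<open>The bound decreases in \<epsilon>, so here the lower estimate c h^\<alpha>
      \<le> \<epsilon> enters; the exponent of h becomes (2m + 1) - 2m \<alpha> with m = q +
      1.\<close>
    also have "C * S * (h ^ (2 * m + 1) / \<epsilon> ^ (2 * m)) \<le> C * S * (h ^ (2 * m + 1) / (c * h powr \<alpha>) ^ (2 * m))"
      using that p C(1) S(1) \<epsilon> by (intro mult_left_mono divide_left_mono power_mono mult_pos_pos zero_less_power) auto
    also have "h ^ (2 * m + 1) / (c * h powr \<alpha>) ^ (2 * m) = h powr (1 + 2 * (real q + 1) * (1 - \<alpha>)) / c ^ (2 * m)"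
    proof -
      have "(h powr \<alpha>) ^ (2 * m) = h powr (\<alpha> * real (2 * m))" using that by (simp add: powr_powr flip: powr_realpow)
      moreover have "h ^ (2 * m + 1) = h powr real (2 * m + 1)" using that by (simp only: powr_realpow)
      moreover have "real (2 * m + 1) - \<alpha> * real (2 * m) = 1 + 2 * (real q + 1) * (1 - \<alpha>)" by (simp add: m_def algebra_simps)
      ultimately show ?thesis
        by (simp only: power_mult_distrib powr_diff[symmetric] mult.commute[of "c ^ (2 * m)"] divide_divide_eq_left[symmetric])
    qed
    finally show "(\<integral>\<xi>. (\<integral>\<eta>. \<bar>implicit_integral \<Omega> \<gamma> f \<theta> \<epsilon> h \<eta> \<xi> - curve_integral \<gamma> f\<bar>\<^sup>2 \<partial>haar_SO2) \<partial>restrict_space lborel (cbox 0 1))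
        \<le> C * S / c ^ (2 * m) * h powr (1 + 2 * (real q + 1) * (1 - \<alpha>))" by simp
  qed
  show ?thesis
  \<comment> \<open>Half of e1 makes \<epsilon> < e1 strict, so every offset up to \<epsilon> lies
    in the open tube where the curvature of the level curves is known.\<close>
  proof (intro exI[of _ "e1 / 2"] conjI allI impI)
    show "0 < e1 / 2" using e1 by simp
    fix \<epsilon> :: "real \<Rightarrow> real"
    assume *: "(\<exists>c\<^sub>1>0. \<exists>c\<^sub>2>0. \<forall>\<^sub>F h in at_right 0. c\<^sub>1 * h powr \<alpha> \<le> \<epsilon> h \<and> \<epsilon> h \<le> c\<^sub>2 * h powr \<alpha>) \<and>
      (\<forall>\<^sub>F h in at_right 0. \<epsilon> h \<le> e1 / 2 \<and> unique_projection (frontier \<Omega>) (\<epsilon> h))"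
    then obtain c where c: "0 < c" "\<forall>\<^sub>F h in at_right 0. c * h powr \<alpha> \<le> \<epsilon> h"
      unfolding eventually_conj_iff by blast
    have "\<forall>\<^sub>F h :: real in at_right 0. 0 < h \<and> h \<le> 1"
      unfolding eventually_at_right_field by (intro exI[of _ 1]) auto
    then have ev: "\<forall>\<^sub>F h in at_right 0. 0 < h \<and> h \<le> 1 \<and> c * h powr \<alpha> \<le> \<epsilon> h \<and> \<epsilon> h \<le> e1 / 2"
      using c(2) conjunct2[OF *] by eventually_elim auto
    then show "\<forall>\<^sub>F h in at_right 0. integrable (restrict_space lborel (cbox 0 1) \<Otimes>\<^sub>M haar_SO2)
         (\<lambda>(\<xi>, \<eta>). \<bar>implicit_integral \<Omega> \<gamma> f \<theta> (\<epsilon> h) h \<eta> \<xi> - curve_integral \<gamma> f\<bar>\<^sup>2)"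
      by (rule eventually_mono) (use bound(1) c(1) in blast)
    show "(\<lambda>h. \<integral>\<xi>. (\<integral>\<eta>. \<bar>implicit_integral \<Omega> \<gamma> f \<theta> (\<epsilon> h) h \<eta> \<xi> - curve_integral \<gamma> f\<bar>\<^sup>2 \<partial>haar_SO2)
           \<partial>restrict_space lborel (cbox 0 1))
      \<in> O[at_right 0](\<lambda>h. h powr (1 + 2 * (real q + 1) * (1 - \<alpha>)))"
    proof (rule bigoI, rule eventually_mono[OF ev])
      fix h assume h: "0 < h \<and> h \<le> 1 \<and> c * h powr \<alpha> \<le> \<epsilon> h \<and> \<epsilon> h \<le> e1 / 2"
      then show "norm (\<integral>\<xi>. (\<integral>\<eta>. \<bar>implicit_integral \<Omega> \<gamma> f \<theta> (\<epsilon> h) h \<eta> \<xi> - curve_integral \<gamma> f\<bar>\<^sup>2 \<partial>haar_SO2) \<partial>restrict_space lborel (cbox 0 1))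
          \<le> C * S / c ^ (2 * m) * norm (h powr (1 + 2 * (real q + 1) * (1 - \<alpha>)))"
        using bound(2,3)[of h c "\<epsilon> h"] c(1) by simp
    qed
  qed
qed

end
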